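(* Let $w=(S_2\cdot w_{64})^2$, an involution of $X_0(64)$ defined over $\mathbb{Q}$. There exist $x,y,t\in\mathbb{Q}(X_0(64))$ such that $\mathbb{Q}(X_0(64))=\mathbb{Q}(x,y,t)$, the subfield of functions invariant under $w^*$ is $\mathbb{Q}(x,y)$, $w^*(t)=-t$, and $$y^2=x^3-4x,\qquad t^2=(-2+x)(2+x)(4+x^2).$$ In particular these two equations are equations for $X_0(64)$ over $\mathbb{Q}$ (up to birational equivalence over $\mathbb{Q}$).
   Context: $X_0(N)$ denotes the smooth projective curve over $\mathbb{Q}$ attached to $\Gamma_0(N)$, where $\mathbb{Q}(X_0(N))$ is the subfield of $\mathbb{C}(X_0(N))$ of functions with rational $q$-expansion at the cusp $\infty$, $q=e^{2\pi i z}$. For a positive divisor $d$ of $N$ coprime to $N/d$, the Atkin-Lehner involution $w_d$ of $X_0(N)$ is induced by any matrix $\frac{1}{\sqrt d}\begin{pmatrix} A d & B\\ N C & D d\end{pmatrix}$ of determinant $1$ with $A,B,C,D\in\mathbb{Z}$; it is defined over $\mathbb{Q}$. $S_2$ denotes the automorphism of $X_0(64)$ induced by the matrix $\begin{pmatrix}1&1/2\\0&1\end{pmatrix}$, which normalizes $\Gamma_0(64)$ in $\mathrm{SL}_2(\mathbb{R})/\{\pm1\}$. *)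

theory Defs
  imports
    "HOL-Complex_Analysis.Complex_Analysis"
    "HOL-Algebra.Algebra"
    "HOL-Algebra.Algebraic_Closure_Type"
    "HOL-Library.Quotient_Type"
begin

unbundle no Formal_Power_Series.fps_syntax

section \<open>The field of meromorphic functions on the upper half plane\<close>

definition uhp :: "complex set" where
  "uhp = {z. Im z > 0}"

lemma open_uhp: "open uhp"
  unfolding uhp_def by (rule open_halfspace_Im_gt)

lemma connected_uhp: "connected uhp"
  unfolding uhp_def by (intro convex_connected convex_halfspace_Im_gt)

lemma not_eventually_False_uhp: "\<not> (\<forall>\<^sub>\<approx>z\<in>uhp. False)"
proof
  assume "\<forall>\<^sub>\<approx>z\<in>uhp. False"
  hence "eventually (\<lambda>_. False) (at \<i>)"
    by (rule eventually_cosparse_imp_eventually_at) (auto simp: uhp_def)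
  thus False by simp
qed

definition mero_rel :: "(complex \<Rightarrow> complex) \<Rightarrow> (complex \<Rightarrow> complex) \<Rightarrow> bool" where
  "mero_rel f g \<longleftrightarrow>
     f meromorphic_on uhp \<and> g meromorphic_on uhp \<and> (\<forall>\<^sub>\<approx>z\<in>uhp. f z = g z)"

lemma mero_relI:
  "f meromorphic_on uhp \<Longrightarrow> g meromorphic_on uhp \<Longrightarrow> (\<forall>\<^sub>\<approx>z\<in>uhp. f z = g z) \<Longrightarrow> mero_rel f g"
  by (simp add: mero_rel_def)

quotient_type mero_uhp = "complex \<Rightarrow> complex" / partial: mero_rel
proof (rule part_equivpI)
  show "\<exists>f. mero_rel f f"
    by (rule exI[of _ "\<lambda>_. 0"]) (auto simp: mero_rel_def intro!: meromorphic_intros)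
  show "symp mero_rel"
    by (rule sympI) (auto simp: mero_rel_def eq_commute)
  show "transp mero_rel"
    by (rule transpI) (auto simp: mero_rel_def elim: eventually_elim2)
qed

lemma meromorphic_zero_or_nonzero:
  assumes "f meromorphic_on uhp"
  shows   "(\<forall>\<^sub>\<approx>z\<in>uhp. f z = 0) \<or> (\<forall>\<^sub>\<approx>z\<in>uhp. f z \<noteq> 0)"
  using meromorphic_imp_constant_or_avoid[OF assms open_uhp connected_uhp, of 0] .

instantiation mero_uhp :: field
begin

lift_definition zero_mero_uhp :: mero_uhp is "\<lambda>_. 0"
  by (auto intro!: mero_relI meromorphic_intros)

lift_definition one_mero_uhp :: mero_uhp is "\<lambda>_. 1"
  by (auto intro!: mero_relI meromorphic_intros)

lift_definition plus_mero_uhp :: "mero_uhp \<Rightarrow> mero_uhp \<Rightarrow> mero_uhp"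
  is "\<lambda>f g z. f z + g z"
  by (auto simp: mero_rel_def intro!: meromorphic_intros elim: eventually_elim2)

lift_definition minus_mero_uhp :: "mero_uhp \<Rightarrow> mero_uhp \<Rightarrow> mero_uhp"
  is "\<lambda>f g z. f z - g z"
  by (auto simp: mero_rel_def intro!: meromorphic_intros elim: eventually_elim2)

lift_definition uminus_mero_uhp :: "mero_uhp \<Rightarrow> mero_uhp" is "\<lambda>f z. - f z"
  by (auto simp: mero_rel_def intro!: meromorphic_intros elim: eventually_mono)

lift_definition times_mero_uhp :: "mero_uhp \<Rightarrow> mero_uhp \<Rightarrow> mero_uhp"
  is "\<lambda>f g z. f z * g z"
  by (auto simp: mero_rel_def intro!: meromorphic_intros elim: eventually_elim2)

lift_definition inverse_mero_uhp :: "mero_uhp \<Rightarrow> mero_uhp" is "\<lambda>f z. inverse (f z)"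
  by (auto simp: mero_rel_def intro!: meromorphic_intros elim: eventually_mono)

definition divide_mero_uhp :: "mero_uhp \<Rightarrow> mero_uhp \<Rightarrow> mero_uhp" where
  "divide_mero_uhp f g = f * inverse g"

instance
proof
  fix f g h :: mero_uhp
  show "f + g + h = f + (g + h)"
    by transfer (auto simp: mero_rel_def algebra_simps intro!: meromorphic_intros)
  show "f + g = g + f"
    by transfer (auto simp: mero_rel_def algebra_simps intro!: meromorphic_intros)
  show "0 + f = f"
    by transfer (auto simp: mero_rel_def intro!: meromorphic_intros)
  show "- f + f = 0"
    by transfer (auto simp: mero_rel_def intro!: meromorphic_intros)
  show "f - g = f + - g"
    by transfer (auto simp: mero_rel_def intro!: meromorphic_intros)
  show "f * g * h = f * (g * h)"
    by transfer (auto simp: mero_rel_def algebra_simps intro!: meromorphic_intros)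
  show "f * g = g * f"
    by transfer (auto simp: mero_rel_def algebra_simps intro!: meromorphic_intros)
  show "1 * f = f"
    by transfer (auto simp: mero_rel_def intro!: meromorphic_intros)
  show "(f + g) * h = f * h + g * h"
    by transfer (auto simp: mero_rel_def algebra_simps intro!: meromorphic_intros)
  show "(0 :: mero_uhp) \<noteq> 1"
    by transfer (auto simp: mero_rel_def not_eventually_False_uhp)
  show "inverse f * f = 1" if "f \<noteq> 0"
    using that
  proof transfer
    fix f assume f: "mero_rel f f" and nz: "\<not> mero_rel f (\<lambda>_. 0)"
    from f have mero: "f meromorphic_on uhp" by (simp add: mero_rel_def)
    with nz have "\<not> (\<forall>\<^sub>\<approx>z\<in>uhp. f z = 0)"
      by (auto simp: mero_rel_def intro!: meromorphic_intros)
    with meromorphic_zero_or_nonzero[OF mero] have "\<forall>\<^sub>\<approx>z\<in>uhp. f z \<noteq> 0" by blast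
    hence "\<forall>\<^sub>\<approx>z\<in>uhp. inverse (f z) * f z = 1"
      by (rule eventually_mono) auto
    with mero show "mero_rel (\<lambda>z. inverse (f z) * f z) (\<lambda>_. 1)"
      by (auto simp: mero_rel_def intro!: meromorphic_intros)
  qed
  show "f div g = f * inverse g"
    by (simp add: divide_mero_uhp_def)
  show "inverse (0 :: mero_uhp) = 0"
    by transfer (auto simp: mero_rel_def intro!: meromorphic_intros)
qed

end

lift_definition const_mero_uhp :: "complex \<Rightarrow> mero_uhp" is "\<lambda>c _. c"
  by (auto intro!: mero_relI meromorphic_intros)

lemma const_mero_uhp_add: "const_mero_uhp (a + b) = const_mero_uhp a + const_mero_uhp b"
  by transfer (auto simp: mero_rel_def intro!: meromorphic_intros)

lemma const_mero_uhp_0: "const_mero_uhp 0 = 0"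
  by transfer (auto simp: mero_rel_def intro!: meromorphic_intros)

lemma const_mero_uhp_1: "const_mero_uhp 1 = 1"
  by transfer (auto simp: mero_rel_def intro!: meromorphic_intros)

lemma const_mero_uhp_eq_iff: "const_mero_uhp a = const_mero_uhp b \<longleftrightarrow> a = b"
proof
  assume "const_mero_uhp a = const_mero_uhp b"
  thus "a = b"
  proof transfer
    fix a b :: complex assume "mero_rel (\<lambda>_. a) (\<lambda>_. b)"
    thus "a = b"
      using not_eventually_False_uhp by (cases "a = b") (auto simp: mero_rel_def)
  qed
qed auto

lemma of_nat_mero_uhp: "of_nat n = const_mero_uhp (of_nat n)"
  by (induction n) (simp_all add: const_mero_uhp_add const_mero_uhp_0 const_mero_uhp_1)

instance mero_uhp :: field_char_0
proof
  show "inj (of_nat :: nat \<Rightarrow> mero_uhp)"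
    by (auto simp: inj_def of_nat_mero_uhp const_mero_uhp_eq_iff)
qed


section \<open>Matrices acting on the upper half plane and on functions\<close>

definition mat2 :: "real \<Rightarrow> real \<Rightarrow> real \<Rightarrow> real \<Rightarrow> real^2^2" where
  "mat2 a b c d = vector [vector [a, b], vector [c, d]]"

definition act :: "real^2^2 \<Rightarrow> complex \<Rightarrow> complex" where
  "act M = moebius (of_real (M $ 1 $ 1)) (of_real (M $ 1 $ 2))
                   (of_real (M $ 2 $ 1)) (of_real (M $ 2 $ 2))"

lemma act_denom_nonzero:
  fixes M :: "real^2^2"
  assumes "det M > 0" "z \<in> uhp"
  shows   "of_real (M $ 2 $ 1) * z + of_real (M $ 2 $ 2) \<noteq> 0"
proof
  assume *: "of_real (M $ 2 $ 1) * z + of_real (M $ 2 $ 2) = 0"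
  from arg_cong[OF *, of Im] assms(2) have "M $ 2 $ 1 = 0" by (auto simp: uhp_def)
  moreover from this and * have "M $ 2 $ 2 = 0" by simp
  ultimately show False using assms(1) by (simp add: det_2)
qed

lemma Im_act:
  fixes M :: "real^2^2"
  shows   "Im (act M z) = det M * Im z / norm (of_real (M $ 2 $ 1) * z + of_real (M $ 2 $ 2)) ^ 2"
proof -
  let ?a = "M $ 1 $ 1" and ?b = "M $ 1 $ 2" and ?c = "M $ 2 $ 1" and ?d = "M $ 2 $ 2"
  have "(?a * Im z) * (?c * Re z + ?d) - (?a * Re z + ?b) * (?c * Im z) = det M * Im z"
    by (simp add: det_2 ring_distribs mult_ac)
  thus ?thesis
    by (simp add: act_def moebius_def Im_divide cmod_power2)
qed

lemma act_in_uhp: "det (M :: real^2^2) > 0 \<Longrightarrow> z \<in> uhp \<Longrightarrow> act M z \<in> uhp"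
  using Im_act[of M z] act_denom_nonzero[of M z]
  by (simp add: uhp_def)

lemma act_analytic:
  fixes M :: "real^2^2"
  assumes "det M > 0"
  shows   "act M analytic_on uhp"
  unfolding act_def moebius_def using act_denom_nonzero[OF assms]
  by (auto intro!: analytic_intros)

lemma act_inj:
  fixes M :: "real^2^2"
  assumes "det M > 0" "z \<in> uhp" "w \<in> uhp" "act M z = act M w"
  shows   "z = w"
proof -
  let ?a = "complex_of_real (M $ 1 $ 1)" and ?b = "complex_of_real (M $ 1 $ 2)"
  let ?c = "complex_of_real (M $ 2 $ 1)" and ?d = "complex_of_real (M $ 2 $ 2)"
  have "(?a * z + ?b) * (?c * w + ?d) = (?a * w + ?b) * (?c * z + ?d)"
    using assms(4) act_denom_nonzero[OF assms(1)] assms(2,3)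
    by (simp add: act_def moebius_def frac_eq_eq)
  moreover have "(?a * ?d - ?b * ?c) * (z - w) =
      (?a * z + ?b) * (?c * w + ?d) - (?a * w + ?b) * (?c * z + ?d)"
    by (simp add: ring_distribs mult_ac)
  ultimately have "(?a * ?d - ?b * ?c) * (z - w) = 0" by simp
  moreover have "?a * ?d - ?b * ?c \<noteq> 0"
    using assms(1) by (simp add: det_2 flip: of_real_mult of_real_diff)
  ultimately show ?thesis by simp
qed

lemma eventually_cosparse_act:
  fixes M :: "real^2^2"
  assumes "det M > 0" "\<forall>\<^sub>\<approx>z\<in>uhp. P z"
  shows   "\<forall>\<^sub>\<approx>z\<in>uhp. P (act M z)"
proof (subst eventually_cosparse_open_eq[OF open_uhp], safe)
  fix z assume z: "z \<in> uhp"
  have "eventually P (at (act M z))"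
    using assms act_in_uhp[OF assms(1) z] by (intro eventually_cosparse_imp_eventually_at)
  moreover have "filterlim (act M) (at (act M z)) (at z)"
  proof (rule filterlim_atI)
    show "act M \<midarrow>z\<rightarrow> act M z"
      using act_analytic[OF assms(1)] z
      by (meson analytic_at_imp_isCont analytic_on_analytic_at isCont_def)
    have "eventually (\<lambda>w. w \<in> uhp - {z}) (at z)"
      using z open_uhp by (intro eventually_at_in_open) auto
    thus "eventually (\<lambda>w. act M w \<noteq> act M z) (at z)"
      by eventually_elim (use act_inj[OF assms(1) _ z] in blast)
  qed
  ultimately show "eventually (\<lambda>w. P (act M w)) (at z)"
    by (rule eventually_compose_filterlim)
qed

text \<open>Only matrices of positive determinant act on the upper half plane;
  for the others the value below is a dummy.\<close>

lift_definition pullback :: "real^2^2 \<Rightarrow> mero_uhp \<Rightarrow> mero_uhp"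
  is "\<lambda>M f. if det M > 0 then (\<lambda>z. f (act M z)) else (\<lambda>_. 0)"
proof -
  fix M :: "real^2^2" and f g :: "complex \<Rightarrow> complex"
  assume fg: "mero_rel f g"
  have "(\<lambda>z. h (act M z)) meromorphic_on uhp" if "h meromorphic_on uhp" "det M > 0" for h
    by (rule meromorphic_on_compose[OF that(1) act_analytic[OF that(2)]])
       (use act_in_uhp[OF that(2)] in auto)
  with fg show "mero_rel (if det M > 0 then (\<lambda>z. f (act M z)) else (\<lambda>_. 0))
                         (if det M > 0 then (\<lambda>z. g (act M z)) else (\<lambda>_. 0))"
    using eventually_cosparse_act[of M "\<lambda>z. f z = g z"]
    by (auto simp: mero_rel_def intro!: meromorphic_intros)
qed


section \<open>The function field of $X_0(N)$\<close>

definition SL2Z :: "(real^2^2) set" where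
  "SL2Z = {M. det M = 1 \<and> (\<forall>i j. M $ i $ j \<in> \<int>)}"

definition Gamma0 :: "nat \<Rightarrow> (real^2^2) set" where
  "Gamma0 N = {M \<in> SL2Z. \<exists>k::int. M $ 2 $ 1 = of_int (int N * k)}"

text \<open>Laurent expansion \<open>L\<close> in the parameter $e^{2\pi i z/h}$ for \<open>Im z\<close> large.\<close>

definition fun_has_q_expansion :: "nat \<Rightarrow> (complex \<Rightarrow> complex) \<Rightarrow> complex fls \<Rightarrow> bool" where
  "fun_has_q_expansion h f L \<longleftrightarrow> fls_conv_radius L > 0 \<and>
     (\<exists>Y>0. \<forall>\<^sub>\<approx>z\<in>{z. Im z > Y}. f z = eval_fls L (exp (2 * pi * \<i> * z / of_nat h)))"

lemma fun_has_q_expansion_mero_rel: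
  assumes "mero_rel f g" "fun_has_q_expansion h f L"
  shows   "fun_has_q_expansion h g L"
proof -
  let ?E = "\<lambda>z. eval_fls L (exp (2 * pi * \<i> * z / of_nat h))"
  from assms(2) obtain Y where Y: "Y > 0" "\<forall>\<^sub>\<approx>z\<in>{z. Im z > Y}. f z = ?E z"
    and L: "fls_conv_radius L > 0"
    unfolding fun_has_q_expansion_def by blast
  have "\<forall>\<^sub>\<approx>z\<in>uhp. f z = g z" using assms(1) by (simp add: mero_rel_def)
  hence "\<forall>\<^sub>\<approx>z\<in>{z. Im z > Y}. f z = g z"
    unfolding eventually_cosparse
    by (rule sparse_in_subset) (use Y(1) in \<open>auto simp: uhp_def\<close>)
  with Y(2) have "\<forall>\<^sub>\<approx>z\<in>{z. Im z > Y}. g z = ?E z"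
    by eventually_elim auto
  with Y(1) L show ?thesis
    unfolding fun_has_q_expansion_def by blast
qed

lemma mero_rel_sym: "mero_rel f g \<Longrightarrow> mero_rel g f"
  by (auto simp: mero_rel_def eq_commute)

lift_definition has_q_expansion :: "nat \<Rightarrow> mero_uhp \<Rightarrow> complex fls \<Rightarrow> bool"
  is fun_has_q_expansion
  by (intro ext iffI) (blast intro: fun_has_q_expansion_mero_rel mero_rel_sym)+

text \<open>The elements of $\mathbb{C}(X_0(N))$. Every cusp is $\gamma\infty$ for some \<open>\<gamma>\<close> in \<open>SL2Z\<close>,
  and its width divides \<open>N\<close>, so meromorphy at all cusps can be tested in the parameter
  $e^{2\pi i z/N}$.\<close>

definition modular_functions :: "nat \<Rightarrow> mero_uhp set" where
  "modular_functions N = {f. (\<forall>\<gamma>\<in>Gamma0 N. pullback \<gamma> f = f) \<and>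
                             (\<forall>\<gamma>\<in>SL2Z. \<exists>L. has_q_expansion N (pullback \<gamma> f) L)}"

definition rational_modular_functions :: "nat \<Rightarrow> mero_uhp set" where
  "rational_modular_functions N =
     {f \<in> modular_functions N. \<exists>L. has_q_expansion 1 f L \<and> (\<forall>n. fls_nth L n \<in> \<rat>)}"

definition X0_function_field :: "nat \<Rightarrow> mero_uhp ring" where
  "X0_function_field N = ring_of_type_algebra\<lparr>carrier := rational_modular_functions N\<rparr>"

definition Q_adjoin :: "'a::field_char_0 set \<Rightarrow> 'a set" where
  "Q_adjoin S = generate_field ring_of_type_algebra (\<rat> \<union> S)"


section \<open>Automorphisms of $X_0(N)$\<close>

definition atkin_lehner_matrices :: "nat \<Rightarrow> nat \<Rightarrow> (real^2^2) set" where
  "atkin_lehner_matrices N d =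
     {M. d > 0 \<and> d dvd N \<and> coprime d (N div d) \<and> det M = 1 \<and>
         (\<exists>A B C D :: int. M = (1 / sqrt d) *\<^sub>R
            mat2 (of_int (A * int d)) (of_int B) (of_int (int N * C)) (of_int (D * int d)))}"

definition S2 :: "real^2^2" where
  "S2 = mat2 1 (1/2) 0 1"

definition normalizes :: "real^2^2 \<Rightarrow> (real^2^2) set \<Rightarrow> bool" where
  "normalizes M G \<longleftrightarrow> (\<lambda>\<gamma>. M ** \<gamma> ** matrix_inv M) ` G = G"

definition Gamma0_orbit :: "nat \<Rightarrow> complex \<Rightarrow> complex set" where
  "Gamma0_orbit N z = (\<lambda>\<gamma>. act \<gamma> z) ` Gamma0 N"

text \<open>\<open>M\<close> induces an automorphism of $X_0(N)$ that has order exactly 2 (as a map on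
  $\Gamma_0(N)$-orbits, a dense subset of the curve), and that is defined over the rationals,
  i.e. its pullback restricts to an automorphism of the rational function field.\<close>

definition induces_involution_over_Q :: "nat \<Rightarrow> real^2^2 \<Rightarrow> bool" where
  "induces_involution_over_Q N M \<longleftrightarrow>
     det M = 1 \<and> normalizes M (Gamma0 N) \<and>
     (\<forall>z\<in>uhp. Gamma0_orbit N (act M (act M z)) = Gamma0_orbit N z) \<and>
     (\<exists>z\<in>uhp. Gamma0_orbit N (act M z) \<noteq> Gamma0_orbit N z) \<and>
     pullback M \<in> ring_iso (X0_function_field N) (X0_function_field N)"


section \<open>Affine equations for a curve\<close>

definition is_fraction_field :: "('a, 'm) ring_scheme \<Rightarrow> ('b, 'n) ring_scheme \<Rightarrow> bool" where
  "is_fraction_field R K \<longleftrightarrow> domain R \<and> field K \<and>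
     (\<exists>\<phi>\<in>ring_hom R K. inj_on \<phi> (carrier R) \<and>
        carrier K = {\<phi> a \<otimes>\<^bsub>K\<^esub> inv\<^bsub>K\<^esub> \<phi> b |a b. a \<in> carrier R \<and> b \<in> carrier R - {\<zero>\<^bsub>R\<^esub>}})"

text \<open>The ring \<open>\<rat>[X,Y,T]\<close> as iterated univariate polynomials.\<close>

type_synonym poly3 = "rat poly poly poly"

definition polyX :: poly3 where "polyX = [:[:[:0, 1:]:]:]"
definition polyY :: poly3 where "polyY = [:[:0, 1:]:]"
definition polyT :: poly3 where "polyT = [:0, 1:]"

definition coordinate_ring :: "poly3 set \<Rightarrow> poly3 set ring" where
  "coordinate_ring E = ring_of_type_algebra Quot (Idl\<^bsub>ring_of_type_algebra\<^esub> E)"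

text \<open>The affine curve \<open>E = 0\<close> is birationally equivalent over the rationals to the smooth
  projective curve with function field \<open>K\<close>: its own function field is isomorphic to \<open>K\<close>.
  Ring homomorphisms between algebras over the rationals are automatically linear over the
  rationals, so nothing need be said about constants.\<close>

definition affine_equations_over_Q :: "poly3 set \<Rightarrow> 'a ring \<Rightarrow> bool" where
  "affine_equations_over_Q E K \<longleftrightarrow> is_fraction_field (coordinate_ring E) K"

end

theory Submission
  imports Defs "HOL-Library.Nat_Bijection" "HOL-Real_Asymp.Real_Asymp"
begin

text \<open>With \<open>U = \<theta>\<^sub>2 / \<theta>\<^sub>3\<close> and \<open>V = \<theta>\<^sub>4 / \<theta>\<^sub>3\<close> evaluated at \<open>8 z\<close>, Jacobi's identity \<open>U\<^sup>4 + V\<^sup>4 = 1\<close> says that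
  \<open>a = 1 / U\<close> and \<open>b = V / U\<close> parametrise the Fermat quartic \<open>a\<^sup>4 = b\<^sup>4 + 1\<close>, which is a model of
  \<open>X\<^sub>0(64)\<close>. The involution is \<open>(a, b) \<mapsto> (-a, b)\<close>, and \<open>x = 2 (a\<^sup>2 + b\<^sup>2)\<close>, \<open>y = 2 b x\<close>, \<open>t = 2 a y\<close> satisfy
  the two equations because \<open>x\<^sup>2 - 4 = 4 b\<^sup>2 x\<close> and \<open>x\<^sup>2 + 4 = 4 a\<^sup>2 x\<close>.

  That \<open>U\<close> and \<open>V\<close> generate: \<open>\<Gamma>\<^sub>0(64)\<close> is conjugate by \<open>z \<mapsto> 8 z\<close> to a normal subgroup of \<open>\<Gamma>(2)\<close>
  with abelian quotient of type (4, 4). A function on it splits into eigenfunctions of the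
  quotient, and dividing these by monomials in \<open>U\<close> and \<open>V\<close> reduces to functions of level 2, which are
  rational in \<open>\<lambda> = U\<^sup>4\<close>: after clearing poles in the upper half plane and at the cusps the maximum
  principle applies on the compactified quotient. Rationality of the coefficients descends by applying a
  rational linear functional to a complex linear relation between rational expansions.\<close>

text \<open>The analytic obstacle is \<open>theta_u (- 1 / z) = theta_v z\<close>; with translation
  by 1 it gives the action of all of \<open>SL2Z\<close>. It comes from Fourier analysis on a cyclic
  group of order 2N applied to a power of the cosine. The exponent grows like N^2, so that both the
  cosine power and its Fourier coefficients tend to Gaussians. The normalising factor is the same
  for the two characters involved and cancels in the quotient, which is why quotients of theta
  constants are used throughout. The sign of the involution is read off after scaling by 8: its
  matrix becomes an element of \<open>Gamma2\<close> whose off-diagonal entries are 4 times odd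
  numbers. There both multiplier characters take the value -1, so U and V change sign,
  \<open>a = 1 / U\<close> changes sign and \<open>b = V / U\<close> is fixed. Non-constancy is
  detected by translation by 1/4, which multiplies U by i and x by -1. Behaviour at cusps is carried
  as exponential growth, because widths change under scaling by 8 while growth survives it.\<close>

lemma has_sum_product:
  fixes f :: "'a \<Rightarrow> complex" and g :: "'b \<Rightarrow> complex"
  assumes f: "(f has_sum a) A" and g: "(g has_sum b) B"
  shows "((\<lambda>(x, y). f x * g y) has_sum (a * b)) (A \<times> B)"
proof (rule has_sum_SigmaI[where g = "\<lambda>x. f x * b"])
  show "((\<lambda>y. case (x, y) of (x, y) \<Rightarrow> f x * g y) has_sum f x * b) B" for x
    using has_sum_cmult_right[OF g, of "f x"] by simp
  show "((\<lambda>x. f x * b) has_sum a * b) A"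
    by (rule has_sum_cmult_left[OF f])
  \<comment> \<open>Unconditional and absolute summability agree for complex families, so the double
    family is controlled by the product of the two norm families.\<close>
  have "(\<lambda>x. norm (f x)) summable_on A" "(\<lambda>y. norm (g y)) summable_on B"
    using f g by (auto simp: summable_on_iff_abs_summable_on_complex[symmetric] summable_on_def)
  hence "(\<lambda>(x, y). norm (f x) * norm (g y)) summable_on (A \<times> B)"
    by (intro summable_on_SigmaI[where g = "\<lambda>x. norm (f x) * (\<Sum>\<^sub>\<infinity>y\<in>B. norm (g y))"])
       (auto intro!: has_sum_cmult_right has_sum_infsum summable_on_cmult_left)
  hence "(\<lambda>z. norm (case z of (x, y) \<Rightarrow> f x * g y)) summable_on (A \<times> B)"
    by (simp add: case_prod_unfold norm_mult)
  thus "(\<lambda>(x, y). f x * g y) summable_on A \<times> B"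
    using summable_on_iff_abs_summable_on_complex by blast
qed

subsection \<open>Lattice sums\<close>

definition lattice_sum :: "(int \<Rightarrow> nat) \<Rightarrow> complex \<Rightarrow> complex" where
  "lattice_sum e p = (\<Sum>\<^sub>\<infinity>k\<in>UNIV. p ^ e k)"

definition lattice_fps :: "(int \<Rightarrow> nat) \<Rightarrow> complex fps" where
  "lattice_fps e = Abs_fps (\<lambda>n. of_nat (card {k. e k = n}))"

text \<open>Linear growth gives both convergence on the unit disc and finite fibres. The summand 1
  makes room for exponents that vanish at \<open>k = -1\<close>, such as \<open>tri_exp k\<close> or
  \<open>sq_exp (k + 1)\<close>.\<close>

definition proper_exponent :: "(int \<Rightarrow> nat) \<Rightarrow> bool" where
  "proper_exponent e \<longleftrightarrow> (\<forall>k. \<bar>k\<bar> \<le> int (e k) + 1)"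

lemma summable_on_int_geometric:
  fixes r :: real
  assumes "0 \<le> r" "r < 1"
  shows "(\<lambda>k. r ^ (nat \<bar>k\<bar> - 1)) summable_on (UNIV :: int set)"
proof -
  have s: "(\<lambda>n. r ^ (n - 1)) summable_on (UNIV :: nat set)"
  proof -
    have "summable (\<lambda>n. r ^ (n - 1))"
      by (subst summable_Suc_iff[symmetric]) (use assms in simp)
    thus ?thesis
      by (intro norm_summable_imp_summable_on) (use assms in simp)
  qed
  have *: "(\<lambda>k. r ^ (nat \<bar>k\<bar> - 1)) summable_on (range int)"
          "(\<lambda>k. r ^ (nat \<bar>k\<bar> - 1)) summable_on (range (\<lambda>n. - int n))"
    using s by (subst summable_on_reindex; simp add: inj_def o_def)+
  have **: "(\<lambda>k. r ^ (nat \<bar>k\<bar> - 1)) summable_on (range (\<lambda>n. - int n) - range int)"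
    by (rule summable_on_subset_banach[OF *(2)]) auto
  have "range int \<union> (range (\<lambda>n. - int n) - range int) = UNIV"
  proof -
    have "x \<in> range int \<or> x \<in> range (\<lambda>n. - int n)" for x
      by (cases x rule: int_cases2) auto
    thus ?thesis by auto
  qed
  thus ?thesis
    using summable_on_Un_disjoint[OF *(1) **] by auto
qed

lemma lattice_sum_has_sum:
  assumes "proper_exponent e" "norm p < 1"
  shows "((\<lambda>k. p ^ e k) has_sum lattice_sum e p) UNIV"
proof -
  have "(\<lambda>k. norm (p ^ e k)) summable_on UNIV"
  proof (rule Infinite_Sum.abs_summable_on_comparison_test)
    show "(\<lambda>k. norm (norm p ^ (nat \<bar>k\<bar> - 1))) summable_on (UNIV :: int set)"
      using summable_on_int_geometric[of "norm p"] assms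
      by (simp flip: summable_on_iff_abs_summable_on_real)
    show "norm (p ^ e k) \<le> norm (norm p ^ (nat \<bar>k\<bar> - 1))" for k
    proof -
      have "\<bar>k\<bar> \<le> int (e k) + 1" using assms by (auto simp: proper_exponent_def)
      hence "nat \<bar>k\<bar> - 1 \<le> e k" by linarith
      thus ?thesis using assms by (simp add: norm_power power_decreasing)
    qed
  qed
  thus ?thesis unfolding lattice_sum_def
    by (intro has_sum_infsum) (rule abs_summable_summable)
qed

lemma finite_proper_exponent:
  assumes "proper_exponent e"
  shows "finite {k. e k = n}"
proof (rule finite_subset)
  show "{k. e k = n} \<subseteq> {- (int n + 1)..int n + 1}"
  proof safe
    fix k assume "n = e k"
    moreover have "\<bar>k\<bar> \<le> int (e k) + 1"
      using assms by (auto simp: proper_exponent_def)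
    ultimately show "k \<in> {- (int (e k) + 1)..int (e k) + 1}" by auto
  qed
qed auto

text \<open>The sum over \<open>k\<close> is regrouped by the value of the exponent, each fibre
  being finite.\<close>

lemma lattice_sum_sums:
  assumes "proper_exponent e" "norm p < 1"
  shows "(\<lambda>n. fps_nth (lattice_fps e) n * p ^ n) sums lattice_sum e p"
proof -
  have "bij_betw (\<lambda>(n, k). k) (SIGMA n:UNIV. {k. e k = n}) UNIV"
    by (rule bij_betwI[where g = "\<lambda>k. (e k, k)"]) auto
  from has_sum_reindex_bij_betw[OF this, of "\<lambda>k. p ^ e k" "lattice_sum e p"]
  have 1: "((\<lambda>x. p ^ e (snd x)) has_sum lattice_sum e p) (SIGMA n:UNIV. {k. e k = n})"
    using lattice_sum_has_sum[OF assms] by (simp add: case_prod_unfold)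
  have "((\<lambda>n. fps_nth (lattice_fps e) n * p ^ n) has_sum lattice_sum e p) UNIV"
  proof (rule has_sum_SigmaD[OF 1])
    fix n :: nat
    have "((\<lambda>k. p ^ e k) has_sum (\<Sum>k\<in>{k. e k = n}. p ^ e k)) {k. e k = n}"
      by (intro has_sum_finite finite_proper_exponent assms)
    thus "((\<lambda>k. p ^ e (snd (n, k))) has_sum fps_nth (lattice_fps e) n * p ^ n) {k. e k = n}"
      by (simp add: lattice_fps_def)
  qed
  thus ?thesis by (rule has_sum_imp_sums)
qed

lemma lattice_fps_conv_radius:
  assumes "proper_exponent e"
  shows "fps_conv_radius (lattice_fps e) \<ge> 1"
  unfolding fps_conv_radius_def
proof (rule conv_radius_geI_ex')
  fix r :: real assume "0 < r" "ereal r < 1"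
  thus "summable (\<lambda>n. fps_nth (lattice_fps e) n * of_real r ^ n)"
    using sums_summable[OF lattice_sum_sums[OF assms, of "of_real r"]] by simp
qed

lemma eval_lattice_fps:
  assumes "proper_exponent e" "norm p < 1"
  shows "eval_fps (lattice_fps e) p = lattice_sum e p"
  unfolding eval_fps_def by (rule sums_unique[OF lattice_sum_sums[OF assms], symmetric])

lemma lattice_sum_holomorphic:
  assumes "proper_exponent e"
  shows "lattice_sum e holomorphic_on ball 0 1"
proof -
  have "eval_fps (lattice_fps e) holomorphic_on ball 0 1"
  proof (rule holomorphic_on_eval_fps)
    show "(ball 0 1 :: complex set) \<subseteq> eball 0 (fps_conv_radius (lattice_fps e))"
    proof (rule subsetI)
      fix z :: complex assume "z \<in> ball 0 1"
      hence "ereal (dist 0 z) < 1" by simp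
      also note lattice_fps_conv_radius[OF assms]
      finally show "z \<in> eball 0 (fps_conv_radius (lattice_fps e))" by (simp add: eball_def)
    qed
  qed
  thus ?thesis
    by (rule holomorphic_transform) (use assms eval_lattice_fps in auto)
qed

lemma lattice_sum_0:
  assumes "proper_exponent e"
  shows "lattice_sum e 0 = of_nat (card {k. e k = 0})"
  using eval_lattice_fps[OF assms, of 0] by (simp add: eval_fps_at_0 lattice_fps_def)

lemma lattice_sum_reindex:
  assumes "bij g"
  shows "lattice_sum (\<lambda>k. e (g k)) p = lattice_sum e p"
  unfolding lattice_sum_def by (rule infsum_reindex_bij_betw[OF assms])

lemma norm_square_less_1: "norm (p\<^sup>2) < 1" if "norm p < 1" for p :: complex
  using that by (simp add: norm_power power_less_one_iff)

text \<open>The index pairs with even and odd sum are \<open>(a + b, a - b)\<close> and \<open>(a + b + 1, a - b)\<close>.\<close>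

lemma lattice_sum_mult_split:
  assumes e: "proper_exponent e" "proper_exponent e'" and p: "norm p < 1"
    and f: "proper_exponent f1" "proper_exponent f2" "proper_exponent g1" "proper_exponent g2"
    and even_part: "\<And>a b. e (a + b) + e' (a - b) = 2 * f1 a + 2 * f2 b + c"
    and odd_part: "\<And>a b. e (a + b + 1) + e' (a - b) = 2 * g1 a + 2 * g2 b + d"
  shows "lattice_sum e p * lattice_sum e' p =
    p ^ c * lattice_sum f1 (p\<^sup>2) * lattice_sum f2 (p\<^sup>2) + p ^ d * lattice_sum g1 (p\<^sup>2) * lattice_sum g2 (p\<^sup>2)"
proof -
  have p2: "norm (p\<^sup>2) < 1"
    by (rule norm_square_less_1[OF p])
  let ?F = "\<lambda>(m, n). p ^ e m * p ^ e' n"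
  have F_eq: "p ^ i * p ^ j = p ^ k * ((p\<^sup>2) ^ l * (p\<^sup>2) ^ m)" if "i + j = 2 * l + 2 * m + k" for i j k l m
    using that by (simp add: mult_ac add_ac flip: power_add power_mult)
  define E where "E = {(m, n). even (m + n :: int)}"
  define O' where "O' = {(m, n). odd (m + n :: int)}"
  have "((\<lambda>(a, b). (p\<^sup>2) ^ f1 a * (p\<^sup>2) ^ f2 b) has_sum
          (lattice_sum f1 (p\<^sup>2) * lattice_sum f2 (p\<^sup>2))) (UNIV \<times> UNIV)"
    by (intro has_sum_product lattice_sum_has_sum f p2)
  from has_sum_cmult_right[OF this, of "p ^ c"]
  have 1: "((\<lambda>(a, b). ?F (a + b, a - b)) has_sum
          (p ^ c * lattice_sum f1 (p\<^sup>2) * lattice_sum f2 (p\<^sup>2))) (UNIV \<times> UNIV)"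
    by (simp add: case_prod_unfold mult.assoc even_part F_eq)
  have "((\<lambda>(a, b). (p\<^sup>2) ^ g1 a * (p\<^sup>2) ^ g2 b) has_sum
          (lattice_sum g1 (p\<^sup>2) * lattice_sum g2 (p\<^sup>2))) (UNIV \<times> UNIV)"
    by (intro has_sum_product lattice_sum_has_sum f p2)
  from has_sum_cmult_right[OF this, of "p ^ d"]
  have 2: "((\<lambda>(a, b). ?F (a + b + 1, a - b)) has_sum
          (p ^ d * lattice_sum g1 (p\<^sup>2) * lattice_sum g2 (p\<^sup>2))) (UNIV \<times> UNIV)"
    by (simp add: case_prod_unfold mult.assoc odd_part F_eq)
  have b1: "bij_betw (\<lambda>(a, b). (a + b, a - b)) (UNIV \<times> UNIV) E"
    by (rule bij_betwI[where g = "\<lambda>(m, n). ((m + n) div 2, (m - n) div 2)"])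
       (auto simp: E_def, presburger+)
  have b2: "bij_betw (\<lambda>(a, b). (a + b + 1, a - b)) (UNIV \<times> UNIV) O'"
    by (rule bij_betwI[where g = "\<lambda>(m, n). ((m + n - 1) div 2, (m - n - 1) div 2)"])
       (auto simp: O'_def, presburger+)
  have 1: "(?F has_sum (p ^ c * lattice_sum f1 (p\<^sup>2) * lattice_sum f2 (p\<^sup>2))) E"
    using 1 by (subst has_sum_reindex_bij_betw[OF b1, symmetric]) (simp add: case_prod_unfold)
  have 2: "(?F has_sum (p ^ d * lattice_sum g1 (p\<^sup>2) * lattice_sum g2 (p\<^sup>2))) O'"
    using 2 by (subst has_sum_reindex_bij_betw[OF b2, symmetric]) (simp add: case_prod_unfold)
  have "E \<inter> O' = {}" "E \<union> O' = UNIV \<times> UNIV" by (auto simp: E_def O'_def)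
  with has_sum_Un_disjoint[OF 1 2]
  have "(?F has_sum (p ^ c * lattice_sum f1 (p\<^sup>2) * lattice_sum f2 (p\<^sup>2) +
     p ^ d * lattice_sum g1 (p\<^sup>2) * lattice_sum g2 (p\<^sup>2))) (UNIV \<times> UNIV)" by simp
  moreover have "(?F has_sum (lattice_sum e p * lattice_sum e' p)) (UNIV \<times> UNIV)"
    by (intro has_sum_product lattice_sum_has_sum e p)
  ultimately show ?thesis using has_sum_unique by blast
qed

subsection \<open>Theta constants\<close>

definition sq_exp :: "int \<Rightarrow> nat" where "sq_exp k = nat (k\<^sup>2)"
definition tri_exp :: "int \<Rightarrow> nat" where "tri_exp k = nat (k * (k + 1))"

text \<open>With \<open>p = exp (i \<pi> \<tau>)\<close>: \<open>\<theta>\<^sub>3 = theta_phi p\<close>, \<open>\<theta>\<^sub>4 = theta_phi (-p)\<close> and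
  \<open>\<theta>\<^sub>2 = p\<^bsup>1/4\<^esup> theta_psi p\<close>.\<close>

definition theta_phi :: "complex \<Rightarrow> complex" where "theta_phi = lattice_sum sq_exp"
definition theta_psi :: "complex \<Rightarrow> complex" where "theta_psi = lattice_sum tri_exp"

lemma int_sq_exp: "int (sq_exp k) = k\<^sup>2"
  by (simp add: sq_exp_def)

lemma tri_nonneg: "k * (k + 1) \<ge> (0 :: int)"
  by (cases "k \<ge> 0") (auto simp: mult_nonneg_nonneg mult_nonpos_nonpos)

lemma int_tri_exp: "int (tri_exp k) = k * (k + 1)"
  using tri_nonneg[of k] by (simp add: tri_exp_def)

lemma proper_sq_exp: "proper_exponent sq_exp"
  unfolding proper_exponent_def int_sq_exp
proof
  fix k :: int
  have "k\<^sup>2 = \<bar>k\<bar> * \<bar>k\<bar>" by (simp add: power2_eq_square)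
  moreover have "\<bar>k\<bar> \<le> \<bar>k\<bar> * \<bar>k\<bar>"
    by (cases "k = 0") (auto intro: mult_left_mono[of 1 "\<bar>k\<bar>" "\<bar>k\<bar>", simplified])
  ultimately show "\<bar>k\<bar> \<le> k\<^sup>2 + 1" by linarith
qed

lemma proper_tri_exp: "proper_exponent tri_exp"
  unfolding proper_exponent_def int_tri_exp
proof
  fix k :: int
  have "(k + 1)\<^sup>2 \<ge> 0" "k\<^sup>2 \<ge> 0" by auto
  thus "\<bar>k\<bar> \<le> k * (k + 1) + 1" by (simp add: power2_eq_square algebra_simps abs_if)
qed

text \<open>The parity split of index pairs turns m^2 + n^2 into 2 a^2 + 2 b^2 or 2 a (a + 1) + 2 b
  (b + 1) + 1. Classically: theta_3^2 at tau is theta_3^2 + theta_2^2 at 2 tau.\<close>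

lemma theta_phi_square:
  assumes "norm p < 1"
  shows "theta_phi p ^ 2 = theta_phi (p\<^sup>2) ^ 2 + p * theta_psi (p\<^sup>2) ^ 2"
proof -
  have "int (sq_exp (a + b) + sq_exp (a - b)) = int (2 * sq_exp a + 2 * sq_exp b + 0)" for a b
    by (simp only: of_nat_add of_nat_mult int_sq_exp) (simp add: power2_eq_square algebra_simps)
  moreover have "int (sq_exp (a + b + 1) + sq_exp (a - b)) = int (2 * tri_exp a + 2 * tri_exp b + 1)" for a b
    by (simp only: of_nat_add of_nat_mult int_sq_exp int_tri_exp)
       (simp add: power2_eq_square algebra_simps)
  ultimately have "lattice_sum sq_exp p * lattice_sum sq_exp p =
    p ^ 0 * lattice_sum sq_exp (p\<^sup>2) * lattice_sum sq_exp (p\<^sup>2) +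
    p ^ 1 * lattice_sum tri_exp (p\<^sup>2) * lattice_sum tri_exp (p\<^sup>2)"
    by (intro lattice_sum_mult_split proper_sq_exp proper_tri_exp assms)
       (simp_all only: of_nat_eq_iff)
  thus ?thesis by (simp add: theta_phi_def theta_psi_def power2_eq_square)
qed

text \<open>Both parity classes give the same product, since shifting the squares by one only
  reindexes the sum. Classically: theta_2^2 at tau is 2 theta_2 theta_3 at 2 tau.\<close>

lemma theta_psi_square:
  assumes "norm p < 1"
  shows "theta_psi p ^ 2 = 2 * theta_phi (p\<^sup>2) * theta_psi (p\<^sup>2)"
proof -
  let ?s = "\<lambda>k. sq_exp (k + 1)"
  have "proper_exponent ?s"
    unfolding proper_exponent_def int_sq_exp
  proof
    fix k :: int
    have "(k + 1)\<^sup>2 = \<bar>k + 1\<bar> * \<bar>k + 1\<bar>" by (simp add: power2_eq_square)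
    moreover have "\<bar>k + 1\<bar> \<le> \<bar>k + 1\<bar> * \<bar>k + 1\<bar>"
      by (cases "k + 1 = 0") (auto intro: mult_left_mono[of 1 "\<bar>k + 1\<bar>" "\<bar>k + 1\<bar>", simplified])
    ultimately show "\<bar>k\<bar> \<le> (k + 1)\<^sup>2 + 1" by linarith
  qed
  moreover have "int (tri_exp (a + b) + tri_exp (a - b)) = int (2 * tri_exp a + 2 * sq_exp b + 0)" for a b
    by (simp only: of_nat_add of_nat_mult int_sq_exp int_tri_exp)
       (simp add: power2_eq_square algebra_simps)
  moreover have "int (tri_exp (a + b + 1) + tri_exp (a - b)) = int (2 * ?s a + 2 * tri_exp b + 0)" for a b
    by (simp only: of_nat_add of_nat_mult int_sq_exp int_tri_exp)
       (simp add: power2_eq_square algebra_simps)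
  ultimately have "lattice_sum tri_exp p * lattice_sum tri_exp p =
    p ^ 0 * lattice_sum tri_exp (p\<^sup>2) * lattice_sum sq_exp (p\<^sup>2) +
    p ^ 0 * lattice_sum ?s (p\<^sup>2) * lattice_sum tri_exp (p\<^sup>2)"
    by (intro lattice_sum_mult_split proper_sq_exp proper_tri_exp assms)
       (simp_all only: of_nat_eq_iff)
  moreover have "lattice_sum ?s (p\<^sup>2) = lattice_sum sq_exp (p\<^sup>2)"
    by (rule lattice_sum_reindex) (rule bij_betwI[where g = "\<lambda>k. k - 1"], auto)
  ultimately show ?thesis by (simp add: theta_phi_def theta_psi_def power2_eq_square)
qed

lemma theta_psi_minus: "theta_psi (- p) = theta_psi p"
proof -
  have "even (int (tri_exp k))" for k by (simp add: int_tri_exp)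
  thus ?thesis by (simp add: theta_psi_def lattice_sum_def)
qed

lemma theta_phi_minus_square:
  assumes "norm p < 1"
  shows "theta_phi (- p) ^ 2 = theta_phi (p\<^sup>2) ^ 2 - p * theta_psi (p\<^sup>2) ^ 2"
  using theta_phi_square[of "- p"] assms by simp

text \<open>With A = \<open>theta_phi (p^2) ^ 2\<close> and B =
  \<open>p * theta_psi (p^2) ^ 2\<close> this is (A + B)^2 - (A - B)^2 = 4 A B, the right side
  coming from \<open>theta_psi_square\<close>.\<close>

lemma theta_jacobi:
  assumes "norm p < 1"
  shows "theta_phi p ^ 4 = theta_phi (- p) ^ 4 + p * theta_psi p ^ 4"
proof -
  have sq: "x ^ 4 = (x ^ 2) ^ 2" for x :: complex by (simp flip: power_mult)
  show ?thesis
    unfolding sq theta_phi_square[OF assms] theta_phi_minus_square[OF assms] theta_psi_square[OF assms]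
    by (simp add: power2_eq_square algebra_simps)
qed

text \<open>In the same notation the product is A^2 - B^2, which Jacobi's identity at p^2 evaluates.
  It supplies the doubling relation for zeros of \<open>theta_phi\<close>.\<close>

lemma theta_phi_prod:
  assumes "norm p < 1"
  shows "theta_phi p ^ 2 * theta_phi (- p) ^ 2 = theta_phi (- (p\<^sup>2)) ^ 4"
proof -
  have p2: "norm (p\<^sup>2) < 1"
    by (rule norm_square_less_1[OF assms])
  show ?thesis
    using theta_jacobi[OF p2]
    unfolding theta_phi_square[OF assms] theta_phi_minus_square[OF assms]
    by (simp add: power2_eq_square power4_eq_xxxx algebra_simps)
qed

lemma theta_phi_0 [simp]: "theta_phi 0 = 1"
proof -
  have "int (sq_exp k) = 0 \<longleftrightarrow> k = 0" for k unfolding int_sq_exp by simp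
  hence "{k. sq_exp k = 0} = {0}" by auto
  thus ?thesis by (simp add: theta_phi_def lattice_sum_0 proper_sq_exp)
qed

lemma theta_psi_0 [simp]: "theta_psi 0 = 2"
proof -
  have "int (tri_exp k) = 0 \<longleftrightarrow> k \<in> {0, -1}" for k unfolding int_tri_exp by auto
  hence "{k. tri_exp k = 0} = {0, -1}" by auto
  thus ?thesis by (simp add: theta_psi_def lattice_sum_0 proper_tri_exp)
qed

lemma theta_phi_holomorphic: "theta_phi holomorphic_on ball 0 1"
  unfolding theta_phi_def by (rule lattice_sum_holomorphic[OF proper_sq_exp])

lemma theta_psi_holomorphic: "theta_psi holomorphic_on ball 0 1"
  unfolding theta_psi_def by (rule lattice_sum_holomorphic[OF proper_tri_exp])

text \<open>A zero at p propagates to p^2, p^4, p^8 and so on; these points tend to 0, so continuity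
  would force \<open>f 0 = 0\<close>.\<close>

lemma holomorphic_nonzero_by_doubling:
  fixes f :: "complex \<Rightarrow> complex"
  assumes holo: "f holomorphic_on ball 0 1" and f0: "f 0 \<noteq> 0"
    and doubling: "\<And>p. norm p < 1 \<Longrightarrow> f p = 0 \<Longrightarrow> f (p\<^sup>2) = 0"
    and p: "norm p < 1"
  shows "f p \<noteq> 0"
proof
  assume "f p = 0"
  have "norm (p ^ (2 ^ k)) < 1 \<and> f (p ^ (2 ^ k)) = 0" for k
  proof (induction k)
    case (Suc k)
    have "p ^ (2 ^ Suc k) = (p ^ (2 ^ k))\<^sup>2"
      by (simp add: mult.commute flip: power_mult)
    thus ?case using doubling[of "p ^ (2 ^ k)"] norm_square_less_1[of "p ^ (2 ^ k)"] Suc by simp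
  qed (use p \<open>f p = 0\<close> in auto)
  note zero = this
  have cont: "isCont f 0"
    using holomorphic_on_imp_continuous_on[OF holo] continuous_on_eq_continuous_at[of "ball 0 1" f]
    by simp
  have "strict_mono (\<lambda>k. 2 ^ k :: nat)" by (rule strict_monoI) simp
  from LIMSEQ_subseq_LIMSEQ[OF LIMSEQ_power_zero[OF p] this]
  have "(\<lambda>k. p ^ (2 ^ k)) \<longlonglongrightarrow> 0" by (simp only: o_def)
  from isCont_tendsto_compose[OF cont this]
  have "(\<lambda>k. f (p ^ (2 ^ k))) \<longlonglongrightarrow> f 0" .
  moreover have "(\<lambda>k. f (p ^ (2 ^ k))) = (\<lambda>_. 0)" using zero by (intro ext) blast
  ultimately have "f 0 = 0" using LIMSEQ_unique tendsto_const by metis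
  with f0 show False by simp
qed

lemma theta_phi_nonzero:
  assumes "norm p < 1"
  shows "theta_phi p \<noteq> 0"
proof -
  \<comment> \<open>\<open>theta_phi_prod\<close> carries a zero of \<open>theta_phi\<close> from -p
    to -(p^2), so the doubling argument is run for the reflected function and evaluated at
    -p.\<close>
  have "theta_phi (- (- p)) \<noteq> 0"
  proof (rule holomorphic_nonzero_by_doubling[where f = "\<lambda>p. theta_phi (- p)"])
    show "(\<lambda>p. theta_phi (- p)) holomorphic_on ball 0 1"
      by (rule holomorphic_on_compose_gen[OF _ theta_phi_holomorphic, unfolded o_def])
         (auto intro!: holomorphic_intros)
    show "theta_phi (- (p\<^sup>2)) = 0" if "norm p < 1" "theta_phi (- p) = 0" for p
      using theta_phi_prod[OF that(1)] that(2) by simp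
  qed (use assms in auto)
  thus ?thesis by simp
qed

lemma theta_psi_nonzero:
  assumes "norm p < 1"
  shows "theta_psi p \<noteq> 0"
proof (rule holomorphic_nonzero_by_doubling[OF theta_psi_holomorphic _ _ assms])
  fix p :: complex assume p: "norm p < 1" "theta_psi p = 0"
  have "norm (p\<^sup>2) < 1"
    by (rule norm_square_less_1[OF p(1)])
  thus "theta_psi (p\<^sup>2) = 0"
    using theta_psi_square[OF p(1)] p(2) theta_phi_nonzero by auto
qed auto

subsection \<open>Inversion of theta constants\<close>

text \<open>Tannery's theorem carried from the naturals to the integers by the enumeration
  \<open>int_decode\<close>; the majorant also gives summability of every term involved.\<close>

lemma tannery_int:
  fixes a :: "int \<Rightarrow> nat \<Rightarrow> real"
  assumes lim: "\<And>k. (\<lambda>n. a k n) \<longlonglongrightarrow> b k"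
    and bound: "eventually (\<lambda>n. \<forall>k. \<bar>a k n\<bar> \<le> M k) sequentially"
    and M: "M summable_on UNIV"
  shows "(\<lambda>n. \<Sum>\<^sub>\<infinity>k. a k n) \<longlonglongrightarrow> (\<Sum>\<^sub>\<infinity>k. b k)"
proof -
  have sumS: "f summable_on UNIV \<Longrightarrow> summable (\<lambda>i. f (int_decode i))" for f :: "int \<Rightarrow> real"
    using summable_on_reindex_bij_betw[OF bij_int_decode, of f] summable_on_imp_summable by blast
  have inf: "(\<Sum>\<^sub>\<infinity>k. f k) = suminf (\<lambda>i. f (int_decode i))" if "f summable_on UNIV" for f :: "int \<Rightarrow> real"
  proof -
    have "((\<lambda>i. f (int_decode i)) has_sum (\<Sum>\<^sub>\<infinity>k. f k)) UNIV"
      using has_sum_reindex_bij_betw[OF bij_int_decode, of f] has_sum_infsum[OF that] by blast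
    thus ?thesis using has_sum_imp_sums sums_unique by blast
  qed
  have M0: "\<bar>b k\<bar> \<le> M k" for k
  proof (rule tendsto_upperbound[OF tendsto_rabs[OF lim[of k]]])
    show "\<forall>\<^sub>F n in sequentially. \<bar>a k n\<bar> \<le> M k"
      using bound by eventually_elim auto
  qed auto
  have dom: "f summable_on UNIV" if "\<And>k. \<bar>f k\<bar> \<le> M k" for f
  proof -
    have "(\<lambda>k. norm (f k)) summable_on UNIV"
    proof (rule Infinite_Sum.abs_summable_on_comparison_test)
      show "(\<lambda>k. norm (M k)) summable_on UNIV"
        using M summable_on_iff_abs_summable_on_real by blast
      show "norm (f k) \<le> norm (M k)" for k using that[of k] by simp
    qed
    thus ?thesis by (rule abs_summable_summable)
  qed
  have "(\<lambda>n. suminf (\<lambda>i. a (int_decode i) n)) \<longlonglongrightarrow> suminf (\<lambda>i. b (int_decode i))"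
  proof (rule tannerys_theorem[THEN conjunct2, THEN conjunct2])
    show "\<forall>\<^sub>F (k, n) in at_top \<times>\<^sub>F sequentially. norm (a (int_decode k) n) \<le> M (int_decode k)"
      unfolding eventually_prod_filter
      by (rule exI[of _ "\<lambda>_. True"], rule exI[of _ "\<lambda>n. \<forall>k. \<bar>a k n\<bar> \<le> M k"])
         (use bound in auto)
  qed (use lim sumS[OF M] in auto)
  moreover have "\<forall>\<^sub>F n in sequentially. suminf (\<lambda>i. a (int_decode i) n) = (\<Sum>\<^sub>\<infinity>k. a k n)"
    using bound by eventually_elim (simp add: inf dom)
  ultimately show ?thesis
    by (simp add: inf[OF dom[OF M0]] tendsto_cong)
qed

section \<open>Finite Poisson summation for powers of the cosine\<close>

lemma sum_cis_multiples:
  assumes N: "N > (0 :: nat)"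
  shows "(\<Sum>k<2*N. cis (pi * (real k - real N) * of_int l / real N)) = (if int (2 * N) dvd l then of_nat (2 * N) else 0)"
proof -
  \<comment> \<open>Centring the index at \<open>N\<close> contributes only the factor
    \<open>cis (- pi * l)\<close>; what remains is a geometric sum in a root of unity of order
    dividing 2N.\<close>
  define w where "w = cis (pi * of_int l / real N)"
  have "cis (pi * (real k - real N) * of_int l / real N) = cis (- pi * of_int l) * w ^ k" for k
  proof -
    have "pi * (real k - real N) * of_int l / real N = - pi * of_int l + real k * (pi * of_int l / real N)"
      using N by (simp add: field_simps)
    thus ?thesis unfolding w_def Complex.DeMoivre cis_mult by (rule arg_cong)
  qed
  hence eq: "(\<Sum>k<2*N. cis (pi * (real k - real N) * of_int l / real N)) = cis (- pi * of_int l) * (\<Sum>k<2*N. w ^ k)"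
    by (simp add: sum_distrib_left)
  have w2N: "w ^ (2 * N) = 1"
  proof -
    have "w ^ (2 * N) = cis (2 * pi * of_int l)"
      using N by (simp add: w_def Complex.DeMoivre field_simps)
    thus ?thesis by (simp add: cis_multiple_2pi)
  qed
  show ?thesis
  proof (cases "int (2 * N) dvd l")
    case True
    then obtain j where j: "l = int (2 * N) * j" by auto
    have "w = cis (2 * pi * of_int j)" "cis (- pi * of_int l) = cis (2 * pi * of_int (- (int N * j)))"
      using N by (simp_all add: w_def j field_simps)
    hence "w = 1" "cis (- pi * of_int l) = 1" by (simp_all only: cis_multiple_2pi Ints_of_int)
    thus ?thesis using True eq by simp
  next
    case False
    have "w \<noteq> 1"
    proof
      assume "w = 1"
      hence "exp (\<i> * of_real (pi * of_int l / real N)) = 1" by (simp add: w_def cis_conv_exp)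
      then obtain n :: int where "pi * of_int l / real N = of_int (2 * n) * pi"
        unfolding exp_eq_1 by auto
      hence "real_of_int l = of_int (int (2 * N) * n)" using N by (simp add: field_simps)
      hence "l = int (2 * N) * n" by (simp only: of_int_eq_iff)
      with False show False by simp
    qed
    hence "(\<Sum>k<2*N. w ^ k) = 0" by (simp add: geometric_sum w2N)
    thus ?thesis using False eq by simp
  qed
qed

lemma two_cos_power:
  "(2 * complex_of_real (cos x)) ^ (2 * m) =
    (\<Sum>j\<le>2*m. of_nat (2 * m choose j) * cis (x * (2 * real j - 2 * real m)))"
proof -
  have "2 * complex_of_real (cos x) = cis x + cis (- x)"
    by (simp add: complex_eq_iff)
  hence "(2 * complex_of_real (cos x)) ^ (2 * m) =
      (\<Sum>j\<le>2*m. of_nat (2 * m choose j) * cis x ^ j * cis (- x) ^ (2 * m - j))"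
    by (simp only: binomial_ring)
  also have "\<dots> = (\<Sum>j\<le>2*m. of_nat (2 * m choose j) * cis (x * (2 * real j - 2 * real m)))"
  proof (intro sum.cong refl)
    fix j assume "j \<in> {..2*m}"
    hence "real (2 * m - j) = 2 * real m - real j" by (simp add: of_nat_diff)
    hence "cis x ^ j * cis (- x) ^ (2 * m - j) = cis (real j * x + (2 * real m - real j) * (- x))"
      by (simp only: Complex.DeMoivre cis_mult)
    also have "real j * x + (2 * real m - real j) * (- x) = x * (2 * real j - 2 * real m)"
      by (simp add: algebra_simps)
    finally show "of_nat (2 * m choose j) * cis x ^ j * cis (- x) ^ (2 * m - j) =
        of_nat (2 * m choose j) * cis (x * (2 * real j - 2 * real m))"
      by (simp add: mult.assoc)
  qed
  finally show ?thesis .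
qed

text \<open>The coefficient of exp (2 i l x) in (2 cos x)^(2 m), set to zero outside the range of
  frequencies.\<close>

definition central_binomial :: "nat \<Rightarrow> int \<Rightarrow> real" where
  "central_binomial m l = (if \<bar>l\<bar> \<le> int m then real (2 * m choose nat (int m + l)) else 0)"

text \<open>Poisson summation on a finite cyclic group, applied to a power of the cosine.\<close>

lemma discrete_poisson:
  assumes N: "N > (0 :: nat)"
  shows "(\<Sum>k<2*N. cos (pi * real_of_int e * (real k - real N)) * (2 * cos (pi * (real k - real N) / (2 * real N))) ^ (2 * m)) =
    2 * real N * (\<Sum>i\<in>{-int m..int m}. if even (i + e) then central_binomial m (i * int N) else 0)"
proof -
  let ?x = "\<lambda>k. real k - real N"
  have "(\<Sum>k<2*N. cis (pi * real_of_int e * ?x k) * (2 * complex_of_real (cos (pi * ?x k / (2 * real N)))) ^ (2 * m)) =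
     (\<Sum>k<2*N. \<Sum>j\<le>2*m. of_nat (2 * m choose j) * cis (pi * ?x k * of_int (int j - int m + e * int N) / real N))"
  proof (intro sum.cong refl)
    fix k
    have "cis (pi * real_of_int e * ?x k) * cis (pi * ?x k / (2 * real N) * (2 * real j - 2 * real m)) =
      cis (pi * ?x k * of_int (int j - int m + e * int N) / real N)" for j
    proof -
      have "pi * real_of_int e * ?x k + pi * ?x k / (2 * real N) * (2 * real j - 2 * real m) =
         pi * ?x k * of_int (int j - int m + e * int N) / real N"
        using N by (simp add: field_simps)
      thus ?thesis by (simp only: cis_mult)
    qed
    thus "cis (pi * real_of_int e * ?x k) * (2 * complex_of_real (cos (pi * ?x k / (2 * real N)))) ^ (2 * m) =
        (\<Sum>j\<le>2*m. of_nat (2 * m choose j) * cis (pi * ?x k * of_int (int j - int m + e * int N) / real N))"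
      unfolding two_cos_power sum_distrib_left by (intro sum.cong refl) (simp add: mult.left_commute)
  qed
  also have "\<dots> = (\<Sum>j\<le>2*m. of_nat (2 * m choose j) * (\<Sum>k<2*N. cis (pi * ?x k * of_int (int j - int m + e * int N) / real N)))"
    by (subst sum.swap) (simp add: sum_distrib_left)
  also have "\<dots> = (\<Sum>j\<le>2*m. if int (2 * N) dvd (int j - int m + e * int N) then of_nat (2 * m choose j) * of_nat (2 * N) else 0)"
    unfolding sum_cis_multiples[OF N] by (intro sum.cong) auto
  also have "\<dots> = (\<Sum>j\<in>{j. j \<le> 2*m \<and> int (2 * N) dvd (int j - int m + e * int N)}. of_nat (2 * m choose j) * of_nat (2 * N))"
    by (subst sum.inter_filter[symmetric]) (auto intro!: sum.cong)
  also have "\<dots> = (\<Sum>i\<in>{i. \<bar>i\<bar> \<le> int m \<and> \<bar>i * int N\<bar> \<le> int m \<and> even (i + e)}.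
      of_nat (2 * m choose nat (int m + i * int N)) * of_nat (2 * N))"
  \<comment> \<open>Divisibility by 2N says that \<open>j - m = i * N\<close> with
    \<open>i + e\<close> even. The extra bound on \<open>i\<close> itself gives a finite index set
    that does not mention \<open>N\<close>.\<close>
  proof (rule sum.reindex_bij_witness[where i = "\<lambda>i. nat (int m + i * int N)" and j = "\<lambda>j. (int j - int m) div int N"])
    fix j assume j: "j \<in> {j. j \<le> 2*m \<and> int (2 * N) dvd (int j - int m + e * int N)}"
    then obtain c where "int j - int m + e * int N = int (2 * N) * c" by (auto elim: dvdE)
    hence c: "int j - int m = (2 * c - e) * int N" by (simp add: algebra_simps)
    have d: "(int j - int m) div int N = 2 * c - e" unfolding c using N by simp
    show "nat (int m + (int j - int m) div int N * int N) = j"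
      unfolding d c[symmetric] by simp
    have "\<bar>int j - int m\<bar> \<le> int m" using j by auto
    moreover have "\<bar>2 * c - e\<bar> \<le> \<bar>(2 * c - e) * int N\<bar>" using N by (simp add: abs_mult mult_le_cancel_left1)
    ultimately show "(int j - int m) div int N \<in> {i. \<bar>i\<bar> \<le> int m \<and> \<bar>i * int N\<bar> \<le> int m \<and> even (i + e)}"
      unfolding d mem_Collect_eq using c by auto
    show "of_nat (2 * m choose nat (int m + (int j - int m) div int N * int N)) * of_nat (2 * N) =
        (of_nat (2 * m choose j) * of_nat (2 * N) :: complex)"
      unfolding d c[symmetric] by simp
  next
    fix i assume i: "i \<in> {i. \<bar>i\<bar> \<le> int m \<and> \<bar>i * int N\<bar> \<le> int m \<and> even (i + e)}"
    hence nn: "int (nat (int m + i * int N)) = int m + i * int N" by (auto simp: abs_le_iff)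
    show "(int (nat (int m + i * int N)) - int m) div int N = i"
      unfolding nn using N by simp
    from i have "even (i + e)" by simp
    then obtain c where "i + e = 2 * c" by (elim evenE)
    hence "int m + i * int N - int m + e * int N = int (2 * N) * c"
      by (simp flip: distrib_right)
    hence "int (2 * N) dvd (int (nat (int m + i * int N)) - int m + e * int N)"
      unfolding nn by (metis dvd_triv_left)
    moreover have "int (nat (int m + i * int N)) \<le> int (2 * m)" unfolding nn using i by auto
    ultimately show "nat (int m + i * int N) \<in> {j. j \<le> 2*m \<and> int (2 * N) dvd (int j - int m + e * int N)}"
      by (simp only: mem_Collect_eq of_nat_le_iff simp_thms)
  qed
  also have "\<dots> = (\<Sum>i\<in>{i\<in>{-int m..int m}. \<bar>i * int N\<bar> \<le> int m \<and> even (i + e)}.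
      of_real (2 * real N * central_binomial m (i * int N)))"
    by (rule sum.cong) (auto simp: central_binomial_def abs_le_iff)
  also have "\<dots> = (\<Sum>i\<in>{-int m..int m}. if even (i + e) then of_real (2 * real N * central_binomial m (i * int N)) else 0)"
    by (subst sum.inter_filter) (auto intro!: sum.cong simp: central_binomial_def)
  also have "\<dots> = of_real (2 * real N * (\<Sum>i\<in>{-int m..int m}. if even (i + e) then central_binomial m (i * int N) else 0))"
    by (auto simp: sum_distrib_left intro!: sum.cong)
  finally have "Re (\<Sum>k<2*N. cis (pi * real_of_int e * ?x k) * (2 * complex_of_real (cos (pi * ?x k / (2 * real N)))) ^ (2 * m)) =
     2 * real N * (\<Sum>i\<in>{-int m..int m}. if even (i + e) then central_binomial m (i * int N) else 0)"
    by (simp only: Re_complex_of_real)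
  moreover have "Re (cis a * (2 * complex_of_real b) ^ (2 * m)) = cos a * (2 * b) ^ (2 * m)" for a b
  proof -
    have "(2 * complex_of_real b) ^ (2 * m) = complex_of_real ((2 * b) ^ (2 * m))" by simp
    thus ?thesis by (simp only: times_complex.simps cis.simps Re_complex_of_real Im_complex_of_real mult_zero_right diff_zero)
  qed
  ultimately show ?thesis by (simp only: Re_sum)
qed

section \<open>Gaussian limits of binomial ratios and cosine powers\<close>

lemma one_minus_le_exp: "1 - u \<le> exp (- u)" for u :: real
  using exp_ge_add_one_self[of "- u"] by simp

lemma exp_le_one_minus: "exp (- (u / (1 - u))) \<le> 1 - u" if "u < 1" for u :: real
proof -
  have "1 / (1 - u) = 1 + u / (1 - u)" using that by (simp add: field_simps)
  also have "\<dots> \<le> exp (u / (1 - u))" by (rule exp_ge_add_one_self)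
  finally have "inverse (exp (u / (1 - u))) \<le> inverse (1 / (1 - u))"
    using that by (intro le_imp_inverse_le) auto
  thus ?thesis by (simp add: exp_minus)
qed

text \<open>Consecutive coefficients have quotient 1 - (2 i + 1) / (m + i + 1). Each factor is
  bounded by exponentials from both sides, with denominators made uniform in i, and the odd numbers
  2 i + 1 for i < l add up to l^2.\<close>

lemma central_binomial_ratio_bounds:
  assumes "l \<le> m"
  shows "exp (- (real l ^ 2 / (real m - real l + 1))) \<le> real (2 * m choose (m + l)) / real (2 * m choose m)"
    and "real (2 * m choose (m + l)) / real (2 * m choose m) \<le> exp (- (real l ^ 2 / (real m + real l)))"
proof -
  define r where "r = (\<lambda>l. real (2 * m choose (m + l)) / real (2 * m choose m))"
  have pos: "real (2 * m choose m) > 0" by simp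
  have rSuc: "r (Suc i) = r i * (1 - (2 * real i + 1) / (real m + real i + 1))" if i: "i < m" for i
  proof -
    obtain b where b: "m = Suc (i + b)" using i less_iff_Suc_add by blast
    have "Suc (m + i) * (Suc ((m + i) + b) choose Suc (m + i)) = Suc b * (Suc ((m + i) + b) choose (m + i))"
      by (rule Suc_times_binomial_add)
    moreover have "Suc ((m + i) + b) = 2 * m" using b by simp
    ultimately have "real (Suc (m + i) * (2 * m choose (m + Suc i))) = real (Suc b * (2 * m choose (m + i)))"
      by simp
    hence "(real m + real i + 1) * real (2 * m choose (m + Suc i)) = (real b + 1) * real (2 * m choose (m + i))"
      by (simp only: of_nat_mult of_nat_Suc of_nat_add add_ac)
    moreover have "real b + 1 = real m - real i" unfolding b by simp
    ultimately have eq: "(real m + real i + 1) * real (2 * m choose (m + Suc i)) =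
        (real m - real i) * real (2 * m choose (m + i))" by (simp only:)
    have nz: "real m + real i + 1 > 0" by linarith
    have "1 - (2 * real i + 1) / (real m + real i + 1) = (real m - real i) / (real m + real i + 1)"
      using nz by (simp add: diff_divide_eq_iff)
    moreover have "real (2 * m choose (m + Suc i)) =
        (real m - real i) * real (2 * m choose (m + i)) / (real m + real i + 1)"
      unfolding eq[symmetric] using nz by simp
    ultimately have "real (2 * m choose (m + Suc i)) =
        real (2 * m choose (m + i)) * (1 - (2 * real i + 1) / (real m + real i + 1))"
      by (simp only: mult.commute times_divide_eq_right)
    thus ?thesis by (simp add: r_def)
  qed
  have sq: "- (real i ^ 2 / c) - (2 * real i + 1) / c = - ((1 + real i) ^ 2 / c)" for i c
    by (simp add: power2_eq_square add_divide_distrib distrib_left distrib_right)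
  have r0: "r 0 = 1" using pos by (simp add: r_def)
  have up: "i \<le> l \<Longrightarrow> 0 \<le> r i \<and> r i \<le> exp (- (real i ^ 2 / (real m + real l)))" for i
  proof (induction i)
    case (Suc i)
    hence IH: "0 \<le> r i" "r i \<le> exp (- (real i ^ 2 / (real m + real l)))" by auto
    let ?u = "(2 * real i + 1) / (real m + real i + 1)"
    have i: "i < l" "i < m" using Suc assms by auto
    have "?u \<le> 1" using i by (intro divide_le_eq_1_pos[THEN iffD2]) auto
    have "(2 * real i + 1) / (real m + real l) \<le> ?u"
      using i by (intro divide_left_mono) auto
    hence "1 - ?u \<le> exp (- ((2 * real i + 1) / (real m + real l)))"
      by (intro order_trans[OF one_minus_le_exp[of ?u]]) simp
    hence "r (Suc i) \<le> exp (- (real i ^ 2 / (real m + real l))) * exp (- ((2 * real i + 1) / (real m + real l)))"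
      unfolding rSuc[OF i(2)] using IH \<open>?u \<le> 1\<close> by (intro mult_mono) auto
    also have "\<dots> = exp (- (real (Suc i) ^ 2 / (real m + real l)))"
      by (simp add: sq flip: exp_add)
    finally show ?case using rSuc[OF i(2)] IH \<open>?u \<le> 1\<close> r_def by simp
  qed (simp add: r0)
  have lo: "i \<le> l \<Longrightarrow> exp (- (real i ^ 2 / (real m - real l + 1))) \<le> r i" for i
  proof (induction i)
    case (Suc i)
    hence IH: "exp (- (real i ^ 2 / (real m - real l + 1))) \<le> r i" by auto
    let ?u = "(2 * real i + 1) / (real m + real i + 1)"
    have i: "i < l" "i < m" using Suc assms by auto
    have "?u < 1" using i by (intro divide_less_eq_1_pos[THEN iffD2]) auto
    have "?u / (1 - ?u) = (2 * real i + 1) / (real m - real i)"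
    proof -
      have "1 - ?u = (real m - real i) / (real m + real i + 1)"
        using i by (simp add: diff_divide_eq_iff)
      thus ?thesis using i by simp
    qed
    also have "\<dots> \<le> (2 * real i + 1) / (real m - real l + 1)"
    proof (rule divide_left_mono)
      have "real (Suc i) \<le> real l" "real l \<le> real m" using i assms by (simp_all only: of_nat_le_iff Suc_leI)
      thus "real m - real l + 1 \<le> real m - real i" "0 < (real m - real i) * (real m - real l + 1)"
        by simp_all
    qed auto
    finally have "exp (- ((2 * real i + 1) / (real m - real l + 1))) \<le> 1 - ?u"
      by (intro order_trans[OF _ exp_le_one_minus[OF \<open>?u < 1\<close>]]) simp
    hence "exp (- (real i ^ 2 / (real m - real l + 1))) * exp (- ((2 * real i + 1) / (real m - real l + 1))) \<le> r (Suc i)"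
      unfolding rSuc[OF i(2)] using IH by (intro mult_mono) (auto intro: order_trans[OF exp_ge_zero])
    moreover have "exp (- (real i ^ 2 / (real m - real l + 1))) * exp (- ((2 * real i + 1) / (real m - real l + 1))) =
        exp (- (real (Suc i) ^ 2 / (real m - real l + 1)))"
      by (simp add: sq flip: exp_add)
    ultimately show ?case by simp
  qed (simp add: r0)
  show "exp (- (real l ^ 2 / (real m - real l + 1))) \<le> real (2 * m choose (m + l)) / real (2 * m choose m)"
    using lo[of l] by (simp add: r_def)
  show "real (2 * m choose (m + l)) / real (2 * m choose m) \<le> exp (- (real l ^ 2 / (real m + real l)))"
    using up[of l] by (simp add: r_def)
qed

text \<open>The constant 1/4 comes from sin x >= x / 2 on [0, pi / 2]: there x^2 <= 3, so the cubic
  Taylor bound leaves at least x - x / 2.\<close>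

lemma cos_square_le_exp:
  assumes "\<bar>x\<bar> \<le> pi / 2"
  shows "(cos x)\<^sup>2 \<le> exp (- (x\<^sup>2 / 4))"
proof -
  have *: "(sin x)\<^sup>2 \<ge> x\<^sup>2 / 4" if x: "0 \<le> x" "x \<le> pi / 2" for x :: real
  proof -
    have "\<bar>sin x - (\<Sum>m<3. sin_coeff m * x ^ m)\<bar> \<le> inverse (fact 3) * \<bar>x\<bar> ^ 3"
      by (rule Maclaurin_sin_bound)
    hence "\<bar>sin x - x\<bar> \<le> x ^ 3 / 6"
      using x by (simp add: eval_nat_numeral sin_coeff_def)
    hence "sin x \<ge> x - x ^ 3 / 6" by linarith
    moreover have "x ^ 3 \<le> 3 * x"
    proof -
      have "x\<^sup>2 \<le> (pi / 2)\<^sup>2" using x by (intro power_mono) auto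
      also have "\<dots> \<le> (3.2 / 2)\<^sup>2" using pi_less_4 pi_approx by (intro power_mono) auto
      finally have "x\<^sup>2 \<le> 3" by (simp add: power2_eq_square)
      hence "x * x\<^sup>2 \<le> x * 3" using x by (intro mult_left_mono) auto
      thus ?thesis by (simp add: eval_nat_numeral)
    qed
    ultimately have "x / 2 \<le> sin x" by linarith
    hence "(x / 2)\<^sup>2 \<le> (sin x)\<^sup>2" using x by (intro power_mono) auto
    thus ?thesis by (simp add: power_divide)
  qed
  have "(sin x)\<^sup>2 \<ge> x\<^sup>2 / 4"
    using *[of x] *[of "- x"] assms by (cases "x \<ge> 0") auto
  hence "(cos x)\<^sup>2 \<le> 1 - x\<^sup>2 / 4" by (simp add: cos_squared_eq)
  also have "\<dots> \<le> exp (- (x\<^sup>2 / 4))" by (rule one_minus_le_exp)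
  finally show ?thesis .
qed

text \<open>The exponent m is chosen so that m (pi k / (2 N))^2 tends to pi t k^2; the Fourier
  coefficient at frequency j N then decays like exp (- j^2 N^2 / m), with limit exp (- pi j^2 / (4
  t)).\<close>

definition sharpness :: "real \<Rightarrow> nat \<Rightarrow> nat" where
  "sharpness t N = nat \<lfloor>4 * real N ^ 2 * t / pi\<rfloor>"

lemma sharpness_le: "t > 0 \<Longrightarrow> real (sharpness t N) \<le> 4 * real N ^ 2 * t / pi"
  unfolding sharpness_def by (simp add: of_nat_nat)

lemma sharpness_tendsto:
  assumes t: "t > 0"
  shows "(\<lambda>N. real (sharpness t N) / real N ^ 2) \<longlonglongrightarrow> 4 * t / pi"
proof (rule tendsto_sandwich)
  show "\<forall>\<^sub>F N in sequentially. 4 * t / pi - 1 / real N ^ 2 \<le> real (sharpness t N) / real N ^ 2"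
    using eventually_gt_at_top[of 0]
  proof eventually_elim
    case (elim N)
    have "4 * real N ^ 2 * t / pi - 1 \<le> real (sharpness t N)"
      unfolding sharpness_def by linarith
    hence "(4 * real N ^ 2 * t / pi - 1) / real N ^ 2 \<le> real (sharpness t N) / real N ^ 2"
      by (intro divide_right_mono) auto
    moreover have "(4 * real N ^ 2 * t / pi - 1) / real N ^ 2 = 4 * t / pi - 1 / real N ^ 2"
      using elim by (simp add: diff_divide_distrib)
    ultimately show ?case by simp
  qed
  show "\<forall>\<^sub>F N in sequentially. real (sharpness t N) / real N ^ 2 \<le> 4 * t / pi"
    using eventually_gt_at_top[of 0]
  proof eventually_elim
    case (elim N)
    have "real (sharpness t N) / real N ^ 2 \<le> (4 * real N ^ 2 * t / pi) / real N ^ 2"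
      using sharpness_le[OF t] by (intro divide_right_mono) auto
    thus ?case using elim by simp
  qed
  show "(\<lambda>N. 4 * t / pi - 1 / real N ^ 2) \<longlonglongrightarrow> 4 * t / pi"
    by real_asymp
qed auto

lemma central_binomial_altdef:
  assumes "\<bar>l\<bar> \<le> int m"
  shows "central_binomial m l = real (2 * m choose (m + nat \<bar>l\<bar>))"
proof (cases "l \<ge> 0")
  case True
  thus ?thesis using assms by (simp add: central_binomial_def nat_add_distrib)
next
  case False
  define k where "k = nat \<bar>l\<bar>"
  have k: "l = - int k" "k \<le> m" using False assms by (auto simp: k_def)
  have "central_binomial m l = real (2 * m choose (m - k))"
    using assms by (simp add: central_binomial_def k nat_diff_distrib')
  also have "2 * m choose (m - k) = 2 * m choose (2 * m - (m - k))"
    by (rule binomial_symmetric) simp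
  also have "2 * m - (m - k) = m + k" using k by simp
  finally show ?thesis by (simp add: k_def)
qed

lemma central_binomial_tendsto:
  assumes t: "t > 0"
  shows "(\<lambda>N. central_binomial (sharpness t N) (j * int N) / real (2 * sharpness t N choose sharpness t N))
    \<longlonglongrightarrow> exp (- (pi / (4 * t) * of_int j ^ 2))"
proof -
  let ?m = "sharpness t"
  let ?J = "real_of_int \<bar>j\<bar>"
  \<comment> \<open>The parameters \<open>s\<close> and \<open>c\<close> treat both bounds at once:
    \<open>s = -1\<close>, \<open>c = 1\<close> for the lower and \<open>s = 1\<close>,
    \<open>c = 0\<close> for the upper one. After division by N^2 the denominators differ only by
    terms tending to zero.\<close>
  have quot: "(?J * real N) ^ 2 / (real (?m N) + s * (?J * real N) + c) =
      ?J ^ 2 / (real (?m N) / real N ^ 2 + s * ?J / real N + c / real N ^ 2)" if "N > 0" for N s c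
  proof -
    have "?J ^ 2 / (real (?m N) / real N ^ 2 + s * ?J / real N + c / real N ^ 2) =
      (?J ^ 2 * real N ^ 2) / ((real (?m N) / real N ^ 2 + s * ?J / real N + c / real N ^ 2) * real N ^ 2)"
      using that by simp
    also have "(real (?m N) / real N ^ 2 + s * ?J / real N + c / real N ^ 2) * real N ^ 2 =
       real (?m N) + s * (?J * real N) + c"
      using that by (simp add: distrib_right power2_eq_square)
    finally show ?thesis by (simp add: power_mult_distrib)
  qed
  have lim: "(\<lambda>N. exp (- ((?J * real N) ^ 2 / (real (?m N) + s * (?J * real N) + c))))
       \<longlonglongrightarrow> exp (- (pi / (4 * t) * of_int j ^ 2))" for s c
  proof -
    have "(\<lambda>N. s * ?J / real N) \<longlonglongrightarrow> 0" "(\<lambda>N. c / real N ^ 2) \<longlonglongrightarrow> 0"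
      by real_asymp+
    with sharpness_tendsto[OF t]
    have "(\<lambda>N. real (?m N) / real N ^ 2 + s * ?J / real N + c / real N ^ 2) \<longlonglongrightarrow> 4 * t / pi + 0 + 0"
      by (intro tendsto_add)
    hence "(\<lambda>N. exp (- (?J ^ 2 / (real (?m N) / real N ^ 2 + s * ?J / real N + c / real N ^ 2))))
        \<longlonglongrightarrow> exp (- (?J ^ 2 / (4 * t / pi + 0 + 0)))"
      using t by (intro tendsto_exp tendsto_minus tendsto_divide tendsto_const) auto
    also have "?J ^ 2 / (4 * t / pi + 0 + 0) = pi / (4 * t) * of_int j ^ 2" by simp
    finally show ?thesis
      by (rule Lim_transform_eventually)
         (use eventually_gt_at_top[of 0] in eventually_elim, simp only: quot)
  qed
  have ev: "\<forall>\<^sub>F N in sequentially. ?J * real N \<le> real (?m N)"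
  proof -
    have "(\<lambda>N. ?J / real N) \<longlonglongrightarrow> 0" by real_asymp
    with sharpness_tendsto[OF t]
    have "(\<lambda>N. real (?m N) / real N ^ 2 - ?J / real N) \<longlonglongrightarrow> 4 * t / pi - 0"
      by (intro tendsto_diff)
    hence "\<forall>\<^sub>F N in sequentially. real (?m N) / real N ^ 2 - ?J / real N > 0"
      by (rule order_tendstoD(1)) (use t in auto)
    thus ?thesis using eventually_gt_at_top[of 0]
    proof eventually_elim
      case (elim N)
      hence "0 \<le> (real (?m N) / real N ^ 2 - ?J / real N) * real N ^ 2" by simp
      also have "\<dots> = real (?m N) - ?J * real N"
        using elim by (simp add: left_diff_distrib power2_eq_square)
      finally show ?case by simp
    qed
  qed
  have bounds: "\<forall>\<^sub>F N in sequentially.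
     exp (- ((?J * real N) ^ 2 / (real (?m N) + (-1) * (?J * real N) + 1)))
       \<le> central_binomial (?m N) (j * int N) / real (2 * ?m N choose ?m N) \<and>
     central_binomial (?m N) (j * int N) / real (2 * ?m N choose ?m N)
       \<le> exp (- ((?J * real N) ^ 2 / (real (?m N) + 1 * (?J * real N) + 0)))"
    using ev
  proof eventually_elim
    case (elim N)
    define l where "l = nat \<bar>j * int N\<bar>"
    have l: "real l = ?J * real N" by (simp add: l_def abs_mult)
    have le: "l \<le> ?m N" using elim unfolding l[symmetric] by simp
    have "central_binomial (?m N) (j * int N) = real (2 * ?m N choose (?m N + l))"
      unfolding l_def by (rule central_binomial_altdef) (use le l_def in linarith)
    thus ?case
      using central_binomial_ratio_bounds[OF le] unfolding l[symmetric] by simp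
  qed
  show ?thesis
    by (rule tendsto_sandwich[OF _ _ lim[of "-1" 1] lim[of 1 0]]; use bounds in eventually_elim; simp)
qed

text \<open>A majorant uniform in \<open>N\<close>, at half the limiting rate: for a nonzero
  coefficient l <= m, so m + l <= 2 m <= 8 N^2 t / pi.\<close>

lemma central_binomial_le:
  assumes t: "t > 0" and N: "N > 0"
  shows "\<bar>central_binomial (sharpness t N) (j * int N) / real (2 * sharpness t N choose sharpness t N)\<bar>
     \<le> exp (- (pi / (8 * t) * of_int j ^ 2))"
proof (cases "\<bar>j * int N\<bar> \<le> int (sharpness t N)")
  case False
  thus ?thesis by (simp add: central_binomial_def)
next
  case True
  define m where "m = sharpness t N"
  define l where "l = nat \<bar>j * int N\<bar>"
  have l: "real l ^ 2 = of_int j ^ 2 * real N ^ 2"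
  proof -
    have "real l = real_of_int \<bar>j\<bar> * real N" by (simp add: l_def abs_mult)
    thus ?thesis by (simp add: power_mult_distrib)
  qed
  have le: "l \<le> m" using True by (simp add: l_def m_def)
  have eq: "central_binomial m (j * int N) = real (2 * m choose (m + l))"
    unfolding l_def m_def by (rule central_binomial_altdef[OF True])
  have "pi / (8 * t) * of_int j ^ 2 \<le> real l ^ 2 / (real m + real l)"
  proof (cases "m = 0")
    case True
    hence "l = 0" using le by simp
    hence "j = 0" using N by (simp add: l_def)
    thus ?thesis by simp
  next
    case False
    have "pi / (8 * t) * of_int j ^ 2 = real l ^ 2 / (2 * (4 * real N ^ 2 * t / pi))"
      unfolding l using N t by simp
    also have "\<dots> \<le> real l ^ 2 / (real m + real l)"
    proof (rule divide_left_mono)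
      show "real m + real l \<le> 2 * (4 * real N ^ 2 * t / pi)"
        using sharpness_le[OF t, of N] le unfolding m_def[symmetric] by linarith
      show "0 < 2 * (4 * real N ^ 2 * t / pi) * (real m + real l)"
        using False N t by (intro mult_pos_pos) auto
    qed auto
    finally show ?thesis .
  qed
  hence "exp (- (real l ^ 2 / (real m + real l))) \<le> exp (- (pi / (8 * t) * of_int j ^ 2))" by simp
  with central_binomial_ratio_bounds(2)[OF le]
  have "real (2 * m choose (m + l)) / real (2 * m choose m) \<le> exp (- (pi / (8 * t) * of_int j ^ 2))"
    by linarith
  thus ?thesis unfolding m_def[symmetric] eq by simp
qed

text \<open>In \<open>k\<close> the cosine power has period 2N. It is cut off to one period so that
  the finite sum becomes a series over all integers with \<open>N\<close> as limit
  parameter.\<close>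

definition cos_kernel :: "real \<Rightarrow> nat \<Rightarrow> int \<Rightarrow> real" where
  "cos_kernel t N k = (if k \<in> {- int N..<int N} then cos (pi * of_int k / (2 * real N)) ^ (2 * sharpness t N) else 0)"

text \<open>With u the squared sine the kernel is (1 - u)^m, squeezed between exp (- m u / (1 - u))
  and exp (- m u), where m u tends to pi t k^2.\<close>

lemma cos_kernel_tendsto:
  assumes t: "t > 0"
  shows "(\<lambda>N. cos_kernel t N k) \<longlonglongrightarrow> exp (- (pi * t * of_int k ^ 2))"
proof -
  let ?m = "sharpness t"
  define u where "u = (\<lambda>N. sin (pi * of_int k / (2 * real N)) ^ 2)"
  have u0: "u \<longlonglongrightarrow> 0"
  proof -
    have "(\<lambda>N. sin (pi * of_int k / (2 * real N))) \<longlonglongrightarrow> 0" by real_asymp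
    from tendsto_power[OF this, of 2] show ?thesis by (simp add: u_def)
  qed
  have mu: "(\<lambda>N. real (?m N) * u N) \<longlonglongrightarrow> pi * t * of_int k ^ 2"
  proof -
    have "(\<lambda>N. real N * sin (pi * of_int k / (2 * real N))) \<longlonglongrightarrow> pi * of_int k / 2"
      by real_asymp
    hence "(\<lambda>N. (real N * sin (pi * of_int k / (2 * real N))) ^ 2) \<longlonglongrightarrow> (pi * of_int k / 2) ^ 2"
      by (rule tendsto_power)
    with sharpness_tendsto[OF t]
    have "(\<lambda>N. real (?m N) / real N ^ 2 * (real N * sin (pi * of_int k / (2 * real N))) ^ 2)
        \<longlonglongrightarrow> 4 * t / pi * (pi * of_int k / 2) ^ 2"
      by (rule tendsto_mult)
    also have "4 * t / pi * (pi * of_int k / 2) ^ 2 = pi * t * of_int k ^ 2"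
      by (simp add: power2_eq_square)
    finally show ?thesis
      by (rule Lim_transform_eventually)
         (use eventually_gt_at_top[of 0] in eventually_elim, simp add: u_def power_mult_distrib)
  qed
  have "(\<lambda>N. (1 - u N) ^ ?m N) \<longlonglongrightarrow> exp (- (pi * t * of_int k ^ 2))"
  proof (rule tendsto_sandwich)
    have ev: "\<forall>\<^sub>F N in sequentially. u N < 1"
      by (rule order_tendstoD(2)[OF u0]) simp
    show "\<forall>\<^sub>F N in sequentially. exp (- (real (?m N) * u N / (1 - u N))) \<le> (1 - u N) ^ ?m N"
      using ev
    proof eventually_elim
      case (elim N)
      have "exp (- (u N / (1 - u N))) ^ ?m N \<le> (1 - u N) ^ ?m N"
        by (intro power_mono exp_le_one_minus elim) auto
      thus ?case by (simp flip: exp_of_nat_mult)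
    qed
    show "\<forall>\<^sub>F N in sequentially. (1 - u N) ^ ?m N \<le> exp (- (real (?m N) * u N))"
      using ev
    proof eventually_elim
      case (elim N)
      have "(1 - u N) ^ ?m N \<le> exp (- u N) ^ ?m N"
        using elim by (intro power_mono one_minus_le_exp) auto
      thus ?case by (simp flip: exp_of_nat_mult)
    qed
    have "(\<lambda>N. exp (- (real (?m N) * u N / (1 - u N)))) \<longlonglongrightarrow> exp (- (pi * t * of_int k ^ 2 / (1 - 0)))"
      by (intro tendsto_intros mu u0) simp
    thus "(\<lambda>N. exp (- (real (?m N) * u N / (1 - u N)))) \<longlonglongrightarrow> exp (- (pi * t * of_int k ^ 2))" by simp
    show "(\<lambda>N. exp (- (real (?m N) * u N))) \<longlonglongrightarrow> exp (- (pi * t * of_int k ^ 2))"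
      by (intro tendsto_intros mu)
  qed
  moreover have "\<forall>\<^sub>F N in sequentially. (1 - u N) ^ ?m N = cos_kernel t N k"
    using eventually_gt_at_top[of "nat \<bar>k\<bar>"]
  proof eventually_elim
    case (elim N)
    hence "k \<in> {- int N..<int N}" by auto
    thus ?case by (simp add: cos_kernel_def u_def power_mult cos_squared_eq)
  qed
  ultimately show ?thesis by (rule Lim_transform_eventually)
qed

text \<open>The loss of a factor 8 against the limiting rate is 4 from
  \<open>cos_square_le_exp\<close> times 2 from asking only that m / N^2 exceed half its
  limit.\<close>

lemma cos_kernel_le:
  assumes t: "t > 0"
  shows "\<forall>\<^sub>F N in sequentially. \<forall>k. \<bar>cos_kernel t N k\<bar> \<le> exp (- (pi * t / 8 * of_int k ^ 2))"
proof -
  let ?m = "sharpness t"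
  have "\<forall>\<^sub>F N in sequentially. real (?m N) / real N ^ 2 > 2 * t / pi"
    by (rule order_tendstoD(1)[OF sharpness_tendsto[OF t]]) (use t in \<open>simp add: divide_strict_right_mono\<close>)
  thus ?thesis using eventually_gt_at_top[of 0]
  proof eventually_elim
    case (elim N)
    show ?case
    proof
      fix k
      show "\<bar>cos_kernel t N k\<bar> \<le> exp (- (pi * t / 8 * of_int k ^ 2))"
      proof (cases "k \<in> {- int N..<int N}")
        case False
        thus ?thesis unfolding cos_kernel_def by (subst if_not_P) auto
      next
        case True
        define x where "x = pi * of_int k / (2 * real N)"
        have "\<bar>real_of_int k\<bar> \<le> real N" using True by auto
        hence "pi * \<bar>real_of_int k\<bar> / (2 * real N) \<le> pi * real N / (2 * real N)"
          by (intro divide_right_mono mult_left_mono) auto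
        hence x: "\<bar>x\<bar> \<le> pi / 2" using elim by (simp add: x_def abs_mult)
        have "\<bar>cos_kernel t N k\<bar> = ((cos x)\<^sup>2) ^ ?m N"
          using True by (simp add: cos_kernel_def x_def power_mult)
        also have "\<dots> \<le> exp (- (x\<^sup>2 / 4)) ^ ?m N"
          by (intro power_mono cos_square_le_exp x) auto
        also have "\<dots> = exp (- (real (?m N) / real N ^ 2 * (pi\<^sup>2 * of_int k ^ 2 / 16)))"
          by (simp add: x_def power_divide power_mult_distrib flip: exp_of_nat_mult)
        also have "\<dots> \<le> exp (- (2 * t / pi * (pi\<^sup>2 * of_int k ^ 2 / 16)))"
          using elim by (simp only: exp_le_cancel_iff neg_le_iff_le) (intro mult_right_mono, auto)
        also have "2 * t / pi * (pi\<^sup>2 * of_int k ^ 2 / 16) = pi * t / 8 * of_int k ^ 2"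
          by (simp add: power2_eq_square)
        finally show ?thesis .
      qed
    qed
  qed
qed

text \<open>For integers k^2 >= |k|, which leaves two geometric series.\<close>

lemma summable_on_int_exp_square:
  fixes c :: real
  assumes "c > 0"
  shows "(\<lambda>k. exp (- (c * of_int k ^ 2))) summable_on (UNIV :: int set)"
proof -
  let ?r = "exp (- c)"
  have s: "(\<lambda>k. ?r ^ nat k) summable_on {0::int..}"
  proof -
    have "(\<lambda>n. ?r ^ n) summable_on (UNIV :: nat set)"
      by (intro norm_summable_imp_summable_on) (use assms in simp)
    moreover have "bij_betw int UNIV {0..}"
      by (rule bij_betwI[where g = nat]) auto
    ultimately show ?thesis
      using summable_on_reindex_bij_betw[of int UNIV "{0..}" "\<lambda>k. ?r ^ nat k"] by simp
  qed
  have le: "exp (- (c * of_int k ^ 2)) \<le> ?r ^ nat \<bar>k\<bar>" for k :: int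
  proof -
    have "real_of_int \<bar>k\<bar> * 1 \<le> real_of_int \<bar>k\<bar> * real_of_int \<bar>k\<bar>"
    proof (cases "k = 0")
      case False
      hence "1 \<le> real_of_int \<bar>k\<bar>" by linarith
      thus ?thesis by (intro mult_left_mono) auto
    qed simp
    also have "\<dots> = of_int k ^ 2" by (simp add: power2_eq_square)
    finally have "c * real_of_int \<bar>k\<bar> \<le> c * of_int k ^ 2" using assms by simp
    hence "exp (- (c * of_int k ^ 2)) \<le> exp (- (c * real_of_int \<bar>k\<bar>))" by simp
    also have "\<dots> = ?r ^ nat \<bar>k\<bar>" by (simp add: mult.commute flip: exp_of_nat_mult)
    finally show ?thesis .
  qed
  have 1: "(\<lambda>k. exp (- (c * of_int k ^ 2))) summable_on {0::int..}"
  proof (rule summable_on_comparison_test[OF s])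
    fix k :: int assume "k \<in> {0..}"
    thus "exp (- (c * of_int k ^ 2)) \<le> ?r ^ nat k" using le[of k] by simp
  qed simp
  have 2: "(\<lambda>k. exp (- (c * of_int k ^ 2))) summable_on {..0::int}"
  proof -
    have "bij_betw uminus {0::int..} {..0}"
      by (rule bij_betwI[where g = uminus]) auto
    from summable_on_reindex_bij_betw[OF this, of "\<lambda>k. exp (- (c * of_int k ^ 2))"] 1
    show ?thesis by simp
  qed
  have 3: "(\<lambda>k. exp (- (c * of_int k ^ 2))) summable_on {..<0::int}"
    by (rule summable_on_subset_banach[OF 2]) auto
  have "{0::int..} \<union> {..<0} = UNIV" "{0::int..} \<inter> {..<0} = {}" by auto
  thus ?thesis using summable_on_Un_disjoint[OF 1 3] by simp
qed

lemma infsum_finite_support: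
  fixes f :: "'a \<Rightarrow> real"
  assumes "finite A" "\<And>x. x \<notin> A \<Longrightarrow> f x = 0"
  shows "(\<Sum>\<^sub>\<infinity>x. f x) = sum f A"
proof -
  have "(\<Sum>\<^sub>\<infinity>x. f x) = infsum f A"
    by (rule infsum_cong_neutral) (use assms in auto)
  thus ?thesis using assms by simp
qed

text \<open>In classical terms theta_3 (i t) theta_2 (i / t) = theta_4 (i t) theta_3 (i / t). It is
  the limit of the cross product of the finite Poisson identities for \<open>e = 0\<close> and
  \<open>e = 1\<close>.\<close>

lemma gaussian_sum_inversion:
  assumes t: "t > (0 :: real)"
  shows "(\<Sum>\<^sub>\<infinity>k::int. exp (- (pi * t * of_int k ^ 2))) *
      (\<Sum>\<^sub>\<infinity>i::int. if odd i then exp (- (pi / (4 * t) * of_int i ^ 2)) else 0) =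
    (\<Sum>\<^sub>\<infinity>k::int. cos (pi * of_int k) * exp (- (pi * t * of_int k ^ 2))) *
      (\<Sum>\<^sub>\<infinity>i::int. if even i then exp (- (pi / (4 * t) * of_int i ^ 2)) else 0)"
proof -
  let ?m = "sharpness t"
  define C where "C = (\<lambda>e N. \<Sum>\<^sub>\<infinity>k. cos (pi * real_of_int e * of_int k) * cos_kernel t N k)"
  define D where "D = (\<lambda>e N. \<Sum>\<^sub>\<infinity>i. if even (i + e) then
      central_binomial (?m N) (i * int N) / real (2 * ?m N choose ?m N) else 0)"
  have C_lim: "C e \<longlonglongrightarrow> (\<Sum>\<^sub>\<infinity>k. cos (pi * real_of_int e * of_int k) * exp (- (pi * t * of_int k ^ 2)))" for e
    unfolding C_def
  proof (rule tannery_int)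
    show "(\<lambda>N. cos (pi * real_of_int e * of_int k) * cos_kernel t N k) \<longlonglongrightarrow>
        cos (pi * real_of_int e * of_int k) * exp (- (pi * t * of_int k ^ 2))" for k
      by (intro tendsto_mult tendsto_const cos_kernel_tendsto t)
    show "\<forall>\<^sub>F N in sequentially. \<forall>k. \<bar>cos (pi * real_of_int e * of_int k) * cos_kernel t N k\<bar>
        \<le> exp (- (pi * t / 8 * of_int k ^ 2))"
      using cos_kernel_le[OF t]
    proof eventually_elim
      case (elim N)
      show ?case
      proof
        fix k
        have "\<bar>cos (pi * real_of_int e * of_int k) * cos_kernel t N k\<bar> \<le> 1 * \<bar>cos_kernel t N k\<bar>"
          unfolding abs_mult by (intro mult_right_mono) auto
        thus "\<bar>cos (pi * real_of_int e * of_int k) * cos_kernel t N k\<bar> \<le> exp (- (pi * t / 8 * of_int k ^ 2))"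
          using elim[rule_format, of k] by linarith
      qed
    qed
  qed (rule summable_on_int_exp_square, use t in auto)
  have D_lim: "D e \<longlonglongrightarrow> (\<Sum>\<^sub>\<infinity>i. if even (i + e) then exp (- (pi / (4 * t) * of_int i ^ 2)) else 0)" for e
    unfolding D_def
  proof (rule tannery_int)
    show "(\<lambda>N. if even (i + e) then central_binomial (?m N) (i * int N) / real (2 * ?m N choose ?m N) else 0)
        \<longlonglongrightarrow> (if even (i + e) then exp (- (pi / (4 * t) * of_int i ^ 2)) else 0)" for i
      using central_binomial_tendsto[OF t, of i] by simp
    show "\<forall>\<^sub>F N in sequentially. \<forall>i. \<bar>if even (i + e) then
        central_binomial (?m N) (i * int N) / real (2 * ?m N choose ?m N) else 0\<bar>
        \<le> exp (- (pi / (8 * t) * of_int i ^ 2))"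
      using eventually_gt_at_top[of 0]
    proof eventually_elim
      case (elim N)
      thus ?case using central_binomial_le[OF t elim] by auto
    qed
  qed (rule summable_on_int_exp_square, use t in auto)
  \<comment> \<open>The factor in front of \<open>D e N\<close> does not depend on \<open>e\<close>,
    so it disappears from the comparison of \<open>C 0 N * D 1 N\<close> with
    \<open>C 1 N * D 0 N\<close>.\<close>
  have CD: "C e N = 2 * real N * real (2 * ?m N choose ?m N) / 4 ^ ?m N * D e N" if N: "N > 0" for e N
  proof -
    have "C e N = (\<Sum>k\<in>{- int N..<int N}. cos (pi * real_of_int e * of_int k) * cos_kernel t N k)"
      unfolding C_def by (rule infsum_finite_support) (auto simp: cos_kernel_def)
    also have "\<dots> = (\<Sum>k<2*N. cos (pi * real_of_int e * of_int (int k - int N)) * cos_kernel t N (int k - int N))"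
      by (rule sum.reindex_bij_witness[where i = "\<lambda>k. int k - int N" and j = "\<lambda>k. nat (k + int N)"]) auto
    also have "\<dots> * 4 ^ ?m N = (\<Sum>k<2*N. cos (pi * real_of_int e * (real k - real N)) *
         (2 * cos (pi * (real k - real N) / (2 * real N))) ^ (2 * ?m N))"
      unfolding sum_distrib_right
      by (rule sum.cong) (auto simp: cos_kernel_def power_mult_distrib power_mult)
    also have "\<dots> = 2 * real N * (\<Sum>i\<in>{-int (?m N)..int (?m N)}. if even (i + e) then central_binomial (?m N) (i * int N) else 0)"
      by (rule discrete_poisson[OF N])
    also have "(\<Sum>i\<in>{-int (?m N)..int (?m N)}. if even (i + e) then central_binomial (?m N) (i * int N) else 0) =
       (\<Sum>i\<in>{-int (?m N)..int (?m N)}. if even (i + e) then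
          central_binomial (?m N) (i * int N) / real (2 * ?m N choose ?m N) else 0) * real (2 * ?m N choose ?m N)"
      unfolding sum_distrib_right by (rule sum.cong) auto
    also have "(\<Sum>i\<in>{-int (?m N)..int (?m N)}. if even (i + e) then
          central_binomial (?m N) (i * int N) / real (2 * ?m N choose ?m N) else 0) = D e N"
      unfolding D_def
    proof (rule infsum_finite_support[symmetric])
      fix i assume i: "i \<notin> {-int (?m N)..int (?m N)}"
      have "\<bar>i\<bar> * 1 \<le> \<bar>i\<bar> * int N" using N by (intro mult_left_mono) auto
      hence "\<not> \<bar>i * int N\<bar> \<le> int (?m N)" using i by (auto simp: abs_mult)
      thus "(if even (i + e) then central_binomial (?m N) (i * int N) / real (2 * ?m N choose ?m N) else 0) = 0"
        by (simp add: central_binomial_def)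
    qed auto
    finally have "C e N * 4 ^ ?m N = 2 * real N * (D e N * real (2 * ?m N choose ?m N))" .
    thus ?thesis by (simp add: eq_divide_eq mult_ac)
  qed
  have "\<forall>\<^sub>F N in sequentially. C 0 N * D 1 N = C 1 N * D 0 N"
    using eventually_gt_at_top[of 0] by eventually_elim (simp add: CD)
  moreover have "(\<lambda>N. C 0 N * D 1 N) \<longlonglongrightarrow>
     (\<Sum>\<^sub>\<infinity>k. cos (pi * real_of_int 0 * of_int k) * exp (- (pi * t * of_int k ^ 2))) *
     (\<Sum>\<^sub>\<infinity>i. if even (i + 1) then exp (- (pi / (4 * t) * of_int i ^ 2)) else 0)"
    by (intro tendsto_mult C_lim D_lim)
  ultimately have "(\<lambda>N. C 1 N * D 0 N) \<longlonglongrightarrow>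
     (\<Sum>\<^sub>\<infinity>k. cos (pi * real_of_int 0 * of_int k) * exp (- (pi * t * of_int k ^ 2))) *
     (\<Sum>\<^sub>\<infinity>i. if even (i + 1) then exp (- (pi / (4 * t) * of_int i ^ 2)) else 0)"
    by (rule Lim_transform_eventually[rotated])
  moreover have "(\<lambda>N. C 1 N * D 0 N) \<longlonglongrightarrow>
     (\<Sum>\<^sub>\<infinity>k. cos (pi * real_of_int 1 * of_int k) * exp (- (pi * t * of_int k ^ 2))) *
     (\<Sum>\<^sub>\<infinity>i. if even (i + 0) then exp (- (pi / (4 * t) * of_int i ^ 2)) else 0)"
    by (intro tendsto_mult C_lim D_lim)
  ultimately show ?thesis
    using LIMSEQ_unique by (simp add: LIMSEQ_unique)
qed

subsection \<open>Matrices acting on the upper half plane\<close>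

lemma mat2_nth [simp]:
  "mat2 a b c d $ 1 $ 1 = a" "mat2 a b c d $ 1 $ 2 = b"
  "mat2 a b c d $ 2 $ 1 = c" "mat2 a b c d $ 2 $ 2 = d"
  by (simp_all add: mat2_def)

lemma mat2_eqI: "M $ 1 $ 1 = a \<Longrightarrow> M $ 1 $ 2 = b \<Longrightarrow> M $ 2 $ 1 = c \<Longrightarrow> M $ 2 $ 2 = d \<Longrightarrow> M = mat2 a b c d"
  by (simp add: vec_eq_iff forall_2)

lemma det_mat2: "det (mat2 a b c d) = a * d - b * c"
  by (simp add: det_2)

lemma mat2_mult: "mat2 a b c d ** mat2 a' b' c' d' =
    mat2 (a * a' + b * c') (a * b' + b * d') (c * a' + d * c') (c * b' + d * d')"
  by (rule mat2_eqI) (simp_all add: matrix_matrix_mult_def sum_2)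

lemma act_mat2: "act (mat2 a b c d) z = (of_real a * z + of_real b) / (of_real c * z + of_real d)"
  by (simp add: act_def moebius_def)

lemma act_mult:
  fixes M N :: "real^2^2"
  assumes "det N > 0" "z \<in> uhp"
  shows "act (M ** N) z = act M (act N z)"
proof -
  let ?w1 = "of_real (N $ 1 $ 1) * z + of_real (N $ 1 $ 2)"
  let ?w2 = "of_real (N $ 2 $ 1) * z + of_real (N $ 2 $ 2)"
  have nz: "?w2 \<noteq> 0" by (rule act_denom_nonzero[OF assms])
  have aux: "a * (w1 / w2) + b = (a * w1 + b * w2) / w2" if "w2 \<noteq> 0" for a b w1 w2 :: complex
    using that by (simp add: add_divide_distrib)
  have aux2: "(a / w2) / (b / w2) = a / b" if "w2 \<noteq> 0" for a b w2 :: complex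
    using that by simp
  have "act M (act N z) = ((of_real (M $ 1 $ 1) * ?w1 + of_real (M $ 1 $ 2) * ?w2) / ?w2) /
     ((of_real (M $ 2 $ 1) * ?w1 + of_real (M $ 2 $ 2) * ?w2) / ?w2)"
    unfolding act_def moebius_def aux[OF nz] ..
  also have "\<dots> = (of_real (M $ 1 $ 1) * ?w1 + of_real (M $ 1 $ 2) * ?w2) /
     (of_real (M $ 2 $ 1) * ?w1 + of_real (M $ 2 $ 2) * ?w2)"
    using nz by (rule aux2)
  also have "\<dots> = act (M ** N) z"
    by (simp add: act_def moebius_def matrix_matrix_mult_def sum_2 algebra_simps)
  finally show ?thesis ..
qed

lemma act_mat_1 [simp]: "act (mat 1) z = z"
  by (simp add: act_def moebius_def mat_def)

subsection \<open>Meromorphic functions on the upper half plane\<close>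

abbreviation mero_of :: "(complex \<Rightarrow> complex) \<Rightarrow> mero_uhp" where
  "mero_of \<equiv> abs_mero_uhp"

lemma mero_rel_refl: "mero_rel f f \<longleftrightarrow> f meromorphic_on uhp"
  by (auto simp: mero_rel_def)

lemma eventually_cosparse_uhpI: "(\<And>z. z \<in> uhp \<Longrightarrow> P z) \<Longrightarrow> \<forall>\<^sub>\<approx>z\<in>uhp. P z"
  using eventually_in_cosparse[of uhp uhp] open_uhp by (auto elim: eventually_mono)

lemma mero_of_cases [cases type: mero_uhp]:
  obtains f where "f meromorphic_on uhp" "F = mero_of f"
  using Quotient_abs_rep[OF Quotient_mero_uhp, of F] Quotient_rep_reflp[OF Quotient_mero_uhp, of F]
  by (metis mero_rel_refl)

lemma mero_of_eq_iff:
  assumes "f meromorphic_on uhp" "g meromorphic_on uhp"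
  shows "mero_of f = mero_of g \<longleftrightarrow> (\<forall>\<^sub>\<approx>z\<in>uhp. f z = g z)"
  using Quotient_rel[OF Quotient_mero_uhp, of f g] assms by (auto simp: mero_rel_def)

lemma mero_of_eqI:
  assumes "f meromorphic_on uhp" "\<And>z. z \<in> uhp \<Longrightarrow> f z = g z"
  shows "mero_of f = mero_of g"
proof -
  have "\<forall>\<^sub>\<approx>z\<in>uhp. f z = g z" by (rule eventually_cosparse_uhpI) (use assms in auto)
  moreover from this have "g meromorphic_on uhp"
    using assms(1) meromorphic_on_cong'[of f g uhp uhp] by simp
  ultimately show ?thesis using assms(1) mero_of_eq_iff by blast
qed

lemma holomorphic_uhp_imp_meromorphic: "f holomorphic_on uhp \<Longrightarrow> f meromorphic_on uhp"
  by (rule analytic_on_imp_meromorphic_on) (simp add: analytic_on_open open_uhp)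

text \<open>Classes only determine a function off a sparse set; continuity restores equality at
  every point.\<close>

lemma mero_of_eqD:
  assumes "f holomorphic_on uhp" "g holomorphic_on uhp" "mero_of f = mero_of g" "z \<in> uhp"
  shows "f z = g z"
proof -
  have "\<forall>\<^sub>\<approx>z\<in>uhp. f z = g z"
    using assms mero_of_eq_iff holomorphic_uhp_imp_meromorphic by blast
  hence ev: "eventually (\<lambda>z. f z = g z) (at z)"
    using assms(4) eventually_cosparse_imp_eventually_at by blast
  have "isCont f z" "isCont g z"
    using assms open_uhp continuous_on_eq_continuous_at holomorphic_on_imp_continuous_on by blast+
  hence "f \<midarrow>z\<rightarrow> f z" "g \<midarrow>z\<rightarrow> g z" by (auto simp: isCont_def)
  moreover from this(1) have "g \<midarrow>z\<rightarrow> f z"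
    using ev by (simp add: tendsto_cong)
  ultimately show ?thesis using tendsto_unique[of "at z"] by simp
qed

lemma mero_of_add: "f meromorphic_on uhp \<Longrightarrow> g meromorphic_on uhp \<Longrightarrow> mero_of f + mero_of g = mero_of (\<lambda>z. f z + g z)"
  by (simp add: plus_mero_uhp.abs_eq mero_rel_refl)

lemma mero_of_diff: "f meromorphic_on uhp \<Longrightarrow> g meromorphic_on uhp \<Longrightarrow> mero_of f - mero_of g = mero_of (\<lambda>z. f z - g z)"
  by (simp add: minus_mero_uhp.abs_eq mero_rel_refl)

lemma mero_of_mult: "f meromorphic_on uhp \<Longrightarrow> g meromorphic_on uhp \<Longrightarrow> mero_of f * mero_of g = mero_of (\<lambda>z. f z * g z)"
  by (simp add: times_mero_uhp.abs_eq mero_rel_refl)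

lemma mero_of_uminus: "f meromorphic_on uhp \<Longrightarrow> - mero_of f = mero_of (\<lambda>z. - f z)"
  by (simp add: uminus_mero_uhp.abs_eq mero_rel_refl)

lemma mero_of_inverse: "f meromorphic_on uhp \<Longrightarrow> inverse (mero_of f) = mero_of (\<lambda>z. inverse (f z))"
  by (simp add: inverse_mero_uhp.abs_eq mero_rel_refl)

lemma mero_of_const: "const_mero_uhp c = mero_of (\<lambda>_. c)"
  by (simp add: const_mero_uhp.abs_eq)

lemma mero_of_1: "1 = mero_of (\<lambda>_. 1)"
  by (simp add: one_mero_uhp.abs_eq)

lemma mero_of_0: "0 = mero_of (\<lambda>_. 0)"
  by (simp add: zero_mero_uhp.abs_eq)

lemma mero_of_power: "f meromorphic_on uhp \<Longrightarrow> mero_of f ^ n = mero_of (\<lambda>z. f z ^ n)"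
  by (induction n) (simp_all add: mero_of_1 mero_of_mult meromorphic_intros)

lemma const_mero_uhp_mult: "const_mero_uhp (a * b) = const_mero_uhp a * const_mero_uhp b"
  by (simp add: mero_of_const mero_of_mult meromorphic_on_const)

lemma const_mero_uhp_uminus: "const_mero_uhp (- a) = - const_mero_uhp a"
  by (simp add: mero_of_const mero_of_uminus meromorphic_on_const)

lemma const_mero_uhp_inverse: "const_mero_uhp (inverse a) = inverse (const_mero_uhp a)"
  by (simp add: mero_of_const mero_of_inverse meromorphic_on_const)

lemma const_mero_uhp_power: "const_mero_uhp (a ^ n) = const_mero_uhp a ^ n"
  by (induction n) (simp_all add: const_mero_uhp_1 const_mero_uhp_mult)

lemma const_mero_uhp_eq_0_iff [simp]: "const_mero_uhp a = 0 \<longleftrightarrow> a = 0"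
  using const_mero_uhp_eq_iff[of a 0] by (simp add: const_mero_uhp_0)

lemma of_rat_mero_uhp: "of_rat r = const_mero_uhp (of_rat r)"
proof (cases r)
  case (Fract a b)
  have *: "of_int n = const_mero_uhp (of_int n)" for n
    by (cases n rule: int_cases2) (simp_all add: of_nat_mero_uhp const_mero_uhp_uminus)
  show ?thesis using Fract
    by (simp add: of_rat_rat * const_mero_uhp_mult const_mero_uhp_inverse divide_inverse)
qed

lemma meromorphic_on_act:
  assumes "det (M :: real^2^2) > 0" "f meromorphic_on uhp"
  shows "(\<lambda>z. f (act M z)) meromorphic_on uhp"
  by (rule meromorphic_on_compose[OF assms(2) act_analytic[OF assms(1)]])
     (use act_in_uhp[OF assms(1)] in auto)

lemma pullback_mero_of:
  assumes "det M > 0" "f meromorphic_on uhp"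
  shows "pullback M (mero_of f) = mero_of (\<lambda>z. f (act M z))"
  using assms by (simp add: pullback.abs_eq mero_rel_refl)

lemma pullback_pullback:
  assumes "det M > 0" "det N > 0"
  shows "pullback N (pullback M F) = pullback (M ** N) F"
proof (cases F)
  case (1 f)
  have "det (M ** N) > 0" using assms by (simp add: det_mul)
  thus ?thesis using assms 1 meromorphic_on_act[OF assms(2) meromorphic_on_act[OF assms(1) 1(1)]]
    by (auto simp: pullback_mero_of meromorphic_on_act act_mult intro!: mero_of_eqI)
qed

lemma pullback_eqI:
  assumes "det M > 0" "det N > 0" "\<And>z. z \<in> uhp \<Longrightarrow> act M z = act N z"
  shows "pullback M F = pullback N F"
proof (cases F)
  case (1 f)
  thus ?thesis using assms
    by (auto simp: pullback_mero_of meromorphic_on_act intro!: mero_of_eqI)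
qed

lemma pullback_mat_1 [simp]: "pullback (mat 1) F = F"
  by (cases F) (simp add: pullback_mero_of)

lemma pullback_add: "det M > 0 \<Longrightarrow> pullback M (F + G) = pullback M F + pullback M G"
  by (cases F; cases G) (simp add: pullback_mero_of mero_of_add meromorphic_on_act meromorphic_intros)

lemma pullback_diff: "det M > 0 \<Longrightarrow> pullback M (F - G) = pullback M F - pullback M G"
  by (cases F; cases G) (simp add: pullback_mero_of mero_of_diff meromorphic_on_act meromorphic_intros)

lemma pullback_mult: "det M > 0 \<Longrightarrow> pullback M (F * G) = pullback M F * pullback M G"
  by (cases F; cases G) (simp add: pullback_mero_of mero_of_mult meromorphic_on_act meromorphic_intros)

lemma pullback_inverse: "det M > 0 \<Longrightarrow> pullback M (inverse F) = inverse (pullback M F)"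
  by (cases F) (simp add: pullback_mero_of mero_of_inverse meromorphic_on_act meromorphic_intros)

lemma pullback_const: "det M > 0 \<Longrightarrow> pullback M (const_mero_uhp c) = const_mero_uhp c"
  by (simp add: mero_of_const pullback_mero_of meromorphic_on_const)

lemma pullback_0: "det M > 0 \<Longrightarrow> pullback M 0 = 0"
  using pullback_const[of M 0] by (simp add: const_mero_uhp_0)

lemma pullback_1: "det M > 0 \<Longrightarrow> pullback M 1 = 1"
  using pullback_const[of M 1] by (simp add: const_mero_uhp_1)

lemma pullback_power: "det M > 0 \<Longrightarrow> pullback M (F ^ n) = pullback M F ^ n"
  by (induction n) (simp_all add: pullback_1 pullback_mult)

lemma pullback_divide: "det M > 0 \<Longrightarrow> pullback M (F / G) = pullback M F / pullback M G"
  by (simp add: divide_inverse pullback_mult pullback_inverse)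

lemma pullback_sum: "det M > 0 \<Longrightarrow> pullback M (sum f A) = (\<Sum>x\<in>A. pullback M (f x))"
  by (induction A rule: infinite_finite_induct) (simp_all add: pullback_0 pullback_add)

lemma pullback_of_rat: "det M > 0 \<Longrightarrow> pullback M (of_rat r) = of_rat r"
  by (simp add: of_rat_mero_uhp pullback_const)

section \<open>Calculus of Laurent expansions at infinity\<close>

lemma eventually_cosparse_subset:
  "\<forall>\<^sub>\<approx>z\<in>A. P z \<Longrightarrow> B \<subseteq> A \<Longrightarrow> \<forall>\<^sub>\<approx>z\<in>B. P z"
  unfolding eventually_cosparse by (rule sparse_in_subset)

lemma eventually_cosparse_openI: "open A \<Longrightarrow> (\<And>z. z \<in> A \<Longrightarrow> P z) \<Longrightarrow> \<forall>\<^sub>\<approx>z\<in>A. P z"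
  using eventually_in_cosparse[of A A] by (auto elim: eventually_mono)

lemma open_Im_gt: "open {z. Im z > Y}"
  by (rule open_halfspace_Im_gt)

lemma norm_nome: "norm (exp (2 * pi * \<i> * z / of_nat h)) = exp (- (2 * pi / h * Im z))"
  by simp

text \<open>A punctured disc of radius r about 0 pulls back to the half plane Im z > - (h / (2 pi))
  ln r.\<close>

lemma eventually_nome:
  assumes h: "h > 0" and ev: "eventually P (at 0)"
  obtains Y where "Y > 0" "\<And>z. Im z > Y \<Longrightarrow> P (exp (2 * pi * \<i> * z / of_nat h))"
proof -
  from ev obtain r where r: "r > 0" "\<And>w. w \<noteq> 0 \<Longrightarrow> norm w < r \<Longrightarrow> P w"
    by (auto simp: eventually_at dist_norm)
  define Y where "Y = max 1 (- (real h / (2 * pi)) * ln r)"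
  show ?thesis
  proof (rule that[of Y])
    show "Y > 0" by (simp add: Y_def)
    fix z assume "Im z > Y"
    hence "- (real h / (2 * pi)) * ln r < Im z" by (simp add: Y_def)
    hence "2 * pi / real h * (- (real h / (2 * pi)) * ln r) < 2 * pi / real h * Im z"
      using h by (intro mult_strict_left_mono) auto
    hence "- (2 * pi / h * Im z) < ln r" using h by simp
    hence "exp (- (2 * pi / h * Im z)) < exp (ln r)" by (simp only: exp_less_cancel_iff)
    hence "norm (exp (2 * pi * \<i> * z / of_nat h)) < r" unfolding norm_nome using r(1) by simp
    thus "P (exp (2 * pi * \<i> * z / of_nat h))" by (intro r(2)) auto
  qed
qed

text \<open>Allowing any function with Laurent expansion \<open>L\<close> in place of
  \<open>eval_fls L\<close> gives access to the closure rules of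
  \<open>has_laurent_expansion\<close>.\<close>

lemma fun_has_q_expansion_iff:
  assumes h: "h > 0"
  shows "fun_has_q_expansion h f L \<longleftrightarrow> (\<exists>g. g has_laurent_expansion L \<and>
    (\<exists>Y>0. \<forall>\<^sub>\<approx>z\<in>{z. Im z > Y}. f z = g (exp (2 * pi * \<i> * z / of_nat h))))"
proof safe
  assume "fun_has_q_expansion h f L"
  thus "\<exists>g. g has_laurent_expansion L \<and>
    (\<exists>Y>0. \<forall>\<^sub>\<approx>z\<in>{z. Im z > Y}. f z = g (exp (2 * pi * \<i> * z / of_nat h)))"
    unfolding fun_has_q_expansion_def
    by (intro exI[of _ "eval_fls L"]) (auto simp: has_laurent_expansion_def)
next
  fix g Y assume g: "g has_laurent_expansion L" and Y: "Y > 0"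
    "\<forall>\<^sub>\<approx>z\<in>{z. Im z > Y}. f z = g (exp (2 * pi * \<i> * z / of_nat h))"
  from g have "eventually (\<lambda>w. eval_fls L w = g w) (at 0)" and L: "fls_conv_radius L > 0"
    by (auto simp: has_laurent_expansion_def)
  from eventually_nome[OF h this(1)] obtain Y' where Y': "Y' > 0"
    "\<And>z. Im z > Y' \<Longrightarrow> eval_fls L (exp (2 * pi * \<i> * z / of_nat h)) = g (exp (2 * pi * \<i> * z / of_nat h))"
    by blast
  have "\<forall>\<^sub>\<approx>z\<in>{z. Im z > max Y Y'}. f z = g (exp (2 * pi * \<i> * z / of_nat h))"
    by (rule eventually_cosparse_subset[OF Y(2)]) auto
  moreover have "\<forall>\<^sub>\<approx>z\<in>{z. Im z > max Y Y'}. eval_fls L (exp (2 * pi * \<i> * z / of_nat h)) = g (exp (2 * pi * \<i> * z / of_nat h))"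
    by (rule eventually_cosparse_openI[OF open_Im_gt]) (use Y' in auto)
  ultimately have "\<forall>\<^sub>\<approx>z\<in>{z. Im z > max Y Y'}. f z = eval_fls L (exp (2 * pi * \<i> * z / of_nat h))"
    by eventually_elim simp
  thus "fun_has_q_expansion h f L"
    unfolding fun_has_q_expansion_def using L Y(1) by (intro conjI exI[of _ "max Y Y'"]) auto
qed

lemma has_q_expansion_mero_of:
  assumes "h > 0" "f meromorphic_on uhp"
  shows "has_q_expansion h (mero_of f) L \<longleftrightarrow> (\<exists>g. g has_laurent_expansion L \<and>
    (\<exists>Y>0. \<forall>\<^sub>\<approx>z\<in>{z. Im z > Y}. f z = g (exp (2 * pi * \<i> * z / of_nat h))))"
  using assms by (simp add: has_q_expansion.abs_eq mero_rel_refl fun_has_q_expansion_iff)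

text \<open>One argument for all field operations; inversion is fitted in as a binary operation that
  ignores its second argument.\<close>

lemma has_q_expansion_binop:
  assumes h: "h > 0"
    and mero: "\<And>f g. f meromorphic_on uhp \<Longrightarrow> g meromorphic_on uhp \<Longrightarrow>
       (\<lambda>z. opf (f z) (g z)) meromorphic_on uhp \<and> opm (mero_of f) (mero_of g) = mero_of (\<lambda>z. opf (f z) (g z))"
    and laurent: "\<And>f g L K. f has_laurent_expansion L \<Longrightarrow> g has_laurent_expansion K \<Longrightarrow>
       (\<lambda>z. opf (f z) (g z)) has_laurent_expansion (opl L K)"
    and F: "has_q_expansion h F L" and G: "has_q_expansion h G K"
  shows "has_q_expansion h (opm F G) (opl L K)"
proof (cases F; cases G)
  fix f g assume f: "f meromorphic_on uhp" "F = mero_of f" and g: "g meromorphic_on uhp" "G = mero_of g"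
  from F obtain f' Y1 where 1: "f' has_laurent_expansion L" "Y1 > 0"
    "\<forall>\<^sub>\<approx>z\<in>{z. Im z > Y1}. f z = f' (exp (2 * pi * \<i> * z / of_nat h))"
    unfolding f(2) has_q_expansion_mero_of[OF h f(1)] by blast
  from G obtain g' Y2 where 2: "g' has_laurent_expansion K" "Y2 > 0"
    "\<forall>\<^sub>\<approx>z\<in>{z. Im z > Y2}. g z = g' (exp (2 * pi * \<i> * z / of_nat h))"
    unfolding g(2) has_q_expansion_mero_of[OF h g(1)] by blast
  have "\<forall>\<^sub>\<approx>z\<in>{z. Im z > max Y1 Y2}. f z = f' (exp (2 * pi * \<i> * z / of_nat h))"
       "\<forall>\<^sub>\<approx>z\<in>{z. Im z > max Y1 Y2}. g z = g' (exp (2 * pi * \<i> * z / of_nat h))"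
    by (rule eventually_cosparse_subset[OF 1(3)], force) (rule eventually_cosparse_subset[OF 2(3)], force)
  hence "\<forall>\<^sub>\<approx>z\<in>{z. Im z > max Y1 Y2}. opf (f z) (g z) =
     (\<lambda>w. opf (f' w) (g' w)) (exp (2 * pi * \<i> * z / of_nat h))"
    by eventually_elim simp
  note ev = this
  have fg: "(\<lambda>z. opf (f z) (g z)) meromorphic_on uhp"
    and eq: "opm (mero_of f) (mero_of g) = mero_of (\<lambda>z. opf (f z) (g z))"
    using mero[OF f(1) g(1)] by blast+
  show ?thesis
    unfolding f(2) g(2) eq has_q_expansion_mero_of[OF h fg]
    using laurent[OF 1(1) 2(1)] ev 1(2)
    by (intro exI[of _ "\<lambda>w. opf (f' w) (g' w)"] conjI exI[of _ "max Y1 Y2"]) auto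
qed

lemma has_q_expansion_add: "h > 0 \<Longrightarrow> has_q_expansion h F L \<Longrightarrow> has_q_expansion h G K \<Longrightarrow> has_q_expansion h (F + G) (L + K)"
  by (rule has_q_expansion_binop[where opf = "(+)" and opm = "(+)" and opl = "(+)"])
     (auto simp: mero_of_add intro: meromorphic_intros laurent_expansion_intros)

lemma has_q_expansion_diff: "h > 0 \<Longrightarrow> has_q_expansion h F L \<Longrightarrow> has_q_expansion h G K \<Longrightarrow> has_q_expansion h (F - G) (L - K)"
  by (rule has_q_expansion_binop[where opf = "(-)" and opm = "(-)" and opl = "(-)"])
     (auto simp: mero_of_diff intro: meromorphic_intros laurent_expansion_intros)

lemma has_q_expansion_mult: "h > 0 \<Longrightarrow> has_q_expansion h F L \<Longrightarrow> has_q_expansion h G K \<Longrightarrow> has_q_expansion h (F * G) (L * K)"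
  by (rule has_q_expansion_binop[where opf = "(*)" and opm = "(*)" and opl = "(*)"])
     (auto simp: mero_of_mult intro: meromorphic_intros laurent_expansion_intros)

lemma has_q_expansion_inverse: "h > 0 \<Longrightarrow> has_q_expansion h F L \<Longrightarrow> has_q_expansion h (inverse F) (inverse L)"
  by (rule has_q_expansion_binop[where opf = "\<lambda>a b. inverse a" and opm = "\<lambda>a b. inverse a" and opl = "\<lambda>a b. inverse a" and G = F and K = L])
     (auto simp: mero_of_inverse intro: meromorphic_intros laurent_expansion_intros)

lemma has_q_expansion_const: "h > 0 \<Longrightarrow> has_q_expansion h (const_mero_uhp c) (fls_const c)"
  unfolding mero_of_const
  by (subst has_q_expansion_mero_of)
     (auto intro!: exI[of _ "\<lambda>_. c"] exI[of _ "1::real"])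

lemma has_q_expansion_sum:
  assumes "h > 0" "\<And>i. i \<in> I \<Longrightarrow> has_q_expansion h (F i) (L i)"
  shows "has_q_expansion h (\<Sum>i\<in>I. F i) (\<Sum>i\<in>I. L i)"
  using assms(2)
proof (induction I rule: infinite_finite_induct)
  case (insert x I)
  thus ?case using has_q_expansion_add[OF assms(1)] by simp
qed (use has_q_expansion_const[OF assms(1), of 0] in \<open>simp_all add: const_mero_uhp_0\<close>)

text \<open>A nonzero Laurent series has no zeros near the origin, so otherwise a whole half plane
  would be a sparse set. Relations between functions thus become relations between series.\<close>

lemma has_q_expansion_0D:
  assumes h: "h > 0" and "has_q_expansion h 0 L"
  shows "L = 0"
proof (rule ccontr)
  assume "L \<noteq> 0"
  from assms obtain g Y where g: "g has_laurent_expansion L" "Y > 0"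
    "\<forall>\<^sub>\<approx>z\<in>{z. Im z > Y}. 0 = g (exp (2 * pi * \<i> * z / of_nat h))"
    unfolding mero_of_0 has_q_expansion_mero_of[OF h meromorphic_on_const] by blast
  obtain Y' where Y': "Y' > 0" "\<And>z. Im z > Y' \<Longrightarrow> g (exp (2 * pi * \<i> * z / of_nat h)) \<noteq> 0"
    by (rule eventually_nome[OF h has_laurent_expansion_nonzero_imp_eventually_nonzero[OF g(1) \<open>L \<noteq> 0\<close>]]) blast
  have "\<forall>\<^sub>\<approx>z\<in>{z. Im z > max Y Y'}. 0 = g (exp (2 * pi * \<i> * z / of_nat h))"
    by (rule eventually_cosparse_subset[OF g(3)]) auto
  moreover have "\<forall>\<^sub>\<approx>z\<in>{z. Im z > max Y Y'}. g (exp (2 * pi * \<i> * z / of_nat h)) \<noteq> 0"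
    by (rule eventually_cosparse_openI[OF open_Im_gt]) (use Y' in auto)
  ultimately have "\<forall>\<^sub>\<approx>z\<in>{z. Im z > max Y Y'}. False"
    by eventually_elim simp
  hence "{z. Im z > max Y Y'} = {}"
    by (simp only: eventually_False cosparse_eq_bot_iff')
  moreover have "Complex 0 (max Y Y' + 1) \<in> {z. Im z > max Y Y'}"
    unfolding mem_Collect_eq complex.sel by linarith
  ultimately show False by blast
qed

text \<open>The way back from series to functions: vanishing on a half plane spreads to the
  connected upper half plane.\<close>

lemma has_q_expansion_0_imp_0:
  assumes "h > 0" "has_q_expansion h F 0"
  shows "F = 0"
proof (cases F)
  case (1 f)
  from assms obtain g Y where g: "g has_laurent_expansion 0" "Y > 0"
    "\<forall>\<^sub>\<approx>z\<in>{z. Im z > Y}. f z = g (exp (2 * pi * \<i> * z / of_nat h))"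
    unfolding 1 has_q_expansion_mero_of[OF assms(1) 1(1)] by blast
  from g(1) have "eventually (\<lambda>w. eval_fls 0 w = g w) (at 0)"
    by (simp only: has_laurent_expansion_def)
  hence ev0: "eventually (\<lambda>w. g w = 0) (at 0)"
    by (rule eventually_mono) simp
  obtain Y' where Y': "Y' > 0" "\<And>z. Im z > Y' \<Longrightarrow> g (exp (2 * pi * \<i> * z / of_nat h)) = 0"
    by (rule eventually_nome[OF assms(1) ev0]) blast
  have *: "\<forall>\<^sub>\<approx>z\<in>{z. Im z > max Y Y'}. f z = g (exp (2 * pi * \<i> * z / of_nat h))"
    by (rule eventually_cosparse_subset[OF g(3)]) auto
  have "\<not> (\<forall>\<^sub>\<approx>z\<in>uhp. f z \<noteq> 0)"
  proof
    assume "\<forall>\<^sub>\<approx>z\<in>uhp. f z \<noteq> 0"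
    hence "\<forall>\<^sub>\<approx>z\<in>{z. Im z > max Y Y'}. f z \<noteq> 0"
      by (rule eventually_cosparse_subset) (use g(2) in \<open>auto simp: uhp_def\<close>)
    moreover have "\<forall>\<^sub>\<approx>z\<in>{z. Im z > max Y Y'}. g (exp (2 * pi * \<i> * z / of_nat h)) = 0"
      by (rule eventually_cosparse_openI[OF open_Im_gt]) (use Y' in auto)
    ultimately have "\<forall>\<^sub>\<approx>z\<in>{z. Im z > max Y Y'}. False"
      using * by eventually_elim simp
    hence "{z. Im z > max Y Y'} = {}"
      by (simp only: eventually_False cosparse_eq_bot_iff')
    moreover have "Complex 0 (max Y Y' + 1) \<in> {z. Im z > max Y Y'}"
      unfolding mem_Collect_eq complex.sel by linarith
    ultimately show False by blast
  qed
  hence "\<forall>\<^sub>\<approx>z\<in>uhp. f z = 0" using meromorphic_zero_or_nonzero[OF 1(1)] by blast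
  thus ?thesis unfolding 1 mero_of_0 using 1(1) mero_of_eq_iff by blast
qed

subsection \<open>The theta quotients\<close>

definition nome :: "complex \<Rightarrow> complex" where "nome z = exp (of_real pi * \<i> * z)"

text \<open>\<open>theta_u = \<theta>\<^sub>2 / \<theta>\<^sub>3\<close> and \<open>theta_v = \<theta>\<^sub>4 / \<theta>\<^sub>3\<close>.\<close>

definition theta_u :: "complex \<Rightarrow> complex" where
  "theta_u z = exp (of_real pi * \<i> * z / 4) * theta_psi (nome z) / theta_phi (nome z)"

definition theta_v :: "complex \<Rightarrow> complex" where
  "theta_v z = theta_phi (- nome z) / theta_phi (nome z)"

lemma norm_nome_less_1: "z \<in> uhp \<Longrightarrow> norm (nome z) < 1"
  by (simp add: nome_def uhp_def)

lemma nome_add_1: "nome (z + 1) = - nome z"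
proof -
  have "nome (z + 1) = nome z * exp (of_real pi * \<i>)"
    by (simp add: nome_def distrib_left exp_add)
  thus ?thesis by simp
qed

lemma nome_holomorphic [holomorphic_intros]: "nome holomorphic_on A"
  unfolding nome_def by (intro holomorphic_intros)

lemma theta_u_holomorphic: "theta_u holomorphic_on uhp"
proof -
  have "(theta_psi \<circ> nome) holomorphic_on uhp" "(theta_phi \<circ> nome) holomorphic_on uhp"
    by (rule holomorphic_on_compose_gen[OF nome_holomorphic theta_psi_holomorphic]
             holomorphic_on_compose_gen[OF nome_holomorphic theta_phi_holomorphic];
        use norm_nome_less_1 in auto)+
  thus ?thesis unfolding theta_u_def o_def
    using theta_phi_nonzero norm_nome_less_1 by (intro holomorphic_intros) auto
qed

lemma theta_v_holomorphic: "theta_v holomorphic_on uhp"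
proof -
  have 1: "(\<lambda>z. - nome z) holomorphic_on uhp" by (intro holomorphic_intros)
  have "(theta_phi \<circ> (\<lambda>z. - nome z)) holomorphic_on uhp" "(theta_phi \<circ> nome) holomorphic_on uhp"
    by (rule holomorphic_on_compose_gen[OF 1 theta_phi_holomorphic]
             holomorphic_on_compose_gen[OF nome_holomorphic theta_phi_holomorphic];
        use norm_nome_less_1 in auto)+
  thus ?thesis unfolding theta_v_def o_def
    using theta_phi_nonzero norm_nome_less_1 by (intro holomorphic_intros) auto
qed

lemma theta_u_nonzero: "z \<in> uhp \<Longrightarrow> theta_u z \<noteq> 0"
  using norm_nome_less_1[of z] by (simp add: theta_u_def theta_phi_nonzero theta_psi_nonzero)

lemma theta_v_nonzero: "z \<in> uhp \<Longrightarrow> theta_v z \<noteq> 0"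
  using norm_nome_less_1[of z] by (simp add: theta_v_def theta_phi_nonzero)

lemma theta_uv_jacobi:
  assumes "z \<in> uhp"
  shows "theta_u z ^ 4 + theta_v z ^ 4 = 1"
proof -
  let ?p = "nome z"
  have nz: "theta_phi ?p \<noteq> 0" using theta_phi_nonzero norm_nome_less_1[OF assms] by blast
  have "exp (of_real pi * \<i> * z / 4) ^ 4 = ?p"
    unfolding nome_def by (subst exp_of_nat_mult[symmetric]) simp
  hence "theta_u z ^ 4 = ?p * theta_psi ?p ^ 4 / theta_phi ?p ^ 4"
    by (simp add: theta_u_def power_mult_distrib power_divide)
  hence "theta_u z ^ 4 + theta_v z ^ 4 = (theta_phi (- ?p) ^ 4 + ?p * theta_psi ?p ^ 4) / theta_phi ?p ^ 4"
    by (simp add: theta_v_def power_divide add_divide_distrib)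
  also have "\<dots> = theta_phi ?p ^ 4 / theta_phi ?p ^ 4"
    by (rule arg_cong2[where f = "(/)", OF sym[OF theta_jacobi[OF norm_nome_less_1[OF assms]]] refl])
  also have "\<dots> = 1" using nz by simp
  finally show ?thesis .
qed

definition zeta8 :: complex where "zeta8 = exp (of_real pi * \<i> / 4)"

lemma zeta8_square: "zeta8 ^ 2 = \<i>"
proof -
  have "zeta8 ^ 2 = exp (of_real pi * \<i> / 2)"
    unfolding zeta8_def by (subst exp_of_nat_mult[symmetric]) (simp add: mult.commute)
  also have "of_real pi * \<i> / 2 = \<i> * complex_of_real (pi / 2)" by simp
  also have "exp \<dots> = cis (pi / 2)" by (simp only: cis_conv_exp)
  finally show ?thesis by simp
qed

lemma zeta8_nonzero: "zeta8 \<noteq> 0" by (simp add: zeta8_def)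

text \<open>Translation by 1 negates the nome. This exchanges \<open>theta_phi\<close> at p and -p,
  leaves the even function \<open>theta_psi\<close> alone, and the explicit fourth root of the nome
  picks up \<open>zeta8\<close>.\<close>

lemma theta_u_add_1: "z \<in> uhp \<Longrightarrow> theta_u (z + 1) = zeta8 * theta_u z / theta_v z"
proof -
  assume z: "z \<in> uhp"
  have nz: "theta_phi (nome z) \<noteq> 0" using theta_phi_nonzero norm_nome_less_1[OF z] by blast
  have "exp (of_real pi * \<i> * (z + 1) / 4) = zeta8 * exp (of_real pi * \<i> * z / 4)"
    by (simp add: zeta8_def distrib_left add_divide_distrib exp_add)
  thus ?thesis using nz by (simp add: theta_u_def theta_v_def nome_add_1 theta_psi_minus)
qed

lemma theta_v_add_1: "theta_v (z + 1) = 1 / theta_v z"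
  by (simp add: theta_v_def nome_add_1)

lemma uhp_add_numeral [simp]: "z + 1 \<in> uhp \<longleftrightarrow> z \<in> uhp" "z - 1 \<in> uhp \<longleftrightarrow> z \<in> uhp"
  "z + numeral n \<in> uhp \<longleftrightarrow> z \<in> uhp" "z - numeral n \<in> uhp \<longleftrightarrow> z \<in> uhp"
  by (simp_all add: uhp_def)

lemma theta_u_add_2: "z \<in> uhp \<Longrightarrow> theta_u (z + 2) = \<i> * theta_u z"
proof -
  assume z: "z \<in> uhp"
  have "z + 2 = (z + 1) + 1" by simp
  hence "theta_u (z + 2) = theta_u ((z + 1) + 1)" by (simp only:)
  also have "\<dots> = zeta8 * theta_u (z + 1) / theta_v (z + 1)"
    by (rule theta_u_add_1) (use z in simp)
  also have "\<dots> = zeta8 ^ 2 * theta_u z"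
    unfolding theta_u_add_1[OF z] theta_v_add_1 using theta_v_nonzero[OF z]
    by (simp add: power2_eq_square)
  finally show ?thesis by (simp add: zeta8_square)
qed

lemma theta_v_add_2: "theta_v (z + 2) = theta_v z"
proof -
  have "z + 2 = (z + 1) + 1" by simp
  hence "theta_v (z + 2) = theta_v ((z + 1) + 1)" by (simp only:)
  thus ?thesis by (simp only: theta_v_add_1) simp
qed

lemma theta_u_diff_2: "z \<in> uhp \<Longrightarrow> theta_u (z - 2) = - \<i> * theta_u z"
  using theta_u_add_2[of "z - 2"] by (simp add: mult.assoc[symmetric])

lemma theta_v_diff_2: "theta_v (z - 2) = theta_v z"
  using theta_v_add_2[of "z - 2"] by simp

section \<open>The inversion formula on the upper half plane\<close>

lemma lattice_sum_of_real:
  assumes "proper_exponent e" "\<bar>r\<bar> < 1"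
  shows "lattice_sum e (of_real r) = of_real (\<Sum>\<^sub>\<infinity>k. r ^ e k)"
    and "(\<lambda>k. r ^ e k) summable_on UNIV"
proof -
  have "(\<lambda>k. complex_of_real r ^ e k) summable_on UNIV"
    using lattice_sum_has_sum[of e "of_real r"] assms by (auto simp: summable_on_def)
  hence "(\<lambda>k. norm (complex_of_real r ^ e k)) summable_on UNIV"
    by (rule iffD1[OF summable_on_iff_abs_summable_on_complex])
  hence "(\<lambda>k. norm (r ^ e k)) summable_on UNIV" by (simp add: norm_power power_abs)
  thus s: "(\<lambda>k. r ^ e k) summable_on UNIV"
    by (rule iffD2[OF summable_on_iff_abs_summable_on_real])
  have "((\<lambda>k. complex_of_real (r ^ e k)) has_sum of_real (\<Sum>\<^sub>\<infinity>k. r ^ e k)) UNIV"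
    by (intro has_sum_of_real has_sum_infsum s)
  thus "lattice_sum e (of_real r) = of_real (\<Sum>\<^sub>\<infinity>k. r ^ e k)"
    using infsumI by (fastforce simp: lattice_sum_def)
qed

lemma exp_sq_exp: "exp (- c) ^ sq_exp k = exp (- (c * of_int k ^ 2))" for c :: real
proof -
  have "real (sq_exp k) = of_int k ^ 2"
    using arg_cong[OF int_sq_exp[of k], of real_of_int] by simp
  thus ?thesis by (simp add: mult.commute flip: exp_of_nat_mult)
qed

text \<open>The fourth root of the nome completes the square: k (k + 1) + 1/4 = (2 k + 1)^2 /
  4.\<close>

lemma exp_tri_exp: "exp (- (c / 4)) * exp (- c) ^ tri_exp k = exp (- (c / 4 * of_int (2 * k + 1) ^ 2))" for c :: real
proof -
  have "real (tri_exp k) = of_int k * (of_int k + 1)"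
    using arg_cong[OF int_tri_exp[of k], of real_of_int] by simp
  hence "exp (- c) ^ tri_exp k = exp (of_int k * (of_int k + 1) * (- c))"
    by (simp only: exp_of_nat_mult[symmetric])
  moreover have "- (c / 4) + of_int k * (of_int k + 1) * (- c) = - (c / 4 * of_int (2 * k + 1) ^ 2)"
    by (simp add: power2_eq_square algebra_simps)
  ultimately show ?thesis by (simp only: exp_add[symmetric])
qed

text \<open>On the imaginary axis the nome is real and all theta values are Gaussian sums. At i / t
  the even indices i = 2 k form theta_3 and the odd ones i = 2 k + 1 form theta_2, so
  \<open>gaussian_sum_inversion\<close> applies.\<close>

lemma theta_inversion_imaginary:
  assumes t: "t > (0 :: real)"
  shows "theta_u (- 1 / (\<i> * of_real t)) = theta_v (\<i> * of_real t)"
proof -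
  define r where "r = exp (- (pi * t))"
  define r' where "r' = exp (- (pi / t))"
  have r: "\<bar>r\<bar> < 1" "\<bar>- r\<bar> < 1" "\<bar>r'\<bar> < 1" using t by (auto simp: r_def r'_def)
  have inv: "- 1 / (\<i> * of_real t) = \<i> * of_real (1 / t)"
    using t by (simp add: field_simps)
  have nome1: "nome (\<i> * of_real t) = of_real r"
  proof -
    have "of_real pi * \<i> * (\<i> * of_real t) = complex_of_real (- (pi * t))" by (simp add: complex_eq_iff)
    thus ?thesis by (simp only: nome_def r_def exp_of_real)
  qed
  have nome2: "nome (\<i> * of_real (1 / t)) = of_real r'"
  proof -
    have "of_real pi * \<i> * (\<i> * of_real (1 / t)) = complex_of_real (- (pi / t))" by (simp add: complex_eq_iff)
    thus ?thesis by (simp only: nome_def r'_def exp_of_real)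
  qed
  have e4: "exp (of_real pi * \<i> * (\<i> * of_real (1 / t)) / 4) = complex_of_real (exp (- (pi / t / 4)))"
  proof -
    have "of_real pi * \<i> * (\<i> * of_real (1 / t)) / 4 = complex_of_real (- (pi / t / 4))" by (simp add: complex_eq_iff)
    thus ?thesis by (simp only: exp_of_real)
  qed
  have s1: "theta_phi (of_real r) = of_real (\<Sum>\<^sub>\<infinity>k. exp (- (pi * t * of_int k ^ 2)))"
    unfolding theta_phi_def lattice_sum_of_real(1)[OF proper_sq_exp r(1)] by (simp only: r_def exp_sq_exp)
  have s2: "theta_phi (- of_real r) = of_real (\<Sum>\<^sub>\<infinity>k. cos (pi * of_int k) * exp (- (pi * t * of_int k ^ 2)))"
  proof -
    have "(- r) ^ sq_exp k = cos (pi * of_int k) * exp (- (pi * t * of_int k ^ 2))" for k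
    proof -
      have "even (int (sq_exp k)) \<longleftrightarrow> even k" unfolding int_sq_exp by simp
      hence "even (sq_exp k) \<longleftrightarrow> even k" by simp
      thus ?thesis by (auto simp: r_def exp_sq_exp power_minus_odd)
    qed
    thus ?thesis
      using lattice_sum_of_real(1)[OF proper_sq_exp r(2)] by (simp add: theta_phi_def)
  qed
  have s3: "theta_phi (of_real r') = of_real (\<Sum>\<^sub>\<infinity>i. if even i then exp (- (pi / (4 * t) * of_int i ^ 2)) else 0)"
  proof -
    have "(\<Sum>\<^sub>\<infinity>i::int. if even i then exp (- (pi / (4 * t) * of_int i ^ 2)) else 0) =
       (\<Sum>\<^sub>\<infinity>i\<in>{i::int. even i}. exp (- (pi / (4 * t) * of_int i ^ 2)))"
      by (rule infsum_cong_neutral) auto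
    also have "\<dots> = (\<Sum>\<^sub>\<infinity>k::int. exp (- (pi / (4 * t) * of_int (2 * k) ^ 2)))"
    proof (rule infsum_reindex_bij_betw[symmetric])
      show "bij_betw (\<lambda>k. 2 * k) UNIV {i::int. even i}"
        by (rule bij_betwI[where g = "\<lambda>i. i div 2"]) auto
    qed
    also have "\<dots> = (\<Sum>\<^sub>\<infinity>k::int. exp (- (pi / t * of_int k ^ 2)))"
      by (simp add: power_mult_distrib)
    finally show ?thesis
      unfolding theta_phi_def lattice_sum_of_real(1)[OF proper_sq_exp r(3)] by (simp only: r'_def exp_sq_exp)
  qed
  have s4: "of_real (exp (- (pi / t / 4))) * theta_psi (of_real r') =
     of_real (\<Sum>\<^sub>\<infinity>i. if odd i then exp (- (pi / (4 * t) * of_int i ^ 2)) else 0)"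
  proof -
    have "(\<Sum>\<^sub>\<infinity>i::int. if odd i then exp (- (pi / (4 * t) * of_int i ^ 2)) else 0) =
       (\<Sum>\<^sub>\<infinity>i\<in>{i::int. odd i}. exp (- (pi / (4 * t) * of_int i ^ 2)))"
      by (rule infsum_cong_neutral) auto
    also have "\<dots> = (\<Sum>\<^sub>\<infinity>k::int. exp (- (pi / (4 * t) * of_int (2 * k + 1) ^ 2)))"
    proof (rule infsum_reindex_bij_betw[symmetric])
      show "bij_betw (\<lambda>k. 2 * k + 1) UNIV {i::int. odd i}"
        by (rule bij_betwI[where g = "\<lambda>i. (i - 1) div 2"]) auto
    qed
    also have "\<dots> = (\<Sum>\<^sub>\<infinity>k::int. exp (- (pi / t / 4)) * r' ^ tri_exp k)"
      unfolding r'_def exp_tri_exp by (simp add: mult.commute[of t 4])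
    also have "\<dots> = exp (- (pi / t / 4)) * (\<Sum>\<^sub>\<infinity>k::int. r' ^ tri_exp k)"
      by (rule infsum_cmult_right) (use lattice_sum_of_real(2)[OF proper_tri_exp r(3)] in auto)
    finally show ?thesis
      unfolding theta_psi_def lattice_sum_of_real(1)[OF proper_tri_exp r(3)] by simp
  qed
  have "theta_phi (of_real r) * (of_real (exp (- (pi / t / 4))) * theta_psi (of_real r')) =
      theta_phi (- of_real r) * theta_phi (of_real r')"
    unfolding s1 s2 s3 s4 of_real_mult[symmetric] gaussian_sum_inversion[OF t] ..
  moreover have "theta_phi (of_real r) \<noteq> 0" "theta_phi (of_real r') \<noteq> 0"
    using r by (auto intro!: theta_phi_nonzero)
  ultimately show ?thesis
    unfolding theta_u_def theta_v_def inv nome1 nome2 e4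
    by (simp add: frac_eq_eq mult_ac)
qed

lemma uhp_inversion: "z \<in> uhp \<Longrightarrow> - 1 / z \<in> uhp"
  by (auto simp: uhp_def Im_divide divide_pos_pos sum_power2_gt_zero_iff zero_less_divide_iff)

lemma uhp_nonzero: "z \<in> uhp \<Longrightarrow> z \<noteq> 0"
  by (auto simp: uhp_def)

text \<open>Both sides are holomorphic and agree on the imaginary axis, which accumulates at
  i.\<close>

lemma theta_u_inversion:
  assumes "z \<in> uhp"
  shows "theta_u (- 1 / z) = theta_v z"
proof -
  have "(theta_u \<circ> (\<lambda>z. - 1 / z)) holomorphic_on uhp"
    by (rule holomorphic_on_compose_gen[OF _ theta_u_holomorphic])
       (use uhp_inversion uhp_nonzero in \<open>auto intro!: holomorphic_intros\<close>)
  hence holo: "(\<lambda>z. theta_u (- 1 / z) - theta_v z) holomorphic_on uhp"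
    unfolding o_def by (intro holomorphic_intros theta_v_holomorphic)
  have lim: "\<i> islimpt {\<i> * of_real t |t. t > 0}"
    unfolding islimpt_approachable
  proof (intro allI impI)
    fix e :: real assume "e > 0"
    thus "\<exists>x'\<in>{\<i> * of_real t |t. t > 0}. x' \<noteq> \<i> \<and> dist x' \<i> < e"
      by (intro bexI[of _ "\<i> * of_real (1 + e / 2)"]) (auto simp: dist_norm algebra_simps norm_mult complex_eq_iff intro!: exI[of _ "1 + e / 2"])
  qed
  have "theta_u (- 1 / z) - theta_v z = 0"
    by (rule analytic_continuation[OF holo open_uhp connected_uhp _ _ lim])
       (use theta_inversion_imaginary assms in \<open>auto simp: uhp_def\<close>)
  thus ?thesis by simp
qed

lemma theta_v_inversion:
  assumes "z \<in> uhp"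
  shows "theta_v (- 1 / z) = theta_u z"
  using theta_u_inversion[OF uhp_inversion[OF assms]] uhp_nonzero[OF assms] by simp

subsection \<open>The action of the principal congruence subgroup of level 2\<close>

lemma ii_powi_add4: "\<i> powi (n + 4 * k) = \<i> powi n"
proof -
  have "\<i> powi (4 * k) = (\<i> powi 4) powi k" by (rule power_int_mult)
  also have "\<i> powi 4 = 1" by simp
  finally show ?thesis by (simp add: power_int_add)
qed

text \<open>Half of each off-diagonal entry is the parameter, because the multipliers of
  \<open>theta_u\<close> and \<open>theta_v\<close> turn out to be powers of i with exponents
  \<open>a * b\<close> and \<open>- (c * d)\<close>.\<close>

definition gamma2_mat :: "int \<Rightarrow> int \<Rightarrow> int \<Rightarrow> int \<Rightarrow> real^2^2" where
  "gamma2_mat a b c d = mat2 (of_int a) (of_int (2 * b)) (of_int (2 * c)) (of_int d)"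

text \<open>The determinant forces the diagonal entries to be odd. Minus the identity belongs to the
  set, as it does to \<open>Gamma0 64\<close>.\<close>

definition Gamma2 :: "(real^2^2) set" where
  "Gamma2 = {gamma2_mat a b c d |a b c d. a * d - 4 * b * c = 1}"

lemma det_gamma2_mat:
  assumes "a * d - 4 * b * c = 1"
  shows "det (gamma2_mat a b c d) = 1"
proof -
  have "det (gamma2_mat a b c d) = real_of_int (a * d - 4 * b * c)"
    by (simp add: gamma2_mat_def det_mat2)
  thus ?thesis using assms by simp
qed

text \<open>w / (1 + 2 w) = -1 / (-1 / w - 2): these maps are translations by 2 conjugated by the
  inversion, which exchanges the two quotients.\<close>

lemma theta_uv_lower:
  assumes w: "w \<in> uhp"
  shows "theta_u (w / (1 + 2 * w)) = theta_u w" "theta_v (w / (1 + 2 * w)) = - \<i> * theta_v w"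
    "theta_u (w / (1 - 2 * w)) = theta_u w" "theta_v (w / (1 - 2 * w)) = \<i> * theta_v w"
proof -
  have nz: "w \<noteq> 0" by (rule uhp_nonzero[OF w])
  have u: "- 1 / w - 2 \<in> uhp" "- 1 / w + 2 \<in> uhp" "- 1 / w \<in> uhp"
    using uhp_inversion[OF w] by (simp_all only: uhp_add_numeral)
  have "- 1 / w - 2 = - ((1 + 2 * w) / w)" "- 1 / w + 2 = - ((1 - 2 * w) / w)"
    using nz by (simp_all add: add_divide_distrib diff_divide_distrib)
  hence eq: "w / (1 + 2 * w) = - 1 / (- 1 / w - 2)" "w / (1 - 2 * w) = - 1 / (- 1 / w + 2)"
    by simp_all
  show "theta_u (w / (1 + 2 * w)) = theta_u w"
    unfolding eq theta_u_inversion[OF u(1)] theta_v_diff_2 theta_v_inversion[OF w] ..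
  show "theta_v (w / (1 + 2 * w)) = - \<i> * theta_v w"
    unfolding eq theta_v_inversion[OF u(1)] theta_u_diff_2[OF u(3)] theta_u_inversion[OF w] ..
  show "theta_u (w / (1 - 2 * w)) = theta_u w"
    unfolding eq theta_u_inversion[OF u(2)] theta_v_add_2 theta_v_inversion[OF w] ..
  show "theta_v (w / (1 - 2 * w)) = \<i> * theta_v w"
    unfolding eq theta_v_inversion[OF u(2)] theta_u_add_2[OF u(3)] theta_u_inversion[OF w] ..
qed

text \<open>The four moves of the Euclidean algorithm: adding or subtracting twice one row of the
  matrix to the other.\<close>

lemma act_gamma2_mat_shift:
  assumes "a * d - 4 * b * c = 1" "z \<in> uhp"
  defines "w \<equiv> act (gamma2_mat a b c d) z"
  shows "act (gamma2_mat (a + 4 * c) (b + d) c d) z = w + 2"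
    "act (gamma2_mat (a - 4 * c) (b - d) c d) z = w - 2"
    "act (gamma2_mat a b (c + a) (d + 4 * b)) z = w / (1 + 2 * w)"
    "act (gamma2_mat a b (c - a) (d - 4 * b)) z = w / (1 - 2 * w)"
proof -
  define n m where "n = of_int a * z + of_int (2 * b)" and "m = of_int (2 * c) * z + of_int d"
  have m: "m \<noteq> 0"
    using act_denom_nonzero[of "gamma2_mat a b c d" z] det_gamma2_mat[OF assms(1)] assms(2)
    by (simp add: gamma2_mat_def m_def)
  have w: "w = n / m" by (simp add: w_def gamma2_mat_def act_mat2 n_def m_def)
  have "act (gamma2_mat (a + 4 * c) (b + d) c d) z = (n + 2 * m) / m"
    "act (gamma2_mat (a - 4 * c) (b - d) c d) z = (n - 2 * m) / m"
    "act (gamma2_mat a b (c + a) (d + 4 * b)) z = n / (m + 2 * n)"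
    "act (gamma2_mat a b (c - a) (d - 4 * b)) z = n / (m - 2 * n)"
    by (simp_all add: gamma2_mat_def act_mat2 n_def m_def algebra_simps)
  moreover have "m + 2 * n = m * (1 + 2 * w)" "m - 2 * n = m * (1 - 2 * w)"
    using m by (simp_all add: w algebra_simps)
  ultimately show "act (gamma2_mat (a + 4 * c) (b + d) c d) z = w + 2"
    "act (gamma2_mat (a - 4 * c) (b - d) c d) z = w - 2"
    "act (gamma2_mat a b (c + a) (d + 4 * b)) z = w / (1 + 2 * w)"
    "act (gamma2_mat a b (c - a) (d - 4 * b)) z = w / (1 - 2 * w)"
    using m by (simp_all add: w add_divide_distrib diff_divide_distrib)
qed

lemma theta_uv_translate:
  assumes "z \<in> uhp"
  shows "theta_u (z + of_int (2 * n)) = \<i> powi n * theta_u z \<and> theta_v (z + of_int (2 * n)) = theta_v z"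
proof (induction n rule: int_induct[where k = 0])
  case (step1 n)
  let ?z = "z + of_int (2 * n)"
  have eq: "z + of_int (2 * (n + 1)) = ?z + 2" by simp
  have "?z \<in> uhp" using assms by (simp add: uhp_def)
  thus ?case unfolding eq theta_v_add_2 theta_u_add_2[OF \<open>?z \<in> uhp\<close>]
    using step1 by (simp add: power_int_add)
next
  case (step2 n)
  let ?z = "z + of_int (2 * n)"
  have eq: "z + of_int (2 * (n - 1)) = ?z - 2" by simp
  have "?z \<in> uhp" using assms by (simp add: uhp_def)
  thus ?case unfolding eq theta_v_diff_2 theta_u_diff_2[OF \<open>?z \<in> uhp\<close>]
    using step2 by (simp add: power_int_diff)
qed simp

text \<open>The Euclidean algorithm with even quotients on the first column.\<close>

lemma theta_uv_gamma2_mat: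
  assumes "a * d - 4 * b * c = 1" "z \<in> uhp"
  shows "theta_u (act (gamma2_mat a b c d) z) = \<i> powi (a * b) * theta_u z \<and>
         theta_v (act (gamma2_mat a b c d) z) = \<i> powi (- (c * d)) * theta_v z"
  using assms(1)
proof (induction "nat (\<bar>a\<bar> + \<bar>2 * c\<bar>)" arbitrary: a b c d rule: less_induct)
  case (less a c b d)
  note det = less.prems
  define w where "w = act (gamma2_mat a b c d) z"
  have w: "w \<in> uhp" unfolding w_def by (rule act_in_uhp) (use det_gamma2_mat[OF det] assms in auto)
  note shift = act_gamma2_mat_shift[OF det assms(2), folded w_def]
  have "odd a"
  proof
    assume "even a"
    hence "even (a * d - 4 * b * c)" by simp
    thus False using det by simp
  qed
  \<comment> \<open>An odd number never has the same absolute value as an even one, so one of the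
    two entries is strictly larger and some move strictly decreases it.\<close>
  hence a0: "a \<noteq> 0" and neq: "\<bar>a\<bar> \<noteq> \<bar>2 * c\<bar>" by (auto, presburger+)
  have goal: "theta_u w = \<i> powi (a * b) * theta_u z \<and> theta_v w = \<i> powi (- (c * d)) * theta_v z"
  proof (cases "c = 0")
    case True
    \<comment> \<open>The algorithm ends here: up to sign the matrix is a translation by
      \<open>2 * a * b\<close>, and the sign acts trivially.\<close>
    hence ad: "a * d = 1" using det by simp
    hence "a = 1 \<and> d = 1 \<or> a = -1 \<and> d = -1" using zmult_eq_1_iff by blast
    hence "w = z + of_int (2 * (a * b))"
      by (auto simp: w_def gamma2_mat_def act_mat2 True)
    thus ?thesis using theta_uv_translate[OF assms(2), of "a * b"] True by simp
  next
    case False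
    show ?thesis
    proof (cases "\<bar>a\<bar> > \<bar>2 * c\<bar>")
      case True
      show ?thesis
      proof (cases "\<bar>a + 4 * c\<bar> < \<bar>a\<bar>")
        case lt: True
        have det': "(a + 4 * c) * d - 4 * (b + d) * c = 1" using det by (simp add: algebra_simps)
        have IH: "theta_u (w + 2) = \<i> powi ((a + 4 * c) * (b + d)) * theta_u z"
          "theta_v (w + 2) = \<i> powi (- (c * d)) * theta_v z"
          using less.hyps[OF _ det'] lt unfolding shift by auto
        \<comment> \<open>The determinant replaces \<open>a * d\<close> by 1 modulo 4, so the
          exponent grows by exactly 1 modulo 4, as \<open>theta_u_add_2\<close> demands. The other
          three branches are analogous.\<close>
        have "(a + 4 * c) * (b + d) = (a * b + 1) + 4 * (2 * b * c + c * d)"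
          using det by (simp add: algebra_simps)
        hence "\<i> powi ((a + 4 * c) * (b + d)) = \<i> powi (a * b) * \<i>"
          by (simp only: ii_powi_add4) (simp add: power_int_add)
        thus ?thesis using IH theta_u_add_2[OF w] theta_v_add_2[of w] by simp
      next
        case ge: False
        have lt: "\<bar>a - 4 * c\<bar> < \<bar>a\<bar>" using True ge False by linarith
        have det': "(a - 4 * c) * d - 4 * (b - d) * c = 1" using det by (simp add: algebra_simps)
        have IH: "theta_u (w - 2) = \<i> powi ((a - 4 * c) * (b - d)) * theta_u z"
          "theta_v (w - 2) = \<i> powi (- (c * d)) * theta_v z"
          using less.hyps[OF _ det'] lt unfolding shift by auto
        have "(a - 4 * c) * (b - d) = (a * b - 1) + 4 * (- 2 * b * c + c * d)"
          using det by (simp add: algebra_simps)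
        hence "\<i> powi ((a - 4 * c) * (b - d)) = - \<i> * \<i> powi (a * b)"
          by (simp only: ii_powi_add4) (simp add: power_int_diff)
        thus ?thesis using IH theta_u_diff_2[OF w] theta_v_diff_2[of w] by simp
      qed
    next
      case False
      hence gt: "\<bar>2 * c\<bar> > \<bar>a\<bar>" using neq by linarith
      show ?thesis
      proof (cases "\<bar>c + a\<bar> < \<bar>c\<bar>")
        case lt: True
        have det': "a * (d + 4 * b) - 4 * b * (c + a) = 1" using det by (simp add: algebra_simps)
        have "nat (\<bar>a\<bar> + \<bar>2 * (c + a)\<bar>) < nat (\<bar>a\<bar> + \<bar>2 * c\<bar>)"
          using lt gt by (subst nat_less_eq_zless) (auto simp: abs_mult)
        hence IH: "theta_u (w / (1 + 2 * w)) = \<i> powi (a * b) * theta_u z"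
          "theta_v (w / (1 + 2 * w)) = \<i> powi (- ((c + a) * (d + 4 * b))) * theta_v z"
          using less.hyps[OF _ det'] unfolding shift by auto
        have "- ((c + a) * (d + 4 * b)) = (- (c * d) - 1) + 4 * (- (2 * b * c) - a * b)"
          using det by (simp add: algebra_simps)
        hence "\<i> powi (- ((c + a) * (d + 4 * b))) = - \<i> * \<i> powi (- (c * d))"
          by (simp only: ii_powi_add4) (simp add: power_int_diff)
        thus ?thesis using IH theta_uv_lower[OF w] by simp
      next
        case ge: False
        have lt: "\<bar>c - a\<bar> < \<bar>c\<bar>" using gt ge a0 by linarith
        have det': "a * (d - 4 * b) - 4 * b * (c - a) = 1" using det by (simp add: algebra_simps)
        have "nat (\<bar>a\<bar> + \<bar>2 * (c - a)\<bar>) < nat (\<bar>a\<bar> + \<bar>2 * c\<bar>)"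
          using lt gt by (subst nat_less_eq_zless) (auto simp: abs_mult)
        hence IH: "theta_u (w / (1 - 2 * w)) = \<i> powi (a * b) * theta_u z"
          "theta_v (w / (1 - 2 * w)) = \<i> powi (- ((c - a) * (d - 4 * b))) * theta_v z"
          using less.hyps[OF _ det'] unfolding shift by auto
        have "- ((c - a) * (d - 4 * b)) = (- (c * d) + 1) + 4 * (2 * b * c - a * b)"
          using det by (simp add: algebra_simps)
        hence "\<i> powi (- ((c - a) * (d - 4 * b))) = \<i> powi (- (c * d)) * \<i>"
          by (simp only: ii_powi_add4) (rule power_int_add_1, simp)
        thus ?thesis using IH theta_uv_lower[OF w] by simp
      qed
    qed
  qed
  thus ?case unfolding w_def .
qed

subsection \<open>Reduction theory\<close>

definition T_mat :: "int \<Rightarrow> real^2^2" where "T_mat k = mat2 1 (of_int k) 0 1"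

lemma act_T_mat [simp]: "act (T_mat k) z = z + of_int k"
  by (simp add: T_mat_def act_mat2)

lemma det_T_mat [simp]: "det (T_mat k) = 1"
  by (simp add: T_mat_def det_mat2)

lemma SL2Z_I: "a * d - b * c = 1 \<Longrightarrow> mat2 (of_int a) (of_int b) (of_int c) (of_int d) \<in> SL2Z"
  by (auto simp: SL2Z_def det_mat2 forall_2 simp flip: of_int_mult of_int_diff)

lemma SL2Z_E:
  assumes "M \<in> SL2Z"
  obtains a b c d :: int where "M = mat2 (of_int a) (of_int b) (of_int c) (of_int d)" "a * d - b * c = 1"
proof -
  from assms have "\<forall>i j. M $ i $ j \<in> \<int>" "det M = 1" by (auto simp: SL2Z_def)
  then obtain a b c d where abcd: "M $ 1 $ 1 = of_int a" "M $ 1 $ 2 = of_int b"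
    "M $ 2 $ 1 = of_int c" "M $ 2 $ 2 = of_int d" by (meson Ints_cases)
  have "real_of_int (a * d - b * c) = of_int 1"
    using \<open>det M = 1\<close> by (simp add: det_2 abcd)
  hence "a * d - b * c = 1" by (simp only: of_int_eq_iff)
  with mat2_eqI[OF abcd] show ?thesis by (rule that)
qed

lemma SL2Z_mult: "M \<in> SL2Z \<Longrightarrow> N \<in> SL2Z \<Longrightarrow> M ** N \<in> SL2Z"
proof -
  assume "M \<in> SL2Z" "N \<in> SL2Z"
  hence "det (M ** N) = 1" "\<forall>i j. (M ** N) $ i $ j \<in> \<int>"
    by (simp add: SL2Z_def det_mul)
       (use \<open>M \<in> SL2Z\<close> \<open>N \<in> SL2Z\<close> in \<open>auto simp: SL2Z_def matrix_matrix_mult_def sum_2 intro!: Ints_add Ints_mult\<close>)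
  thus ?thesis by (simp add: SL2Z_def)
qed

lemma SL2Z_det: "M \<in> SL2Z \<Longrightarrow> det M = 1"
  by (simp add: SL2Z_def)

lemma T_mat_SL2Z: "T_mat k \<in> SL2Z"
  using SL2Z_I[of 1 1 k 0] by (simp add: T_mat_def)

lemma gamma2_mat_SL2Z: "a * d - 4 * b * c = 1 \<Longrightarrow> gamma2_mat a b c d \<in> SL2Z"
  unfolding gamma2_mat_def by (rule SL2Z_I) simp

lemma Gamma2_SL2Z: "Gamma2 \<subseteq> SL2Z"
  by (auto simp: Gamma2_def gamma2_mat_SL2Z)

text \<open>These matrices carry infinity to the three cusps infinity, 0 and 1 of
  \<open>Gamma2\<close>.\<close>

definition cusp_reps :: "(real^2^2) set" where
  "cusp_reps = {mat2 1 0 0 1, mat2 0 (-1) 1 0, mat2 1 (-1) 1 0}"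

lemma cusp_reps_SL2Z: "cusp_reps \<subseteq> SL2Z"
  using SL2Z_I[of 1 1 0 0] SL2Z_I[of 0 0 "-1" 1] SL2Z_I[of 1 0 "-1" 1]
  by (auto simp: cusp_reps_def)

lemma Gamma2_I:
  assumes "even b" "even c" "a * d - b * c = 1"
  shows "mat2 (of_int a) (of_int b) (of_int c) (of_int d) \<in> Gamma2"
proof -
  from assms obtain b' c' where "b = 2 * b'" "c = 2 * c'" by (auto elim!: evenE)
  hence "mat2 (of_int a) (of_int b) (of_int c) (of_int d) = gamma2_mat a b' c' d" "a * d - 4 * b' * c' = 1"
    using assms(3) by (simp_all add: gamma2_mat_def)
  thus ?thesis unfolding Gamma2_def by blast
qed

text \<open>The parity of the first column tells which cusp is the image of infinity: c even gives
  infinity, c odd and a even gives 0, both odd gives 1.\<close>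

lemma SL2Z_coset:
  assumes "M \<in> SL2Z"
  obtains N r k where "N \<in> Gamma2" "r \<in> cusp_reps" "M = N ** r ** T_mat k"
proof -
  from SL2Z_E[OF assms] obtain a b c d :: int
    where M: "M = mat2 (of_int a) (of_int b) (of_int c) (of_int d)" and det: "a * d - b * c = 1" .
  \<comment> \<open>The translation makes the upper right entry even when c is even, and the lower
    right entry even when c is odd.\<close>
  define k where "k = (if even c then b mod 2 else d mod 2)"
  define b' where "b' = b - k * a"
  define d' where "d' = d - k * c"
  have det': "a * d' - b' * c = 1" using det by (simp add: b'_def d'_def algebra_simps)
  have odd_det: "odd (a * d' - b' * c)" unfolding det' by simp
  have M': "M = mat2 (of_int a) (of_int b') (of_int c) (of_int d') ** T_mat k"
    by (simp add: M T_mat_def mat2_mult b'_def d'_def)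
  show ?thesis
  proof (cases "even c")
    case True
    hence "odd a" using odd_det by auto
    hence "even b'" using True by (auto simp: b'_def k_def)
    hence "mat2 (of_int a) (of_int b') (of_int c) (of_int d') \<in> Gamma2"
      using True det' by (intro Gamma2_I) auto
    moreover have "mat2 (of_int a) (of_int b') (of_int c) (of_int d') ** mat2 1 0 0 1 =
        mat2 (of_int a) (of_int b') (of_int c) (of_int d')"
      by (simp add: mat2_mult)
    ultimately show ?thesis
      by (intro that[of "mat2 (of_int a) (of_int b') (of_int c) (of_int d')" "mat2 1 0 0 1" k])
         (auto simp: cusp_reps_def M')
  next
    case False
    have d': "even d'" using False by (auto simp: d'_def k_def)
    hence b': "odd b'" using odd_det by auto
    show ?thesis
    proof (cases "even a")
      case True
      have "mat2 (of_int (- b')) (of_int a) (of_int (- d')) (of_int c) \<in> Gamma2"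
        using True d' det' by (intro Gamma2_I) auto
      moreover have "mat2 (of_int (- b')) (of_int a) (of_int (- d')) (of_int c) ** mat2 0 (-1) 1 0 =
          mat2 (of_int a) (of_int b') (of_int c) (of_int d')"
        by (simp add: mat2_mult)
      ultimately show ?thesis
        by (intro that[of "mat2 (of_int (- b')) (of_int a) (of_int (- d')) (of_int c)" "mat2 0 (-1) 1 0" k])
           (auto simp: cusp_reps_def M')
    next
      case odd: False
      have "mat2 (of_int (- b')) (of_int (a + b')) (of_int (- d')) (of_int (c + d')) \<in> Gamma2"
        using odd b' d' det' by (intro Gamma2_I) (auto simp: algebra_simps)
      moreover have "mat2 (of_int (- b')) (of_int (a + b')) (of_int (- d')) (of_int (c + d')) ** mat2 1 (-1) 1 0 =
          mat2 (of_int a) (of_int b') (of_int c) (of_int d')"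
        by (simp add: mat2_mult)
      ultimately show ?thesis
        by (intro that[of "mat2 (of_int (- b')) (of_int (a + b')) (of_int (- d')) (of_int (c + d'))" "mat2 1 (-1) 1 0" k])
           (auto simp: cusp_reps_def M')
    qed
  qed
qed

text \<open>By Dirichlet approximation every orbit meets a half plane on which the local parameters at
  the cusps converge.\<close>

lemma SL2Z_orbit_height:
  assumes z: "z \<in> uhp"
  obtains M where "M \<in> SL2Z" "Im (act M z) \<ge> 1/5"
proof (cases "Im z \<ge> 1/5")
  case True
  show ?thesis by (rule that[of "T_mat 0"]) (use True T_mat_SL2Z in auto)
next
  case False
  define y where "y = Im z"
  have y: "0 < y" "y < 1/5" using z False by (auto simp: y_def uhp_def)
  \<comment> \<open>With N about y^(-1/2), Dirichlet gives (h - k x)^2 <= y, and k <= N <= 2 / s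
    gives (k y)^2 <= 4 y. The denominator in the formula for the new height is then at most 5 y,
    which is the source of the bound 1/5.\<close>
  define s where "s = sqrt y"
  have s: "0 < s" "s < 1" "s ^ 2 = y" using y by (auto simp: s_def)
  define N where "N = nat \<lceil>1 / s\<rceil>"
  have N: "1 / s \<le> real N" "real N \<le> 1 / s + 1"
  proof -
    have "0 < 1 / s" using s by simp
    hence "0 < \<lceil>1 / s\<rceil>" by linarith
    hence "real N = of_int \<lceil>1 / s\<rceil>" by (simp add: N_def)
    thus "1 / s \<le> real N" "real N \<le> 1 / s + 1" by linarith+
  qed
  have "N > 0" using N(1) s by (cases N) (auto simp: field_simps)
  then obtain h k where hk: "coprime h k" "0 < k" "k \<le> int N" "\<bar>of_int k * Re z - of_int h\<bar> < 1 / real N"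
    using Dirichlet_approx_coprime[of N "Re z"] by blast
  from hk(1) have "gcd k h = 1" by (simp add: coprime_iff_gcd_eq_1 gcd.commute)
  then obtain u v where uv: "u * k + v * h = 1" using bezout_int[of k h] by metis
  define M where "M = mat2 (of_int v) (of_int u) (of_int (- k)) (of_int h)"
  have M: "M \<in> SL2Z" unfolding M_def by (rule SL2Z_I) (use uv in \<open>simp add: algebra_simps\<close>)
  define D where "D = norm (of_real (M $ 2 $ 1) * z + of_real (M $ 2 $ 2)) ^ 2"
  have Dpos: "D > 0"
    using act_denom_nonzero[of M z] SL2Z_det[OF M] z by (simp add: D_def)
  have D: "D = (of_int h - of_int k * Re z) ^ 2 + (of_int k * y) ^ 2"
    by (simp add: D_def M_def cmod_power2 y_def)
  have "(of_int h - of_int k * Re z) ^ 2 \<le> (1 / real N) ^ 2"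
    using hk(4) by (intro abs_le_square_iff[THEN iffD1]) (simp add: abs_minus_commute)
  also have "\<dots> \<le> s ^ 2"
  proof (rule power_mono)
    have "1 \<le> real N * s" using N(1) s by (simp add: field_simps)
    thus "1 / real N \<le> s" using \<open>N > 0\<close> by (simp add: field_simps)
  qed simp
  finally have 1: "(of_int h - of_int k * Re z) ^ 2 \<le> y" using s by simp
  have "(of_int k * y) ^ 2 \<le> (2 * s) ^ 2"
  proof (rule power_mono)
    have "real_of_int k \<le> real N" using hk(3) by linarith
    also have "\<dots> \<le> 1 / s + 1 / s" using N(2) s by (simp add: field_simps)
    finally have "real_of_int k * s \<le> 2" using s by (simp add: field_simps)
    hence "real_of_int k * s * s \<le> 2 * s" using s by (intro mult_right_mono) auto
    thus "of_int k * y \<le> 2 * s" using s(3) by (simp add: power2_eq_square mult.assoc)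
    show "0 \<le> of_int k * y" using hk(2) y by simp
  qed
  hence "D \<le> 5 * y" using 1 s by (simp add: D power_mult_distrib)
  have "Im (act M z) = y / D"
    unfolding Im_act SL2Z_det[OF M] D_def y_def by simp
  moreover have "1 / 5 \<le> y / D" using \<open>D \<le> 5 * y\<close> Dpos by (simp add: field_simps)
  ultimately show ?thesis by (intro that[of M] M) simp
qed

text \<open>The inverse of the height-raising matrix is split by \<open>SL2Z_coset\<close>; its
  translation part preserves the height and is absorbed into z'.\<close>

lemma uhp_reduction:
  assumes z: "z \<in> uhp"
  obtains N r z' where "N \<in> Gamma2" "r \<in> cusp_reps" "z' \<in> uhp" "Im z' \<ge> 1/5" "z = act N (act r z')"
proof -
  obtain M where M: "M \<in> SL2Z" "Im (act M z) \<ge> 1/5" by (rule SL2Z_orbit_height[OF z])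
  from SL2Z_E[OF M(1)] obtain a b c d :: int
    where M': "M = mat2 (of_int a) (of_int b) (of_int c) (of_int d)" and det: "a * d - b * c = 1" .
  define M1 where "M1 = mat2 (of_int d) (of_int (- b)) (of_int (- c)) (of_int a)"
  have M1: "M1 \<in> SL2Z" unfolding M1_def by (rule SL2Z_I) (use det in \<open>simp add: algebra_simps\<close>)
  have "M1 ** M = mat2 (of_int (a * d - b * c)) 0 0 (of_int (a * d - b * c))"
    by (simp add: M' M1_def mat2_mult algebra_simps)
  hence "act (M1 ** M) z = z" unfolding det by (simp add: act_mat2)
  hence z_eq: "z = act M1 (act M z)"
    using act_mult[of M z M1] z SL2Z_det[OF M(1)] by simp
  obtain N r k where Nrk: "N \<in> Gamma2" "r \<in> cusp_reps" "M1 = N ** r ** T_mat k"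
    by (rule SL2Z_coset[OF M1])
  have Mz: "act M z \<in> uhp" using act_in_uhp[of M z] z SL2Z_det[OF M(1)] by simp
  have r: "r \<in> SL2Z" using Nrk(2) cusp_reps_SL2Z by blast
  define z' where "z' = act (T_mat k) (act M z)"
  have z': "z' \<in> uhp" "Im z' \<ge> 1/5" using Mz M(2) by (simp_all add: z'_def uhp_def)
  have "z = act (N ** r) z'"
    using z_eq act_mult[of "T_mat k" "act M z" "N ** r"] Mz unfolding Nrk(3) z'_def by simp
  also have "\<dots> = act N (act r z')"
    using act_mult[of r z' N] z' SL2Z_det[OF r] by simp
  finally show ?thesis using that Nrk z' by blast
qed

subsection \<open>Moderate growth and local boundedness\<close>

text \<open>Growth refers to no width and survives upper triangular substitutions such as those
  arising between z and 8 z, unlike an expansion in a fixed parameter. The sparse exceptional set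
  makes it a property of classes.\<close>

lift_definition moderate :: "mero_uhp \<Rightarrow> bool"
  is "\<lambda>f. \<exists>Y>0. \<exists>C k. \<forall>\<^sub>\<approx>z\<in>{z. Im z > Y}. norm (f z) \<le> C * exp (k * Im z)"
proof -
  have *: "\<exists>Y>0. \<exists>C k. \<forall>\<^sub>\<approx>z\<in>{z. Im z > Y}. norm (g z) \<le> C * exp (k * Im z)"
    if "mero_rel f g" "\<exists>Y>0. \<exists>C k. \<forall>\<^sub>\<approx>z\<in>{z. Im z > Y}. norm (f z) \<le> C * exp (k * Im z)" for f g
  proof -
    from that(2) obtain Y C k where Y: "Y > 0" "\<forall>\<^sub>\<approx>z\<in>{z. Im z > Y}. norm (f z) \<le> C * exp (k * Im z)" by blast
    have "\<forall>\<^sub>\<approx>z\<in>uhp. f z = g z" using that(1) by (simp add: mero_rel_def)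
    hence "\<forall>\<^sub>\<approx>z\<in>{z. Im z > Y}. f z = g z"
      by (rule eventually_cosparse_subset) (use Y in \<open>auto simp: uhp_def\<close>)
    with Y(2) have "\<forall>\<^sub>\<approx>z\<in>{z. Im z > Y}. norm (g z) \<le> C * exp (k * Im z)"
      by eventually_elim simp
    thus ?thesis using Y(1) by blast
  qed
  fix f g assume "mero_rel f g"
  thus "(\<exists>Y>0. \<exists>C k. \<forall>\<^sub>\<approx>z\<in>{z. Im z > Y}. norm (f z) \<le> C * exp (k * Im z)) =
     (\<exists>Y>0. \<exists>C k. \<forall>\<^sub>\<approx>z\<in>{z. Im z > Y}. norm (g z) \<le> C * exp (k * Im z))"
    using *[of f g] *[OF mero_rel_sym, of f g] by blast
qed

lemma moderate_mero_of:
  assumes "f meromorphic_on uhp"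
  shows "moderate (mero_of f) \<longleftrightarrow> (\<exists>Y>0. \<exists>C\<ge>0. \<exists>k\<ge>0. \<forall>\<^sub>\<approx>z\<in>{z. Im z > Y}. norm (f z) \<le> C * exp (k * Im z))"
proof -
  have "\<exists>C\<ge>0. \<exists>k\<ge>0. \<forall>\<^sub>\<approx>z\<in>{z. Im z > Y}. norm (f z) \<le> C * exp (k * Im z)"
    if "Y > 0" "\<forall>\<^sub>\<approx>z\<in>{z. Im z > Y}. norm (f z) \<le> C * exp (k * Im z)" for Y C k
  proof -
    have "\<forall>\<^sub>\<approx>z\<in>{z. Im z > Y}. z \<in> {z. Im z > Y}"
      by (rule eventually_in_cosparse) (auto simp: open_Im_gt)
    with that(2) have "\<forall>\<^sub>\<approx>z\<in>{z. Im z > Y}. norm (f z) \<le> \<bar>C\<bar> * exp (\<bar>k\<bar> * Im z)"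
    proof eventually_elim
      case (elim z)
      have "C * exp (k * Im z) \<le> \<bar>C\<bar> * exp (\<bar>k\<bar> * Im z)"
        using elim that(1) by (intro mult_mono) (auto intro!: mult_right_mono)
      thus ?case using elim by linarith
    qed
    thus ?thesis by (intro exI[of _ "\<bar>C\<bar>"] exI[of _ "\<bar>k\<bar>"] conjI) auto
  qed
  thus ?thesis using assms by (simp add: moderate.abs_eq mero_rel_refl) blast
qed

lemma moderate_mero_ofI:
  assumes "f meromorphic_on uhp" "Y > 0" "\<And>z. Im z > Y \<Longrightarrow> norm (f z) \<le> C * exp (k * Im z)"
  shows "moderate (mero_of f)"
proof -
  have "\<forall>\<^sub>\<approx>z\<in>{z. Im z > Y}. norm (f z) \<le> C * exp (k * Im z)"
    by (rule eventually_cosparse_openI[OF open_Im_gt]) (use assms in auto)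
  thus ?thesis using assms(1,2) by (simp add: moderate.abs_eq mero_rel_refl) blast
qed

lemma moderate_mero_ofI':
  assumes "f meromorphic_on uhp" "Y > 0" "\<forall>\<^sub>\<approx>z\<in>{z. Im z > Y}. norm (f z) \<le> C * exp (k * Im z)"
  shows "moderate (mero_of f)"
  using assms by (simp add: moderate.abs_eq mero_rel_refl) blast

text \<open>The maximum of sum and product of the norms serves addition and multiplication
  together.\<close>

lemma moderate_binop:
  assumes mero: "\<And>f g. f meromorphic_on uhp \<Longrightarrow> g meromorphic_on uhp \<Longrightarrow>
       (\<lambda>z. opf (f z) (g z)) meromorphic_on uhp \<and> opm (mero_of f) (mero_of g) = mero_of (\<lambda>z. opf (f z) (g z))"
    and bound: "\<And>a b. norm (opf a b :: complex) \<le> max (norm a + norm b) (norm a * norm b)"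
    and F: "moderate F" and G: "moderate G"
  shows "moderate (opm F G)"
proof (cases F; cases G)
  fix f g assume f: "f meromorphic_on uhp" "F = mero_of f" and g: "g meromorphic_on uhp" "G = mero_of g"
  from F obtain Y1 C1 k1 where 1: "Y1 > 0" "C1 \<ge> 0" "k1 \<ge> 0"
    "\<forall>\<^sub>\<approx>z\<in>{z. Im z > Y1}. norm (f z) \<le> C1 * exp (k1 * Im z)"
    unfolding f(2) moderate_mero_of[OF f(1)] by blast
  from G obtain Y2 C2 k2 where 2: "Y2 > 0" "C2 \<ge> 0" "k2 \<ge> 0"
    "\<forall>\<^sub>\<approx>z\<in>{z. Im z > Y2}. norm (g z) \<le> C2 * exp (k2 * Im z)"
    unfolding g(2) moderate_mero_of[OF g(1)] by blast
  define Y where "Y = max Y1 Y2"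
  have "\<forall>\<^sub>\<approx>z\<in>{z. Im z > Y}. norm (f z) \<le> C1 * exp (k1 * Im z)"
    by (rule eventually_cosparse_subset[OF 1(4)]) (auto simp: Y_def)
  moreover have "\<forall>\<^sub>\<approx>z\<in>{z. Im z > Y}. norm (g z) \<le> C2 * exp (k2 * Im z)"
    by (rule eventually_cosparse_subset[OF 2(4)]) (auto simp: Y_def)
  moreover have "\<forall>\<^sub>\<approx>z\<in>{z. Im z > Y}. z \<in> {z. Im z > Y}"
    by (rule eventually_in_cosparse) (auto simp: open_Im_gt)
  ultimately have "\<forall>\<^sub>\<approx>z\<in>{z. Im z > Y}. norm (opf (f z) (g z)) \<le> (C1 + C2 + C1 * C2) * exp ((k1 + k2) * Im z)"
  proof eventually_elim
    case (elim z)
    have Im: "Im z \<ge> 0" using elim 1(1) by (auto simp: Y_def)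
    let ?E = "exp ((k1 + k2) * Im z)"
    have e: "exp (k1 * Im z) \<le> ?E" "exp (k2 * Im z) \<le> ?E" "exp (k1 * Im z) * exp (k2 * Im z) = ?E"
      using Im 1 2 by (auto simp: distrib_right exp_add)
    have "norm (f z) \<le> C1 * ?E" "norm (g z) \<le> C2 * ?E"
      using elim e 1 2 by (meson mult_left_mono order_trans)+
    moreover have "norm (f z) * norm (g z) \<le> (C1 * exp (k1 * Im z)) * (C2 * exp (k2 * Im z))"
      using elim by (intro mult_mono) (auto intro: order_trans[OF norm_ge_zero])
    hence "norm (f z) * norm (g z) \<le> C1 * C2 * ?E" unfolding e(3)[symmetric] by (simp add: mult_ac)
    moreover have "0 \<le> C1 * ?E" "0 \<le> C2 * ?E" "0 \<le> C1 * C2 * ?E" using 1 2 by auto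
    ultimately have "max (norm (f z) + norm (g z)) (norm (f z) * norm (g z)) \<le> C1 * ?E + C2 * ?E + C1 * C2 * ?E"
      by linarith
    with bound[of "f z" "g z"] have "norm (opf (f z) (g z)) \<le> C1 * ?E + C2 * ?E + C1 * C2 * ?E"
      by (rule order_trans)
    thus ?case by (simp only: distrib_right)
  qed
  moreover have "Y > 0" using 1(1) by (simp add: Y_def)
  ultimately show ?thesis
    using mero[OF f(1) g(1)] unfolding f(2) g(2) by (auto simp: moderate.abs_eq mero_rel_refl)
qed

lemma moderate_add: "moderate F \<Longrightarrow> moderate G \<Longrightarrow> moderate (F + G)"
  by (rule moderate_binop[where opf = "(+)"])
     (auto simp: mero_of_add intro: meromorphic_intros norm_triangle_ineq max.coboundedI1)

lemma moderate_mult: "moderate F \<Longrightarrow> moderate G \<Longrightarrow> moderate (F * G)"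
  by (rule moderate_binop[where opf = "(*)"])
     (auto simp: mero_of_mult norm_mult intro: meromorphic_intros)

lemma moderate_const: "moderate (const_mero_uhp c)"
  unfolding mero_of_const by (rule moderate_mero_ofI[where Y = 1 and C = "norm c" and k = 0]) auto

lemma moderate_power: "moderate F \<Longrightarrow> moderate (F ^ n)"
  using moderate_const[of 1] by (induction n) (auto intro: moderate_mult simp: const_mero_uhp_1)

lemma moderate_sum: "(\<And>i. i \<in> I \<Longrightarrow> moderate (F i)) \<Longrightarrow> moderate (\<Sum>i\<in>I. F i)"
  using moderate_const[of 0]
  by (induction I rule: infinite_finite_induct) (auto intro: moderate_add simp: const_mero_uhp_0)

text \<open>Such a matrix only rescales the imaginary part by p / s.\<close>

lemma moderate_pullback_upper:
  assumes p: "p > 0" and s: "s > 0" and F: "moderate F"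
  shows "moderate (pullback (mat2 p r 0 s) F)"
proof (cases F)
  case (1 f)
  let ?M = "mat2 p r 0 s"
  have det: "det ?M > 0" using p s by (simp add: det_mat2)
  from F obtain Y C k where Y: "Y > 0" "\<forall>\<^sub>\<approx>z\<in>{z. Im z > Y}. norm (f z) \<le> C * exp (k * Im z)"
    unfolding 1 moderate_mero_of[OF 1(1)] by blast
  have Im: "Im (act ?M z) = p / s * Im z" for z
    using p s unfolding Im_act by (simp add: det_mat2 power2_eq_square)
  have "\<forall>\<^sub>\<approx>z\<in>{z. Im z > Y * s / p}. norm (f (act ?M z)) \<le> C * exp ((k * p / s) * Im z)"
    unfolding eventually_cosparse_open_eq[OF open_Im_gt]
  proof
    fix z assume "z \<in> {z. Im z > Y * s / p}"
    hence z: "Y * s / p < Im z" by simp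
    hence "Y < p / s * Im z" using p s by (simp add: field_simps)
    hence "act ?M z \<in> {z. Im z > Y}" by (simp add: Im)
    with Y(2) have "eventually (\<lambda>w. norm (f w) \<le> C * exp (k * Im w)) (at (act ?M z))"
      by (intro eventually_cosparse_imp_eventually_at)
    moreover have "filterlim (act ?M) (at (act ?M z)) (at z)"
    proof (rule filterlim_atI)
      have eq: "act ?M = (\<lambda>z. of_real (p / s) * z + of_real (r / s))"
        by (rule ext) (simp add: act_mat2 add_divide_distrib)
      show "act ?M \<midarrow>z\<rightarrow> act ?M z" unfolding eq by (intro tendsto_intros)
      have "eventually (\<lambda>w. w \<noteq> z) (at z)" by (rule eventually_neq_at_within)
      thus "eventually (\<lambda>w. act ?M w \<noteq> act ?M z) (at z)"
        by eventually_elim (use p s in \<open>simp add: act_mat2\<close>)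
    qed
    ultimately have "eventually (\<lambda>w. norm (f (act ?M w)) \<le> C * exp (k * Im (act ?M w))) (at z)"
      by (rule eventually_compose_filterlim)
    thus "eventually (\<lambda>w. norm (f (act ?M w)) \<le> C * exp (k * p / s * Im w)) (at z)"
      by (simp add: Im mult.assoc)
  qed
  note ev = this
  have "Y * s / p > 0" using Y p s by simp
  from this ev show ?thesis
    unfolding 1(2) pullback_mero_of[OF det 1(1)]
    by (rule moderate_mero_ofI'[OF meromorphic_on_act[OF det 1(1)]])
qed

text \<open>Apart from its leading power the Laurent series is bounded near 0, and that power of |q|
  is an exponential of Im z.\<close>

lemma has_q_expansion_imp_moderate:
  assumes h: "h > 0" and L: "has_q_expansion h F L"
  shows "moderate F"
proof (cases F)
  case (1 f)
  from L obtain g Y where g: "g has_laurent_expansion L" "Y > 0"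
    "\<forall>\<^sub>\<approx>z\<in>{z. Im z > Y}. f z = g (exp (2 * pi * \<i> * z / of_nat h))"
    unfolding 1 has_q_expansion_mero_of[OF h 1(1)] by blast
  let ?s = "fls_subdegree L"
  let ?B = "fls_base_factor_to_fps L"
  have "fls_conv_radius L > 0" and ev: "eventually (\<lambda>w. eval_fls L w = g w) (at 0)"
    using g(1) by (auto simp: has_laurent_expansion_def)
  define B where "B = norm (eval_fps ?B 0) + 1"
  have "isCont (eval_fps ?B) 0"
    using \<open>fls_conv_radius L > 0\<close> by (intro continuous_eval_fps) (simp add: zero_ereal_def fps_conv_radius_fls_regpart)
  hence "(eval_fps ?B \<longlongrightarrow> eval_fps ?B 0) (at 0)" by (simp add: isCont_def)
  hence "eventually (\<lambda>w. norm (eval_fps ?B w) < B) (at 0)"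
    by (intro order_tendstoD(2)[OF tendsto_norm]) (auto simp: B_def)
  with ev have "eventually (\<lambda>w. norm (g w) \<le> B * norm w powi ?s) (at 0)"
  proof eventually_elim
    case (elim w)
    have "norm (g w) = norm (eval_fps ?B w) * norm w powi ?s"
      unfolding elim(1)[symmetric] eval_fls_def by (simp add: norm_mult norm_power_int)
    also have "\<dots> \<le> B * norm w powi ?s" using elim(2) by (intro mult_right_mono) auto
    finally show ?case .
  qed
  from eventually_nome[OF h this] obtain Y' where Y': "Y' > 0"
    "\<And>z. Im z > Y' \<Longrightarrow> norm (g (exp (2 * pi * \<i> * z / of_nat h))) \<le>
        B * norm (exp (2 * pi * \<i> * z / of_nat h)) powi ?s" by blast
  have "\<forall>\<^sub>\<approx>z\<in>{z. Im z > max Y Y'}. f z = g (exp (2 * pi * \<i> * z / of_nat h))"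
    by (rule eventually_cosparse_subset[OF g(3)]) auto
  moreover have "\<forall>\<^sub>\<approx>z\<in>{z. Im z > max Y Y'}. z \<in> {z. Im z > max Y Y'}"
    by (rule eventually_in_cosparse) (auto simp: open_Im_gt simp del: max_less_iff_conj)
  ultimately have "\<forall>\<^sub>\<approx>z\<in>{z. Im z > max Y Y'}. norm (f z) \<le> B * exp (- (2 * pi * of_int ?s / h) * Im z)"
  proof eventually_elim
    case (elim z)
    have "norm (exp (2 * pi * \<i> * z / of_nat h)) powi ?s = exp (- (2 * pi * of_int ?s / h) * Im z)"
      unfolding norm_nome by (simp add: exp_power_int mult_ac)
    thus ?case using Y'(2)[of z] elim by simp
  qed
  note ev = this
  have "max Y Y' > 0" using g(2) by simp
  from this ev show ?thesis unfolding 1(2) by (rule moderate_mero_ofI'[OF 1(1)])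
qed

section \<open>Absence of poles at points of the upper half plane\<close>

lift_definition bounded_near :: "complex \<Rightarrow> mero_uhp \<Rightarrow> bool"
  is "\<lambda>z f. z \<in> uhp \<and> (\<exists>B. eventually (\<lambda>w. norm (f w) \<le> B) (at z))"
proof -
  have *: "\<exists>B. eventually (\<lambda>w. norm (g w) \<le> B) (at z)"
    if "mero_rel f g" "z \<in> uhp" "\<exists>B. eventually (\<lambda>w. norm (f w) \<le> B) (at z)" for f g z
  proof -
    have "eventually (\<lambda>w. f w = g w) (at z)"
      using that(1,2) by (auto simp: mero_rel_def intro: eventually_cosparse_imp_eventually_at)
    moreover from that(3) obtain B where "eventually (\<lambda>w. norm (f w) \<le> B) (at z)" by blast
    ultimately have "eventually (\<lambda>w. norm (g w) \<le> B) (at z)" by eventually_elim simp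
    thus ?thesis by blast
  qed
  fix z :: complex and f g assume "mero_rel f g"
  thus "(z \<in> uhp \<and> (\<exists>B. eventually (\<lambda>w. norm (f w) \<le> B) (at z))) =
        (z \<in> uhp \<and> (\<exists>B. eventually (\<lambda>w. norm (g w) \<le> B) (at z)))"
    using *[of f g] *[OF mero_rel_sym, of f g] by blast
qed

lemma bounded_near_mero_of:
  "f meromorphic_on uhp \<Longrightarrow> bounded_near z (mero_of f) \<longleftrightarrow> z \<in> uhp \<and> (\<exists>B. eventually (\<lambda>w. norm (f w) \<le> B) (at z))"
  by (simp add: bounded_near.abs_eq mero_rel_refl)

lemma bounded_near_holomorphic:
  assumes "f holomorphic_on uhp" "z \<in> uhp"
  shows "bounded_near z (mero_of f)"
proof -
  have "isCont f z"
    using assms open_uhp continuous_on_eq_continuous_at holomorphic_on_imp_continuous_on by blast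
  hence "eventually (\<lambda>w. norm (f w) < norm (f z) + 1) (at z)"
    by (intro order_tendstoD(2)[OF tendsto_norm]) (auto simp: isCont_def)
  hence "eventually (\<lambda>w. norm (f w) \<le> norm (f z) + 1) (at z)" by eventually_elim simp
  thus ?thesis
    using bounded_near_mero_of[OF holomorphic_uhp_imp_meromorphic[OF assms(1)]] assms(2) by blast
qed

lemma bounded_near_mult:
  assumes "bounded_near z F" "bounded_near z G"
  shows "bounded_near z (F * G)"
proof (cases F; cases G)
  fix f g assume f: "f meromorphic_on uhp" "F = mero_of f" and g: "g meromorphic_on uhp" "G = mero_of g"
  from assms obtain B C where "z \<in> uhp" "eventually (\<lambda>w. norm (f w) \<le> B) (at z)" "eventually (\<lambda>w. norm (g w) \<le> C) (at z)"
    unfolding f(2) g(2) bounded_near_mero_of[OF f(1)] bounded_near_mero_of[OF g(1)] by blast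
  from this(2,3) have "eventually (\<lambda>w. norm (f w * g w) \<le> B * C) (at z)"
  proof eventually_elim
    case (elim w)
    thus ?case unfolding norm_mult by (intro mult_mono) (auto intro: order_trans[OF norm_ge_zero])
  qed
  thus ?thesis unfolding f(2) g(2) mero_of_mult[OF f(1) g(1)]
    using \<open>z \<in> uhp\<close> by (subst bounded_near_mero_of) (auto intro!: meromorphic_intros f g)
qed

lemma SL2Z_inverse:
  assumes "M \<in> SL2Z"
  obtains M' where "M' \<in> SL2Z" "M ** M' = mat 1" "M' ** M = mat 1"
proof -
  from SL2Z_E[OF assms] obtain a b c d :: int
    where M: "M = mat2 (of_int a) (of_int b) (of_int c) (of_int d)" and det: "a * d - b * c = 1" .
  define M' where "M' = mat2 (of_int d) (of_int (- b)) (of_int (- c)) (of_int a)"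
  have det': "real_of_int a * of_int d - of_int b * of_int c = 1"
    using arg_cong[OF det, of real_of_int] by simp
  have one: "mat 1 = mat2 1 0 0 1" by (rule mat2_eqI) (simp_all add: mat_def)
  show ?thesis
  proof (rule that)
    show "M' \<in> SL2Z" unfolding M'_def by (rule SL2Z_I) (use det in \<open>simp add: algebra_simps\<close>)
    show "M ** M' = mat 1" "M' ** M = mat 1"
      using det' by (simp_all add: M M'_def mat2_mult one algebra_simps)
  qed
qed

text \<open>Injectivity of the action carries punctured neighbourhoods into punctured
  neighbourhoods, so the limit filters match.\<close>

lemma bounded_near_pullbackI:
  assumes det: "det M > 0" and z: "z \<in> uhp" and F: "bounded_near (act M z) F"
  shows "bounded_near z (pullback M F)"
proof (cases F)
  case (1 f)
  from F obtain B where "eventually (\<lambda>w. norm (f w) \<le> B) (at (act M z))"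
    unfolding 1 bounded_near_mero_of[OF 1(1)] by blast
  moreover have "filterlim (act M) (at (act M z)) (at z)"
  proof (rule filterlim_atI)
    show "act M \<midarrow>z\<rightarrow> act M z"
      using act_analytic[OF det] z
      by (meson analytic_at_imp_isCont analytic_on_analytic_at isCont_def)
    have "eventually (\<lambda>w. w \<in> uhp - {z}) (at z)"
      using z open_uhp by (intro eventually_at_in_open) auto
    thus "eventually (\<lambda>w. act M w \<noteq> act M z) (at z)"
      by eventually_elim (use act_inj[OF det _ z] in blast)
  qed
  ultimately have "eventually (\<lambda>w. norm (f (act M w)) \<le> B) (at z)"
    by (rule eventually_compose_filterlim)
  thus ?thesis
    unfolding 1 pullback_mero_of[OF det 1(1)] bounded_near_mero_of[OF meromorphic_on_act[OF det 1(1)]]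
    using z by blast
qed

lemma bounded_near_pullback_iff:
  assumes M: "M \<in> SL2Z" and z: "z \<in> uhp"
  shows "bounded_near z (pullback M F) \<longleftrightarrow> bounded_near (act M z) F"
proof
  obtain M' where M': "M' \<in> SL2Z" "M ** M' = mat 1" "M' ** M = mat 1" by (rule SL2Z_inverse[OF M])
  have det: "det M > 0" "det M' > 0" using SL2Z_det M M'(1) by simp_all
  assume "bounded_near z (pullback M F)"
  moreover have "act M' (act M z) = z"
    using act_mult[OF det(1) z, of M'] M'(3) by simp
  ultimately have "bounded_near (act M' (act M z)) (pullback M F)" by simp
  from bounded_near_pullbackI[OF det(2) act_in_uhp[OF det(1) z] this]
  have "bounded_near (act M z) (pullback M' (pullback M F))" .
  thus "bounded_near (act M z) F"
    by (simp add: pullback_pullback[OF det] M'(2))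
qed (use bounded_near_pullbackI[of M z F] SL2Z_det[OF M] z in auto)

text \<open>Riemann's theorem at each point: a bounded meromorphic germ is not a pole, so filling in
  all limits by \<open>remove_sings\<close> gives a holomorphic representative.\<close>

lemma bounded_near_imp_holomorphic:
  assumes "\<And>z. z \<in> uhp \<Longrightarrow> bounded_near z F"
  obtains g where "g holomorphic_on uhp" "F = mero_of g"
proof (cases F)
  case (1 f)
  have "remove_sings f analytic_on {z}" if z: "z \<in> uhp" for z
  proof -
    obtain B where B: "eventually (\<lambda>w. norm (f w) \<le> B) (at z)"
      using assms[OF z] unfolding 1 bounded_near_mero_of[OF 1(1)] by blast
    have mero: "f meromorphic_on {z}" using 1(1) z by (auto intro: meromorphic_on_subset)
    have "\<not> is_pole f z"
    proof
      assume "is_pole f z"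
      hence "filterlim (\<lambda>w. norm (f w)) at_top (at z)"
        by (simp add: is_pole_def filterlim_at_infinity_conv_norm_at_top)
      hence "eventually (\<lambda>w. norm (f w) \<ge> B + 1) (at z)"
        unfolding filterlim_at_top by blast
      with B have "eventually (\<lambda>w. False) (at z)" by eventually_elim linarith
      thus False by simp
    qed
    moreover have "not_essential f z" "isolated_singularity_at f z"
      using mero by (auto simp: meromorphic_at_iff)
    ultimately obtain c where "f \<midarrow>z\<rightarrow> c" by (auto simp: not_essential_def)
    thus ?thesis using remove_sings_analytic_at \<open>isolated_singularity_at f z\<close> by blast
  qed
  hence "remove_sings f analytic_on uhp" using analytic_on_analytic_at by blast
  hence holo: "remove_sings f holomorphic_on uhp" by (simp add: analytic_on_open open_uhp)
  moreover have "F = mero_of (remove_sings f)"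
    unfolding 1(2)
    by (subst mero_of_eq_iff)
       (use 1(1) holomorphic_uhp_imp_meromorphic[OF holo] eventually_remove_sings_eq[OF 1(1)]
         in \<open>auto elim: eventually_mono\<close>)
  ultimately show ?thesis by (rule that)
qed

text \<open>Moderate growth confines the poles below some height; with translations this leaves a
  compact region in which poles have to be cleared.\<close>

lemma moderate_imp_bounded_near:
  assumes "moderate F"
  obtains Y where "Y > 0" "\<And>z. Im z > Y \<Longrightarrow> bounded_near z F"
proof (cases F)
  case (1 f)
  from assms obtain Y C k where Y: "Y > 0" "C \<ge> 0" "k \<ge> 0" "\<forall>\<^sub>\<approx>z\<in>{z. Im z > Y}. norm (f z) \<le> C * exp (k * Im z)"
    unfolding 1 moderate_mero_of[OF 1(1)] by blast
  show ?thesis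
  proof (rule that[OF Y(1)])
    fix z assume z: "Im z > Y"
    hence "eventually (\<lambda>w. norm (f w) \<le> C * exp (k * Im w)) (at z)"
      using eventually_cosparse_imp_eventually_at[OF Y(4)] by simp
    moreover have "eventually (\<lambda>w. Im w < Im z + 1) (at z)"
      by (rule order_tendstoD(2)[of Im "Im z"]) (auto intro!: tendsto_eq_intros)
    ultimately have "eventually (\<lambda>w. norm (f w) \<le> C * exp (k * (Im z + 1))) (at z)"
    proof eventually_elim
      case (elim w)
      have "C * exp (k * Im w) \<le> C * exp (k * (Im z + 1))"
        using elim Y by (intro mult_left_mono) (auto intro!: mult_left_mono)
      thus ?case using elim by linarith
    qed
    thus "bounded_near z F"
      unfolding 1 bounded_near_mero_of[OF 1(1)] using z Y(1) by (auto simp: uhp_def)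
  qed
qed

lemma moderate_holomorphicE:
  assumes "moderate (mero_of f)" "f holomorphic_on uhp"
  obtains Y C k where "Y > 0" "C \<ge> 0" "k \<ge> 0" "\<And>z. Im z > Y \<Longrightarrow> norm (f z) \<le> C * exp (k * Im z)"
proof -
  note mero = holomorphic_uhp_imp_meromorphic[OF assms(2)]
  from assms(1) obtain Y C k where Y: "Y > 0" "C \<ge> 0" "k \<ge> 0" "\<forall>\<^sub>\<approx>z\<in>{z. Im z > Y}. norm (f z) \<le> C * exp (k * Im z)"
    unfolding moderate_mero_of[OF mero] by blast
  have "norm (f z) \<le> C * exp (k * Im z)" if z: "Im z > Y" for z
  proof (rule tendsto_le[of "at z"])
    have "z \<in> uhp" using z Y(1) by (simp add: uhp_def)
    hence "isCont f z"
      using assms(2) open_uhp continuous_on_eq_continuous_at holomorphic_on_imp_continuous_on by blast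
    thus "((\<lambda>w. norm (f w)) \<longlongrightarrow> norm (f z)) (at z)" by (intro tendsto_norm) (simp add: isCont_def)
    show "((\<lambda>w. C * exp (k * Im w)) \<longlongrightarrow> C * exp (k * Im z)) (at z)" by (intro tendsto_intros)
    show "eventually (\<lambda>w. norm (f w) \<le> C * exp (k * Im w)) (at z)"
      using eventually_cosparse_imp_eventually_at[OF Y(4)] z by simp
  qed simp
  thus ?thesis using that Y(1-3) by blast
qed

subsection \<open>Periodic functions\<close>

lemma periodic_multiple:
  assumes "\<And>z. z \<in> uhp \<Longrightarrow> f (z + of_nat h) = f z" "z \<in> uhp"
  shows "f (z + of_int n * of_nat h) = f z"
proof (induction n rule: int_induct[where k = 0])
  case (step1 n)
  have eq: "z + of_int (n + 1) * of_nat h = (z + of_int n * of_nat h) + of_nat h"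
    by (simp add: algebra_simps)
  have u: "z + of_int n * of_nat h \<in> uhp" using assms(2) by (simp add: uhp_def)
  show ?case unfolding eq assms(1)[OF u] by (rule step1(2))
next
  case (step2 n)
  have "z + of_int n * of_nat h = (z + of_int (n - 1) * of_nat h) + of_nat h"
    by (simp add: algebra_simps)
  moreover have "z + of_int (n - 1) * of_nat h \<in> uhp" using assms(2) by (simp add: uhp_def)
  ultimately show ?case using assms(1) step2 by metis
qed simp

lemma log_nome_uhp:
  assumes h: "h > 0" and "exp l = w" "w \<in> ball 0 1 - {0}"
  defines "z \<equiv> of_nat h / (2 * pi * \<i>) * l"
  shows "z \<in> uhp" "exp (2 * pi * \<i> * z / of_nat h) = w" "Im z = - (h / (2 * pi)) * ln (norm w)"
proof -
  have nw: "norm w = exp (Re l)" using assms(2) by auto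
  have "z = of_real (h / (2 * pi)) * (- \<i> * l)"
    unfolding z_def by (simp add: field_simps)
  hence Im: "Im z = - (h / (2 * pi)) * Re l" by simp
  show "Im z = - (h / (2 * pi)) * ln (norm w)" unfolding Im nw by simp
  have "exp (Re l) < exp 0" using assms(3) nw by simp
  hence "Re l < 0" by (simp only: exp_less_cancel_iff)
  hence "h / (2 * pi) * (- Re l) > 0" using h by (intro mult_pos_pos) auto
  thus "z \<in> uhp" by (simp add: uhp_def Im)
  have "2 * pi * \<i> * z / of_nat h = l" unfolding z_def using h by simp
  thus "exp (2 * pi * \<i> * z / of_nat h) = w" using assms(2) by simp
qed

text \<open>Periodicity makes the value independent of the logarithm chosen, so two slit discs with
  different branches together give holomorphy on the punctured disc.\<close>

lemma periodic_factor:
  assumes h: "h > 0" and holo: "f holomorphic_on uhp"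
    and per: "\<And>z. z \<in> uhp \<Longrightarrow> f (z + of_nat h) = f z"
  obtains G where "G holomorphic_on ball 0 1 - {0}"
    "\<And>z. z \<in> uhp \<Longrightarrow> f z = G (exp (2 * pi * \<i> * z / of_nat h))"
proof
  define G where "G = (\<lambda>w. f (of_nat h / (2 * pi * \<i>) * Ln w))"
  have G: "f z = G (exp (2 * pi * \<i> * z / of_nat h))" if z: "z \<in> uhp" for z
  proof -
    let ?w = "exp (2 * pi * \<i> * z / of_nat h)"
    have "exp (Ln ?w) = exp (2 * pi * \<i> * z / of_nat h)" by simp
    then obtain n :: int where n: "Ln ?w = 2 * pi * \<i> * z / of_nat h + (of_int (2 * n) * pi) * \<i>"
      unfolding exp_eq by blast
    have "of_nat h / (2 * pi * \<i>) * Ln ?w = z + of_int n * of_nat h"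
      unfolding n using h by (simp add: field_simps)
    hence "G ?w = f (z + of_int n * of_nat h)" unfolding G_def by (rule arg_cong)
    also have "\<dots> = f z" by (rule periodic_multiple[of f h z, OF per z])
    finally show ?thesis ..
  qed
  \<comment> \<open>\<open>G\<close> agrees with f composed with any holomorphic logarithm on S,
    although it is defined by the principal one.\<close>
  have local: "G holomorphic_on S"
    if S: "S \<subseteq> ball 0 1 - {0}" and l: "l holomorphic_on S" "\<And>w. w \<in> S \<Longrightarrow> exp (l w) = w" for S l
  proof -
    have uhp: "of_nat h / (2 * pi * \<i>) * l w \<in> uhp"
      and e: "exp (2 * pi * \<i> * (of_nat h / (2 * pi * \<i>) * l w) / of_nat h) = w" if "w \<in> S" for w
      using log_nome_uhp[OF h l(2)[OF that]] that S by blast+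
    have "(f \<circ> (\<lambda>w. of_nat h / (2 * pi * \<i>) * l w)) holomorphic_on S"
      by (rule holomorphic_on_compose_gen[OF _ holo]) (use uhp l(1) in \<open>auto intro!: holomorphic_intros\<close>)
    thus ?thesis
      by (rule holomorphic_transform) (simp only: o_def G[OF uhp] e)
  qed
  have 1: "G holomorphic_on (ball 0 1 - \<real>\<^sub>\<le>\<^sub>0)"
  proof (rule local[of _ Ln])
    fix w :: complex assume "w \<in> ball 0 1 - \<real>\<^sub>\<le>\<^sub>0"
    hence "w \<noteq> 0" by auto
    thus "exp (Ln w) = w" by simp
  qed (auto intro!: holomorphic_intros)
  \<comment> \<open>The slit is turned to the positive axis; the branch Ln (-w) + i pi covers the
    points missed by the principal one.\<close>
  have 2: "G holomorphic_on (ball 0 1 \<inter> {w. - w \<notin> \<real>\<^sub>\<le>\<^sub>0})"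
  proof (rule local[of _ "\<lambda>w. Ln (- w) + \<i> * pi"])
    show "(\<lambda>w. Ln (- w) + \<i> * pi) holomorphic_on (ball 0 1 \<inter> {w. - w \<notin> \<real>\<^sub>\<le>\<^sub>0})"
      by (auto intro!: holomorphic_intros)
    fix w assume "w \<in> ball 0 1 \<inter> {w. - w \<notin> (\<real>\<^sub>\<le>\<^sub>0 :: complex set)}"
    hence "w \<noteq> 0" by auto
    thus "exp (Ln (- w) + \<i> * pi) = w" by (simp add: exp_add mult.commute)
  qed auto
  have "{w. - w \<notin> (\<real>\<^sub>\<le>\<^sub>0 :: complex set)} = uminus -` (- \<real>\<^sub>\<le>\<^sub>0)" by auto
  hence "open {w. - w \<notin> (\<real>\<^sub>\<le>\<^sub>0 :: complex set)}"
    using continuous_open_vimage[of "- (\<real>\<^sub>\<le>\<^sub>0 :: complex set)" uminus] closed_nonpos_Reals_complex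
    by (simp add: open_Compl)
  hence "G holomorphic_on (ball 0 1 - \<real>\<^sub>\<le>\<^sub>0) \<union> (ball 0 1 \<inter> {w. - w \<notin> \<real>\<^sub>\<le>\<^sub>0})"
    by (intro holomorphic_on_Un 1 2 open_Diff open_Int closed_nonpos_Reals_complex) auto
  moreover have "(ball 0 1 - \<real>\<^sub>\<le>\<^sub>0) \<union> (ball 0 1 \<inter> {w. - w \<notin> \<real>\<^sub>\<le>\<^sub>0}) = ball 0 1 - {0 :: complex}"
    by (auto simp: complex_nonpos_Reals_iff complex_eq_iff)
  ultimately show "G holomorphic_on ball 0 1 - {0}" by simp
  show "\<And>z. z \<in> uhp \<Longrightarrow> f z = G (exp (2 * pi * \<i> * z / of_nat h))" by (rule G)
qed

text \<open>A bound high up is a bound near 0 in the local parameter, so the puncture is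
  removable.\<close>

lemma periodic_bounded_factor:
  assumes h: "h > 0" and holo: "f holomorphic_on uhp"
    and per: "\<And>z. z \<in> uhp \<Longrightarrow> f (z + of_nat h) = f z"
    and bound: "\<And>z. Im z > Y \<Longrightarrow> norm (f z) \<le> B"
  obtains G where "G holomorphic_on ball 0 1"
    "\<And>z. z \<in> uhp \<Longrightarrow> f z = G (exp (2 * pi * \<i> * z / of_nat h))"
proof -
  obtain G where G: "G holomorphic_on ball 0 1 - {0}"
    "\<And>z. z \<in> uhp \<Longrightarrow> f z = G (exp (2 * pi * \<i> * z / of_nat h))"
    using periodic_factor[OF h holo per] by blast
  have "\<exists>B. eventually (\<lambda>w. norm (G w) \<le> B) (at 0)"
  proof
    have "eventually (\<lambda>w. w \<in> ball 0 (min 1 (exp (- (2 * pi / h * Y)))) - {0}) (at (0 :: complex))"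
      by (intro eventually_at_in_open) auto
    thus "eventually (\<lambda>w. norm (G w) \<le> B) (at 0)"
    proof eventually_elim
      case (elim w)
      hence w: "w \<in> ball 0 1 - {0}" "norm w < exp (- (2 * pi / h * Y))" by auto
      define z where "z = of_nat h / (2 * pi * \<i>) * Ln w"
      have "exp (Ln w) = w" using w by simp
      note z = log_nome_uhp[OF h this w(1), folded z_def]
      have "ln (norm w) < ln (exp (- (2 * pi / h * Y)))" using w by (subst ln_less_cancel_iff) auto
      hence "ln (norm w) < - (2 * pi / h * Y)" by simp
      hence "h / (2 * pi) * (2 * pi / h * Y) < h / (2 * pi) * (- ln (norm w))"
        using h by (intro mult_strict_left_mono) auto
      hence "Y < Im z" using h by (simp add: z(3))
      hence "norm (f z) \<le> B" by (rule bound)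
      thus ?case using G(2)[OF z(1)] z(2) by simp
    qed
  qed
  moreover have "(0 :: complex) \<in> interior (ball 0 1)" by simp
  ultimately obtain G' where G': "G' holomorphic_on ball 0 1" "\<And>w. w \<in> ball 0 1 - {0} \<Longrightarrow> G' w = G w"
    using holomorphic_on_extend_bounded[OF G(1)] by blast
  have "f z = G' (exp (2 * pi * \<i> * z / of_nat h))" if z: "z \<in> uhp" for z
  proof -
    have "norm (exp (2 * pi * \<i> * z / of_nat h)) < 1"
      unfolding norm_nome using z h by (simp add: uhp_def)
    thus ?thesis using G'(2)[of "exp (2 * pi * \<i> * z / of_nat h)"] G(2)[OF z] by simp
  qed
  with G'(1) show ?thesis by (rule that)
qed

lemma exp_nome_periodic:
  assumes "h > 0"
  shows "exp (2 * pi * \<i> * (z + of_nat h) / of_nat h) = exp (2 * pi * \<i> * z / of_nat h)"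
proof -
  have "2 * pi * \<i> * (z + of_nat h) / of_nat h = 2 * pi * \<i> * z / of_nat h + 2 * pi * \<i>"
    using assms by (simp add: field_simps)
  thus ?thesis by (simp add: exp_add)
qed

text \<open>Multiplying by q^n with n >= k h / (2 pi) cancels growth exp (k Im z) and reduces to the
  bounded case.\<close>

lemma periodic_moderate_factor:
  assumes h: "h > 0" and holo: "f holomorphic_on uhp"
    and per: "\<And>z. z \<in> uhp \<Longrightarrow> f (z + of_nat h) = f z"
    and mod: "moderate (mero_of f)"
  obtains G n where "G holomorphic_on ball 0 1"
    "\<And>z. z \<in> uhp \<Longrightarrow> f z * exp (2 * pi * \<i> * z / of_nat h) ^ n = G (exp (2 * pi * \<i> * z / of_nat h))"
proof -
  obtain Y C k where Y: "Y > 0" "C \<ge> 0" "k \<ge> 0" "\<And>z. Im z > Y \<Longrightarrow> norm (f z) \<le> C * exp (k * Im z)"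
    using moderate_holomorphicE[OF mod holo] by blast
  define n where "n = nat \<lceil>k * h / (2 * pi)\<rceil>"
  have "k * h / (2 * pi) \<le> n" by (simp add: n_def) linarith
  hence n: "k \<le> n * (2 * pi / h)" using h by (simp add: field_simps)
  define g where "g = (\<lambda>z. f z * exp (2 * pi * \<i> * z / of_nat h) ^ n)"
  have "g holomorphic_on uhp" unfolding g_def using h by (intro holomorphic_intros holo) auto
  moreover have "g (z + of_nat h) = g z" if "z \<in> uhp" for z
    unfolding g_def exp_nome_periodic[OF h] per[OF that] ..
  moreover have "norm (g z) \<le> C" if z: "Im z > Y" for z
  proof -
    have "norm (g z) = norm (f z) * exp (- (2 * pi / h * Im z)) ^ n"
      unfolding g_def norm_mult norm_power norm_nome ..
    also have "\<dots> = norm (f z) * exp (- (n * (2 * pi / h) * Im z))"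
      by (simp flip: exp_of_nat_mult)
    also have "\<dots> \<le> C * exp (k * Im z) * exp (- (n * (2 * pi / h) * Im z))"
      by (intro mult_right_mono Y(4) z) auto
    also have "\<dots> = C * exp ((k - n * (2 * pi / h)) * Im z)"
      by (simp add: left_diff_distrib flip: exp_add)
    also have "\<dots> \<le> C * 1"
    proof (intro mult_left_mono Y(2))
      have "(k - n * (2 * pi / h)) * Im z \<le> 0" using n z Y(1) by (intro mult_nonpos_nonneg) auto
      thus "exp ((k - n * (2 * pi / h)) * Im z) \<le> 1" by simp
    qed
    finally show ?thesis by simp
  qed
  ultimately obtain G where "G holomorphic_on ball 0 1"
    "\<And>z. z \<in> uhp \<Longrightarrow> g z = G (exp (2 * pi * \<i> * z / of_nat h))"
    using periodic_bounded_factor[OF h, of g Y C] by blast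
  thus ?thesis using that unfolding g_def by blast
qed

lemma periodic_moderate_has_q_expansion:
  assumes h: "h > 0" and holo: "f holomorphic_on uhp"
    and per: "\<And>z. z \<in> uhp \<Longrightarrow> f (z + of_nat h) = f z"
    and mod: "moderate (mero_of f)"
  shows "\<exists>L. has_q_expansion h (mero_of f) L"
proof -
  obtain G n where G: "G holomorphic_on ball 0 1"
    "\<And>z. z \<in> uhp \<Longrightarrow> f z * exp (2 * pi * \<i> * z / of_nat h) ^ n = G (exp (2 * pi * \<i> * z / of_nat h))"
    using periodic_moderate_factor[OF assms] by blast
  have "G analytic_on {0}" using G(1) analytic_at[of G 0] by (metis centre_in_ball open_ball zero_less_one)
  hence "G has_laurent_expansion fps_to_fls (fps_expansion G 0)"
    by (intro has_laurent_expansion_fps analytic_at_imp_has_fps_expansion_0)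
  hence lau: "(\<lambda>w. G w / w ^ n) has_laurent_expansion fps_to_fls (fps_expansion G 0) / fls_X ^ n"
    by (intro laurent_expansion_intros)
  have "\<forall>\<^sub>\<approx>z\<in>{z. Im z > 1}. f z = (\<lambda>w. G w / w ^ n) (exp (2 * pi * \<i> * z / of_nat h))"
  proof (rule eventually_cosparse_openI[OF open_Im_gt])
    fix z :: complex assume "z \<in> {z. Im z > 1}"
    hence "z \<in> uhp" by (simp add: uhp_def)
    thus "f z = (\<lambda>w. G w / w ^ n) (exp (2 * pi * \<i> * z / of_nat h))"
      using G(2)[of z] by (simp add: eq_divide_eq)
  qed
  thus ?thesis
    unfolding has_q_expansion_mero_of[OF h holomorphic_uhp_imp_meromorphic[OF holo]]
    using lau zero_less_one by blast
qed

subsection \<open>Functions invariant under the principal congruence subgroup of level 2\<close>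

lemma nome_eq: "exp (2 * pi * \<i> * z / of_nat 2) = nome z"
  by (simp add: nome_def mult.assoc)

lemma norm_nome_eq: "norm (nome z) = exp (- (pi * Im z))"
  by (simp add: nome_def)

lemma act_holomorphic: "det M > 0 \<Longrightarrow> act M holomorphic_on uhp"
  using act_analytic analytic_imp_holomorphic by blast

lemma holomorphic_act:
  assumes "det M > 0" "g holomorphic_on uhp"
  shows "(\<lambda>z. g (act M z)) holomorphic_on uhp"
proof -
  have "(g \<circ> act M) holomorphic_on uhp"
    by (rule holomorphic_on_compose_gen[OF act_holomorphic[OF assms(1)] assms(2)])
       (use act_in_uhp[OF assms(1)] in auto)
  thus ?thesis by (simp add: o_def)
qed

lemma SL2Z_act_uhp: "M \<in> SL2Z \<Longrightarrow> z \<in> uhp \<Longrightarrow> act M z \<in> uhp"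
  using act_in_uhp[of M z] SL2Z_det[of M] by simp

lemma SL2Z_act_mult: "N \<in> SL2Z \<Longrightarrow> z \<in> uhp \<Longrightarrow> act (M ** N) z = act M (act N z)"
  using act_mult[of N z M] SL2Z_det[of N] by simp

lemma SL2Z_act_surj:
  assumes "M \<in> SL2Z" "z \<in> uhp"
  obtains z' where "z' \<in> uhp" "act M z' = z"
proof -
  obtain M' where M': "M' \<in> SL2Z" "M ** M' = mat 1" "M' ** M = mat 1" by (rule SL2Z_inverse[OF assms(1)])
  show ?thesis
    by (rule that[of "act M' z"])
       (use SL2Z_act_uhp[OF M'(1) assms(2)] SL2Z_act_mult[OF M'(1) assms(2), of M] M'(2) in auto)
qed

text \<open>All three cusps have width 2; the witnesses are the conjugates of translation by 2 by
  the representatives.\<close>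

lemma cusp_reps_translate:
  assumes "r \<in> cusp_reps"
  obtains N where "N \<in> Gamma2" "N ** r = r ** T_mat 2"
proof -
  have "gamma2_mat 1 1 0 1 \<in> Gamma2" "gamma2_mat 1 0 (-1) 1 \<in> Gamma2" "gamma2_mat (-1) 1 (-1) 3 \<in> Gamma2"
    unfolding Gamma2_def by force+
  moreover have "gamma2_mat 1 1 0 1 ** mat2 1 0 0 1 = mat2 1 0 0 1 ** T_mat 2"
    "gamma2_mat 1 0 (-1) 1 ** mat2 0 (-1) 1 0 = mat2 0 (-1) 1 0 ** T_mat 2"
    "gamma2_mat (-1) 1 (-1) 3 ** mat2 1 (-1) 1 0 = mat2 1 (-1) 1 0 ** T_mat 2"
    by (simp_all add: gamma2_mat_def T_mat_def mat2_mult)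
  ultimately show ?thesis using assms that unfolding cusp_reps_def by auto
qed

lemma gamma2_invariant_periodic:
  assumes inv: "\<And>N z. N \<in> Gamma2 \<Longrightarrow> z \<in> uhp \<Longrightarrow> g (act N z) = g z"
    and r: "r \<in> cusp_reps" and z: "z \<in> uhp"
  shows "g (act r (z + 2)) = g (act r z)"
proof -
  obtain N where N: "N \<in> Gamma2" "N ** r = r ** T_mat 2" by (rule cusp_reps_translate[OF r])
  have rS: "r \<in> SL2Z" using r cusp_reps_SL2Z by blast
  have "act r (z + 2) = act (r ** T_mat 2) z"
    using SL2Z_act_mult[OF T_mat_SL2Z z, of r 2] by simp
  also have "\<dots> = act N (act r z)"
    unfolding N(2)[symmetric] by (rule SL2Z_act_mult[OF rS z])
  finally show ?thesis using inv[OF N(1) SL2Z_act_uhp[OF rS z]] by simp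
qed

text \<open>The maximum modulus principle on the compactified quotient.\<close>

lemma gamma2_bounded_constant:
  assumes holo: "g holomorphic_on uhp"
    and inv: "\<And>N z. N \<in> Gamma2 \<Longrightarrow> z \<in> uhp \<Longrightarrow> g (act N z) = g z"
    and bound: "\<And>r. r \<in> cusp_reps \<Longrightarrow> \<exists>Y B. \<forall>z. Im z > Y \<longrightarrow> norm (g (act r z)) \<le> B"
  obtains c where "\<And>z. z \<in> uhp \<Longrightarrow> g z = c"
proof -
  have "\<exists>G. G holomorphic_on ball 0 1 \<and> (\<forall>z\<in>uhp. g (act r z) = G (nome z))" if r: "r \<in> cusp_reps" for r
  proof -
    from bound[OF r] obtain Y B where YB: "\<And>z. Im z > Y \<Longrightarrow> norm (g (act r z)) \<le> B" by blast
    have "det r > 0" using r cusp_reps_SL2Z SL2Z_det by fastforce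
    from periodic_bounded_factor[OF _ holomorphic_act[OF this holo] _ YB, of 2]
    obtain G where "G holomorphic_on ball 0 1" "\<And>z. z \<in> uhp \<Longrightarrow> g (act r z) = G (exp (2 * pi * \<i> * z / of_nat 2))"
      using gamma2_invariant_periodic[OF inv r] by auto
    thus ?thesis unfolding nome_eq by blast
  qed
  then obtain G where G: "\<And>r. r \<in> cusp_reps \<Longrightarrow> G r holomorphic_on ball 0 1"
    "\<And>r z. r \<in> cusp_reps \<Longrightarrow> z \<in> uhp \<Longrightarrow> g (act r z) = G r (nome z)" by metis
  \<comment> \<open>The radius is the modulus of the nome at height 1/5, so by
    \<open>uhp_reduction\<close> the three copies of this disc meet every orbit.\<close>
  define K :: "complex set" where "K = cball 0 (exp (- (pi / 5)))"
  have K: "compact K" "0 \<in> K" "K \<subseteq> ball 0 1"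
  proof -
    have "exp (- (pi / 5)) < 1" by simp
    thus "compact K" "0 \<in> K" "K \<subseteq> ball 0 1" by (auto simp: K_def simp del: exp_less_one_iff)
  qed
  have "\<exists>p\<in>K. \<forall>q\<in>K. norm (G r q) \<le> norm (G r p)" if "r \<in> cusp_reps" for r
  proof (rule continuous_attains_sup[OF K(1)])
    show "continuous_on K (\<lambda>q. norm (G r q))"
      using holomorphic_on_imp_continuous_on[OF G(1)[OF that]] K(3)
      by (intro continuous_on_norm) (rule continuous_on_subset)
  qed (use K(2) in auto)
  then obtain P where P: "\<And>r. r \<in> cusp_reps \<Longrightarrow> P r \<in> K"
    "\<And>r q. r \<in> cusp_reps \<Longrightarrow> q \<in> K \<Longrightarrow> norm (G r q) \<le> norm (G r (P r))" by metis
  have fin: "finite cusp_reps" "cusp_reps \<noteq> {}" by (auto simp: cusp_reps_def)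
  define m where "m = Max ((\<lambda>r. norm (G r (P r))) ` cusp_reps)"
  have "m \<in> (\<lambda>r. norm (G r (P r))) ` cusp_reps" unfolding m_def by (rule Max_in) (use fin in auto)
  then obtain r0 where r0: "r0 \<in> cusp_reps" "m = norm (G r0 (P r0))" by blast
  have max: "norm (G r q) \<le> m" if "r \<in> cusp_reps" "q \<in> K" for r q
  proof -
    have "norm (G r (P r)) \<le> m" unfolding m_def by (rule Max_ge) (use fin that in auto)
    thus ?thesis using P(2)[OF that] by linarith
  qed
  have "norm (G r0 q) \<le> norm (G r0 (P r0))" if q: "q \<in> ball 0 1" for q
  proof (cases "q = 0")
    case True
    thus ?thesis using max[OF r0(1) K(2)] r0(2) by simp
  next
    case False
    define z where "z = of_nat 2 / (2 * pi * \<i>) * Ln q"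
    have "exp (Ln q) = q" using False by simp
    from log_nome_uhp[OF _ this, of 2, folded z_def] False q
    have z: "z \<in> uhp" "nome z = q" unfolding nome_eq by auto
    \<comment> \<open>The point over q is moved to height at least 1/5 at some cusp; by invariance
      its value is one already bounded by the maximum over the three compact discs.\<close>
    obtain N r z' where Nrz: "N \<in> Gamma2" "r \<in> cusp_reps" "z' \<in> uhp" "Im z' \<ge> 1/5" "act r0 z = act N (act r z')"
      using uhp_reduction[OF SL2Z_act_uhp[OF _ z(1), of r0]] r0(1) cusp_reps_SL2Z by blast
    have "G r0 q = g (act r0 z)" using G(2)[OF r0(1) z(1)] z(2) by simp
    also have "\<dots> = g (act r z')"
      unfolding Nrz(5) using inv[OF Nrz(1)] SL2Z_act_uhp Nrz(2,3) cusp_reps_SL2Z by blast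
    also have "\<dots> = G r (nome z')" by (rule G(2)[OF Nrz(2,3)])
    finally have eq: "G r0 q = G r (nome z')" .
    have "nome z' \<in> K" using Nrz(4) unfolding K_def by (simp add: norm_nome_eq)
    thus ?thesis using max[OF Nrz(2)] eq r0(2) by simp
  qed
  \<comment> \<open>The maximum over the whole open disc is attained at \<open>P r0\<close>, an
    interior point because K lies inside the open disc.\<close>
  hence "G r0 constant_on ball 0 1"
    by (intro maximum_modulus_principle[OF G(1)[OF r0(1)], of "ball 0 1" "P r0"]) (use P(1)[OF r0(1)] K(3) in auto)
  then obtain c where c: "\<And>q. q \<in> ball 0 1 \<Longrightarrow> G r0 q = c" by (auto simp: constant_on_def)
  show ?thesis
  proof (rule that[of c])
    fix z assume "z \<in> uhp"
    then obtain z' where z': "z' \<in> uhp" "act r0 z' = z"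
      using SL2Z_act_surj[of r0] r0(1) cusp_reps_SL2Z by blast
    have "g (act r0 z') = G r0 (nome z')" by (rule G(2)[OF r0(1) z'(1)])
    thus "g z = c" using c[of "nome z'"] norm_nome_less_1[OF z'(1)] z'(2) by simp
  qed
qed

section \<open>The modular lambda function and level 2 functions holomorphic on the upper half
  plane\<close>

definition theta_lambda :: "complex \<Rightarrow> complex" where "theta_lambda z = theta_u z ^ 4"

lemma theta_lambda_holomorphic: "theta_lambda holomorphic_on uhp"
  unfolding theta_lambda_def by (intro holomorphic_intros theta_u_holomorphic)

lemma ii_powi_4: "(\<i> powi n) ^ 4 = 1"
proof -
  have "(\<i> powi n) ^ 4 = \<i> powi (n * int 4)" by (simp only: power_int_mult power_int_of_nat)
  also have "n * int 4 = 0 + 4 * n" by simp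
  also have "\<i> powi (0 + 4 * n) = \<i> powi 0" by (rule ii_powi_add4)
  finally show ?thesis by simp
qed

lemma theta_lambda_gamma2:
  assumes "N \<in> Gamma2" "z \<in> uhp"
  shows "theta_lambda (act N z) = theta_lambda z"
  using assms theta_uv_gamma2_mat[OF _ assms(2)]
  by (auto simp: Gamma2_def theta_lambda_def power_mult_distrib ii_powi_4)

lemma act_cusp_reps:
  assumes "z \<in> uhp"
  shows "act (mat2 1 0 0 1) z = z" "act (mat2 0 (-1) 1 0) z = - 1 / z"
    "act (mat2 1 (-1) 1 0) z = - 1 / z + 1"
  using uhp_nonzero[OF assms] by (simp_all add: act_mat2 field_simps)

lemma theta_v_power4: "z \<in> uhp \<Longrightarrow> theta_v z ^ 4 = 1 - theta_lambda z"
  using theta_uv_jacobi[of z] by (simp add: theta_lambda_def eq_diff_eq add.commute)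

lemma zeta8_4: "zeta8 ^ 4 = -1"
proof -
  have "zeta8 ^ 4 = (zeta8 ^ 2) ^ 2" by (simp flip: power_mult)
  thus ?thesis by (simp add: zeta8_square)
qed

text \<open>The second representative is the inversion, the third is the inversion followed by
  translation by 1.\<close>

lemma theta_uv_cusps:
  assumes z: "z \<in> uhp"
  shows "theta_u (act (mat2 1 0 0 1) z) = theta_u z" "theta_v (act (mat2 1 0 0 1) z) = theta_v z"
    "theta_u (act (mat2 0 (-1) 1 0) z) = theta_v z" "theta_v (act (mat2 0 (-1) 1 0) z) = theta_u z"
    "theta_u (act (mat2 1 (-1) 1 0) z) = zeta8 * theta_v z / theta_u z"
    "theta_v (act (mat2 1 (-1) 1 0) z) = 1 / theta_u z"
  unfolding act_cusp_reps[OF z]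
  using z theta_u_add_1[OF uhp_inversion[OF z]] theta_v_add_1[of "- 1 / z"]
  by (simp_all add: theta_u_inversion[OF z, simplified] theta_v_inversion[OF z, simplified])

text \<open>As the nome tends to 0 the quotient of \<open>theta_psi\<close> by
  \<open>theta_phi\<close> tends to 2 and that of \<open>theta_phi (- p)\<close> by
  \<open>theta_phi p\<close> to 1; the constants enclose these limits. The lower bounds serve the
  inverses.\<close>

lemma theta_uv_bounds:
  obtains Y where "Y > 0"
    "\<And>z. Im z > Y \<Longrightarrow> exp (- (pi / 4 * Im z)) \<le> norm (theta_u z)"
    "\<And>z. Im z > Y \<Longrightarrow> norm (theta_u z) \<le> 3 * exp (- (pi / 4 * Im z))"
    "\<And>z. Im z > Y \<Longrightarrow> 1 / 2 \<le> norm (theta_v z)" "\<And>z. Im z > Y \<Longrightarrow> norm (theta_v z) \<le> 2"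
proof -
  have c1: "isCont theta_phi 0" "isCont theta_psi 0"
    using theta_phi_holomorphic theta_psi_holomorphic
    by (auto intro!: continuous_on_interior[OF holomorphic_on_imp_continuous_on])
  have c2: "isCont (\<lambda>p. theta_phi (- p)) 0"
    using isCont_o2[of "0 :: complex" uminus theta_phi] c1(1) by simp
  have t: "theta_phi \<midarrow>0\<rightarrow> 1" "theta_psi \<midarrow>0\<rightarrow> 2" "(\<lambda>p. theta_phi (- p)) \<midarrow>0\<rightarrow> 1"
    using c1 c2 by (simp_all add: isCont_def)
  have l: "((\<lambda>p. norm (theta_psi p / theta_phi p)) \<longlongrightarrow> 2) (at 0)"
    "((\<lambda>p. norm (theta_phi (- p) / theta_phi p)) \<longlongrightarrow> 1) (at 0)"
    using tendsto_norm[OF tendsto_divide[OF t(2,1)]] tendsto_norm[OF tendsto_divide[OF t(3,1)]] by simp_all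
  have "eventually (\<lambda>p. norm (theta_psi p / theta_phi p) > 1) (at 0)"
       "eventually (\<lambda>p. norm (theta_psi p / theta_phi p) < 3) (at 0)"
       "eventually (\<lambda>p. norm (theta_phi (- p) / theta_phi p) > 1 / 2) (at 0)"
       "eventually (\<lambda>p. norm (theta_phi (- p) / theta_phi p) < 2) (at 0)"
    by (rule order_tendstoD[OF l(1)] order_tendstoD[OF l(2)]; simp)+
  hence "eventually (\<lambda>p. norm (theta_psi p / theta_phi p) > 1 \<and> norm (theta_psi p / theta_phi p) < 3 \<and>
     norm (theta_phi (- p) / theta_phi p) > 1 / 2 \<and> norm (theta_phi (- p) / theta_phi p) < 2) (at 0)"
    by eventually_elim simp
  from eventually_nome[OF _ this, of 2] obtain Y where Y: "Y > 0"
    "\<And>z. Im z > Y \<Longrightarrow> norm (theta_psi (nome z) / theta_phi (nome z)) > 1 \<and> norm (theta_psi (nome z) / theta_phi (nome z)) < 3 \<and>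
     norm (theta_phi (- nome z) / theta_phi (nome z)) > 1 / 2 \<and> norm (theta_phi (- nome z) / theta_phi (nome z)) < 2"
    unfolding nome_eq by auto
  have u: "norm (theta_u z) = exp (- (pi / 4 * Im z)) * norm (theta_psi (nome z) / theta_phi (nome z))" for z
    by (simp add: theta_u_def norm_mult norm_divide)
  show ?thesis
  proof (rule that[OF Y(1)])
    fix z assume z: "Im z > Y"
    show "exp (- (pi / 4 * Im z)) \<le> norm (theta_u z)"
      unfolding u using mult_left_mono[of 1 "norm (theta_psi (nome z) / theta_phi (nome z))" "exp (- (pi / 4 * Im z))"] Y(2)[OF z] by simp
    show "norm (theta_u z) \<le> 3 * exp (- (pi / 4 * Im z))"
      unfolding u using mult_left_mono[of "norm (theta_psi (nome z) / theta_phi (nome z))" 3 "exp (- (pi / 4 * Im z))"] Y(2)[OF z] by (simp add: mult.commute)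
    show "1 / 2 \<le> norm (theta_v z)" "norm (theta_v z) \<le> 2"
      unfolding theta_v_def using Y(2)[OF z] by auto
  qed
qed

text \<open>At the third cusp \<open>theta_lambda\<close> has a simple pole, so poles of higher order there can be
  removed one order at a time by subtracting multiples of powers of \<open>theta_lambda\<close>.\<close>

lemma theta_lambda_pole:
  obtains K where "K holomorphic_on ball 0 1" "K 0 \<noteq> 0"
    "\<And>z. z \<in> uhp \<Longrightarrow> theta_lambda (act (mat2 1 (-1) 1 0) z) * nome z = K (nome z)"
proof -
  \<comment> \<open>At this cusp lambda becomes -(V / U)^4, the sign being \<open>zeta8 ^ 4\<close>;
    the factors \<open>theta_phi p\<close> cancel, and the nome in U^4 is the simple pole.\<close>
  define K where "K = (\<lambda>p. - (theta_phi (- p) ^ 4 / theta_psi p ^ 4))"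
  have "(theta_phi \<circ> uminus) holomorphic_on ball 0 1"
    by (rule holomorphic_on_compose_gen[OF _ theta_phi_holomorphic]) (auto intro!: holomorphic_intros)
  hence 1: "K holomorphic_on ball 0 1"
    unfolding K_def o_def by (intro holomorphic_intros theta_psi_holomorphic) (auto simp: theta_psi_nonzero)
  have 2: "K 0 \<noteq> 0" by (simp add: K_def)
  have 3: "theta_lambda (act (mat2 1 (-1) 1 0) z) * nome z = K (nome z)" if z: "z \<in> uhp" for z
  proof -
    let ?p = "nome z"
    have nz: "theta_phi ?p \<noteq> 0" "theta_psi ?p \<noteq> 0" "?p \<noteq> 0"
      using theta_phi_nonzero theta_psi_nonzero norm_nome_less_1[OF z] by (auto simp: nome_def)
    have e: "exp (of_real pi * \<i> * z / 4) ^ 4 = ?p"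
      unfolding nome_def by (subst exp_of_nat_mult[symmetric]) simp
    have "theta_u z ^ 4 = ?p * theta_psi ?p ^ 4 / theta_phi ?p ^ 4"
      by (simp add: theta_u_def power_mult_distrib power_divide e)
    moreover have "theta_v z ^ 4 = theta_phi (- ?p) ^ 4 / theta_phi ?p ^ 4"
      by (simp add: theta_v_def power_divide)
    moreover have "theta_lambda (act (mat2 1 (-1) 1 0) z) = - (theta_v z ^ 4 / theta_u z ^ 4)"
      unfolding theta_lambda_def theta_uv_cusps[OF z] by (simp add: power_mult_distrib power_divide zeta8_4)
    ultimately show ?thesis using nz by (simp add: K_def)
  qed
  show ?thesis using that 1 2 3 by blast
qed

lemma theta_lambda_bounded:
  obtains Y where "Y > 0" "\<And>z. Im z > Y \<Longrightarrow> norm (theta_lambda (act (mat2 1 0 0 1) z)) \<le> 81"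
     "\<And>z. Im z > Y \<Longrightarrow> norm (theta_lambda (act (mat2 0 (-1) 1 0) z)) \<le> 16"
proof -
  obtain Y where Y: "Y > 0"
    "\<And>z. Im z > Y \<Longrightarrow> norm (theta_u z) \<le> 3 * exp (- (pi / 4 * Im z))"
    "\<And>z. Im z > Y \<Longrightarrow> norm (theta_v z) \<le> 2"
    using theta_uv_bounds by metis
  show ?thesis
  proof (rule that[OF Y(1)])
    fix z assume z: "Im z > Y"
    hence zu: "z \<in> uhp" using Y(1) by (simp add: uhp_def)
    have "exp (- (pi / 4 * Im z)) \<le> 1" using z Y(1) by simp
    hence "norm (theta_u z) \<le> 3" using Y(2)[OF z] by linarith
    hence "norm (theta_u z) ^ 4 \<le> 3 ^ 4" by (intro power_mono) auto
    thus "norm (theta_lambda (act (mat2 1 0 0 1) z)) \<le> 81"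
      unfolding theta_lambda_def theta_uv_cusps[OF zu] norm_power by simp
    have "norm (theta_v z) ^ 4 \<le> 2 ^ 4" using Y(3)[OF z] by (intro power_mono) auto
    thus "norm (theta_lambda (act (mat2 0 (-1) 1 0) z)) \<le> 16"
      unfolding theta_lambda_def theta_uv_cusps[OF zu] norm_power by simp
  qed
qed

text \<open>Differentiability at 0 bounds the difference quotient; this is the gain of one order in
  the removal of the leading pole term.\<close>

lemma holomorphic_zero_bound:
  assumes "H holomorphic_on ball 0 1" "H 0 = 0"
  obtains B where "eventually (\<lambda>p. norm (H p) \<le> B * norm p) (at 0)"
proof -
  have "H field_differentiable at 0" using assms(1) by (intro holomorphic_on_imp_differentiable_at) auto
  then obtain D where "(H has_field_derivative D) (at 0)" by (auto simp: field_differentiable_def)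
  hence "((\<lambda>p. H p / p) \<longlongrightarrow> D) (at 0)" by (simp add: has_field_derivative_iff assms(2))
  hence "eventually (\<lambda>p. norm (H p / p) < norm D + 1) (at 0)"
    by (intro order_tendstoD(2)[OF tendsto_norm]) auto
  moreover have "eventually (\<lambda>p. p \<noteq> 0) (at (0 :: complex))" by (rule eventually_neq_at_within)
  ultimately have "eventually (\<lambda>p. norm (H p) \<le> (norm D + 1) * norm p) (at 0)"
  proof eventually_elim
    case (elim p)
    thus ?case by (simp add: norm_divide divide_less_eq less_imp_le)
  qed
  thus ?thesis by (rule that)
qed

text \<open>Induction on the allowed pole order at the third cusp. The correction by a power of
  lambda keeps boundedness at the other two cusps, where lambda is bounded, and the base case is
  \<open>gamma2_bounded_constant\<close>.\<close>

lemma gamma2_polynomial: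
  assumes "g holomorphic_on uhp"
    and "\<And>N z. N \<in> Gamma2 \<Longrightarrow> z \<in> uhp \<Longrightarrow> g (act N z) = g z"
    and "\<exists>Y B. \<forall>z. Im z > Y \<longrightarrow> norm (g (act (mat2 1 0 0 1) z)) \<le> B"
    and "\<exists>Y B. \<forall>z. Im z > Y \<longrightarrow> norm (g (act (mat2 0 (-1) 1 0) z)) \<le> B"
    and "\<exists>Y B. \<forall>z. Im z > Y \<longrightarrow> norm (g (act (mat2 1 (-1) 1 0) z) * nome z ^ n) \<le> B"
  shows "\<exists>P. \<forall>z\<in>uhp. g z = poly P (theta_lambda z)"
  using assms
proof (induction n arbitrary: g)
  case 0
  have "\<exists>Y B. \<forall>z. Im z > Y \<longrightarrow> norm (g (act r z)) \<le> B" if "r \<in> cusp_reps" for r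
    using that 0(3,4,5) by (auto simp: cusp_reps_def)
  then obtain c where "\<And>z. z \<in> uhp \<Longrightarrow> g z = c"
    using gamma2_bounded_constant[OF 0(1,2)] by blast
  thus ?case by (intro exI[of _ "[:c:]"]) auto
next
  case (Suc n g)
  let ?r = "mat2 1 (-1) 1 0"
  have det: "det ?r > 0" by (simp add: det_mat2)
  have r: "?r \<in> cusp_reps" by (simp add: cusp_reps_def)
  obtain K where K: "K holomorphic_on ball 0 1" "K 0 \<noteq> 0"
    "\<And>z. z \<in> uhp \<Longrightarrow> theta_lambda (act ?r z) * nome z = K (nome z)" by (rule theta_lambda_pole) blast
  from Suc.prems(5) obtain Y B where YB: "\<And>z. Im z > Y \<Longrightarrow> norm (g (act ?r z) * nome z ^ Suc n) \<le> B" by blast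
  have "(\<lambda>z. g (act ?r z) * nome z ^ Suc n) holomorphic_on uhp"
    by (intro holomorphic_intros holomorphic_act det Suc.prems(1))
  moreover have "g (act ?r (z + of_nat 2)) * nome (z + of_nat 2) ^ Suc n = g (act ?r z) * nome z ^ Suc n" if "z \<in> uhp" for z
  proof -
    have "z + 2 = z + 1 + 1" by simp
    hence "nome (z + 2) = nome z" by (simp only: nome_add_1 minus_minus)
    thus ?thesis using gamma2_invariant_periodic[OF Suc.prems(2) r that] by simp
  qed
  ultimately obtain G where G: "G holomorphic_on ball 0 1"
    "\<And>z. z \<in> uhp \<Longrightarrow> g (act ?r z) * nome z ^ Suc n = G (nome z)"
    using periodic_bounded_factor[of 2 "\<lambda>z. g (act ?r z) * nome z ^ Suc n" Y B] YB unfolding nome_eq by auto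
  \<comment> \<open>Chosen so that the leading terms at the third cusp cancel: the expansion of g
    begins with \<open>G 0\<close>, that of lambda^(n+1) with \<open>K 0 ^ Suc n\<close>.\<close>
  define c where "c = G 0 / K 0 ^ Suc n"
  define H where "H = (\<lambda>p. G p - c * K p ^ Suc n)"
  have "H holomorphic_on ball 0 1" unfolding H_def by (intro holomorphic_intros G(1) K(1))
  moreover have "H 0 = 0" using K(2) by (simp add: H_def c_def)
  ultimately obtain B' where B': "eventually (\<lambda>p. norm (H p) \<le> B' * norm p) (at 0)"
    by (rule holomorphic_zero_bound)
  define g' where "g' = (\<lambda>z. g z - c * theta_lambda z ^ Suc n)"
  obtain Y0 where Y0: "Y0 > 0" "\<And>z. Im z > Y0 \<Longrightarrow> norm (theta_lambda (act (mat2 1 0 0 1) z)) \<le> 81"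
     "\<And>z. Im z > Y0 \<Longrightarrow> norm (theta_lambda (act (mat2 0 (-1) 1 0) z)) \<le> 16"
    by (rule theta_lambda_bounded) blast
  have bounded: "\<exists>Y B. \<forall>z. Im z > Y \<longrightarrow> norm (g' (act r z)) \<le> B"
    if a1: "\<exists>Y B. \<forall>z. Im z > Y \<longrightarrow> norm (g (act r z)) \<le> B"
      and a2: "\<And>z. Im z > Y0 \<Longrightarrow> norm (theta_lambda (act r z)) \<le> C" for r C
  proof -
    from a1 obtain Y1 B1 where 1: "\<And>z. Im z > Y1 \<Longrightarrow> norm (g (act r z)) \<le> B1" by blast
    have "norm (g' (act r z)) \<le> B1 + norm c * C ^ Suc n" if z: "Im z > max Y0 Y1" for z
    proof -
      have "norm (g' (act r z)) \<le> norm (g (act r z)) + norm (c * theta_lambda (act r z) ^ Suc n)"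
        unfolding g'_def by (rule norm_triangle_ineq4)
      also have "norm (c * theta_lambda (act r z) ^ Suc n) = norm c * norm (theta_lambda (act r z)) ^ Suc n"
        by (simp only: norm_mult norm_power)
      also have "norm c * norm (theta_lambda (act r z)) ^ Suc n \<le> norm c * C ^ Suc n"
        using a2[of z] z by (intro mult_left_mono power_mono) auto
      also have "norm (g (act r z)) \<le> B1" using 1 z by simp
      finally show ?thesis by simp
    qed
    thus ?thesis by blast
  qed
  have "\<exists>P. \<forall>z\<in>uhp. g' z = poly P (theta_lambda z)"
  proof (rule Suc.IH)
    show "g' holomorphic_on uhp"
      unfolding g'_def by (intro holomorphic_intros Suc.prems(1) theta_lambda_holomorphic)
    show "g' (act N z) = g' z" if "N \<in> Gamma2" "z \<in> uhp" for N z
      unfolding g'_def using Suc.prems(2)[OF that] theta_lambda_gamma2[OF that] by simp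
    show "\<exists>Y B. \<forall>z. Im z > Y \<longrightarrow> norm (g' (act (mat2 1 0 0 1) z)) \<le> B"
      by (rule bounded[OF Suc.prems(3) Y0(2)])
    show "\<exists>Y B. \<forall>z. Im z > Y \<longrightarrow> norm (g' (act (mat2 0 (-1) 1 0) z)) \<le> B"
      by (rule bounded[OF Suc.prems(4) Y0(3)])
    from eventually_nome[OF _ B', of 2] obtain Y1 where Y1: "Y1 > 0"
      "\<And>z. Im z > Y1 \<Longrightarrow> norm (H (nome z)) \<le> B' * norm (nome z)"
      unfolding nome_eq by auto
    have "norm (g' (act ?r z) * nome z ^ n) \<le> B'" if z: "Im z > Y1" for z
    proof -
      have zu: "z \<in> uhp" using z Y1(1) by (simp add: uhp_def)
      have nz: "nome z \<noteq> 0" by (simp add: nome_def)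
      have "g' (act ?r z) * nome z ^ Suc n = g (act ?r z) * nome z ^ Suc n - c * (theta_lambda (act ?r z) * nome z) ^ Suc n"
        by (simp only: g'_def left_diff_distrib power_mult_distrib mult.assoc)
      also have "\<dots> = H (nome z)" unfolding G(2)[OF zu] K(3)[OF zu] H_def ..
      finally have eq: "H (nome z) = g' (act ?r z) * nome z ^ Suc n" ..
      have "norm (H (nome z)) = norm (g' (act ?r z) * nome z ^ n) * norm (nome z)"
        unfolding eq by (simp add: norm_mult)
      with Y1(2)[OF z] show ?thesis using nz by simp
    qed
    thus "\<exists>Y B. \<forall>z. Im z > Y \<longrightarrow> norm (g' (act ?r z) * nome z ^ n) \<le> B" by blast
  qed
  then obtain P where "\<forall>z\<in>uhp. g' z = poly P (theta_lambda z)" by blast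
  hence "\<forall>z\<in>uhp. g z = poly (P + Polynomial.monom c (Suc n)) (theta_lambda z)"
    by (simp add: g'_def poly_monom diff_eq_eq)
  thus ?case by blast
qed

section \<open>Clearing poles in the upper half plane\<close>

lemma meromorphic_pole_bound:
  assumes "f meromorphic_on {z0}"
  obtains n B where "eventually (\<lambda>w. norm (f w) * norm (w - z0) ^ n \<le> B) (at z0)"
proof -
  obtain L where L: "(\<lambda>w. f (z0 + w)) has_laurent_expansion L"
    using assms by (auto simp: meromorphic_on_def)
  let ?s = "fls_subdegree L"
  let ?B = "fls_base_factor_to_fps L"
  have "fls_conv_radius L > 0" and ev: "eventually (\<lambda>w. eval_fls L w = f (z0 + w)) (at 0)"
    using L by (auto simp: has_laurent_expansion_def)
  define B where "B = norm (eval_fps ?B 0) + 1"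
  have "isCont (eval_fps ?B) 0"
    using \<open>fls_conv_radius L > 0\<close> by (intro continuous_eval_fps) (simp add: zero_ereal_def fps_conv_radius_fls_regpart)
  hence "(eval_fps ?B \<longlongrightarrow> eval_fps ?B 0) (at 0)" by (simp add: isCont_def)
  hence "eventually (\<lambda>w. norm (eval_fps ?B w) < B) (at 0)"
    by (intro order_tendstoD(2)[OF tendsto_norm]) (auto simp: B_def)
  moreover have "eventually (\<lambda>w. w \<in> ball 0 1 - {0}) (at (0 :: complex))"
    by (intro eventually_at_in_open) auto
  \<comment> \<open>\<open>nat (- ?s)\<close> is the pole order, or 0 if there is no pole; in that
    case the remaining power of |w| is at most 1 on the unit disc.\<close>
  ultimately have "eventually (\<lambda>w. norm (f (z0 + w)) * norm w ^ nat (- ?s) \<le> B) (at 0)"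
    using ev
  proof eventually_elim
    case (elim w)
    hence w: "w \<noteq> 0" "norm w < 1" by auto
    have "norm (f (z0 + w)) * norm w ^ nat (- ?s) = norm (eval_fps ?B w) * (norm w powi ?s * norm w ^ nat (- ?s))"
      unfolding elim(3)[symmetric] eval_fls_def by (simp add: norm_mult norm_power_int)
    also have "\<dots> \<le> B * 1"
    proof (rule mult_mono)
      show "norm w powi ?s * norm w ^ nat (- ?s) \<le> 1"
      proof (cases "?s \<ge> 0")
        case True
        thus ?thesis using w by (simp add: power_int_def power_le_one)
      next
        case False
        thus ?thesis using w by (simp add: power_int_def flip: power_mult_distrib)
      qed
    qed (use elim in \<open>auto simp: B_def\<close>)
    finally show ?case by simp
  qed
  hence "eventually (\<lambda>w. norm (f w) * norm (w - z0) ^ nat (- ?s) \<le> B) (at z0)"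
    by (subst eventually_at_to_0) (simp add: add.commute)
  thus ?thesis by (rule that)
qed

abbreviation lambda_poly :: "complex poly \<Rightarrow> mero_uhp" where
  "lambda_poly P \<equiv> mero_of (\<lambda>z. poly P (theta_lambda z))"

lemma lambda_poly_holomorphic: "(\<lambda>z. poly P (theta_lambda z)) holomorphic_on uhp"
  by (intro holomorphic_intros theta_lambda_holomorphic)

lemmas lambda_poly_meromorphic = holomorphic_uhp_imp_meromorphic[OF lambda_poly_holomorphic]

lemma lambda_poly_mult: "lambda_poly (P * Q) = lambda_poly P * lambda_poly Q"
  by (simp add: mero_of_mult[OF lambda_poly_meromorphic lambda_poly_meromorphic])

lemma lambda_poly_bounded_near: "z \<in> uhp \<Longrightarrow> bounded_near z (lambda_poly P)"
  by (rule bounded_near_holomorphic[OF lambda_poly_holomorphic])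

text \<open>(lambda - lambda (z0))^n vanishes to order at least n at z0. Only a bound for the
  difference quotient of lambda enters, so critical points cause no trouble.\<close>

lemma remove_pole:
  assumes "z0 \<in> uhp"
  obtains D where "D \<noteq> 0" "bounded_near z0 (lambda_poly D * F)"
proof (cases F)
  case (1 f)
  obtain n B where B: "eventually (\<lambda>w. norm (f w) * norm (w - z0) ^ n \<le> B) (at z0)"
    using meromorphic_pole_bound[of f z0] meromorphic_on_subset[OF 1(1), of "{z0}"] assms by auto
  have "theta_lambda field_differentiable at z0"
    using theta_lambda_holomorphic open_uhp assms by (intro holomorphic_on_imp_differentiable_at)
  then obtain C where "(theta_lambda has_field_derivative C) (at z0)" by (auto simp: field_differentiable_def)
  hence "((\<lambda>w. (theta_lambda w - theta_lambda z0) / (w - z0)) \<longlongrightarrow> C) (at z0)"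
    by (simp add: has_field_derivative_iff)
  hence "eventually (\<lambda>w. norm ((theta_lambda w - theta_lambda z0) / (w - z0)) < norm C + 1) (at z0)"
    by (intro order_tendstoD(2)[OF tendsto_norm]) auto
  moreover have "eventually (\<lambda>w. w \<noteq> z0) (at z0)" by (rule eventually_neq_at_within)
  ultimately have "eventually (\<lambda>w. norm (poly ([:- theta_lambda z0, 1:] ^ n) (theta_lambda w) * f w) \<le> (norm C + 1) ^ n * B) (at z0)"
    using B
  proof eventually_elim
    case (elim w)
    have "norm (theta_lambda w - theta_lambda z0) \<le> (norm C + 1) * norm (w - z0)"
      using elim by (simp add: norm_divide divide_less_eq less_imp_le)
    hence "norm (theta_lambda w - theta_lambda z0) ^ n \<le> ((norm C + 1) * norm (w - z0)) ^ n"
      by (intro power_mono) auto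
    hence "norm (theta_lambda w - theta_lambda z0) ^ n * norm (f w) \<le> ((norm C + 1) * norm (w - z0)) ^ n * norm (f w)"
      by (intro mult_right_mono) auto
    also have "\<dots> = (norm C + 1) ^ n * (norm (f w) * norm (w - z0) ^ n)"
      by (simp add: power_mult_distrib)
    also have "\<dots> \<le> (norm C + 1) ^ n * B" using elim by (intro mult_left_mono) auto
    finally show ?case by (simp add: norm_mult norm_power)
  qed
  hence "bounded_near z0 (lambda_poly ([:- theta_lambda z0, 1:] ^ n) * F)"
    unfolding 1(2) mero_of_mult[OF lambda_poly_meromorphic 1(1)] using assms
    by (subst bounded_near_mero_of[OF meromorphic_on_mult[OF lambda_poly_meromorphic 1(1)]]) blast
  thus ?thesis by (rule that[rotated]) simp
qed

text \<open>The same local bound works at all nearby points; this openness lets compactness replace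
  pointwise choices of a polynomial by one product.\<close>

lemma bounded_near_open:
  assumes "bounded_near z F"
  obtains e where "e > 0" "\<And>w. w \<in> ball z e \<Longrightarrow> bounded_near w F"
proof (cases F)
  case (1 f)
  from assms obtain B where z: "z \<in> uhp" and B: "eventually (\<lambda>w. norm (f w) \<le> B) (at z)"
    unfolding 1 bounded_near_mero_of[OF 1(1)] by blast
  from B obtain d where d: "d > 0" "\<And>w. w \<noteq> z \<Longrightarrow> dist w z < d \<Longrightarrow> norm (f w) \<le> B"
    by (auto simp: eventually_at)
  obtain e where e: "e > 0" "ball z e \<subseteq> uhp" using open_uhp z open_contains_ball by blast
  show ?thesis
  proof (rule that[of "min d e"])
    fix w assume w: "w \<in> ball z (min d e)"
    have "bounded_near w (mero_of f)"
    proof (cases "w = z")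
      case True
      thus ?thesis using assms 1 by simp
    next
      case False
      have "eventually (\<lambda>v. v \<in> (ball z (min d e) - {z}) - {w}) (at w)"
        by (intro eventually_at_in_open) (use w False in auto)
      hence "eventually (\<lambda>v. norm (f v) \<le> B) (at w)"
        by eventually_elim (use d in \<open>auto simp: dist_commute\<close>)
      thus ?thesis unfolding bounded_near_mero_of[OF 1(1)] using w e by auto
    qed
    thus "bounded_near w F" using 1 by simp
  qed (use d e in auto)
qed

lemma remove_poles_compact:
  assumes "compact K" "K \<subseteq> uhp"
  obtains D where "D \<noteq> 0" "\<And>z. z \<in> K \<Longrightarrow> bounded_near z (lambda_poly D * F)"
proof -
  have "\<exists>D e. D \<noteq> 0 \<and> e > 0 \<and> (\<forall>w\<in>ball z e. bounded_near w (lambda_poly D * F))" if "z \<in> K" for z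
    using remove_pole[of z F] bounded_near_open that assms(2) by (metis subsetD)
  then obtain D e where De: "\<And>z. z \<in> K \<Longrightarrow> D z \<noteq> 0" "\<And>z. z \<in> K \<Longrightarrow> e z > 0"
    "\<And>z w. z \<in> K \<Longrightarrow> w \<in> ball z (e z) \<Longrightarrow> bounded_near w (lambda_poly (D z) * F)" by metis
  have "K \<subseteq> (\<Union>z\<in>K. ball z (e z))" using De(2) by force
  then obtain T where T: "T \<subseteq> K" "finite T" "K \<subseteq> (\<Union>z\<in>T. ball z (e z))"
    using compactE_image[OF assms(1), of K "\<lambda>z. ball z (e z)"] by (metis open_ball)
  show ?thesis
  proof (rule that[of "prod D T"])
    show "prod D T \<noteq> 0" using De(1) T by (auto simp: prod_zero_iff)
    fix w assume w: "w \<in> K"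
    then obtain z where z: "z \<in> T" "w \<in> ball z (e z)" using T(3) by blast
    have "prod D T = prod D (T - {z}) * D z" using prod.remove[OF T(2) z(1), of D] by simp
    hence eq: "lambda_poly (prod D T) * F = lambda_poly (prod D (T - {z})) * (lambda_poly (D z) * F)"
      by (simp only: lambda_poly_mult mult.assoc)
    have "z \<in> K" "w \<in> uhp" using z T(1) w assms(2) by auto
    thus "bounded_near w (lambda_poly (prod D T) * F)"
      unfolding eq by (intro bounded_near_mult lambda_poly_bounded_near De(3) z(2))
  qed
qed

lemma det_SL2Z_pos: "M \<in> SL2Z \<Longrightarrow> det M > 0"
  by (simp add: SL2Z_det)

lemma pullback_lambda_poly: "N \<in> Gamma2 \<Longrightarrow> pullback N (lambda_poly P) = lambda_poly P"
  using Gamma2_SL2Z theta_lambda_gamma2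
  by (subst pullback_mero_of)
     (auto intro!: mero_of_eqI meromorphic_on_act lambda_poly_meromorphic det_SL2Z_pos
       simp: meromorphic_on_act[OF det_SL2Z_pos lambda_poly_meromorphic])

text \<open>Multiplication by a polynomial in \<open>theta_lambda\<close> removes all poles in the upper half plane,
  and by powers of \<open>theta_lambda\<close> and \<open>1 - theta_lambda\<close> those at two of the three cusps.\<close>

lemma gamma2_remove_poles:
  assumes inv: "\<And>N. N \<in> Gamma2 \<Longrightarrow> pullback N F = F"
    and mod: "\<And>M. M \<in> SL2Z \<Longrightarrow> moderate (pullback M F)"
  obtains D g where "D \<noteq> 0" "g holomorphic_on uhp" "lambda_poly D * F = mero_of g"
proof -
  have "\<exists>Y>0. \<forall>z. Im z > Y \<longrightarrow> bounded_near z (pullback r F)" if "r \<in> cusp_reps" for r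
    using moderate_imp_bounded_near[OF mod[of r]] that cusp_reps_SL2Z by (metis subsetD)
  then obtain Yr where Yr: "\<And>r z. r \<in> cusp_reps \<Longrightarrow> Im z > Yr r \<Longrightarrow> bounded_near z (pullback r F)" by metis
  have fin: "finite cusp_reps" by (simp add: cusp_reps_def)
  define Y where "Y = Max (Yr ` cusp_reps)"
  have Y: "bounded_near z (pullback r F)" if "r \<in> cusp_reps" "Im z > Y" for r z
  proof (rule Yr[OF that(1)])
    have "Yr r \<le> Y" unfolding Y_def using fin that by (intro Max_ge) auto
    thus "Im z > Yr r" using that(2) by simp
  qed
  \<comment> \<open>Above height Y there are no poles near any of the cusps, below 1/5 no
    representatives are needed, and translation by 2 confines the real part to [-1, 1].\<close>
  define K where "K = cbox (Complex (-1) (1/5)) (Complex 1 Y)"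
  have Ku: "K \<subseteq> uhp" by (auto simp: K_def in_cbox_complex_iff uhp_def)
  define K' where "K' = (\<Union>r\<in>cusp_reps. act r ` K)"
  have "compact (act r ` K)" if "r \<in> cusp_reps" for r
  proof (rule compact_continuous_image)
    have "act r holomorphic_on uhp" using that cusp_reps_SL2Z by (intro act_holomorphic det_SL2Z_pos) auto
    thus "continuous_on K (act r)" using Ku by (meson continuous_on_subset holomorphic_on_imp_continuous_on)
  qed (simp add: K_def)
  hence "compact K'" unfolding K'_def using fin by (intro compact_UN) auto
  moreover have "K' \<subseteq> uhp" unfolding K'_def using SL2Z_act_uhp Ku cusp_reps_SL2Z by blast
  ultimately obtain D where D: "D \<noteq> 0" "\<And>z. z \<in> K' \<Longrightarrow> bounded_near z (lambda_poly D * F)"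
    using remove_poles_compact by blast
  define G where "G = lambda_poly D * F"
  have Ginv: "pullback N G = G" if "N \<in> Gamma2" for N
    unfolding G_def using that Gamma2_SL2Z
    by (subst pullback_mult) (auto simp: det_SL2Z_pos pullback_lambda_poly inv)
  have "bounded_near z G" if z: "z \<in> uhp" for z
  proof -
    obtain N r z' where Nrz: "N \<in> Gamma2" "r \<in> cusp_reps" "z' \<in> uhp" "Im z' \<ge> 1/5" "z = act N (act r z')"
      by (rule uhp_reduction[OF z])
    have S: "N \<in> SL2Z" "r \<in> SL2Z" using Nrz Gamma2_SL2Z cusp_reps_SL2Z by auto
    have "bounded_near z' (pullback r G)"
    proof (cases "Im z' > Y")
      case True
      have "bounded_near z' (pullback r (lambda_poly D))"
        by (rule bounded_near_pullbackI[OF det_SL2Z_pos[OF S(2)] Nrz(3)])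
           (rule lambda_poly_bounded_near[OF SL2Z_act_uhp[OF S(2) Nrz(3)]])
      thus ?thesis unfolding G_def pullback_mult[OF det_SL2Z_pos[OF S(2)]]
        by (intro bounded_near_mult Y Nrz True)
    next
      case False
      \<comment> \<open>Rounding Re z' / 2 brings the real part into [-1, 1] by an even translation,
        under which the pullback to the cusp is invariant.\<close>
      define k where "k = - round (Re z' / 2)"
      define z'' where "z'' = act (T_mat (2 * k)) z'"
      have "\<bar>of_int (round (Re z' / 2)) - Re z' / 2\<bar> \<le> 1 / 2" by (rule of_int_round_abs_le)
      hence "- 1 \<le> Re z' - 2 * of_int (round (Re z' / 2))" "Re z' - 2 * of_int (round (Re z' / 2)) \<le> 1"
        by linarith+
      hence "z'' \<in> K" using False Nrz(4) unfolding K_def z''_def in_cbox_complex_iff by (simp add: k_def)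
      hence "act r z'' \<in> K'" using Nrz(2) by (auto simp: K'_def)
      hence "bounded_near (act r z'') G" unfolding G_def by (rule D(2))
      have z''u: "z'' \<in> uhp" using \<open>z'' \<in> K\<close> Ku by blast
      have "bounded_near z'' (pullback r G)"
        using bounded_near_pullback_iff[OF S(2) z''u] \<open>bounded_near (act r z'') G\<close> by blast
      hence *: "bounded_near z' (pullback (T_mat (2 * k)) (pullback r G))"
        unfolding z''_def using bounded_near_pullback_iff[OF T_mat_SL2Z Nrz(3)] by blast
      have per: "pullback (T_mat 2) (pullback r G) = pullback r G"
      proof -
        obtain M where M: "M \<in> Gamma2" "M ** r = r ** T_mat 2" by (rule cusp_reps_translate[OF Nrz(2)])
        have "M \<in> SL2Z" using M(1) Gamma2_SL2Z by blast
        have "pullback (T_mat 2) (pullback r G) = pullback (M ** r) G"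
          unfolding M(2) using S(2) by (intro pullback_pullback det_SL2Z_pos T_mat_SL2Z)
        also have "\<dots> = pullback r (pullback M G)"
          using S(2) \<open>M \<in> SL2Z\<close> by (intro pullback_pullback[symmetric] det_SL2Z_pos)
        finally show ?thesis unfolding Ginv[OF M(1)] .
      qed
      have "pullback (T_mat (2 * k)) (pullback r G) = pullback r G"
      proof (induction k rule: int_induct[where k = 0])
        case base
        have "T_mat (2 * 0) = mat 1" unfolding T_mat_def by (intro mat2_eqI[symmetric]) (simp_all add: mat_def)
        thus ?case by simp
      next
        case (step1 i)
        have "T_mat (2 * (i + 1)) = T_mat 2 ** T_mat (2 * i)" by (simp add: T_mat_def mat2_mult)
        thus ?case using step1 per
          by (simp add: pullback_pullback[OF det_SL2Z_pos[OF T_mat_SL2Z] det_SL2Z_pos[OF T_mat_SL2Z], symmetric])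
      next
        case (step2 i)
        have "T_mat (2 * i) = T_mat 2 ** T_mat (2 * (i - 1))" by (simp add: T_mat_def mat2_mult)
        thus ?case using step2 per
          by (simp add: pullback_pullback[OF det_SL2Z_pos[OF T_mat_SL2Z] det_SL2Z_pos[OF T_mat_SL2Z], symmetric])
      qed
      with * show ?thesis by simp
    qed
    hence "bounded_near (act r z') G" using bounded_near_pullback_iff[OF S(2) Nrz(3)] by blast
    hence "bounded_near (act r z') (pullback N G)" unfolding Ginv[OF Nrz(1)] .
    thus ?thesis unfolding Nrz(5)
      using bounded_near_pullback_iff[OF S(1) SL2Z_act_uhp[OF S(2) Nrz(3)]] by blast
  qed
  then obtain g where "g holomorphic_on uhp" "G = mero_of g"
    using bounded_near_imp_holomorphic by blast
  thus ?thesis using that[OF D(1)] unfolding G_def by blast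
qed

text \<open>Once the poles in the upper half plane are cleared, lambda (1 - lambda) vanishes at the
  cusps infinity and 0, so a power of it absorbs the growth there, and
  \<open>gamma2_polynomial\<close> deals with the pole left at the cusp 1.\<close>

theorem gamma2_rational:
  assumes inv: "\<And>N. N \<in> Gamma2 \<Longrightarrow> pullback N F = F"
    and mod: "\<And>M. M \<in> SL2Z \<Longrightarrow> moderate (pullback M F)"
  obtains D P where "D \<noteq> 0" "lambda_poly D * F = lambda_poly P"
proof -
  obtain D g where D: "D \<noteq> 0" "g holomorphic_on uhp" "lambda_poly D * F = mero_of g"
    using gamma2_remove_poles[OF inv mod] by blast
  have ginv: "g (act N z) = g z" if N: "N \<in> Gamma2" and z: "z \<in> uhp" for N z
  proof -
    have S: "N \<in> SL2Z" using N Gamma2_SL2Z by blast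
    have "mero_of (\<lambda>z. g (act N z)) = pullback N (mero_of g)"
      by (rule pullback_mero_of[symmetric, OF det_SL2Z_pos[OF S] holomorphic_uhp_imp_meromorphic[OF D(2)]])
    also have "\<dots> = mero_of g"
      unfolding D(3)[symmetric] pullback_mult[OF det_SL2Z_pos[OF S]] pullback_lambda_poly[OF N] inv[OF N] ..
    finally show ?thesis
      by (rule mero_of_eqD[OF holomorphic_act[OF det_SL2Z_pos[OF S] D(2)] D(2) _ z])
  qed
  obtain Y where Y: "Y > 0"
    "\<And>z. Im z > Y \<Longrightarrow> exp (- (pi / 4 * Im z)) \<le> norm (theta_u z)"
    "\<And>z. Im z > Y \<Longrightarrow> norm (theta_u z) \<le> 3 * exp (- (pi / 4 * Im z))"
    "\<And>z. Im z > Y \<Longrightarrow> 1 / 2 \<le> norm (theta_v z)" "\<And>z. Im z > Y \<Longrightarrow> norm (theta_v z) \<le> 2"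
    by (rule theta_uv_bounds) blast
  have u4: "norm (theta_u z ^ 4) \<le> 81 * exp (- (pi * Im z))" and v4: "norm (theta_v z ^ 4) \<le> 16"
    and iu4: "norm (1 / theta_u z ^ 4) \<le> exp (pi * Im z)" if z: "Im z > Y" for z
  proof -
    have e: "exp (- (pi / 4 * Im z)) ^ 4 = exp (- (pi * Im z))" by (simp flip: exp_of_nat_mult)
    have "norm (theta_u z) ^ 4 \<le> (3 * exp (- (pi / 4 * Im z))) ^ 4" using Y(3)[OF z] by (intro power_mono) auto
    thus "norm (theta_u z ^ 4) \<le> 81 * exp (- (pi * Im z))" unfolding power_mult_distrib e norm_power by simp
    have "norm (theta_v z) ^ 4 \<le> 2 ^ 4" using Y(5)[OF z] by (intro power_mono) auto
    thus "norm (theta_v z ^ 4) \<le> 16" by (simp add: norm_power)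
    have "exp (- (pi / 4 * Im z)) ^ 4 \<le> norm (theta_u z) ^ 4" using Y(2)[OF z] by (intro power_mono) auto
    hence "exp (- (pi * Im z)) \<le> norm (theta_u z ^ 4)" unfolding e norm_power .
    moreover from this have "0 < norm (theta_u z ^ 4)" by (rule less_le_trans[OF exp_gt_zero])
    ultimately have "1 / norm (theta_u z ^ 4) \<le> 1 / exp (- (pi * Im z))"
      by (intro divide_left_mono mult_pos_pos) auto
    thus "norm (1 / theta_u z ^ 4) \<le> exp (pi * Im z)" by (simp add: norm_divide exp_minus field_simps)
  qed
  have growth: "\<exists>Y1 C k. Y1 > 0 \<and> C \<ge> 0 \<and> k \<ge> 0 \<and> (\<forall>z. Im z > Y1 \<longrightarrow> norm (g (act r z)) \<le> C * exp (k * Im z))"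
    if r: "r \<in> cusp_reps" for r
  proof -
    have S: "r \<in> SL2Z" using r cusp_reps_SL2Z by blast
    have "moderate (pullback r (lambda_poly D))"
    proof -
      obtain Y2 C where Y2: "Y2 > 0" "\<And>z. Im z > Y2 \<Longrightarrow> norm (theta_lambda (act r z)) \<le> C * exp (pi * Im z)"
      proof (rule that[OF Y(1), of "81"])
        fix z assume z: "Im z > Y"
        have zu: "z \<in> uhp" using z Y(1) by (simp add: uhp_def)
        have e: "1 \<le> exp (pi * Im z)" "exp (- (pi * Im z)) \<le> 1" using z Y(1) by auto
        consider "r = mat2 1 0 0 1" | "r = mat2 0 (-1) 1 0" | "r = mat2 1 (-1) 1 0"
          using r by (auto simp: cusp_reps_def)
        thus "norm (theta_lambda (act r z)) \<le> 81 * exp (pi * Im z)"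
        proof cases
          case 1
          have "norm (theta_lambda (act r z)) = norm (theta_u z ^ 4)" unfolding 1 theta_lambda_def theta_uv_cusps[OF zu] ..
          thus ?thesis using u4[OF z] e by linarith
        next
          case 2
          have "norm (theta_lambda (act r z)) = norm (theta_v z ^ 4)" unfolding 2 theta_lambda_def theta_uv_cusps[OF zu] ..
          thus ?thesis using v4[OF z] e by linarith
        next
          case 3
          have "norm (theta_lambda (act r z)) = norm (theta_v z ^ 4) * norm (1 / theta_u z ^ 4)"
            unfolding 3 theta_lambda_def theta_uv_cusps[OF zu]
            by (simp add: norm_mult norm_divide norm_power power_mult_distrib power_divide zeta8_4 flip: norm_power)
          also have "\<dots> \<le> 16 * exp (pi * Im z)" by (intro mult_mono u4 v4 iu4 z) auto
          finally show ?thesis using e by linarith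
        qed
      qed
      have L: "(\<lambda>z. theta_lambda (act r z)) meromorphic_on uhp"
        by (rule meromorphic_on_act[OF det_SL2Z_pos[OF S] holomorphic_uhp_imp_meromorphic[OF theta_lambda_holomorphic]])
      have "moderate (mero_of (\<lambda>z. theta_lambda (act r z)))" by (rule moderate_mero_ofI[OF L Y2])
      hence "moderate (\<Sum>i\<le>Polynomial.degree D. const_mero_uhp (Polynomial.coeff D i) * mero_of (\<lambda>z. theta_lambda (act r z)) ^ i)"
        by (intro moderate_sum moderate_mult moderate_const moderate_power)
      also have "(\<Sum>i\<le>Polynomial.degree D. const_mero_uhp (Polynomial.coeff D i) * mero_of (\<lambda>z. theta_lambda (act r z)) ^ i) =
          mero_of (\<lambda>z. \<Sum>i\<le>Polynomial.degree D. Polynomial.coeff D i * theta_lambda (act r z) ^ i)"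
      proof -
        have "(\<Sum>i\<in>A. const_mero_uhp (Polynomial.coeff D i) * mero_of (\<lambda>z. theta_lambda (act r z)) ^ i) =
          mero_of (\<lambda>z. \<Sum>i\<in>A. Polynomial.coeff D i * theta_lambda (act r z) ^ i)" if "finite A" for A
          using that
        proof induction
          case (insert x A)
          thus ?case using L by (simp add: mero_of_const mero_of_power mero_of_mult mero_of_add meromorphic_intros)
        qed (simp add: mero_of_0)
        thus ?thesis by blast
      qed
      also have "\<dots> = pullback r (lambda_poly D)"
        unfolding pullback_mero_of[OF det_SL2Z_pos[OF S] lambda_poly_meromorphic] by (simp only: poly_altdef)
      finally show ?thesis .
    qed
    hence "moderate (pullback r (mero_of g))"
      unfolding D(3)[symmetric] pullback_mult[OF det_SL2Z_pos[OF S]] by (intro moderate_mult mod S)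
    hence "moderate (mero_of (\<lambda>z. g (act r z)))"
      by (simp only: pullback_mero_of[OF det_SL2Z_pos[OF S] holomorphic_uhp_imp_meromorphic[OF D(2)]])
    thus ?thesis
      using moderate_holomorphicE[OF _ holomorphic_act[OF det_SL2Z_pos[OF S] D(2)]] by metis
  qed
  then obtain Y1 C k where Y1: "\<And>r. r \<in> cusp_reps \<Longrightarrow> C r \<ge> 0" "\<And>r. r \<in> cusp_reps \<Longrightarrow> k r \<ge> 0"
    "\<And>r z. r \<in> cusp_reps \<Longrightarrow> Im z > Y1 r \<Longrightarrow> norm (g (act r z)) \<le> C r * exp (k r * Im z)" by metis
  let ?I = "mat2 1 0 0 1 :: real^2^2" and ?S = "mat2 0 (-1) 1 0 :: real^2^2" and ?R = "mat2 1 (-1) 1 0 :: real^2^2"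
  have reps: "?I \<in> cusp_reps" "?S \<in> cusp_reps" "?R \<in> cusp_reps" by (auto simp: cusp_reps_def)
  \<comment> \<open>One exponent for all three cusps: growth rates are measured in multiples of pi,
    because exp (pi Im z) is the inverse modulus of the nome.\<close>
  define n where "n = nat \<lceil>max (k ?I) (max (k ?S) (k ?R)) / pi\<rceil>"
  have n: "k r \<le> n * pi" if "r \<in> {?I, ?S, ?R}" for r
  proof -
    have "max (k ?I) (max (k ?S) (k ?R)) / pi \<le> n" unfolding n_def by linarith
    hence "max (k ?I) (max (k ?S) (k ?R)) \<le> n * pi" by (simp add: pos_divide_le_eq)
    moreover have "k r \<le> max (k ?I) (max (k ?S) (k ?R))" using that by auto
    ultimately show ?thesis by linarith
  qed
  have gb: "norm (g (act r z)) \<le> C r * exp (pi * Im z) ^ n" if "r \<in> {?I, ?S, ?R}" "Im z > max Y (Y1 r)" for r z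
  proof -
    have r: "r \<in> cusp_reps" using that(1) reps by auto
    have "norm (g (act r z)) \<le> C r * exp (k r * Im z)" using Y1(3)[OF r, of z] that(2) by simp
    also have "k r * Im z \<le> (n * pi) * Im z" using that Y(1) n[OF that(1)] by (intro mult_right_mono) auto
    hence "C r * exp (k r * Im z) \<le> C r * exp ((n * pi) * Im z)" using Y1(1)[OF r] by (intro mult_left_mono) auto
    also have "exp ((n * pi) * Im z) = exp (pi * Im z) ^ n" by (simp add: mult.assoc flip: exp_of_nat_mult)
    finally show ?thesis .
  qed
  define g1 where "g1 = (\<lambda>z. g z * (theta_lambda z * (1 - theta_lambda z)) ^ n)"
  have lam1: "1 - theta_lambda z = theta_v z ^ 4" if "z \<in> uhp" for z using theta_v_power4[OF that] by simp
  have "\<exists>P. \<forall>z\<in>uhp. g1 z = poly P (theta_lambda z)"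
  \<comment> \<open>At the third cusp g contributes a pole of order at most n, and each factor
    lambda (1 - lambda) a double pole.\<close>
  proof (rule gamma2_polynomial[where n = "3 * n"])
    show "g1 holomorphic_on uhp" unfolding g1_def by (intro holomorphic_intros D(2) theta_lambda_holomorphic)
    show "g1 (act N z) = g1 z" if "N \<in> Gamma2" "z \<in> uhp" for N z
      unfolding g1_def ginv[OF that] theta_lambda_gamma2[OF that] ..
    have uv: "norm (g (act r z) * (theta_u z ^ 4 * theta_v z ^ 4) ^ n) \<le> C r * (81 * 16) ^ n"
      if "r \<in> {?I, ?S, ?R}" "Im z > max Y (Y1 r)" for r z
    proof -
      have z: "Im z > Y" using that(2) by simp
      have "norm (g (act r z) * (theta_u z ^ 4 * theta_v z ^ 4) ^ n) =
        norm (g (act r z)) * (norm (theta_u z ^ 4) * norm (theta_v z ^ 4)) ^ n"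
        by (simp only: norm_mult norm_power)
      also have "\<dots> \<le> (C r * exp (pi * Im z) ^ n) * ((81 * exp (- (pi * Im z))) * 16) ^ n"
        using gb[OF that] by (intro mult_mono power_mono u4 v4 z) (auto intro: order_trans[OF norm_ge_zero])
      also have "\<dots> = C r * (81 * 16) ^ n * (exp (pi * Im z) * exp (- (pi * Im z))) ^ n"
        by (simp add: power_mult_distrib)
      also have "exp (pi * Im z) * exp (- (pi * Im z)) = 1" by (simp flip: exp_add)
      finally show ?thesis by simp
    qed
    show "\<exists>Y B. \<forall>z. Im z > Y \<longrightarrow> norm (g1 (act ?I z)) \<le> B"
    proof (intro exI allI impI)
      fix z assume z: "Im z > max Y (Y1 ?I)"
      hence zu: "z \<in> uhp" using Y(1) by (simp add: uhp_def)
      have "theta_lambda (act ?I z) * (1 - theta_lambda (act ?I z)) = theta_u z ^ 4 * theta_v z ^ 4"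
        unfolding lam1[OF SL2Z_act_uhp[OF subsetD[OF cusp_reps_SL2Z reps(1)] zu]]
        unfolding theta_lambda_def theta_uv_cusps[OF zu] ..
      thus "norm (g1 (act ?I z)) \<le> C ?I * (81 * 16) ^ n"
        using uv[of ?I z] z unfolding g1_def by simp
    qed
    show "\<exists>Y B. \<forall>z. Im z > Y \<longrightarrow> norm (g1 (act ?S z)) \<le> B"
    proof (intro exI allI impI)
      fix z assume z: "Im z > max Y (Y1 ?S)"
      hence zu: "z \<in> uhp" using Y(1) by (simp add: uhp_def)
      have "theta_lambda (act ?S z) * (1 - theta_lambda (act ?S z)) = theta_u z ^ 4 * theta_v z ^ 4"
        unfolding lam1[OF SL2Z_act_uhp[OF subsetD[OF cusp_reps_SL2Z reps(2)] zu]]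
        unfolding theta_lambda_def theta_uv_cusps[OF zu] by (rule mult.commute)
      thus "norm (g1 (act ?S z)) \<le> C ?S * (81 * 16) ^ n"
        using uv[of ?S z] z unfolding g1_def by simp
    qed
    show "\<exists>Y B. \<forall>z. Im z > Y \<longrightarrow> norm (g1 (act ?R z) * nome z ^ (3 * n)) \<le> B"
    proof (intro exI allI impI)
      fix z assume z: "Im z > max Y (Y1 ?R)"
      hence zu: "z \<in> uhp" and zY: "Im z > Y" using Y(1) by (simp_all add: uhp_def)
      have eq: "theta_lambda (act ?R z) * (1 - theta_lambda (act ?R z)) = - (theta_v z ^ 4 * (1 / theta_u z ^ 4) * (1 / theta_u z ^ 4))"
        unfolding lam1[OF SL2Z_act_uhp[OF subsetD[OF cusp_reps_SL2Z reps(3)] zu]]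
        unfolding theta_lambda_def theta_uv_cusps[OF zu]
        by (simp add: power_mult_distrib power_divide zeta8_4)
      have nz: "norm (nome z ^ (3 * n)) = (exp (- (pi * Im z)) * exp (- (pi * Im z)) * exp (- (pi * Im z))) ^ n"
        by (simp add: norm_power norm_mult norm_nome_eq power_mult power3_eq_cube)
      have "norm (g1 (act ?R z) * nome z ^ (3 * n)) = norm (g (act ?R z)) *
         (norm (theta_v z ^ 4) * norm (1 / theta_u z ^ 4) * norm (1 / theta_u z ^ 4)) ^ n * norm (nome z ^ (3 * n))"
        unfolding g1_def eq norm_mult norm_power norm_minus_cancel ..
      also have "\<dots> \<le> (C ?R * exp (pi * Im z) ^ n) * (16 * exp (pi * Im z) * exp (pi * Im z)) ^ n * norm (nome z ^ (3 * n))"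
        using gb[of ?R z] z
        by (intro mult_mono mult_right_mono power_mono v4 iu4 zY) (auto intro: order_trans[OF norm_ge_zero])
      also have "\<dots> = C ?R * 16 ^ n * ((exp (pi * Im z) * exp (- (pi * Im z))) * (exp (pi * Im z) * exp (- (pi * Im z))) * (exp (pi * Im z) * exp (- (pi * Im z)))) ^ n"
        unfolding nz by (simp only: power_mult_distrib mult_ac)
      also have "exp (pi * Im z) * exp (- (pi * Im z)) = 1" by (simp flip: exp_add)
      finally show "norm (g1 (act ?R z) * nome z ^ (3 * n)) \<le> C ?R * 16 ^ n" by simp
    qed
  qed
  then obtain P where P: "\<And>z. z \<in> uhp \<Longrightarrow> g1 z = poly P (theta_lambda z)" by blast
  define D' where "D' = ([:0, 1:] * [:1, -1:]) ^ n * D"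
  have "lambda_poly D' * F = lambda_poly (([:0, 1:] * [:1, -1:]) ^ n) * mero_of g"
    unfolding D'_def lambda_poly_mult mult.assoc D(3) ..
  also have "\<dots> = mero_of (\<lambda>z. poly (([:0, 1:] * [:1, -1:]) ^ n) (theta_lambda z) * g z)"
    by (rule mero_of_mult[OF lambda_poly_meromorphic holomorphic_uhp_imp_meromorphic[OF D(2)]])
  also have "\<dots> = lambda_poly P"
  proof (rule mero_of_eqI)
    show "(\<lambda>z. poly (([:0, 1:] * [:1, -1:]) ^ n) (theta_lambda z) * g z) meromorphic_on uhp"
      by (intro meromorphic_on_mult lambda_poly_meromorphic holomorphic_uhp_imp_meromorphic[OF D(2)])
    fix z assume "z \<in> uhp"
    thus "poly (([:0, 1:] * [:1, -1:]) ^ n) (theta_lambda z) * g z = poly P (theta_lambda z)"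
      using P[of z] by (simp add: g1_def mult.commute)
  qed
  finally show ?thesis by (rule that[rotated]) (use D(1) in \<open>simp add: D'_def\<close>)
qed

subsection \<open>Functions of level 8\<close>

definition theta_U :: mero_uhp where "theta_U = mero_of theta_u"
definition theta_V :: mero_uhp where "theta_V = mero_of theta_v"

lemmas theta_u_meromorphic = holomorphic_uhp_imp_meromorphic[OF theta_u_holomorphic]
lemmas theta_v_meromorphic = holomorphic_uhp_imp_meromorphic[OF theta_v_holomorphic]

lemma theta_UV_nonzero: "theta_U \<noteq> 0" "theta_V \<noteq> 0"
proof -
  have i: "\<i> \<in> uhp" by (simp add: uhp_def)
  show "theta_U \<noteq> 0"
    using mero_of_eqD[OF theta_u_holomorphic holomorphic_on_const _ i, of 0] theta_u_nonzero[OF i]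
    by (auto simp: theta_U_def mero_of_0)
  show "theta_V \<noteq> 0"
    using mero_of_eqD[OF theta_v_holomorphic holomorphic_on_const _ i, of 0] theta_v_nonzero[OF i]
    by (auto simp: theta_V_def mero_of_0)
qed

lemma theta_UV_jacobi: "theta_U ^ 4 + theta_V ^ 4 = 1"
  unfolding theta_U_def theta_V_def mero_of_power[OF theta_u_meromorphic] mero_of_power[OF theta_v_meromorphic] mero_of_1
  by (subst mero_of_add)
     (auto intro!: mero_of_eqI theta_uv_jacobi meromorphic_intros theta_u_meromorphic theta_v_meromorphic)

lemma pullback_theta_UV:
  assumes "det M > 0"
  shows "pullback M theta_U = mero_of (\<lambda>z. theta_u (act M z))" "pullback M theta_V = mero_of (\<lambda>z. theta_v (act M z))"
  unfolding theta_U_def theta_V_def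
  by (rule pullback_mero_of[OF assms theta_u_meromorphic] pullback_mero_of[OF assms theta_v_meromorphic])+

lemma mero_of_cmult: "f meromorphic_on uhp \<Longrightarrow> const_mero_uhp c * mero_of f = mero_of (\<lambda>z. c * f z)"
  unfolding mero_of_const by (rule mero_of_mult[OF meromorphic_on_const])

lemma pullback_gamma2_theta_UV:
  assumes "a * d - 4 * b * c = 1"
  shows "pullback (gamma2_mat a b c d) theta_U = const_mero_uhp (\<i> powi (a * b)) * theta_U"
    "pullback (gamma2_mat a b c d) theta_V = const_mero_uhp (\<i> powi (- (c * d))) * theta_V"
proof -
  have det: "det (gamma2_mat a b c d) > 0" using det_gamma2_mat[OF assms] by simp
  show "pullback (gamma2_mat a b c d) theta_U = const_mero_uhp (\<i> powi (a * b)) * theta_U"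
    unfolding pullback_theta_UV[OF det] unfolding theta_U_def mero_of_cmult[OF theta_u_meromorphic]
    by (rule mero_of_eqI)
       (use meromorphic_on_act[OF det theta_u_meromorphic] theta_uv_gamma2_mat[OF assms] in auto)
  show "pullback (gamma2_mat a b c d) theta_V = const_mero_uhp (\<i> powi (- (c * d))) * theta_V"
    unfolding pullback_theta_UV[OF det] unfolding theta_V_def mero_of_cmult[OF theta_v_meromorphic]
    by (rule mero_of_eqI)
       (use meromorphic_on_act[OF det theta_v_meromorphic] theta_uv_gamma2_mat[OF assms] in auto)
qed

lemma pullback_cusps_theta_UV:
  "pullback (mat2 1 0 0 1) theta_U = theta_U" "pullback (mat2 1 0 0 1) theta_V = theta_V"
  "pullback (mat2 0 (-1) 1 0) theta_U = theta_V" "pullback (mat2 0 (-1) 1 0) theta_V = theta_U"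
  "pullback (mat2 1 (-1) 1 0) theta_U = const_mero_uhp zeta8 * theta_V * inverse theta_U"
  "pullback (mat2 1 (-1) 1 0) theta_V = inverse theta_U"
proof -
  have det: "det (mat2 1 0 0 1) > 0" "det (mat2 0 (-1) 1 0) > 0" "det (mat2 1 (-1) 1 0) > 0"
    by (simp_all add: det_mat2)
  note m = meromorphic_on_act[OF det(1)] meromorphic_on_act[OF det(2)] meromorphic_on_act[OF det(3)]
    theta_u_meromorphic theta_v_meromorphic
  show "pullback (mat2 1 0 0 1) theta_U = theta_U" "pullback (mat2 1 0 0 1) theta_V = theta_V"
    "pullback (mat2 0 (-1) 1 0) theta_U = theta_V" "pullback (mat2 0 (-1) 1 0) theta_V = theta_U"
    unfolding pullback_theta_UV[OF det(1)] pullback_theta_UV[OF det(2)]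
    unfolding theta_U_def theta_V_def by (intro mero_of_eqI m theta_uv_cusps; assumption)+
  have "const_mero_uhp zeta8 * theta_V * inverse theta_U = mero_of (\<lambda>z. zeta8 * theta_v z * inverse (theta_u z))"
    unfolding theta_U_def theta_V_def mero_of_cmult[OF theta_v_meromorphic] mero_of_inverse[OF theta_u_meromorphic]
    by (rule mero_of_mult) (intro meromorphic_intros m)+
  thus "pullback (mat2 1 (-1) 1 0) theta_U = const_mero_uhp zeta8 * theta_V * inverse theta_U"
    unfolding pullback_theta_UV[OF det(3)]
    using theta_uv_cusps(5) by (auto intro!: mero_of_eqI m simp: divide_inverse)
  show "pullback (mat2 1 (-1) 1 0) theta_V = inverse theta_U"
    unfolding pullback_theta_UV[OF det(3)] theta_U_def mero_of_inverse[OF theta_u_meromorphic]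
    using theta_uv_cusps(6) by (auto intro!: mero_of_eqI m simp: divide_inverse)
qed

lemma pullback_T_theta_UV:
  "pullback (T_mat 1) theta_U = const_mero_uhp zeta8 * theta_U * inverse theta_V"
  "pullback (T_mat 1) theta_V = inverse theta_V"
proof -
  have det: "det (T_mat 1) > 0" by simp
  note m = meromorphic_on_act[OF det] theta_u_meromorphic theta_v_meromorphic
  have "const_mero_uhp zeta8 * theta_U * inverse theta_V = mero_of (\<lambda>z. zeta8 * theta_u z * inverse (theta_v z))"
    unfolding theta_U_def theta_V_def mero_of_cmult[OF theta_u_meromorphic] mero_of_inverse[OF theta_v_meromorphic]
    by (rule mero_of_mult) (intro meromorphic_intros m)+
  thus "pullback (T_mat 1) theta_U = const_mero_uhp zeta8 * theta_U * inverse theta_V"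
    unfolding pullback_theta_UV[OF det]
    using theta_u_add_1 m(1)[OF m(2)] by (auto intro!: mero_of_eqI simp: divide_inverse)
  show "pullback (T_mat 1) theta_V = inverse theta_V"
    unfolding pullback_theta_UV[OF det]
    unfolding theta_V_def mero_of_inverse[OF theta_v_meromorphic]
    using theta_v_add_1 m(1)[OF m(3)] by (auto intro!: mero_of_eqI simp: divide_inverse)
qed

text \<open>Moderate growth of a function says nothing about its inverse. These units are moderate
  together with their inverses, and they are permuted by \<open>SL2Z\<close>, so an eigenfunction
  can be divided by them at every cusp.\<close>

inductive_set theta_monomials :: "mero_uhp set" where
  const: "c \<noteq> 0 \<Longrightarrow> const_mero_uhp c \<in> theta_monomials"
| U: "theta_U \<in> theta_monomials"
| V: "theta_V \<in> theta_monomials"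
| mult: "F \<in> theta_monomials \<Longrightarrow> G \<in> theta_monomials \<Longrightarrow> F * G \<in> theta_monomials"
| inverse: "F \<in> theta_monomials \<Longrightarrow> inverse F \<in> theta_monomials"

lemma theta_monomials_power: "F \<in> theta_monomials \<Longrightarrow> F ^ n \<in> theta_monomials"
  by (induction n) (use theta_monomials.const[of 1] theta_monomials.mult in \<open>auto simp: const_mero_uhp_1\<close>)

lemma theta_monomials_moderate:
  assumes "F \<in> theta_monomials"
  shows "moderate F \<and> moderate (inverse F)"
proof -
  obtain Y where Y: "Y > 0"
    "\<And>z. Im z > Y \<Longrightarrow> exp (- (pi / 4 * Im z)) \<le> norm (theta_u z)"
    "\<And>z. Im z > Y \<Longrightarrow> norm (theta_u z) \<le> 3 * exp (- (pi / 4 * Im z))"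
    "\<And>z. Im z > Y \<Longrightarrow> 1 / 2 \<le> norm (theta_v z)" "\<And>z. Im z > Y \<Longrightarrow> norm (theta_v z) \<le> 2"
    by (rule theta_uv_bounds) blast
  have iu: "norm (inverse (theta_u z)) \<le> 1 * exp (pi / 4 * Im z)" if "Im z > Y" for z
  proof -
    have "inverse (norm (theta_u z)) \<le> inverse (exp (- (pi / 4 * Im z)))"
      by (rule le_imp_inverse_le[OF Y(2)[OF that]]) simp
    thus ?thesis by (simp add: norm_inverse exp_minus)
  qed
  have iv: "norm (inverse (theta_v z)) \<le> 2 * exp (0 * Im z)" if "Im z > Y" for z
  proof -
    have "inverse (norm (theta_v z)) \<le> inverse (1 / 2)"
      by (rule le_imp_inverse_le[OF Y(4)[OF that]]) simp
    thus ?thesis by (simp add: norm_inverse)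
  qed
  have "moderate theta_U"
    unfolding theta_U_def by (rule moderate_mero_ofI[OF theta_u_meromorphic Y(1), of 3 "- (pi / 4)"]) (use Y(3) in simp)
  moreover have "moderate (inverse theta_U)"
    unfolding theta_U_def mero_of_inverse[OF theta_u_meromorphic]
    by (rule moderate_mero_ofI[OF meromorphic_on_inverse[OF theta_u_meromorphic] Y(1) iu])
  moreover have "moderate theta_V"
    unfolding theta_V_def by (rule moderate_mero_ofI[OF theta_v_meromorphic Y(1), of 2 0]) (use Y(5) in simp)
  moreover have "moderate (inverse theta_V)"
    unfolding theta_V_def mero_of_inverse[OF theta_v_meromorphic]
    by (rule moderate_mero_ofI[OF meromorphic_on_inverse[OF theta_v_meromorphic] Y(1) iv])
  ultimately have UV: "moderate theta_U" "moderate (inverse theta_U)" "moderate theta_V" "moderate (inverse theta_V)"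
    by blast+
  show ?thesis using assms
    by (induction rule: theta_monomials.induct)
       (use UV in \<open>auto intro: moderate_mult moderate_const simp flip: const_mero_uhp_inverse\<close>)
qed

lemma theta_monomials_closed:
  assumes det: "det M > 0" and UV: "pullback M theta_U \<in> theta_monomials" "pullback M theta_V \<in> theta_monomials"
    and F: "F \<in> theta_monomials"
  shows "pullback M F \<in> theta_monomials"
  using F by induction
    (use UV in \<open>auto simp: pullback_const pullback_mult pullback_inverse det intro: theta_monomials.intros\<close>)

text \<open>By \<open>SL2Z_coset\<close> the action is checked on \<open>Gamma2\<close>, on the
  representatives and on translations; odd translations are an element of \<open>Gamma2\<close>
  followed by translation by 1.\<close>

lemma theta_monomials_pullback:
  assumes M: "M \<in> SL2Z" and F: "F \<in> theta_monomials"
  shows "pullback M F \<in> theta_monomials"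
proof -
  obtain N r k where Nrk: "N \<in> Gamma2" "r \<in> cusp_reps" "M = N ** r ** T_mat k" by (rule SL2Z_coset[OF M])
  have S: "N \<in> SL2Z" "r \<in> SL2Z" using Nrk Gamma2_SL2Z cusp_reps_SL2Z by auto
  from Nrk(1) obtain a b c d where N: "N = gamma2_mat a b c d" "a * d - 4 * b * c = 1"
    by (auto simp: Gamma2_def)
  have c: "const_mero_uhp (\<i> powi n) \<in> theta_monomials" "const_mero_uhp zeta8 \<in> theta_monomials" for n
    by (auto intro!: theta_monomials.const simp: zeta8_nonzero)
  have 1: "pullback N G \<in> theta_monomials" if "G \<in> theta_monomials" for G
    by (rule theta_monomials_closed[OF det_SL2Z_pos[OF S(1)] _ _ that])
       (auto simp: N pullback_gamma2_theta_UV[OF N(2)] intro!: theta_monomials.intros(2-) c)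
  have 2: "pullback r G \<in> theta_monomials" if "G \<in> theta_monomials" for G
    by (rule theta_monomials_closed[OF det_SL2Z_pos[OF S(2)] _ _ that])
       (use Nrk(2) in \<open>auto simp: cusp_reps_def pullback_cusps_theta_UV intro!: theta_monomials.intros(2-) c\<close>)
  have T2: "pullback (T_mat (2 * k)) G \<in> theta_monomials" if "G \<in> theta_monomials" for G k
  proof (rule theta_monomials_closed[OF det_SL2Z_pos[OF T_mat_SL2Z] _ _ that])
    have eq: "T_mat (2 * k) = gamma2_mat 1 k 0 1" by (simp add: T_mat_def gamma2_mat_def)
    show "pullback (T_mat (2 * k)) theta_U \<in> theta_monomials" "pullback (T_mat (2 * k)) theta_V \<in> theta_monomials"
      unfolding eq using pullback_gamma2_theta_UV[of 1 1 k 0] by (auto intro!: theta_monomials.intros(2-) theta_monomials.const c)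
  qed
  have T1: "pullback (T_mat 1) G \<in> theta_monomials" if "G \<in> theta_monomials" for G
    by (rule theta_monomials_closed[OF det_SL2Z_pos[OF T_mat_SL2Z] _ _ that])
       (auto simp: pullback_T_theta_UV intro!: theta_monomials.intros(2-) c)
  have T: "pullback (T_mat k) G \<in> theta_monomials" if "G \<in> theta_monomials" for G
  proof (cases "even k")
    case True
    thus ?thesis using T2[OF that] by (auto elim!: evenE)
  next
    case False
    then obtain l where l: "k = 2 * l + 1" by (auto elim: oddE)
    have "T_mat k = T_mat (2 * l) ** T_mat 1" by (simp add: l T_mat_def mat2_mult add.commute)
    thus ?thesis
      using T1[OF T2[OF that, of l]]
      by (simp add: pullback_pullback[OF det_SL2Z_pos[OF T_mat_SL2Z] det_SL2Z_pos[OF T_mat_SL2Z]])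
  qed
  have "pullback M F = pullback (T_mat k) (pullback r (pullback N F))"
    unfolding Nrk(3)
    by (simp add: pullback_pullback det_SL2Z_pos S T_mat_SL2Z SL2Z_mult)
  thus ?thesis using T[OF 2[OF 1[OF F]]] by simp
qed

section \<open>The conjugate of \<open>Gamma0 64\<close> by scaling with 8, and its
  functions\<close>

definition Gamma8 :: "(real^2^2) set" where
  "Gamma8 = {gamma2_mat a (4 * b) (4 * c) d |a b c d. a * d - 64 * b * c = 1}"

lemma Gamma8_I:
  assumes "a * d - b * c = 1" "8 dvd b" "8 dvd c"
  shows "mat2 (of_int a) (of_int b) (of_int c) (of_int d) \<in> Gamma8"
proof -
  from assms(2,3) obtain b' c' where bc: "b = 8 * b'" "c = 8 * c'" by (auto elim!: dvdE)
  have "mat2 (of_int a) (of_int b) (of_int c) (of_int d) = gamma2_mat a (4 * b') (4 * c') d"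
    by (simp add: gamma2_mat_def bc)
  moreover have "a * d - 64 * b' * c' = 1" using assms(1) bc by simp
  ultimately show ?thesis unfolding Gamma8_def by blast
qed

text \<open>Odd squares are 1 modulo 8, so every unit modulo 8 is its own inverse and
  \<open>a * d\<close> congruent to 1 forces d congruent to a. The matrices are thus scalar modulo
  8.\<close>

lemma Gamma8_E:
  assumes "N \<in> Gamma8"
  obtains a b c d where "N = mat2 (of_int a) (of_int (8 * b)) (of_int (8 * c)) (of_int d)" "a * d - 64 * b * c = 1"
    "8 dvd (d - a)"
proof -
  from assms obtain a b c d where N: "N = gamma2_mat a (4 * b) (4 * c) d" and det: "a * d - 64 * b * c = 1"
    by (auto simp: Gamma8_def)
  have "odd a"
  proof
    assume "even a"
    hence "even (a * d - 64 * b * c)" by simp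
    thus False using det by simp
  qed
  then obtain m where m: "a = 2 * m + 1" by (auto elim: oddE)
  have "even (m * (m + 1))" by simp
  then obtain l where "m * (m + 1) = 2 * l" by (elim evenE)
  hence "a * a = 8 * l + 1" unfolding m by (simp add: algebra_simps)
  hence "a * (d - a) = 8 * (8 * b * c - l)" using det by (simp add: algebra_simps)
  hence "8 dvd a * (d - a)" by simp
  moreover have "coprime 8 a"
  proof -
    have "coprime ((2::int) ^ 3) a" using \<open>odd a\<close> by (simp only: coprime_power_left_iff) simp
    thus ?thesis by simp
  qed
  ultimately have "8 dvd (d - a)" by (simp add: coprime_dvd_mult_right_iff)
  thus ?thesis using that[of a b c d] N det by (simp add: gamma2_mat_def)
qed

lemma Gamma8_SL2Z: "Gamma8 \<subseteq> SL2Z"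
  using gamma2_mat_SL2Z by (auto simp: Gamma8_def)

text \<open>Being scalar modulo 8 is unaffected by conjugation: the off-diagonal entries of M N M^-1
  combine b, c and (d - a) / 8 with a common factor 8.\<close>

lemma Gamma8_normal:
  assumes M: "M \<in> SL2Z" and N: "N \<in> Gamma8"
  obtains N' where "N' \<in> Gamma8" "M ** N = N' ** M"
proof -
  from SL2Z_E[OF M] obtain p q r s :: int
    where M': "M = mat2 (of_int p) (of_int q) (of_int r) (of_int s)" and det: "p * s - q * r = 1" .
  from Gamma8_E[OF N] obtain a b c d where N': "N = mat2 (of_int a) (of_int (8 * b)) (of_int (8 * c)) (of_int d)"
    "a * d - 64 * b * c = 1" "8 dvd (d - a)" .
  from N'(3) obtain k where k: "d = a + 8 * k" by (auto elim!: dvdE simp: algebra_simps)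
  let ?e11 = "(p * a + 8 * q * c) * s - (8 * p * b + q * d) * r"
  let ?e12 = "(8 * p * b + q * d) * p - (p * a + 8 * q * c) * q"
  let ?e21 = "(r * a + 8 * s * c) * s - (8 * r * b + s * d) * r"
  let ?e22 = "(8 * r * b + s * d) * p - (r * a + 8 * s * c) * q"
  have "?e11 * ?e22 - ?e12 * ?e21 = (p * s - q * r) * (p * s - q * r) * (a * d - 64 * b * c)"
    by (simp add: algebra_simps)
  hence 1: "?e11 * ?e22 - ?e12 * ?e21 = 1" unfolding det N'(2) by simp
  have "?e12 = 8 * (p * q * k + p * p * b - q * q * c)" "?e21 = 8 * (s * s * c - r * s * k - r * r * b)"
    unfolding k by (simp_all add: algebra_simps)
  hence 2: "8 dvd ?e12" "8 dvd ?e21" by (simp_all only: dvd_triv_left)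
  have id: "?e11 * p + ?e12 * r = (p * s - q * r) * (p * a + 8 * q * c)"
    "?e11 * q + ?e12 * s = (p * s - q * r) * (8 * p * b + q * d)"
    "?e21 * p + ?e22 * r = (p * s - q * r) * (r * a + 8 * s * c)"
    "?e21 * q + ?e22 * s = (p * s - q * r) * (8 * r * b + s * d)"
    by (simp_all add: algebra_simps)
  have "M ** N = mat2 (of_int (p * a + 8 * q * c)) (of_int (8 * p * b + q * d))
      (of_int (r * a + 8 * s * c)) (of_int (8 * r * b + s * d))"
    by (simp add: M' N'(1) mat2_mult mult_ac)
  also have "\<dots> = mat2 (of_int (?e11 * p + ?e12 * r)) (of_int (?e11 * q + ?e12 * s))
      (of_int (?e21 * p + ?e22 * r)) (of_int (?e21 * q + ?e22 * s))"
    unfolding id det by simp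
  also have "\<dots> = mat2 (of_int ?e11) (of_int ?e12) (of_int ?e21) (of_int ?e22) ** M"
    unfolding M' mat2_mult of_int_mult of_int_add ..
  finally show ?thesis using that Gamma8_I[OF 1 2] by blast
qed

definition level8_functions :: "mero_uhp set" where
  "level8_functions = {F. (\<forall>N\<in>Gamma8. pullback N F = F) \<and> (\<forall>M\<in>SL2Z. moderate (pullback M F))}"

lemma level8_pullback:
  assumes M: "M \<in> SL2Z" and F: "F \<in> level8_functions"
  shows "pullback M F \<in> level8_functions"
proof -
  have "pullback N (pullback M F) = pullback M F" if N: "N \<in> Gamma8" for N
  proof -
    obtain N' where N': "N' \<in> Gamma8" "M ** N = N' ** M" by (rule Gamma8_normal[OF M N])
    have S: "N \<in> SL2Z" "N' \<in> SL2Z" using N N'(1) Gamma8_SL2Z by auto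
    have "pullback N (pullback M F) = pullback M (pullback N' F)"
      by (simp add: pullback_pullback det_SL2Z_pos M S N'(2))
    thus ?thesis using F N'(1) by (simp add: level8_functions_def)
  qed
  moreover have "moderate (pullback N (pullback M F))" if "N \<in> SL2Z" for N
    using F SL2Z_mult[OF M that] by (simp add: pullback_pullback det_SL2Z_pos M that level8_functions_def)
  ultimately show ?thesis by (simp add: level8_functions_def)
qed

lemma level8_add: "F \<in> level8_functions \<Longrightarrow> G \<in> level8_functions \<Longrightarrow> F + G \<in> level8_functions"
  using Gamma8_SL2Z
  by (auto simp: level8_functions_def pullback_add det_SL2Z_pos subset_iff intro!: moderate_add)

lemma level8_mult: "F \<in> level8_functions \<Longrightarrow> G \<in> level8_functions \<Longrightarrow> F * G \<in> level8_functions"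
  using Gamma8_SL2Z
  by (auto simp: level8_functions_def pullback_mult det_SL2Z_pos subset_iff intro!: moderate_mult)

lemma level8_const: "const_mero_uhp c \<in> level8_functions"
  using Gamma8_SL2Z
  by (auto simp: level8_functions_def pullback_const det_SL2Z_pos subset_iff moderate_const)

lemma Gamma8_theta_UV:
  assumes "N \<in> Gamma8"
  shows "pullback N theta_U = theta_U" "pullback N theta_V = theta_V"
proof -
  from assms obtain a b c d where N: "N = gamma2_mat a (4 * b) (4 * c) d" and det: "a * d - 4 * (4 * b) * (4 * c) = 1"
    by (auto simp: Gamma8_def)
  have "\<i> powi (a * (4 * b)) = 1" "\<i> powi (- ((4 * c) * d)) = 1"
    using ii_powi_add4[of 0 "a * b"] ii_powi_add4[of 0 "- (c * d)"] by (simp_all add: mult_ac)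
  thus "pullback N theta_U = theta_U" "pullback N theta_V = theta_V"
    using pullback_gamma2_theta_UV[OF det] by (simp_all add: N const_mero_uhp_1)
qed

lemma level8_theta_UV: "theta_U \<in> level8_functions" "theta_V \<in> level8_functions"
  "inverse theta_U \<in> level8_functions" "inverse theta_V \<in> level8_functions"
  using theta_monomials_moderate[OF theta_monomials_pullback]  Gamma8_SL2Z
  by (auto simp: level8_functions_def Gamma8_theta_UV pullback_inverse det_SL2Z_pos subset_iff intro: theta_monomials.intros)

section \<open>The quotient of \<open>Gamma2\<close> by \<open>Gamma8\<close> and its
  eigenfunctions\<close>

definition L_mat :: "int \<Rightarrow> real^2^2" where "L_mat k = mat2 1 0 (of_int (2 * k)) 1"

lemma T_mat_gamma2: "T_mat (2 * k) = gamma2_mat 1 k 0 1"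
  by (simp add: T_mat_def gamma2_mat_def)

lemma L_mat_gamma2: "L_mat k = gamma2_mat 1 0 k 1"
  by (simp add: L_mat_def gamma2_mat_def)

lemma L_mat_SL2Z: "L_mat k \<in> SL2Z"
  unfolding L_mat_gamma2 by (rule gamma2_mat_SL2Z) simp

text \<open>The quotient of \<open>Gamma2\<close> by \<open>Gamma8\<close> is generated by two commuting elements of order 4.\<close>

lemma Gamma2_coset:
  assumes "N \<in> Gamma2"
  obtains N' m n where "N' \<in> Gamma8" "N = N' ** T_mat (2 * m) ** L_mat n"
proof -
  from assms obtain a b c d where N: "N = gamma2_mat a b c d" and det: "a * d - 4 * b * c = 1"
    by (auto simp: Gamma2_def)
  have odd_sq: "\<exists>k. x * x = 4 * k + 1" if "odd x" for x :: int
  proof -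
    from that obtain l where "x = 2 * l + 1" by (elim oddE)
    hence "x * x = 4 * (l * l + l) + 1" by (simp add: algebra_simps)
    thus ?thesis by blast
  qed
  \<comment> \<open>The odd numbers d and a' are their own inverses modulo 4, so n = c d clears the
    lower left entry modulo 8 and afterwards m = b a' clears the upper right one.\<close>
  define n where "n = c * d"
  define a' where "a' = a - 4 * b * n"
  define m where "m = b * a'"
  define c' where "c' = c - d * n"
  have "odd (a * d - 4 * b * c)" unfolding det by simp
  hence "odd a" "odd d" by auto
  hence "odd a'" by (simp add: a'_def)
  obtain k where k: "d * d = 4 * k + 1" using odd_sq[OF \<open>odd d\<close>] by blast
  obtain l where l: "a' * a' = 4 * l + 1" using odd_sq[OF \<open>odd a'\<close>] by blast
  have "c' = c * (1 - d * d)" by (simp add: c'_def n_def algebra_simps)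
  hence c': "c' = 4 * (- c * k)" unfolding k by (simp add: algebra_simps)
  have "b - m * a' = b * (1 - a' * a')" by (simp add: m_def algebra_simps)
  hence b': "b - m * a' = 4 * (- b * l)" unfolding l by (simp add: algebra_simps)
  define N' where "N' = mat2 (of_int a') (of_int (2 * (b - m * a'))) (of_int (2 * c')) (of_int (d - 4 * m * c'))"
  have "N' \<in> Gamma8" unfolding N'_def
  proof (rule Gamma8_I)
    have "a' * (d - 4 * m * c') - 2 * (b - m * a') * (2 * c') = a * d - 4 * b * c"
      by (simp add: a'_def c'_def algebra_simps)
    thus "a' * (d - 4 * m * c') - 2 * (b - m * a') * (2 * c') = 1" unfolding det .
    show "8 dvd 2 * (b - m * a')" "8 dvd 2 * c'" unfolding b' c' by (simp_all add: mult.assoc[symmetric])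
  qed
  moreover have "N = N' ** T_mat (2 * m) ** L_mat n"
    by (simp add: N N'_def gamma2_mat_def T_mat_def L_mat_def mat2_mult a'_def c'_def algebra_simps)
  ultimately show ?thesis by (rule that)
qed

lemma pullback_T_mat_L_mat_fixed:
  assumes "pullback (T_mat 2) F = F" "pullback (L_mat 1) F = F"
  shows "pullback (T_mat (2 * k)) F = F" "pullback (L_mat k) F = F"
proof -
  note pp = pullback_pullback[OF det_SL2Z_pos[OF T_mat_SL2Z] det_SL2Z_pos[OF T_mat_SL2Z], symmetric]
    pullback_pullback[OF det_SL2Z_pos[OF L_mat_SL2Z] det_SL2Z_pos[OF L_mat_SL2Z], symmetric]
  have one: "T_mat 0 = mat 1" "L_mat 0 = mat 1"
    unfolding T_mat_def L_mat_def by (intro mat2_eqI[symmetric]; simp add: mat_def)+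
  show "pullback (T_mat (2 * k)) F = F"
  proof (induction k rule: int_induct[where k = 0])
    case (step1 i)
    have "T_mat (2 * (i + 1)) = T_mat 2 ** T_mat (2 * i)" by (simp add: T_mat_def mat2_mult)
    thus ?case using step1 assms by (simp add: pp)
  next
    case (step2 i)
    have "T_mat (2 * i) = T_mat 2 ** T_mat (2 * (i - 1))" by (simp add: T_mat_def mat2_mult)
    thus ?case using step2 assms by (simp add: pp)
  qed (simp add: one)
  show "pullback (L_mat k) F = F"
  proof (induction k rule: int_induct[where k = 0])
    case (step1 i)
    have "L_mat (i + 1) = L_mat 1 ** L_mat i" by (simp add: L_mat_def mat2_mult add.commute)
    thus ?case using step1 assms by (simp add: pp)
  next
    case (step2 i)
    have "L_mat i = L_mat 1 ** L_mat (i - 1)" by (simp add: L_mat_def mat2_mult add.commute)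
    thus ?case using step2 assms by (simp add: pp)
  qed (simp add: one)
qed

text \<open>The projector onto the eigenspace for i^j of an operator with fourth power 1, namely the
  average of i^(-j m) times its m-th power.\<close>

definition eigen_part :: "(mero_uhp \<Rightarrow> mero_uhp) \<Rightarrow> nat \<Rightarrow> mero_uhp \<Rightarrow> mero_uhp" where
  "eigen_part \<phi> j F = const_mero_uhp (1 / 4) * (F + const_mero_uhp ((- \<i>) ^ j) * \<phi> F +
     const_mero_uhp ((- \<i>) ^ j) ^ 2 * \<phi> (\<phi> F) + const_mero_uhp ((- \<i>) ^ j) ^ 3 * \<phi> (\<phi> (\<phi> F)))"

lemma const_mero_uhp_sum: "const_mero_uhp (sum f A) = (\<Sum>x\<in>A. const_mero_uhp (f x))"
  by (induction A rule: infinite_finite_induct) (simp_all add: const_mero_uhp_0 const_mero_uhp_add)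

lemma eigen_part_sum: "(\<Sum>j<4. eigen_part \<phi> j F) = F"
proof -
  let ?c = "\<lambda>j. const_mero_uhp ((- \<i>) ^ j)"
  have "(\<Sum>j<4. eigen_part \<phi> j F) = const_mero_uhp (1 / 4) * ((\<Sum>j<4::nat. 1) * F + (\<Sum>j<4. ?c j) * \<phi> F +
     (\<Sum>j<4. ?c j ^ 2) * \<phi> (\<phi> F) + (\<Sum>j<4. ?c j ^ 3) * \<phi> (\<phi> (\<phi> F)))"
    by (simp only: eigen_part_def sum_distrib_left sum_distrib_right sum.distrib distrib_left mult_1 mult.assoc)
  also have "(\<Sum>j<4. ?c j) = const_mero_uhp (\<Sum>j<4. (- \<i>) ^ j)"
    by (simp only: const_mero_uhp_sum)
  also have "(\<Sum>j<4. (- \<i>) ^ j) = 0" by (simp add: eval_nat_numeral)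
  also have "(\<Sum>j<4. ?c j ^ 2) = const_mero_uhp (\<Sum>j<4. ((- \<i>) ^ j) ^ 2)"
    unfolding const_mero_uhp_power[symmetric] by (simp only: const_mero_uhp_sum)
  also have "(\<Sum>j<4. ((- \<i>) ^ j) ^ 2) = 0" by (simp add: eval_nat_numeral)
  also have "(\<Sum>j<4. ?c j ^ 3) = const_mero_uhp (\<Sum>j<4. ((- \<i>) ^ j) ^ 3)"
    unfolding const_mero_uhp_power[symmetric] by (simp only: const_mero_uhp_sum)
  also have "(\<Sum>j<4. ((- \<i>) ^ j) ^ 3) = 0" by (simp add: eval_nat_numeral)
  also have "(\<Sum>j<4::nat. 1) = const_mero_uhp 4"
    using of_nat_mero_uhp[of 4] by simp
  finally have "(\<Sum>j<4. eigen_part \<phi> j F) = const_mero_uhp (1 / 4) * const_mero_uhp 4 * F"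
    by (simp add: const_mero_uhp_0)
  thus ?thesis by (simp flip: const_mero_uhp_mult add: const_mero_uhp_1)
qed

text \<open>Since d = c^(-1) = c^3, multiplication by d shifts the four coefficients
  cyclically.\<close>

lemma root_of_unity_shift:
  fixes c d k :: "'a :: comm_ring_1"
  assumes "d * c = 1" "c ^ 4 = 1"
  shows "k * (A1 + c * A2 + c ^ 2 * A3 + c ^ 3 * F) = d * (k * (F + c * A1 + c ^ 2 * A2 + c ^ 3 * A3))"
proof -
  have "c ^ 3 = (d * c) * c ^ 3" by (simp add: assms)
  also have "\<dots> = d * c ^ 4" by (simp add: eval_nat_numeral mult_ac)
  finally have c3: "c ^ 3 = d" by (simp add: assms)
  have "d * (k * (F + c * A1 + c ^ 2 * A2 + c ^ 3 * A3)) =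
      k * (d * F + (d * c) * A1 + (d * c) * c * A2 + (d * c) * c ^ 2 * A3)"
    by (simp add: power2_eq_square power3_eq_cube algebra_simps)
  thus ?thesis unfolding c3 by (simp add: assms add_ac)
qed

lemma eigen_part_eigen:
  assumes add: "\<And>F G. \<phi> (F + G) = \<phi> F + \<phi> G" and mult: "\<And>c F. \<phi> (const_mero_uhp c * F) = const_mero_uhp c * \<phi> F"
    and order4: "\<phi> (\<phi> (\<phi> (\<phi> F))) = F"
  shows "\<phi> (eigen_part \<phi> j F) = const_mero_uhp (\<i> ^ j) * eigen_part \<phi> j F"
proof -
  let ?c = "const_mero_uhp ((- \<i>) ^ j)" and ?d = "const_mero_uhp (\<i> ^ j)"
  have "(\<i> * - \<i>) ^ j = 1" by simp
  hence dc: "?d * ?c = 1" by (simp only: const_mero_uhp_mult[symmetric] power_mult_distrib const_mero_uhp_1)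
  have "((- \<i>) ^ j) ^ 4 = ((- \<i>) ^ 4) ^ j" by (simp only: power_mult[symmetric] mult.commute)
  hence "?c ^ 4 = 1" by (simp add: const_mero_uhp_power[symmetric] const_mero_uhp_1)
  note c4 = this
  have "\<phi> (eigen_part \<phi> j F) = const_mero_uhp (1 / 4) * (\<phi> F + ?c * \<phi> (\<phi> F) + ?c ^ 2 * \<phi> (\<phi> (\<phi> F)) + ?c ^ 3 * F)"
    by (simp only: eigen_part_def const_mero_uhp_power[symmetric] add mult order4)
  also have "\<dots> = ?d * eigen_part \<phi> j F"
    unfolding eigen_part_def by (rule root_of_unity_shift[OF dc c4])
  finally show ?thesis .
qed

lemma eigen_part_commute:
  assumes add: "\<And>F G. \<psi> (F + G) = \<psi> F + \<psi> G" and mult: "\<And>c F. \<psi> (const_mero_uhp c * F) = const_mero_uhp c * \<psi> F"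
    and comm: "\<psi> (\<phi> F) = \<phi> (\<psi> F)" "\<psi> (\<phi> (\<phi> F)) = \<phi> (\<phi> (\<psi> F))" "\<psi> (\<phi> (\<phi> (\<phi> F))) = \<phi> (\<phi> (\<phi> (\<psi> F)))"
  shows "\<psi> (eigen_part \<phi> j F) = eigen_part \<phi> j (\<psi> F)"
  by (simp only: eigen_part_def const_mero_uhp_power[symmetric] add mult comm)

lemma eigen_part_scale:
  assumes mult: "\<And>c F. \<phi> (const_mero_uhp c * F) = const_mero_uhp c * \<phi> F"
  shows "eigen_part \<phi> j (const_mero_uhp c * F) = const_mero_uhp c * eigen_part \<phi> j F"
  by (simp only: eigen_part_def mult) (simp add: algebra_simps)

lemma eigen_part_level8:
  assumes "M \<in> SL2Z" "F \<in> level8_functions"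
  shows "eigen_part (pullback M) j F \<in> level8_functions"
  unfolding eigen_part_def const_mero_uhp_power[symmetric]
  by (intro level8_mult level8_add level8_const level8_pullback assms)

text \<open>The two generators act on level 8 functions as commuting operators with fourth power 1,
  so the 16 compositions of their projectors are simultaneous eigenprojectors.\<close>

lemma level8_eigen_decomposition:
  assumes F: "F \<in> level8_functions"
  obtains G where "F = (\<Sum>j<4. \<Sum>k<4. G j k)" "\<And>j k. G j k \<in> level8_functions"
    "\<And>j k. pullback (T_mat 2) (G j k) = const_mero_uhp (\<i> ^ j) * G j k"
    "\<And>j k. pullback (L_mat 1) (G j k) = const_mero_uhp (\<i> ^ k) * G j k"
proof -
  let ?a = "pullback (T_mat 2)" and ?b = "pullback (L_mat 1)"
  have det: "det (T_mat 2) > 0" "det (L_mat 1) > 0" using det_SL2Z_pos T_mat_SL2Z L_mat_SL2Z by blast+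
  have add: "?a (F + G) = ?a F + ?a G" "?b (F + G) = ?b F + ?b G" for F G
    using det by (simp_all add: pullback_add)
  have mult: "?a (const_mero_uhp c * F) = const_mero_uhp c * ?a F" "?b (const_mero_uhp c * F) = const_mero_uhp c * ?b F" for c F
    using det by (simp_all add: pullback_mult pullback_const)
  note pp = pullback_pullback[OF det(1) det(2)] pullback_pullback[OF det(2) det(1)]
  have fix8: "pullback N G = G" if "N \<in> Gamma8" "G \<in> level8_functions" for N G
    using that by (simp add: level8_functions_def)
  have a4: "?a (?a (?a (?a G))) = G" if "G \<in> level8_functions" for G
  proof -
    have "?a (?a (?a (?a G))) = pullback (T_mat 2 ** T_mat 2 ** T_mat 2 ** T_mat 2) G"
      by (simp add: pullback_pullback det_SL2Z_pos T_mat_SL2Z SL2Z_mult matrix_mul_assoc)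
    also have "T_mat 2 ** T_mat 2 ** T_mat 2 ** T_mat 2 = mat2 (of_int 1) (of_int 8) (of_int 0) (of_int 1)"
      by (simp add: T_mat_def mat2_mult)
    also have "pullback \<dots> G = G" by (rule fix8[OF Gamma8_I that]) auto
    finally show ?thesis .
  qed
  have b4: "?b (?b (?b (?b G))) = G" if "G \<in> level8_functions" for G
  proof -
    have "?b (?b (?b (?b G))) = pullback (L_mat 1 ** L_mat 1 ** L_mat 1 ** L_mat 1) G"
      by (simp add: pullback_pullback det_SL2Z_pos L_mat_SL2Z SL2Z_mult matrix_mul_assoc)
    also have "L_mat 1 ** L_mat 1 ** L_mat 1 ** L_mat 1 = mat2 (of_int 1) (of_int 0) (of_int 8) (of_int 1)"
      by (simp add: L_mat_def mat2_mult)
    also have "pullback \<dots> G = G" by (rule fix8[OF Gamma8_I that]) auto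
    finally show ?thesis .
  qed
  have comm: "?a (?b G) = ?b (?a G)" if "G \<in> level8_functions" for G
  proof -
    \<comment> \<open>The commutator of the two generators; it is congruent to 5 times the identity
      modulo 8.\<close>
    let ?N = "mat2 (of_int 21) (of_int (- 8)) (of_int 8) (of_int (- 3))"
    have N: "?N \<in> Gamma8" by (rule Gamma8_I) auto
    have "?b (?a G) = pullback (T_mat 2 ** L_mat 1) G" by (rule pp)
    also have "T_mat 2 ** L_mat 1 = ?N ** (L_mat 1 ** T_mat 2)"
      by (simp add: T_mat_def L_mat_def mat2_mult)
    also have "pullback \<dots> G = pullback (L_mat 1 ** T_mat 2) (pullback ?N G)"
      using N Gamma8_SL2Z by (intro pullback_pullback[symmetric] det_SL2Z_pos SL2Z_mult T_mat_SL2Z L_mat_SL2Z) auto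
    also have "pullback ?N G = G" by (rule fix8[OF N that])
    also have "pullback (L_mat 1 ** T_mat 2) G = ?a (?b G)" by (rule pp[symmetric])
    finally show ?thesis ..
  qed
  define G where "G = (\<lambda>j k. eigen_part ?b k (eigen_part ?a j F))"
  have E: "eigen_part ?a j F \<in> level8_functions" for j by (rule eigen_part_level8[OF T_mat_SL2Z F])
  have L: "?b H \<in> level8_functions" if "H \<in> level8_functions" for H by (rule level8_pullback[OF L_mat_SL2Z that])
  show ?thesis
  proof (rule that)
    show "F = (\<Sum>j<4. \<Sum>k<4. G j k)" unfolding G_def eigen_part_sum ..
    show "G j k \<in> level8_functions" for j k
      unfolding G_def by (intro eigen_part_level8 L_mat_SL2Z E)
    show "?b (G j k) = const_mero_uhp (\<i> ^ k) * G j k" for j k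
      unfolding G_def by (rule eigen_part_eigen[OF add(2) mult(2) b4[OF E]])
    show "?a (G j k) = const_mero_uhp (\<i> ^ j) * G j k" for j k
    proof -
      have "?a (G j k) = eigen_part ?b k (?a (eigen_part ?a j F))"
        unfolding G_def
        by (rule eigen_part_commute[OF add(1) mult(1)]) (simp_all add: comm E L)
      also have "?a (eigen_part ?a j F) = const_mero_uhp (\<i> ^ j) * eigen_part ?a j F"
        by (rule eigen_part_eigen[OF add(1) mult(1) a4[OF F]])
      also have "eigen_part ?b k \<dots> = const_mero_uhp (\<i> ^ j) * G j k"
        unfolding G_def by (rule eigen_part_scale[OF mult(2)])
      finally show ?thesis .
    qed
  qed
qed

text \<open>U has eigenvalue i under translation by 2 and V has eigenvalue -i under the lower
  generator, where (-i)^3 = i. Hence U^j V^(3 k) has the eigenvalues of G, and the quotient is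
  invariant under \<open>Gamma2\<close>.\<close>

lemma level8_eigen_rational:
  assumes G: "G \<in> level8_functions" and a: "pullback (T_mat 2) G = const_mero_uhp (\<i> ^ j) * G"
    and b: "pullback (L_mat 1) G = const_mero_uhp (\<i> ^ k) * G"
  obtains D P where "D \<noteq> 0" "lambda_poly D * G = lambda_poly P * (theta_U ^ j * theta_V ^ (3 * k))"
proof -
  define m where "m = theta_U ^ j * theta_V ^ (3 * k)"
  have m0: "m \<noteq> 0" by (simp add: m_def theta_UV_nonzero)
  have mm: "m \<in> theta_monomials"
    unfolding m_def by (intro theta_monomials.mult theta_monomials_power theta_monomials.U theta_monomials.V)
  define R where "R = G * inverse m"
  have det: "det (T_mat 2) > 0" "det (L_mat 1) > 0" using det_SL2Z_pos T_mat_SL2Z L_mat_SL2Z by blast+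
  have aU: "pullback (T_mat 2) theta_U = const_mero_uhp \<i> * theta_U" "pullback (T_mat 2) theta_V = theta_V"
    using T_mat_gamma2[of 1] pullback_gamma2_theta_UV[of 1 1 1 0] by (simp_all add: const_mero_uhp_1)
  have bU: "pullback (L_mat 1) theta_U = theta_U" "pullback (L_mat 1) theta_V = const_mero_uhp (- \<i>) * theta_V"
    using L_mat_gamma2[of 1] pullback_gamma2_theta_UV[of 1 1 0 1] by (simp_all add: const_mero_uhp_1 power_int_minus)
  have am: "pullback (T_mat 2) m = const_mero_uhp (\<i> ^ j) * m"
    by (simp add: m_def pullback_mult pullback_power det aU power_mult_distrib const_mero_uhp_power)
  have i3: "(- \<i>) ^ 3 = \<i>" by (simp add: eval_nat_numeral)
  have bm: "pullback (L_mat 1) m = const_mero_uhp (\<i> ^ k) * m"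
  proof -
    have "pullback (L_mat 1) m = theta_U ^ j * (const_mero_uhp (- \<i>) * theta_V) ^ (3 * k)"
      by (simp only: m_def pullback_mult[OF det(2)] pullback_power[OF det(2)] bU)
    also have "(const_mero_uhp (- \<i>) * theta_V) ^ (3 * k) = const_mero_uhp (((- \<i>) ^ 3) ^ k) * theta_V ^ (3 * k)"
      by (simp only: power_mult_distrib const_mero_uhp_power power_mult)
    also have "theta_U ^ j * \<dots> = const_mero_uhp (((- \<i>) ^ 3) ^ k) * m"
      by (simp only: m_def mult_ac)
    finally show ?thesis unfolding i3 .
  qed
  have nz: "const_mero_uhp (\<i> ^ n) \<noteq> 0" for n by simp
  have aR: "pullback (T_mat 2) R = R"
    unfolding R_def pullback_mult[OF det(1)] pullback_inverse[OF det(1)] a am using nz[of j] by (simp add: field_simps)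
  have bR: "pullback (L_mat 1) R = R"
    unfolding R_def pullback_mult[OF det(2)] pullback_inverse[OF det(2)] b bm using nz[of k] by (simp add: field_simps)
  have m8: "pullback N m = m" if "N \<in> Gamma8" for N
    using that Gamma8_SL2Z by (simp add: m_def pullback_mult pullback_power det_SL2Z_pos subset_iff Gamma8_theta_UV)
  have R8: "pullback N R = R" if "N \<in> Gamma8" for N
    using that Gamma8_SL2Z G m8[OF that]
    by (simp add: R_def pullback_mult pullback_inverse det_SL2Z_pos subset_iff level8_functions_def)
  have "pullback N R = R" if N2: "N \<in> Gamma2" for N
  proof -
    obtain N' l n where N: "N' \<in> Gamma8" "N = N' ** T_mat (2 * l) ** L_mat n" by (rule Gamma2_coset[OF N2])
    have "N' \<in> SL2Z" using N(1) Gamma8_SL2Z by blast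
    hence "pullback N R = pullback (L_mat n) (pullback (T_mat (2 * l)) (pullback N' R))"
      unfolding N(2) by (simp add: pullback_pullback det_SL2Z_pos SL2Z_mult T_mat_SL2Z L_mat_SL2Z)
    thus ?thesis by (simp add: R8[OF N(1)] pullback_T_mat_L_mat_fixed[OF aR bR])
  qed
  moreover have "moderate (pullback M R)" if M: "M \<in> SL2Z" for M
  proof -
    have "moderate (pullback M G)" using G M by (simp add: level8_functions_def)
    moreover have "moderate (inverse (pullback M m))"
      using theta_monomials_moderate[OF theta_monomials_pullback[OF M mm]] by blast
    ultimately show ?thesis
      unfolding R_def pullback_mult[OF det_SL2Z_pos[OF M]] pullback_inverse[OF det_SL2Z_pos[OF M]]
      by (rule moderate_mult)
  qed
  ultimately obtain D P where DP: "D \<noteq> 0" "lambda_poly D * R = lambda_poly P"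
    using gamma2_rational by blast
  have "G = R * m" using m0 by (simp add: R_def)
  hence "lambda_poly D * G = lambda_poly P * m" using DP(2) by (simp add: mult.assoc[symmetric])
  thus ?thesis unfolding m_def by (rule that[OF DP(1)])
qed

lemma common_denominator:
  assumes "finite I" "\<And>i. i \<in> I \<Longrightarrow> \<exists>D P. D \<noteq> 0 \<and> lambda_poly D * G i = lambda_poly P * m i"
  shows "\<exists>D Q. D \<noteq> 0 \<and> lambda_poly D * (\<Sum>i\<in>I. G i) = (\<Sum>i\<in>I. lambda_poly (Q i) * m i)"
  using assms
proof (induction I)
  case empty
  show ?case by (rule exI[of _ 1]) simp
next
  case (insert x I)
  obtain D Q where DQ: "D \<noteq> 0" "lambda_poly D * (\<Sum>i\<in>I. G i) = (\<Sum>i\<in>I. lambda_poly (Q i) * m i)"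
    using insert.IH[OF insert.prems] by blast
  obtain D1 P where D1: "D1 \<noteq> 0" "lambda_poly D1 * G x = lambda_poly P * m x"
    using insert.prems[of x] by blast
  define Q' where "Q' = (\<lambda>i. if i = x then D * P else D1 * Q i)"
  have "lambda_poly (D * D1) * (\<Sum>i\<in>insert x I. G i) =
      lambda_poly D * (lambda_poly D1 * G x) + lambda_poly D1 * (lambda_poly D * (\<Sum>i\<in>I. G i))"
    unfolding sum.insert[OF insert.hyps] lambda_poly_mult by (simp only: distrib_left mult_ac)
  also have "\<dots> = lambda_poly (D * P) * m x + (\<Sum>i\<in>I. lambda_poly (D1 * Q i) * m i)"
    unfolding D1(2) DQ(2)
    unfolding lambda_poly_mult sum_distrib_left by (simp only: mult.assoc)
  also have "(\<Sum>i\<in>I. lambda_poly (D1 * Q i) * m i) = (\<Sum>i\<in>I. lambda_poly (Q' i) * m i)"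
    by (rule sum.cong) (use insert.hyps in \<open>auto simp: Q'_def\<close>)
  also have "lambda_poly (D * P) = lambda_poly (Q' x)" by (simp add: Q'_def)
  also have "lambda_poly (Q' x) * m x + (\<Sum>i\<in>I. lambda_poly (Q' i) * m i) = (\<Sum>i\<in>insert x I. lambda_poly (Q' i) * m i)"
    by (rule sum.insert[OF insert.hyps, symmetric])
  finally show ?case using DQ(1) D1(1) by (intro exI[of _ "D * D1"] exI[of _ Q'] conjI) auto
qed

theorem level8_rational:
  assumes "F \<in> level8_functions"
  obtains D Q where "D \<noteq> 0"
    "lambda_poly D * F = (\<Sum>(j, k)\<in>{..<4} \<times> {..<4}. lambda_poly (Q (j, k)) * (theta_U ^ j * theta_V ^ (3 * k)))"
proof -
  obtain G where G: "F = (\<Sum>j<4. \<Sum>k<4. G j k)" "\<And>j k. G j k \<in> level8_functions"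
    "\<And>j k. pullback (T_mat 2) (G j k) = const_mero_uhp (\<i> ^ j) * G j k"
    "\<And>j k. pullback (L_mat 1) (G j k) = const_mero_uhp (\<i> ^ k) * G j k"
    using level8_eigen_decomposition[OF assms] by blast
  have "\<exists>D P. D \<noteq> 0 \<and> lambda_poly D * G (fst i) (snd i) = lambda_poly P * (theta_U ^ fst i * theta_V ^ (3 * snd i))" for i
    by (rule level8_eigen_rational[OF G(2)[of "fst i" "snd i"] G(3) G(4)]) blast
  note eigen = this
  have "\<exists>D Q. D \<noteq> 0 \<and> lambda_poly D * (\<Sum>i\<in>{..<4} \<times> {..<4}. G (fst i) (snd i)) =
     (\<Sum>i\<in>{..<4} \<times> {..<4}. lambda_poly (Q i) * (theta_U ^ fst i * theta_V ^ (3 * snd i)))"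
    by (rule common_denominator, simp, rule eigen)
  then obtain D Q where DQ: "D \<noteq> 0" "lambda_poly D * (\<Sum>i\<in>{..<4} \<times> {..<4}. G (fst i) (snd i)) =
     (\<Sum>i\<in>{..<4} \<times> {..<4}. lambda_poly (Q i) * (theta_U ^ fst i * theta_V ^ (3 * snd i)))" by blast
  have F_eq: "F = (\<Sum>i\<in>{..<4} \<times> {..<4}. G (fst i) (snd i))"
    unfolding G(1) sum.cartesian_product case_prod_unfold ..
  show ?thesis
    by (rule that[OF DQ(1), of Q]) (use DQ(2) in \<open>simp only: F_eq case_prod_unfold prod.collapse\<close>)
qed

subsection \<open>Laurent series with rational coefficients\<close>

definition rational_fls :: "complex fls \<Rightarrow> bool" where
  "rational_fls L \<longleftrightarrow> (\<forall>n. fls_nth L n \<in> \<rat>)"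

lemma rational_fls_add: "rational_fls L \<Longrightarrow> rational_fls K \<Longrightarrow> rational_fls (L + K)"
  by (simp add: rational_fls_def)

lemma rational_fls_diff: "rational_fls L \<Longrightarrow> rational_fls K \<Longrightarrow> rational_fls (L - K)"
  by (simp add: rational_fls_def)

lemma rational_fls_mult: "rational_fls L \<Longrightarrow> rational_fls K \<Longrightarrow> rational_fls (L * K)"
  by (auto simp: rational_fls_def fls_times_nth(1) intro!: Rats_sum Rats_mult)

lemma rational_fls_const: "c \<in> \<rat> \<Longrightarrow> rational_fls (fls_const c)"
  by (simp add: rational_fls_def)

lemma rational_fps_inverse:
  fixes f :: "complex fps"
  assumes "\<And>n. fps_nth f n \<in> \<rat>" "fps_nth f 0 \<noteq> 0"
  shows "fps_nth (inverse f) n \<in> \<rat>"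
proof (induction n rule: less_induct)
  case (less n)
  show ?case
  proof (cases "n = 0")
    case True
    thus ?thesis using assms(1)[of 0] by (simp add: Rats_inverse)
  next
    case False
    have "0 = fps_nth (inverse f * f) n" using assms(2) False by (simp add: inverse_mult_eq_1)
    also have "\<dots> = (\<Sum>i=0..n. fps_nth (inverse f) i * fps_nth f (n - i))" by (rule fps_mult_nth)
    also have "{0..n} = insert n {0..<n}" by auto
    also have "(\<Sum>i\<in>insert n {0..<n}. fps_nth (inverse f) i * fps_nth f (n - i)) =
        fps_nth (inverse f) n * fps_nth f 0 + (\<Sum>i<n. fps_nth (inverse f) i * fps_nth f (n - i))"
      by (simp add: lessThan_atLeast0)
    finally have "fps_nth (inverse f) n * fps_nth f 0 = - (\<Sum>i<n. fps_nth (inverse f) i * fps_nth f (n - i))"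
      by (simp add: eq_neg_iff_add_eq_0)
    hence "fps_nth (inverse f) n = - (\<Sum>i<n. fps_nth (inverse f) i * fps_nth f (n - i)) / fps_nth f 0"
      by (subst nonzero_eq_divide_eq[OF assms(2)])
    moreover have "(\<Sum>i<n. fps_nth (inverse f) i * fps_nth f (n - i)) \<in> \<rat>"
      using less assms(1) by (intro Rats_sum Rats_mult) auto
    ultimately show ?thesis using assms(1)[of 0] by (simp add: Rats_divide)
  qed
qed

lemma rational_fls_inverse:
  assumes "rational_fls L"
  shows "rational_fls (inverse L)"
proof (cases "L = 0")
  case False
  have "fps_nth (inverse (fls_base_factor_to_fps L)) n \<in> \<rat>" for n
    by (rule rational_fps_inverse) (use assms False in \<open>auto simp: rational_fls_def\<close>)
  thus ?thesis by (simp add: rational_fls_def fls_inverse_def)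
qed (use assms in simp)

lemma rational_fls_fps: "(\<And>n. fps_nth F n \<in> \<rat>) \<Longrightarrow> rational_fls (fps_to_fls F)"
  by (simp add: rational_fls_def)

definition rational_q :: "mero_uhp set" where
  "rational_q = {F. \<exists>L. has_q_expansion 1 F L \<and> rational_fls L}"

lemma rational_q_add: "F \<in> rational_q \<Longrightarrow> G \<in> rational_q \<Longrightarrow> F + G \<in> rational_q"
  unfolding rational_q_def mem_Collect_eq
  by (elim exE conjE, intro exI conjI, erule (1) has_q_expansion_add[OF zero_less_one], erule (1) rational_fls_add)

lemma rational_q_diff: "F \<in> rational_q \<Longrightarrow> G \<in> rational_q \<Longrightarrow> F - G \<in> rational_q"
  unfolding rational_q_def mem_Collect_eq
  by (elim exE conjE, intro exI conjI, erule (1) has_q_expansion_diff[OF zero_less_one], erule (1) rational_fls_diff)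

lemma rational_q_mult: "F \<in> rational_q \<Longrightarrow> G \<in> rational_q \<Longrightarrow> F * G \<in> rational_q"
  unfolding rational_q_def mem_Collect_eq
  by (elim exE conjE, intro exI conjI, erule (1) has_q_expansion_mult[OF zero_less_one], erule (1) rational_fls_mult)

lemma rational_q_inverse: "F \<in> rational_q \<Longrightarrow> inverse F \<in> rational_q"
  unfolding rational_q_def mem_Collect_eq
  by (elim exE conjE, intro exI conjI, erule has_q_expansion_inverse[OF zero_less_one], erule rational_fls_inverse)

lemma rational_q_of_rat: "of_rat r \<in> rational_q"
  unfolding rational_q_def of_rat_mero_uhp mem_Collect_eq
  by (rule exI, rule conjI, rule has_q_expansion_const, simp, rule rational_fls_const, simp)

lemma rational_q_power: "F \<in> rational_q \<Longrightarrow> F ^ n \<in> rational_q"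
  using rational_q_of_rat[of 1] by (induction n) (auto intro: rational_q_mult)

text \<open>Any rational linear functional on the complex numbers can be applied to the coefficients of
  a linear relation between functions with rational expansions.\<close>

lemma rational_functional:
  assumes "c \<noteq> (0 :: complex)"
  obtains \<phi> :: "complex \<Rightarrow> rat" where "\<phi> c = 1" "\<And>x y. \<phi> (x + y) = \<phi> x + \<phi> y"
    "\<And>r x. \<phi> (of_rat r * x) = r * \<phi> x"
proof -
  interpret V: vector_space "\<lambda>(r :: rat) (x :: complex). of_rat r * x"
    by unfold_locales (simp_all add: algebra_simps of_rat_add of_rat_mult)
  \<comment> \<open>The functional is the coordinate along c in a rational basis of the complex
    numbers that contains c.\<close>
  define B where "B = V.extend_basis {c}"
  have ind: "V.independent {c}" using assms by simp
  have B: "V.independent B" "c \<in> B" "V.span B = UNIV"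
    unfolding B_def using V.independent_extend_basis[OF ind] V.extend_basis_superset[OF ind] V.span_extend_basis[OF ind]
    by auto
  show ?thesis
  proof (rule that[of "\<lambda>x. V.representation B x c"])
    show "V.representation B c c = 1" using V.representation_basis[OF B(1,2)] by simp
    show "V.representation B (x + y) c = V.representation B x c + V.representation B y c" for x y
      using V.representation_add[OF B(1), of y x] B(3) by simp
    show "V.representation B (of_rat r * x) c = r * V.representation B x c" for r x
      using V.representation_scale[OF B(1), of x r] B(3) by simp
  qed
qed

text \<open>Comparing each coefficient of the expansions gives a linear relation between the
  \<open>c i\<close> over the rationals, which a rational functional preserves. Normalising at
  \<open>i0\<close> keeps the relation nontrivial.\<close>

lemma rational_relation:
  assumes I: "finite I" "i0 \<in> I" "c i0 \<noteq> 0" and e: "\<And>i. i \<in> I \<Longrightarrow> e i \<in> rational_q"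
    and rel: "(\<Sum>i\<in>I. const_mero_uhp (c i) * e i) = 0"
  obtains r :: "'i \<Rightarrow> rat" where "r i0 = 1" "(\<Sum>i\<in>I. of_rat (r i) * e i) = 0"
proof -
  have "\<forall>i\<in>I. \<exists>L. has_q_expansion 1 (e i) L \<and> (\<forall>n. \<exists>q. fls_nth L n = of_rat q)"
    using e by (fastforce simp: rational_q_def rational_fls_def elim!: Rats_cases)
  then obtain L q where L: "\<And>i. i \<in> I \<Longrightarrow> has_q_expansion 1 (e i) (L i)"
    "\<And>i n. i \<in> I \<Longrightarrow> fls_nth (L i) n = of_rat (q i n)" by metis
  have "has_q_expansion 1 (\<Sum>i\<in>I. const_mero_uhp (c i) * e i) (\<Sum>i\<in>I. fls_const (c i) * L i)"
    by (intro has_q_expansion_sum has_q_expansion_mult has_q_expansion_const L) auto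
  hence "(\<Sum>i\<in>I. fls_const (c i) * L i) = 0" unfolding rel by (rule has_q_expansion_0D[rotated]) simp
  note Lrel = this
  have "(\<Sum>i\<in>I. of_rat (q i n) * c i) = 0" for n
  proof -
    have "(\<Sum>i\<in>I. of_rat (q i n) * c i) = (\<Sum>i\<in>I. fls_nth (fls_const (c i) * L i) n)"
      by (rule sum.cong) (simp_all add: L(2) fls_mult_const_nth)
    also have "\<dots> = fls_nth (\<Sum>i\<in>I. fls_const (c i) * L i) n" by (simp only: fls_nth_sum)
    finally show ?thesis unfolding Lrel by simp
  qed
  note rel' = this
  obtain \<phi> :: "complex \<Rightarrow> rat" where \<phi>: "\<phi> (c i0) = 1" "\<And>x y. \<phi> (x + y) = \<phi> x + \<phi> y"
    "\<And>r x. \<phi> (of_rat r * x) = r * \<phi> x" using rational_functional[OF I(3)] by blast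
  have \<phi>0: "\<phi> 0 = 0" using \<phi>(3)[of 0 0] by simp
  have \<phi>sum: "\<phi> (\<Sum>i\<in>A. f i) = (\<Sum>i\<in>A. \<phi> (f i))" if "finite A" for A f
    using that by induction (simp_all add: \<phi>0 \<phi>(2))
  have "(\<Sum>i\<in>I. q i n * \<phi> (c i)) = 0" for n
    using arg_cong[OF rel'[of n], of \<phi>] by (simp add: \<phi>sum[OF I(1)] \<phi>(3) \<phi>0)
  note rel'' = this
  have "(\<Sum>i\<in>I. fls_const (of_rat (\<phi> (c i))) * L i) = 0"
  proof (rule fls_eqI)
    fix n
    have "fls_nth (\<Sum>i\<in>I. fls_const (of_rat (\<phi> (c i))) * L i) n = (\<Sum>i\<in>I. of_rat (q i n * \<phi> (c i)))"
      unfolding fls_nth_sum by (rule sum.cong) (simp_all add: L(2) fls_mult_const_nth of_rat_mult)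
    also have "\<dots> = of_rat (\<Sum>i\<in>I. q i n * \<phi> (c i))" by (simp only: of_rat_sum)
    finally have "fls_nth (\<Sum>i\<in>I. fls_const (of_rat (\<phi> (c i))) * L i) n = of_rat (\<Sum>i\<in>I. q i n * \<phi> (c i))" .
    thus "fls_nth (\<Sum>i\<in>I. fls_const (of_rat (\<phi> (c i))) * L i) n = fls_nth 0 n" by (simp add: rel'')
  qed
  moreover have "has_q_expansion 1 (\<Sum>i\<in>I. of_rat (\<phi> (c i)) * e i) (\<Sum>i\<in>I. fls_const (of_rat (\<phi> (c i))) * L i)"
    unfolding of_rat_mero_uhp
    by (intro has_q_expansion_sum has_q_expansion_mult has_q_expansion_const L) auto
  ultimately have "(\<Sum>i\<in>I. of_rat (\<phi> (c i)) * e i) = 0"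
    using has_q_expansion_0_imp_0[of 1] by simp
  thus ?thesis using that[of "\<lambda>i. \<phi> (c i)"] \<phi>(1) by simp
qed

subsection \<open>Modular functions of level 64\<close>

lemma Gamma0_SL2Z: "Gamma0 N \<subseteq> SL2Z"
  by (auto simp: Gamma0_def)

lemma modular_functions_binop:
  assumes "\<And>M F G. det M > 0 \<Longrightarrow> pullback M (opm F G) = opm (pullback M F) (pullback M G)"
    and "\<And>F G L K. has_q_expansion N F L \<Longrightarrow> has_q_expansion N G K \<Longrightarrow> has_q_expansion N (opm F G) (opl L K)"
    and "F \<in> modular_functions N" "G \<in> modular_functions N"
  shows "opm F G \<in> modular_functions N"
proof -
  have "pullback \<gamma> (opm F G) = opm F G" if "\<gamma> \<in> Gamma0 N" for \<gamma>
    using that assms(1,3,4) Gamma0_SL2Z det_SL2Z_pos by (fastforce simp: modular_functions_def)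
  moreover have "\<exists>L. has_q_expansion N (pullback \<gamma> (opm F G)) L" if g: "\<gamma> \<in> SL2Z" for \<gamma>
  proof -
    have "\<exists>L. has_q_expansion N (pullback \<gamma> F) L" "\<exists>L. has_q_expansion N (pullback \<gamma> G) L"
      using g assms(3,4) unfolding modular_functions_def by blast+
    then obtain L K where "has_q_expansion N (pullback \<gamma> F) L" "has_q_expansion N (pullback \<gamma> G) K"
      by blast
    from assms(2)[OF this] show ?thesis unfolding assms(1)[OF det_SL2Z_pos[OF g]] by blast
  qed
  ultimately show ?thesis by (simp add: modular_functions_def)
qed

lemma modular_functions_add: "N > 0 \<Longrightarrow> F \<in> modular_functions N \<Longrightarrow> G \<in> modular_functions N \<Longrightarrow> F + G \<in> modular_functions N"
  by (rule modular_functions_binop[where opm = "(+)" and opl = "(+)"]) (auto intro: pullback_add has_q_expansion_add)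

lemma modular_functions_diff: "N > 0 \<Longrightarrow> F \<in> modular_functions N \<Longrightarrow> G \<in> modular_functions N \<Longrightarrow> F - G \<in> modular_functions N"
  by (rule modular_functions_binop[where opm = "(-)" and opl = "(-)"]) (auto intro: pullback_diff has_q_expansion_diff)

lemma modular_functions_mult: "N > 0 \<Longrightarrow> F \<in> modular_functions N \<Longrightarrow> G \<in> modular_functions N \<Longrightarrow> F * G \<in> modular_functions N"
  by (rule modular_functions_binop[where opm = "(*)" and opl = "(*)"]) (auto intro: pullback_mult has_q_expansion_mult)

lemma modular_functions_inverse: "N > 0 \<Longrightarrow> F \<in> modular_functions N \<Longrightarrow> inverse F \<in> modular_functions N"
  by (rule modular_functions_binop[where opm = "\<lambda>F G. inverse F" and opl = "\<lambda>L K. inverse L" and G = F])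
     (auto intro: pullback_inverse has_q_expansion_inverse)

lemma modular_functions_const: "N > 0 \<Longrightarrow> const_mero_uhp c \<in> modular_functions N"
  using Gamma0_SL2Z[of N] has_q_expansion_const[of N c]
  by (auto simp: modular_functions_def pullback_const det_SL2Z_pos subset_iff)

lemma modular_functions_of_rat: "N > 0 \<Longrightarrow> of_rat r \<in> modular_functions N"
  unfolding of_rat_mero_uhp by (rule modular_functions_const)

lemma rational_modular_functions_altdef: "rational_modular_functions N = modular_functions N \<inter> rational_q"
  by (auto simp: rational_modular_functions_def rational_q_def rational_fls_def)

lemma rational_modular_functions_closed:
  assumes "N > 0"
  shows "F \<in> rational_modular_functions N \<Longrightarrow> G \<in> rational_modular_functions N \<Longrightarrow> F + G \<in> rational_modular_functions N"
    "F \<in> rational_modular_functions N \<Longrightarrow> G \<in> rational_modular_functions N \<Longrightarrow> F - G \<in> rational_modular_functions N"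
    "F \<in> rational_modular_functions N \<Longrightarrow> G \<in> rational_modular_functions N \<Longrightarrow> F * G \<in> rational_modular_functions N"
    "F \<in> rational_modular_functions N \<Longrightarrow> inverse F \<in> rational_modular_functions N"
    "of_rat r \<in> rational_modular_functions N"
  using assms unfolding rational_modular_functions_altdef
  by (auto intro: modular_functions_add modular_functions_diff modular_functions_mult modular_functions_inverse
      rational_q_add rational_q_diff rational_q_mult rational_q_inverse
      rational_q_of_rat modular_functions_of_rat)

text \<open>Hermite normal form: dividing the first column by its gcd makes it primitive, and Bezout
  coefficients complete it to a matrix of determinant 1.\<close>

lemma integer_matrix_decomposition:
  fixes a b c d n :: int
  assumes det: "a * d - b * c = n" and n: "n > 0"
  obtains M p r s where "M \<in> SL2Z" "p > 0" "s > 0"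
    "mat2 (of_int a) (of_int b) (of_int c) (of_int d) = M ** mat2 p r 0 s"
proof -
  define p where "p = gcd a c"
  have "p > 0" using det n by (auto simp: p_def)
  obtain u v where uv: "u * a + v * c = p" using bezout_int[of a c] by (auto simp: p_def)
  obtain a1 c1 where ac: "a = p * a1" "c = p * c1" unfolding p_def by (meson dvdE gcd_dvd1 gcd_dvd2)
  have "p * (u * a1 + v * c1) = p * 1" using uv unfolding ac by (simp add: algebra_simps)
  hence one: "u * a1 + v * c1 = 1" using \<open>p > 0\<close> by (simp only: mult_cancel_left) simp
  define s where "s = a1 * d - c1 * b"
  have "p * s = n" using det unfolding ac s_def by (simp add: algebra_simps)
  hence "s > 0" using n \<open>p > 0\<close> by (metis zero_less_mult_pos)
  define r where "r = u * b + v * d"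
  have "mat2 (of_int a1) (of_int (- v)) (of_int c1) (of_int u) \<in> SL2Z"
    by (rule SL2Z_I) (use one in \<open>simp add: algebra_simps\<close>)
  moreover have "b = (u * a1 + v * c1) * b" "d = (u * a1 + v * c1) * d" unfolding one by simp_all
  hence b: "b = a1 * r + (- v) * s" and d: "d = c1 * r + u * s"
    by (simp_all add: r_def s_def algebra_simps)
  have "mat2 (of_int a) (of_int b) (of_int c) (of_int d) =
      mat2 (of_int a1) (of_int (- v)) (of_int c1) (of_int u) ** mat2 (of_int p) (of_int r) 0 (of_int s)"
    unfolding mat2_mult using arg_cong[OF b, of real_of_int] arg_cong[OF d, of real_of_int]
    by (simp add: ac mult.commute)
  ultimately show ?thesis using that[of _ "of_int p" "of_int s" "of_int r"] \<open>p > 0\<close> \<open>s > 0\<close> by simp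
qed

section \<open>Passage between \<open>Gamma0 64\<close> and \<open>Gamma8\<close>\<close>

definition scale8 :: "real^2^2" where "scale8 = mat2 8 0 0 1"
text \<open>An integral multiple of the inverse of \<open>scale8\<close>, with the same action;
  integrality is what \<open>integer_matrix_decomposition\<close> asks for.\<close>

definition unscale8 :: "real^2^2" where "unscale8 = mat2 1 0 0 8"

lemma det_scale8 [simp]: "det scale8 = 8" "det unscale8 = 8"
  by (simp_all add: scale8_def unscale8_def det_mat2)

lemma pullback_scale8_unscale8: "pullback scale8 (pullback unscale8 F) = F"
proof -
  have "pullback scale8 (pullback unscale8 F) = pullback (unscale8 ** scale8) F"
    by (rule pullback_pullback) simp_all
  also have "\<dots> = pullback (mat 1) F"
    by (rule pullback_eqI) (simp_all add: unscale8_def scale8_def mat2_mult det_mat2 act_mat2)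
  finally show ?thesis by simp
qed

lemma Gamma0_E:
  assumes "M \<in> Gamma0 64"
  obtains a b k d :: int where "M = mat2 (of_int a) (of_int b) (of_int (64 * k)) (of_int d)" "a * d - 64 * b * k = 1"
proof -
  obtain a b c d :: int where M: "M = mat2 (of_int a) (of_int b) (of_int c) (of_int d)" and det: "a * d - b * c = 1"
    using SL2Z_E[of M] assms Gamma0_SL2Z by blast
  from assms obtain k :: int where "M $ 2 $ 1 = of_int (64 * k)" by (auto simp: Gamma0_def)
  hence "c = 64 * k" unfolding M mat2_nth by (simp only: of_int_eq_iff)
  thus ?thesis using that[of a b k d] M det by simp
qed

lemma Gamma0_I:
  assumes "a * d - b * c = 1" "64 dvd c"
  shows "mat2 (of_int a) (of_int b) (of_int c) (of_int d) \<in> Gamma0 64"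
  using SL2Z_I[OF assms(1)] assms(2) by (auto simp: Gamma0_def elim!: dvdE)

text \<open>Invariance is a conjugation. For growth, \<open>unscale8 ** M\<close> is an element of
  \<open>SL2Z\<close> times an upper triangular matrix, so it is governed by the expansion of F at
  some cusp.\<close>

lemma modular_imp_level8:
  assumes F: "F \<in> modular_functions 64"
  shows "pullback unscale8 F \<in> level8_functions"
proof -
  have "pullback N (pullback unscale8 F) = pullback unscale8 F" if N: "N \<in> Gamma8" for N
  proof -
    from Gamma8_E[OF N] obtain a b c d where N': "N = mat2 (of_int a) (of_int (8 * b)) (of_int (8 * c)) (of_int d)"
      and det: "a * d - 64 * b * c = 1" .
    let ?M = "mat2 (of_int a) (of_int b) (of_int (64 * c)) (of_int d)"
    have M: "?M \<in> Gamma0 64" by (rule Gamma0_I) (use det in auto)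
    have MS: "det ?M > 0" using M Gamma0_SL2Z det_SL2Z_pos by blast
    have "pullback N (pullback unscale8 F) = pullback (unscale8 ** N) F"
      using N Gamma8_SL2Z det_SL2Z_pos by (intro pullback_pullback) auto
    also have "unscale8 ** N = ?M ** unscale8"
      by (simp add: N' unscale8_def mat2_mult mult.commute)
    also have "pullback \<dots> F = pullback unscale8 (pullback ?M F)"
      by (rule pullback_pullback[symmetric]) (use MS in auto)
    also have "pullback ?M F = F" using F M by (simp add: modular_functions_def)
    finally show ?thesis .
  qed
  moreover have "moderate (pullback M (pullback unscale8 F))" if M: "M \<in> SL2Z" for M
  proof -
    from SL2Z_E[OF M] obtain a b c d :: int
      where M': "M = mat2 (of_int a) (of_int b) (of_int c) (of_int d)" and det: "a * d - b * c = 1" .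
    have prod: "unscale8 ** M = mat2 (of_int a) (of_int b) (of_int (8 * c)) (of_int (8 * d))"
      by (simp add: unscale8_def M' mat2_mult)
    have "a * (8 * d) - b * (8 * c) = 8" using det by (simp add: algebra_simps)
    then obtain M1 p r s where M1: "M1 \<in> SL2Z" "p > 0" "s > 0" "unscale8 ** M = M1 ** mat2 p r 0 s"
      unfolding prod by (rule integer_matrix_decomposition) simp_all
    have "pullback M (pullback unscale8 F) = pullback (mat2 p r 0 s) (pullback M1 F)"
      using M1 M by (simp add: pullback_pullback det_SL2Z_pos det_mat2)
    moreover have "moderate (pullback M1 F)"
      using F M1(1) has_q_expansion_imp_moderate[of 64] by (auto simp: modular_functions_def)
    ultimately show ?thesis using moderate_pullback_upper[OF M1(2,3)] by simp
  qed
  ultimately show ?thesis by (simp add: level8_functions_def)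
qed

text \<open>Growth is transported as in the converse; together with holomorphy and period 64 of
  every translate it yields the Laurent expansion.\<close>

lemma level8_imp_modular:
  assumes g: "g holomorphic_on uhp" and F: "mero_of g \<in> level8_functions"
  shows "pullback scale8 (mero_of g) \<in> modular_functions 64"
proof -
  let ?G = "pullback scale8 (mero_of g)"
  have inv: "pullback M ?G = ?G" if M: "M \<in> Gamma0 64" for M
  proof -
    from Gamma0_E[OF M] obtain a b k d where M': "M = mat2 (of_int a) (of_int b) (of_int (64 * k)) (of_int d)"
      and det: "a * d - 64 * b * k = 1" .
    let ?N = "mat2 (of_int a) (of_int (8 * b)) (of_int (8 * k)) (of_int d)"
    have N: "?N \<in> Gamma8" by (rule Gamma8_I) (use det in auto)
    have NS: "det ?N > 0" using N Gamma8_SL2Z det_SL2Z_pos by blast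
    have "pullback M ?G = pullback (scale8 ** M) (mero_of g)"
      using M Gamma0_SL2Z det_SL2Z_pos by (intro pullback_pullback) auto
    also have "scale8 ** M = ?N ** scale8" by (simp add: M' scale8_def mat2_mult mult.commute)
    also have "pullback \<dots> (mero_of g) = pullback scale8 (pullback ?N (mero_of g))"
      by (rule pullback_pullback[symmetric]) (use NS in auto)
    also have "pullback ?N (mero_of g) = mero_of g" using F N by (simp add: level8_functions_def)
    finally show ?thesis .
  qed
  have "\<exists>L. has_q_expansion 64 (pullback M ?G) L" if M: "M \<in> SL2Z" for M
  proof -
    from SL2Z_E[OF M] obtain a b c d :: int
      where M': "M = mat2 (of_int a) (of_int b) (of_int c) (of_int d)" and det: "a * d - b * c = 1" .
    have prod: "scale8 ** M = mat2 (of_int (8 * a)) (of_int (8 * b)) (of_int c) (of_int d)"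
      by (simp add: scale8_def M' mat2_mult)
    have "8 * a * d - 8 * b * c = 8" using det by (simp add: algebra_simps)
    then obtain M1 p r s where M1: "M1 \<in> SL2Z" "p > 0" "s > 0" "scale8 ** M = M1 ** mat2 p r 0 s"
      unfolding prod by (rule integer_matrix_decomposition) simp_all
    have dets: "det (scale8 ** M) > 0" using det_SL2Z_pos[OF M] by (simp add: det_mul)
    define h where "h = (\<lambda>z. g (act (scale8 ** M) z))"
    have h: "h holomorphic_on uhp" unfolding h_def by (rule holomorphic_act[OF dets g])
    have pM: "pullback M ?G = mero_of h"
      unfolding h_def pullback_mero_of[OF dets holomorphic_uhp_imp_meromorphic[OF g], symmetric]
      using det_SL2Z_pos[OF M] by (intro pullback_pullback) auto
    have "mero_of h = pullback (mat2 p r 0 s) (pullback M1 (mero_of g))"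
      unfolding pM[symmetric] using M1 M by (simp add: pullback_pullback det_SL2Z_pos det_mat2)
    moreover have "moderate (pullback M1 (mero_of g))" using F M1(1) by (simp add: level8_functions_def)
    ultimately have mod: "moderate (mero_of h)" using moderate_pullback_upper[OF M1(2,3)] by simp
    have "pullback (T_mat 64) (mero_of h) = mero_of h"
    proof -
      \<comment> \<open>The conjugate M T^64 M^-1, which lies in \<open>Gamma0 64\<close> because
        its lower left entry is -64 c^2; every cusp width therefore divides 64.\<close>
      let ?N = "mat2 (of_int (1 - 64 * a * c)) (of_int (64 * a * a)) (of_int (- 64 * c * c)) (of_int (1 + 64 * a * c))"
      have N: "?N \<in> Gamma0 64" by (rule Gamma0_I) (simp_all add: algebra_simps)
      have det': "real_of_int a * of_int d - of_int b * of_int c = 1"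
        using arg_cong[OF det, of real_of_int] by simp
      have i: "a * 64 + b = (1 - 64 * a * c) * b + 64 * a * a * d" "c * 64 + d = (- 64 * c * c) * b + (1 + 64 * a * c) * d"
      proof -
        have "(1 - 64 * a * c) * b + 64 * a * a * d = b + 64 * a * (a * d - b * c)"
          "(- 64 * c * c) * b + (1 + 64 * a * c) * d = d + 64 * c * (a * d - b * c)"
          by (simp_all add: algebra_simps)
        thus "a * 64 + b = (1 - 64 * a * c) * b + 64 * a * a * d" "c * 64 + d = (- 64 * c * c) * b + (1 + 64 * a * c) * d"
          unfolding det by simp_all
      qed
      have "M ** T_mat 64 = mat2 (of_int a) (of_int (a * 64 + b)) (of_int c) (of_int (c * 64 + d))"
        by (simp add: M' T_mat_def mat2_mult)
      also have "\<dots> = ?N ** M"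
        unfolding i M' mat2_mult by (simp add: algebra_simps)
      finally have eq: "M ** T_mat 64 = ?N ** M" .
      have "pullback (T_mat 64) (mero_of h) = pullback (M ** T_mat 64) ?G"
        unfolding pM[symmetric] by (rule pullback_pullback) (use det_SL2Z_pos M T_mat_SL2Z in auto)
      also have "\<dots> = pullback M (pullback ?N ?G)"
        unfolding eq by (rule pullback_pullback[symmetric]) (use det_SL2Z_pos M N Gamma0_SL2Z in blast)+
      finally show ?thesis unfolding inv[OF N] pM .
    qed
    hence "mero_of (\<lambda>z. h (act (T_mat 64) z)) = mero_of h"
      by (simp only: pullback_mero_of[OF det_SL2Z_pos[OF T_mat_SL2Z] holomorphic_uhp_imp_meromorphic[OF h]])
    from mero_of_eqD[OF holomorphic_act[OF det_SL2Z_pos[OF T_mat_SL2Z] h] h this]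
    have "h (z + of_nat 64) = h z" if "z \<in> uhp" for z using that by simp
    from periodic_moderate_has_q_expansion[OF _ h this mod] show ?thesis unfolding pM by simp
  qed
  with inv show ?thesis by (simp add: modular_functions_def)
qed

definition quot_U :: mero_uhp where "quot_U = pullback scale8 theta_U"
definition quot_V :: mero_uhp where "quot_V = pullback scale8 theta_V"

lemma quot_UV_modular: "quot_U \<in> modular_functions 64" "quot_V \<in> modular_functions 64"
  using level8_imp_modular[OF theta_u_holomorphic] level8_imp_modular[OF theta_v_holomorphic] level8_theta_UV
  by (simp_all add: quot_U_def quot_V_def theta_U_def theta_V_def)

lemma lattice_sum_fps_expansion:
  assumes e: "proper_exponent e" and s: "norm s = 1" "s \<in> \<rat>"
  obtains F where "(\<lambda>w. lattice_sum e (s * w ^ 4)) has_fps_expansion F" "\<And>n. fps_nth F n \<in> \<rat>"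
proof -
  define F where "F = Abs_fps (\<lambda>m. if 4 dvd m then s ^ (m div 4) * fps_nth (lattice_fps e) (m div 4) else 0)"
  have "(\<lambda>w. lattice_sum e (s * w ^ 4)) has_fps_expansion F"
  proof (rule has_fps_expansionI)
    have "eventually (\<lambda>w. w \<in> ball 0 1) (nhds (0 :: complex))"
      by (rule eventually_nhds_in_open) auto
    thus "eventually (\<lambda>w. (\<lambda>n. fps_nth F n * w ^ n) sums lattice_sum e (s * w ^ 4)) (nhds 0)"
    proof eventually_elim
      case (elim w)
      have "norm (s * w ^ 4) < 1" using elim s(1) by (simp add: norm_mult norm_power power_less_one_iff)
      moreover have "fps_nth F (4 * n) * w ^ (4 * n) = fps_nth (lattice_fps e) n * (s * w ^ 4) ^ n" for n
        by (simp add: F_def power_mult_distrib power_mult[of w 4 n] mult.assoc mult.left_commute)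
      ultimately have "(\<lambda>n. fps_nth F (4 * n) * w ^ (4 * n)) sums lattice_sum e (s * w ^ 4)"
        using lattice_sum_sums[OF e] by simp
      moreover have "fps_nth F n * w ^ n = 0" if "n \<notin> range (\<lambda>n. 4 * n)" for n
        using that by (auto simp: F_def)
      ultimately show ?case
        by (subst (asm) sums_mono_reindex[of "\<lambda>n. 4 * n" "\<lambda>n. fps_nth F n * w ^ n"]) (auto simp: strict_mono_def)
    qed
  qed
  moreover have "fps_nth F n \<in> \<rat>" for n
    using s(2) by (auto simp: F_def lattice_fps_def)
  ultimately show ?thesis by (rule that)
qed

text \<open>At 8 z the nome is q^4, so its fourth root in \<open>theta_u\<close> is q itself and no
  fractional powers remain. The lattice sums have integer coefficients.\<close>

lemma quot_UV_rational: "quot_U \<in> rational_q" "quot_V \<in> rational_q"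
proof -
  obtain P where P: "(\<lambda>w. theta_phi (w ^ 4)) has_fps_expansion P" "\<And>n. fps_nth P n \<in> \<rat>"
    using lattice_sum_fps_expansion[OF proper_sq_exp, of 1] by (auto simp: theta_phi_def)
  obtain Q where Q: "(\<lambda>w. theta_phi (- (w ^ 4))) has_fps_expansion Q" "\<And>n. fps_nth Q n \<in> \<rat>"
    using lattice_sum_fps_expansion[OF proper_sq_exp, of "-1"] by (auto simp: theta_phi_def)
  obtain R where R: "(\<lambda>w. theta_psi (w ^ 4)) has_fps_expansion R" "\<And>n. fps_nth R n \<in> \<rat>"
    using lattice_sum_fps_expansion[OF proper_tri_exp, of 1] by (auto simp: theta_psi_def)
  have u: "(\<lambda>w. w * theta_psi (w ^ 4) * inverse (theta_phi (w ^ 4))) has_laurent_expansion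
      fls_X * fps_to_fls R * inverse (fps_to_fls P)"
    by (intro laurent_expansion_intros has_laurent_expansion_fps P Q R)
  have v: "(\<lambda>w. theta_phi (- (w ^ 4)) * inverse (theta_phi (w ^ 4))) has_laurent_expansion
      fps_to_fls Q * inverse (fps_to_fls P)"
    by (intro laurent_expansion_intros has_laurent_expansion_fps P Q R)
  have "rational_fls fls_X" by (simp add: rational_fls_def)
  hence rat: "rational_fls (fls_X * fps_to_fls R * inverse (fps_to_fls P))"
    "rational_fls (fps_to_fls Q * inverse (fps_to_fls P))"
    by (intro rational_fls_mult rational_fls_inverse rational_fls_fps P Q R; assumption)+
  have act8: "act scale8 z = 8 * z" for z by (simp add: scale8_def act_mat2)
  have det: "det scale8 > 0" by simp
  have nome8: "nome (8 * z) = exp (2 * pi * \<i> * z / of_nat 1) ^ 4" for z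
    unfolding nome_def by (subst exp_of_nat_mult[symmetric]) (simp add: mult_ac)
  have e8: "exp (of_real pi * \<i> * (8 * z) / 4) = exp (2 * pi * \<i> * z / of_nat 1)" for z
    by (simp add: mult_ac)
  have ueq: "theta_u (8 * z) = (\<lambda>w. w * theta_psi (w ^ 4) * inverse (theta_phi (w ^ 4))) (exp (2 * pi * \<i> * z / of_nat 1))" for z
    unfolding theta_u_def nome8 e8 by (simp only: divide_inverse)
  have veq: "theta_v (8 * z) = (\<lambda>w. theta_phi (- (w ^ 4)) * inverse (theta_phi (w ^ 4))) (exp (2 * pi * \<i> * z / of_nat 1))" for z
    unfolding theta_v_def nome8 by (simp only: divide_inverse)
  have U: "quot_U = mero_of (\<lambda>z. theta_u (8 * z))" and V: "quot_V = mero_of (\<lambda>z. theta_v (8 * z))"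
    unfolding quot_U_def quot_V_def pullback_theta_UV[OF det] act8 by (rule refl)+
  have mU: "(\<lambda>z. theta_u (8 * z)) meromorphic_on uhp" and mV: "(\<lambda>z. theta_v (8 * z)) meromorphic_on uhp"
    using meromorphic_on_act[OF det theta_u_meromorphic] meromorphic_on_act[OF det theta_v_meromorphic]
    unfolding act8 by blast+
  have "has_q_expansion 1 quot_U (fls_X * fps_to_fls R * inverse (fps_to_fls P))"
    unfolding U has_q_expansion_mero_of[OF zero_less_one mU]
    by (intro exI conjI, rule u, rule zero_less_one, rule eventually_cosparse_openI[OF open_Im_gt], rule ueq)
  thus "quot_U \<in> rational_q" unfolding rational_q_def using rat(1) by blast
  have "has_q_expansion 1 quot_V (fps_to_fls Q * inverse (fps_to_fls P))"
    unfolding V has_q_expansion_mero_of[OF zero_less_one mV]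
    by (intro exI conjI, rule v, rule zero_less_one, rule eventually_cosparse_openI[OF open_Im_gt], rule veq)
  thus "quot_V \<in> rational_q" unfolding rational_q_def using rat(2) by blast
qed

lemma quot_UV_rational_modular: "quot_U \<in> rational_modular_functions 64" "quot_V \<in> rational_modular_functions 64"
  using quot_UV_modular quot_UV_rational by (simp_all add: rational_modular_functions_altdef)

subsection \<open>Fields generated over the rationals\<close>

lemma ring_of_type_algebra_simps [simp]:
  "carrier (ring_of_type_algebra :: 'a :: ring_1 ring) = UNIV"
  "x \<oplus>\<^bsub>ring_of_type_algebra\<^esub> y = (x + y :: 'a)"
  "x \<otimes>\<^bsub>ring_of_type_algebra\<^esub> y = (x * y :: 'a)"
  "\<zero>\<^bsub>ring_of_type_algebra\<^esub> = (0 :: 'a)"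
  "\<one>\<^bsub>ring_of_type_algebra\<^esub> = (1 :: 'a)"
  by (simp_all add: ring_of_type_algebra_def)

lemma a_inv_ring_of_type_algebra [simp]: "\<ominus>\<^bsub>ring_of_type_algebra\<^esub> (x :: 'a :: comm_ring_1) = - x"
proof -
  interpret ring "ring_of_type_algebra :: 'a ring" by (rule ring_from_type_algebra)
  have "\<ominus>\<^bsub>ring_of_type_algebra\<^esub> x + x = 0" using l_neg[of x] by simp
  thus ?thesis by (simp add: eq_neg_iff_add_eq_0)
qed

lemma m_inv_ring_of_type_algebra [simp]:
  assumes "(x :: 'a :: field) \<noteq> 0"
  shows "inv\<^bsub>ring_of_type_algebra\<^esub> x = inverse x"
proof -
  interpret field "ring_of_type_algebra :: 'a ring" by (rule field_from_type_algebra)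
  have "inv\<^bsub>ring_of_type_algebra\<^esub> x * x = 1" using Units_l_inv[of x] assms by (simp add: field_Units)
  thus ?thesis using assms by (simp add: field_simps)
qed

lemma Q_adjoin_minimal:
  assumes "S \<subseteq> K" "\<And>r. of_rat r \<in> K" "\<And>a b. a \<in> K \<Longrightarrow> b \<in> K \<Longrightarrow> a + b \<in> K"
    "\<And>a b. a \<in> K \<Longrightarrow> b \<in> K \<Longrightarrow> a * b \<in> K" "\<And>a. a \<in> K \<Longrightarrow> inverse a \<in> K"
  shows "Q_adjoin S \<subseteq> K"
proof
  fix h assume "h \<in> Q_adjoin S"
  thus "h \<in> K" unfolding Q_adjoin_def
  proof induction
    case one
    show ?case using assms(2)[of 1] by simp
  next
    case (incl h)
    thus ?case using assms(1,2) by (auto elim!: Rats_cases)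
  next
    case (a_inv h)
    thus ?case using assms(2)[of "-1"] assms(4)[of "-1" h] by simp
  qed (auto intro: assms)
qed

lemma Q_adjoin_base: "s \<in> S \<Longrightarrow> s \<in> Q_adjoin S"
  unfolding Q_adjoin_def by (rule generate_field.incl) simp

lemma Q_adjoin_of_rat: "of_rat r \<in> Q_adjoin S"
  unfolding Q_adjoin_def by (rule generate_field.incl) simp

lemma Q_adjoin_add: "a \<in> Q_adjoin S \<Longrightarrow> b \<in> Q_adjoin S \<Longrightarrow> a + b \<in> Q_adjoin S"
  unfolding Q_adjoin_def using generate_field.eng_add[of a ring_of_type_algebra _ b] by simp

lemma Q_adjoin_mult: "a \<in> Q_adjoin S \<Longrightarrow> b \<in> Q_adjoin S \<Longrightarrow> a * b \<in> Q_adjoin S"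
  unfolding Q_adjoin_def using generate_field.eng_mult[of a ring_of_type_algebra _ b] by simp

lemma Q_adjoin_uminus: "a \<in> Q_adjoin S \<Longrightarrow> - a \<in> Q_adjoin S"
  unfolding Q_adjoin_def using generate_field.a_inv[of a ring_of_type_algebra] by simp

lemma Q_adjoin_inverse: "a \<in> Q_adjoin S \<Longrightarrow> inverse a \<in> Q_adjoin S"
  unfolding Q_adjoin_def using generate_field.m_inv[of a ring_of_type_algebra] by (cases "a = 0") simp_all

lemma Q_adjoin_numeral: "0 \<in> Q_adjoin S" "1 \<in> Q_adjoin S" "numeral k \<in> Q_adjoin S"
  using Q_adjoin_of_rat[of 0] Q_adjoin_of_rat[of 1] Q_adjoin_of_rat[of "numeral k"] by simp_all

lemma Q_adjoin_diff: "a \<in> Q_adjoin S \<Longrightarrow> b \<in> Q_adjoin S \<Longrightarrow> a - b \<in> Q_adjoin S"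
  using Q_adjoin_add[OF _ Q_adjoin_uminus] by fastforce

lemma Q_adjoin_divide: "a \<in> Q_adjoin S \<Longrightarrow> b \<in> Q_adjoin S \<Longrightarrow> a / b \<in> Q_adjoin S"
  unfolding divide_inverse by (intro Q_adjoin_mult Q_adjoin_inverse)

lemma Q_adjoin_power: "a \<in> Q_adjoin S \<Longrightarrow> a ^ n \<in> Q_adjoin S"
  by (induction n) (auto intro: Q_adjoin_mult Q_adjoin_numeral)

lemma Q_adjoin_sum: "(\<And>i. i \<in> I \<Longrightarrow> f i \<in> Q_adjoin S) \<Longrightarrow> sum f I \<in> Q_adjoin S"
  by (induction I rule: infinite_finite_induct) (auto intro: Q_adjoin_add Q_adjoin_numeral)

lemmas Q_adjoin_intros = Q_adjoin_of_rat Q_adjoin_add Q_adjoin_mult Q_adjoin_uminus Q_adjoin_inverse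
  Q_adjoin_numeral Q_adjoin_diff Q_adjoin_divide Q_adjoin_power Q_adjoin_sum

lemma Q_adjoin_subset: "S \<subseteq> Q_adjoin T \<Longrightarrow> Q_adjoin S \<subseteq> Q_adjoin T"
  by (rule Q_adjoin_minimal) (auto intro: Q_adjoin_intros)

lemma Q_adjoin_subset_rational_modular:
  assumes "S \<subseteq> rational_modular_functions N" "N > 0"
  shows "Q_adjoin S \<subseteq> rational_modular_functions N"
  by (rule Q_adjoin_minimal) (use assms in \<open>auto intro: rational_modular_functions_closed\<close>)

subsection \<open>Evaluation of polynomials\<close>

text \<open>Homomorphisms as plain functions between types, so that evaluation at x, y and t can be
  iterated through the nested polynomial type.\<close>

definition poly_hom :: "('a :: comm_ring_1 \<Rightarrow> 'b :: comm_ring_1) \<Rightarrow> bool" where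
  "poly_hom h \<longleftrightarrow> h 0 = 0 \<and> h 1 = 1 \<and> (\<forall>x y. h (x + y) = h x + h y) \<and> (\<forall>x y. h (x * y) = h x * h y)"

definition eval_via :: "('a :: comm_ring_1 \<Rightarrow> 'b :: comm_ring_1) \<Rightarrow> 'b \<Rightarrow> 'a poly \<Rightarrow> 'b" where
  "eval_via h a p = poly (map_poly h p) a"

lemma eval_via_0 [simp]: "eval_via h a 0 = 0"
  by (simp add: eval_via_def)

lemma eval_via_pCons:
  assumes "poly_hom h"
  shows "eval_via h a (pCons c p) = h c + a * eval_via h a p"
  using assms by (simp add: eval_via_def map_poly_pCons poly_hom_def)

lemma poly_hom_eval_via:
  assumes "poly_hom h"
  shows "poly_hom (eval_via h a)"
proof -
  have h: "h 0 = 0" "h 1 = 1" "\<And>x y. h (x + y) = h x + h y" "\<And>x y. h (x * y) = h x * h y"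
    using assms by (auto simp: poly_hom_def)
  note [simp] = eval_via_pCons[OF assms] h
  have add: "eval_via h a (p + q) = eval_via h a p + eval_via h a q" for p q
    by (induction p q rule: poly_induct2) (simp_all add: algebra_simps)
  have smult: "eval_via h a (Polynomial.smult c p) = h c * eval_via h a p" for c p
    by (induction p) (simp_all add: algebra_simps)
  have "eval_via h a (p * q) = eval_via h a p * eval_via h a q" for p q
    by (induction p) (simp_all add: add smult algebra_simps)
  moreover have "eval_via h a 1 = 1" by (simp add: one_pCons)
  ultimately show ?thesis using add by (simp add: poly_hom_def)
qed

lemma poly_hom_of_rat: "poly_hom (of_rat :: rat \<Rightarrow> 'a :: field_char_0)"
  by (simp add: poly_hom_def of_rat_add of_rat_mult)

lemma poly_hom_const: "poly_hom const_mero_uhp"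
  by (simp add: poly_hom_def const_mero_uhp_0 const_mero_uhp_1 const_mero_uhp_add const_mero_uhp_mult)

lemma poly_hom_minus:
  assumes "poly_hom h" shows "h (- x) = - h x" "h (x - y) = h x - h y"
proof -
  have a: "h (x + y) = h x + h y" "h 0 = 0" for x y using assms by (auto simp: poly_hom_def)
  have "h (- x) + h x = 0" for x using a(1)[of "- x" x] a(2) by simp
  hence u: "h (- x) = - h x" for x by (simp add: eq_neg_iff_add_eq_0)
  show "h (- x) = - h x" by (rule u)
  show "h (x - y) = h x - h y" using a(1)[of x "- y"] u[of y] by simp
qed

lemma poly_hom_power: "poly_hom h \<Longrightarrow> h (x ^ n) = h x ^ n"
  by (induction n) (auto simp: poly_hom_def)

lemma poly_hom_of_int: "poly_hom h \<Longrightarrow> h (of_int n) = of_int n"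
proof -
  assume h: "poly_hom h"
  have n: "h (of_nat n) = of_nat n" for n
    by (induction n) (use h in \<open>auto simp: poly_hom_def\<close>)
  show ?thesis by (cases n) (simp_all add: n poly_hom_minus[OF h] del: of_nat_Suc)
qed

lemma poly_hom_numeral: "poly_hom h \<Longrightarrow> h (numeral k) = numeral k"
  using poly_hom_of_int[of h "numeral k"] by simp

lemma eval_via_sum:
  assumes "poly_hom h"
  shows "eval_via h a p = (\<Sum>i\<le>Polynomial.degree p. h (Polynomial.coeff p i) * a ^ i)"
proof (cases "p = 0")
  case False
  have "h 0 = 0" using assms by (simp add: poly_hom_def)
  have "Polynomial.degree (map_poly h p) \<le> Polynomial.degree p" by (rule map_poly_degree_leq)
  hence "poly (map_poly h p) a = (\<Sum>i\<le>Polynomial.degree p. Polynomial.coeff (map_poly h p) i * a ^ i)"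
    unfolding poly_altdef by (intro sum.mono_neutral_left) (auto simp: coeff_eq_0)
  thus ?thesis using \<open>h 0 = 0\<close> by (simp add: eval_via_def coeff_map_poly)
qed (use assms in \<open>simp add: poly_hom_def\<close>)

lemma eval_via_const_mero_of:
  assumes "f meromorphic_on uhp"
  shows "eval_via const_mero_uhp (mero_of f) P = mero_of (\<lambda>z. poly P (f z))"
proof (induction P)
  case 0
  show ?case by (simp add: mero_of_0)
next
  case (pCons c P)
  have m: "(\<lambda>z. poly P (f z)) meromorphic_on uhp"
    unfolding poly_altdef by (intro meromorphic_intros assms)
  show ?case
    unfolding eval_via_pCons[OF poly_hom_const] pCons.IH poly_pCons
    unfolding mero_of_const[of c] mero_of_mult[OF assms m]
    by (rule mero_of_add) (intro meromorphic_intros assms m)+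
qed

text \<open>The complex numbers are algebraically closed: a root of P splits off a linear factor,
  and in a field one of the two factors vanishes at F.\<close>

lemma algebraic_over_constants:
  fixes F :: mero_uhp
  assumes "P \<noteq> 0" "eval_via const_mero_uhp F P = 0"
  obtains c where "F = const_mero_uhp c"
proof -
  have "\<exists>c. F = const_mero_uhp c"
    using assms
  proof (induction "Polynomial.degree P" arbitrary: P)
    case 0
    then obtain c where "P = [:c:]" by (metis degree_eq_zeroE)
    with 0 have "const_mero_uhp c = const_mero_uhp 0" "c \<noteq> 0"
      by (auto simp: eval_via_pCons[OF poly_hom_const] const_mero_uhp_0)
    thus ?case by (simp add: const_mero_uhp_eq_iff)
  next
    case (Suc n)
    hence "\<not> constant (poly P)" by (simp add: constant_degree)
    from fundamental_theorem_of_algebra[OF this] obtain r where "poly P r = 0" by blast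
    then obtain Q where Q: "P = [:- r, 1:] * Q" by (metis dvdE poly_eq_0_iff_dvd)
    have "Q \<noteq> 0" using Suc.prems Q by auto
    have "n = Polynomial.degree Q" using Suc.hyps(2) \<open>Q \<noteq> 0\<close>
      unfolding Q by (subst (asm) degree_mult_eq) auto
    have "eval_via const_mero_uhp F [:- r, 1:] * eval_via const_mero_uhp F Q = 0"
      using poly_hom_eval_via[OF poly_hom_const, of F] Suc.prems(2) unfolding Q poly_hom_def by metis
    moreover have "eval_via const_mero_uhp F [:- r, 1:] = F - const_mero_uhp r"
      by (simp add: eval_via_pCons[OF poly_hom_const] const_mero_uhp_1 const_mero_uhp_uminus)
    ultimately show ?case using Suc.hyps(1)[OF \<open>n = _\<close> \<open>Q \<noteq> 0\<close>] by auto
  qed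
  thus ?thesis using that by blast
qed

lemma algebraic_over_rationals:
  fixes F :: mero_uhp
  assumes "p \<noteq> 0" "eval_via of_rat F p = 0"
  obtains c where "F = const_mero_uhp c"
proof (rule algebraic_over_constants)
  show "map_poly (of_rat :: rat \<Rightarrow> complex) p \<noteq> 0" using assms(1) by (subst map_poly_eq_0_iff) auto
  show "eval_via const_mero_uhp F (map_poly of_rat p) = 0"
    using assms(2) by (simp add: eval_via_def map_poly_map_poly of_rat_mero_uhp[abs_def] o_def)
qed (rule that)

subsection \<open>The generators\<close>

text \<open>After scaling by 8 this is translation by 2, so \<open>quot_U\<close> acquires the
  factor i and \<open>quot_V\<close> is fixed. An eigenvalue other than 1 rules out
  constants.\<close>

definition quarter_shift :: "real^2^2" where "quarter_shift = mat2 1 (1/4) 0 1"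

lemma det_quarter_shift: "det quarter_shift > 0"
  by (simp add: quarter_shift_def det_mat2)

lemma quot_UV_nonzero: "quot_U \<noteq> 0" "quot_V \<noteq> 0"
proof -
  have d: "det scale8 > 0" by simp
  have "quot_U * pullback scale8 (inverse theta_U) = 1" "quot_V * pullback scale8 (inverse theta_V) = 1"
    unfolding quot_U_def quot_V_def pullback_mult[OF d, symmetric]
    by (simp_all add: theta_UV_nonzero pullback_1)
  thus "quot_U \<noteq> 0" "quot_V \<noteq> 0" by auto
qed

lemma quot_UV_jacobi: "quot_U ^ 4 + quot_V ^ 4 = 1"
proof -
  have d: "det scale8 > 0" by simp
  show ?thesis unfolding quot_U_def quot_V_def pullback_power[OF d, symmetric] pullback_add[OF d, symmetric]
    theta_UV_jacobi pullback_1[OF d] ..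
qed

lemma pullback_quot_UV:
  assumes "det M > 0" "scale8 ** M = gamma2_mat a b c d ** scale8" "a * d - 4 * b * c = 1"
  shows "pullback M quot_U = const_mero_uhp (\<i> powi (a * b)) * quot_U"
    "pullback M quot_V = const_mero_uhp (\<i> powi (- (c * d))) * quot_V"
proof -
  have d: "det scale8 > 0" "det (gamma2_mat a b c d) > 0" using det_gamma2_mat[OF assms(3)] by simp_all
  have "pullback M (pullback scale8 F) = pullback scale8 (pullback (gamma2_mat a b c d) F)" for F
    by (simp only: pullback_pullback d assms(1,2))
  thus "pullback M quot_U = const_mero_uhp (\<i> powi (a * b)) * quot_U"
    "pullback M quot_V = const_mero_uhp (\<i> powi (- (c * d))) * quot_V"
    unfolding quot_U_def quot_V_def
    by (simp_all only: pullback_gamma2_theta_UV[OF assms(3)] pullback_mult[OF d(1)] pullback_const[OF d(1)])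
qed

lemma quarter_shift_quot_UV:
  "pullback quarter_shift quot_U = const_mero_uhp \<i> * quot_U" "pullback quarter_shift quot_V = quot_V"
proof -
  have "scale8 ** quarter_shift = gamma2_mat 1 1 0 1 ** scale8"
    by (simp add: scale8_def quarter_shift_def gamma2_mat_def mat2_mult)
  from pullback_quot_UV[OF det_quarter_shift this]
  show "pullback quarter_shift quot_U = const_mero_uhp \<i> * quot_U" "pullback quarter_shift quot_V = quot_V"
    by (simp_all add: const_mero_uhp_1)
qed

lemma const_mero_uhp_not_eigen:
  assumes "det M > 0" "pullback M F = const_mero_uhp c * F" "c \<noteq> 1" "F \<noteq> 0"
  shows "F \<noteq> const_mero_uhp d"
proof
  assume F: "F = const_mero_uhp d"
  have "const_mero_uhp 1 * F = const_mero_uhp c * F"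
    using assms(2) unfolding F pullback_const[OF assms(1)] by (simp add: const_mero_uhp_1)
  thus False using assms(3,4) by (simp add: const_mero_uhp_eq_iff)
qed

lemma quot_U_transcendental: "p \<noteq> 0 \<Longrightarrow> eval_via of_rat quot_U p \<noteq> 0"
  using algebraic_over_rationals[of p quot_U]
    const_mero_uhp_not_eigen[OF det_quarter_shift quarter_shift_quot_UV(1) _ quot_UV_nonzero(1)]
  by fastforce

lemma pullback_scale8_lambda_poly:
  "pullback scale8 (lambda_poly P) = (\<Sum>i\<le>Polynomial.degree P. const_mero_uhp (Polynomial.coeff P i) * quot_U ^ (4 * i))"
proof -
  have d: "det scale8 > 0" by simp
  have m: "theta_lambda meromorphic_on uhp"
    by (rule holomorphic_uhp_imp_meromorphic[OF theta_lambda_holomorphic])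
  have "mero_of theta_lambda = theta_U ^ 4"
    unfolding theta_U_def mero_of_power[OF theta_u_meromorphic] theta_lambda_def ..
  hence "lambda_poly P = (\<Sum>i\<le>Polynomial.degree P. const_mero_uhp (Polynomial.coeff P i) * theta_U ^ (4 * i))"
    using eval_via_const_mero_of[OF m, of P] by (simp add: eval_via_sum[OF poly_hom_const] power_mult)
  thus ?thesis
    by (simp add: pullback_sum pullback_mult pullback_power pullback_const quot_U_def)
qed

text \<open>\<open>level8_rational\<close> is read as a complex linear relation among the functions
  U^(4 i) f and the monomials in U and V, all with rational expansions.
  \<open>rational_relation\<close> makes the coefficients rational, and the relation is then solved
  for f.\<close>

lemma rational_modular_functions_64_UV: "rational_modular_functions 64 = Q_adjoin {quot_U, quot_V}"
proof
  show "Q_adjoin {quot_U, quot_V} \<subseteq> rational_modular_functions 64"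
    by (rule Q_adjoin_subset_rational_modular) (use quot_UV_rational_modular in auto)
  show "rational_modular_functions 64 \<subseteq> Q_adjoin {quot_U, quot_V}"
  proof
    fix f assume f: "f \<in> rational_modular_functions 64"
    hence fm: "f \<in> modular_functions 64" "f \<in> rational_q" by (auto simp: rational_modular_functions_altdef)
    from level8_rational[OF modular_imp_level8[OF fm(1)]] obtain D Q where DQ: "D \<noteq> 0"
      "lambda_poly D * pullback unscale8 f =
        (\<Sum>(j, k)\<in>{..<4} \<times> {..<4}. lambda_poly (Q (j, k)) * (theta_U ^ j * theta_V ^ (3 * k)))"
      by blast
    have d: "det scale8 > 0" by simp
    define n where "n = Polynomial.degree D"
    define J where "J = (SIGMA jk : {..<4 :: nat} \<times> {..<4 :: nat}. {..Polynomial.degree (Q jk)})"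
    define u where "u = (\<lambda>((j, k), i). quot_U ^ (4 * i) * (quot_U ^ j * quot_V ^ (3 * k)))"
    \<comment> \<open>Left summands index the terms containing f, right summands the monomials; the
      leading coefficient of D at \<open>Inl n\<close> is the one to be normalised.\<close>
    define c where "c = case_sum (Polynomial.coeff D) (\<lambda>(jk, i). - Polynomial.coeff (Q jk) i)"
    define e where "e = case_sum (\<lambda>i. quot_U ^ (4 * i) * f) u"
    define I where "I = Inl ` {..n} \<union> Inr ` J"
    have finJ: "finite J" by (simp add: J_def)
    have split: "(\<Sum>i\<in>I. g i) = (\<Sum>i\<le>n. g (Inl i)) + (\<Sum>i\<in>J. g (Inr i))" for g :: "_ \<Rightarrow> mero_uhp"
      unfolding I_def by (subst sum.union_disjoint) (auto simp: finJ sum.reindex)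
    have "pullback scale8 (lambda_poly D * pullback unscale8 f) =
        (\<Sum>i\<le>n. const_mero_uhp (c (Inl i)) * e (Inl i))"
      unfolding pullback_mult[OF d] pullback_scale8_unscale8 pullback_scale8_lambda_poly
      by (simp add: n_def c_def e_def sum_distrib_right mult.assoc)
    moreover have "pullback scale8 (\<Sum>(j, k)\<in>{..<4} \<times> {..<4}. lambda_poly (Q (j, k)) * (theta_U ^ j * theta_V ^ (3 * k)))
        = (\<Sum>jk\<in>{..<4} \<times> {..<4}. \<Sum>i\<le>Polynomial.degree (Q jk). - const_mero_uhp (c (Inr (jk, i))) * e (Inr (jk, i)))"
      unfolding case_prod_unfold pullback_sum[OF d] pullback_mult[OF d] pullback_scale8_lambda_poly pullback_power[OF d]
        quot_U_def[symmetric] quot_V_def[symmetric]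
      by (rule sum.cong) (auto simp: c_def e_def u_def sum_distrib_right mult.assoc const_mero_uhp_uminus)
    moreover have "\<dots> = - (\<Sum>i\<in>J. const_mero_uhp (c (Inr i)) * e (Inr i))"
      unfolding J_def by (subst sum.Sigma) (auto simp: sum_negf case_prod_unfold)
    ultimately have "(\<Sum>i\<in>I. const_mero_uhp (c i) * e i) = 0"
      unfolding split using DQ(2) by simp
    moreover have "e i \<in> rational_q" if "i \<in> I" for i
      using that by (auto simp: I_def e_def u_def intro!: rational_q_mult rational_q_power quot_UV_rational fm(2))
    moreover have "finite I" "Inl n \<in> I" "c (Inl n) \<noteq> 0"
      using DQ(1) by (simp_all add: I_def finJ c_def n_def)
    ultimately obtain r where r: "r (Inl n) = 1" "(\<Sum>i\<in>I. of_rat (r i) * e i) = 0"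
      using rational_relation[of I "Inl n" c e] by blast
    define A where "A = (\<Sum>i\<le>n. of_rat (r (Inl i)) * quot_U ^ (4 * i))"
    define B where "B = (\<Sum>i\<in>J. of_rat (r (Inr i)) * u i)"
    have "A * f + B = 0"
      using r(2) unfolding split by (simp add: A_def B_def e_def sum_distrib_right mult.assoc)
    \<comment> \<open>A is a rational polynomial in U with leading coefficient 1, and U is
      transcendental over the rationals.\<close>
    moreover have "A \<noteq> 0"
    proof -
      define p where "p = (\<Sum>i\<le>n. Polynomial.monom (r (Inl i)) (4 * i))"
      have "Polynomial.coeff p (4 * n) = 1"
        unfolding p_def coeff_sum using r(1) by (subst sum.remove[of _ n]) auto
      hence "p \<noteq> 0" by auto
      note hom = poly_hom_eval_via[OF poly_hom_of_rat, of quot_U]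
      have add: "eval_via of_rat quot_U (a + b) = eval_via of_rat quot_U a + eval_via of_rat quot_U b" for a b
        using hom by (simp add: poly_hom_def)
      have mon: "eval_via of_rat quot_U (Polynomial.monom q k) = of_rat q * quot_U ^ k" for q k
        by (simp add: eval_via_def map_poly_monom poly_monom)
      have "eval_via of_rat quot_U (\<Sum>i\<in>K. Polynomial.monom (r (Inl i)) (4 * i)) =
          (\<Sum>i\<in>K. of_rat (r (Inl i)) * quot_U ^ (4 * i))" if "finite K" for K
        using that by induction (simp_all add: add mon)
      hence "A = eval_via of_rat quot_U p" by (simp add: A_def p_def)
      thus ?thesis using quot_U_transcendental[OF \<open>p \<noteq> 0\<close>] by simp
    qed
    ultimately have "f = - B / A" by (simp add: field_simps eq_neg_iff_add_eq_0)
    moreover have "quot_U \<in> Q_adjoin {quot_U, quot_V}" "quot_V \<in> Q_adjoin {quot_U, quot_V}"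
      by (rule Q_adjoin_base; simp)+
    ultimately show "f \<in> Q_adjoin {quot_U, quot_V}"
      by (auto simp: A_def B_def u_def case_prod_unfold intro!: Q_adjoin_intros)
  qed
qed

section \<open>Orbits of \<open>Gamma0 64\<close>\<close>

lemma Gamma0_mult: "M \<in> Gamma0 64 \<Longrightarrow> N \<in> Gamma0 64 \<Longrightarrow> M ** N \<in> Gamma0 64"
proof -
  assume M: "M \<in> Gamma0 64" and N: "N \<in> Gamma0 64"
  from Gamma0_E[OF M] obtain a b k d where 1: "M = mat2 (of_int a) (of_int b) (of_int (64 * k)) (of_int d)" .
  from Gamma0_E[OF N] obtain a' b' k' d' where 2: "N = mat2 (of_int a') (of_int b') (of_int (64 * k')) (of_int d')" .
  have "(M ** N) $ 2 $ 1 = of_int (int 64 * (k * a' + d * k'))"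
    unfolding 1 2 mat2_mult by (simp add: algebra_simps)
  moreover have "M ** N \<in> SL2Z" using M N Gamma0_SL2Z by (blast intro: SL2Z_mult)
  ultimately show ?thesis unfolding Gamma0_def by blast
qed

lemma Gamma0_inverse:
  assumes "M \<in> Gamma0 64"
  obtains M' where "M' \<in> Gamma0 64" "M' ** M = mat 1"
proof -
  from Gamma0_E[OF assms] obtain a b k d where M: "M = mat2 (of_int a) (of_int b) (of_int (64 * k)) (of_int d)"
    and det: "a * d - 64 * b * k = 1" .
  have det': "real_of_int a * of_int d - 64 * of_int b * of_int k = 1" using arg_cong[OF det, of real_of_int] by simp
  have "mat2 (of_int d) (of_int (- b)) (of_int (- 64 * k)) (of_int a) \<in> Gamma0 64"
    by (rule Gamma0_I) (use det in \<open>auto simp: algebra_simps\<close>)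
  moreover have "mat2 (of_int d) (of_int (- b)) (of_int (- 64 * k)) (of_int a) ** M = mat 1"
    unfolding M mat2_mult by (rule mat2_eqI[symmetric]) (use det' in \<open>auto simp: mat_def algebra_simps\<close>)
  ultimately show ?thesis by (rule that)
qed

lemma Gamma0_det_pos: "M \<in> Gamma0 N \<Longrightarrow> det M > 0"
  using Gamma0_SL2Z det_SL2Z_pos by blast

lemma Gamma0_orbit_act:
  assumes "M \<in> Gamma0 64" "z \<in> uhp"
  shows "Gamma0_orbit 64 (act M z) = Gamma0_orbit 64 z"
proof
  show "Gamma0_orbit 64 (act M z) \<subseteq> Gamma0_orbit 64 z"
    using assms by (auto simp: Gamma0_orbit_def act_mult[OF Gamma0_det_pos, symmetric] intro!: imageI Gamma0_mult)
  obtain M' where M': "M' \<in> Gamma0 64" "M' ** M = mat 1" using Gamma0_inverse[OF assms(1)] .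
  show "Gamma0_orbit 64 z \<subseteq> Gamma0_orbit 64 (act M z)"
  proof
    fix y assume "y \<in> Gamma0_orbit 64 z"
    then obtain N where N: "N \<in> Gamma0 64" "y = act N z" by (auto simp: Gamma0_orbit_def)
    have "act (N ** M') (act M z) = act ((N ** M') ** M) z"
      by (rule act_mult[symmetric]) (use assms Gamma0_det_pos in auto)
    also have "(N ** M') ** M = N" unfolding matrix_mul_assoc[symmetric] M'(2) by simp
    finally have "y = act (N ** M') (act M z)" using N by simp
    thus "y \<in> Gamma0_orbit 64 (act M z)" using N M' by (auto simp: Gamma0_orbit_def intro: Gamma0_mult)
  qed
qed

subsection \<open>The involution\<close>

lemma odd_from_double: "n = 2 * m + 1 \<Longrightarrow> odd (n :: int)"
  by simp

text \<open>The shape of all squares of S2 times an Atkin-Lehner matrix; only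
  \<open>p * s - 16 * q * r = 1\<close> and the oddness of q and r matter afterwards.\<close>

definition involution_mat :: "int \<Rightarrow> int \<Rightarrow> int \<Rightarrow> int \<Rightarrow> real^2^2" where
  "involution_mat p q r s = mat2 (of_int p) (of_int q / 2) (32 * of_int r) (of_int s)"

lemma square_shift_atkin_lehner:
  assumes "W \<in> atkin_lehner_matrices 64 64" "w = (S2 ** W) ** (S2 ** W)"
  obtains p q r s where "w = involution_mat p q r s" "p * s - 16 * q * r = 1" "odd q" "odd r"
proof -
  from assms(1) obtain A B C D :: int where
    W: "W = (1 / sqrt 64) *\<^sub>R mat2 (of_int (A * 64)) (of_int B) (of_int (64 * C)) (of_int (D * 64))"
    and det: "det W = 1" by (auto simp: atkin_lehner_matrices_def)
  have "sqrt 64 = 8" by (rule real_sqrt_unique) auto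
  hence W': "W = mat2 (8 * of_int A) (of_int B / 8) (8 * of_int C) (8 * of_int D)"
    unfolding W by (intro mat2_eqI) simp_all
  have "real_of_int (64 * A * D - B * C) = of_int 1" using det unfolding W' det_mat2 by simp
  hence det': "64 * A * D - B * C = 1" by (simp only: of_int_eq_iff)
  hence "B * C = 2 * (32 * A * D - 1) + 1" by simp
  hence "odd (B * C)" by (rule odd_from_double)
  hence odd: "odd B" "odd C" by auto
  \<comment> \<open>A quarter of the trace of \<open>S2 ** W\<close>, which multiplies the
    off-diagonal entries on squaring. It is odd because C is, since 64 A D - B C = 1.\<close>
  define T where "T = 2 * A + C + 2 * D"
  define p where "p = (8 * A + 4 * C)^2 + C * (B + 32 * D)"
  define s where "s = 64 * D^2 + C * (B + 32 * D)"
  have "w = involution_mat p ((B + 32 * D) * T) (C * T) s"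
    unfolding assms(2) W' S2_def mat2_mult involution_mat_def
    by (rule mat2_eqI) (simp_all add: T_def p_def s_def field_simps power2_eq_square)
  moreover have "p * s - 16 * ((B + 32 * D) * T) * (C * T) = 1"
  proof -
    have "p * s - 16 * ((B + 32 * D) * T) * (C * T) = (64 * A * D - B * C)^2"
      by (simp add: p_def s_def T_def algebra_simps power2_eq_square)
    thus ?thesis unfolding det' by simp
  qed
  moreover have "odd ((B + 32 * D) * T)" "odd (C * T)" using odd by (simp_all add: T_def)
  ultimately show ?thesis by (rule that)
qed

text \<open>Both diagonal entries of M are odd, so their difference is even; this makes the term
  with q / 2 integral and raises the factor 32 to 64 in the lower left entry.\<close>

lemma involution_mat_conjugate:
  assumes "p * s - 16 * q * r = 1" "M \<in> Gamma0 64"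
  shows "involution_mat p q r s ** M ** involution_mat s (- q) (- r) p \<in> Gamma0 64"
proof -
  from Gamma0_E[OF assms(2)] obtain a b k d where M: "M = mat2 (of_int a) (of_int b) (of_int (64 * k)) (of_int d)"
    and det: "a * d - 64 * b * k = 1" .
  hence "a * d = 2 * (32 * b * k) + 1" by simp
  hence "odd (a * d)" by (rule odd_from_double)
  hence "even (d - a)" by auto
  then obtain e where d: "d = a + 2 * e" by (metis add_diff_cancel_left' diff_add_cancel evenE add.commute)
  have det': "real_of_int p * of_int s - 16 * of_int q * of_int r = 1"
    using arg_cong[OF assms(1), of real_of_int] by simp
  define N where "N = involution_mat p q r s ** M ** involution_mat s (- q) (- r) p"
  define a' where "a' = s * (p * a + 32 * q * k) - 32 * r * (p * b) - 16 * r * q * d"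
  define b' where "b' = p * q * e - 16 * q * q * k + p * p * b"
  define c' where "c' = 64 * (s * s * k - r * s * e - 16 * r * r * b)"
  define d' where "d' = p * (32 * r * b + s * d) - 16 * q * r * a - 32 * q * s * k"
  have N: "N = mat2 (of_int a') (of_int b') (of_int c') (of_int d')"
    unfolding N_def involution_mat_def M mat2_mult
    by (rule mat2_eqI) (simp_all add: a'_def b'_def c'_def d'_def d field_simps)
  have "det N = 1"
    unfolding N_def det_mul using det' arg_cong[OF det, of real_of_int]
    by (simp add: M det_mat2 involution_mat_def mult.commute mult.left_commute)
  hence "real_of_int (a' * d' - b' * c') = of_int 1" unfolding N det_mat2 by simp
  hence "a' * d' - b' * c' = 1" by (simp only: of_int_eq_iff)
  hence "N \<in> Gamma0 64" unfolding N by (rule Gamma0_I) (simp add: c'_def)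
  thus ?thesis by (simp add: N_def)
qed

lemma involution_mat_inverse:
  assumes "p * s - 16 * q * r = 1"
  shows "involution_mat p q r s ** involution_mat s (- q) (- r) p = mat 1"
    "involution_mat s (- q) (- r) p ** involution_mat p q r s = mat 1"
proof -
  have det': "real_of_int p * of_int s - 16 * of_int q * of_int r = 1"
    using arg_cong[OF assms(1), of real_of_int] by simp
  show "involution_mat p q r s ** involution_mat s (- q) (- r) p = mat 1"
    "involution_mat s (- q) (- r) p ** involution_mat p q r s = mat 1"
    unfolding involution_mat_def mat2_mult
    by (rule mat2_eqI[symmetric]; use det' in \<open>simp add: mat_def algebra_simps\<close>)+
qed

lemma involution_mat_normalizes:
  assumes "p * s - 16 * q * r = 1"
  shows "normalizes (involution_mat p q r s) (Gamma0 64)"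
proof -
  let ?w = "involution_mat p q r s" and ?v = "involution_mat s (- q) (- r) p"
  note inv = involution_mat_inverse[OF assms]
  have "?w ** matrix_inv ?w = mat 1" unfolding matrix_inv_def by (rule someI2[of _ ?v]) (use inv in auto)
  hence "?v ** (?w ** matrix_inv ?w) = ?v" by simp
  hence minv: "matrix_inv ?w = ?v" unfolding matrix_mul_assoc inv by simp
  have "M \<in> (\<lambda>\<gamma>. ?w ** \<gamma> ** ?v) ` Gamma0 64" if M: "M \<in> Gamma0 64" for M
  proof (rule image_eqI)
    show "?v ** M ** ?w \<in> Gamma0 64"
      using involution_mat_conjugate[of s p "- q" "- r" M] assms M by (simp add: mult.commute)
    have "?w ** (?v ** M ** ?w) ** ?v = (?w ** ?v) ** M ** (?w ** ?v)" by (simp only: matrix_mul_assoc)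
    thus "M = ?w ** (?v ** M ** ?w) ** ?v" by (simp add: inv)
  qed
  thus ?thesis unfolding normalizes_def minv using involution_mat_conjugate[OF assms] by auto
qed

text \<open>The off-diagonal entries of the square are the trace times q / 2 and 32 r, and the trace
  is even because p and s are odd.\<close>

lemma involution_mat_square:
  assumes "p * s - 16 * q * r = 1"
  shows "involution_mat p q r s ** involution_mat p q r s \<in> Gamma0 64"
proof -
  have "p * s = 2 * (8 * q * r) + 1" using assms by simp
  hence "odd (p * s)" by (rule odd_from_double)
  hence "even (p + s)" by auto
  then obtain h where h: "p + s = 2 * h" by (rule evenE)
  hence s: "s = 2 * h - p" by simp
  have eq: "involution_mat p q r s ** involution_mat p q r s =
    mat2 (of_int (p * p + 16 * q * r)) (of_int (q * h)) (of_int (64 * (r * h))) (of_int (16 * q * r + s * s))"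
    unfolding involution_mat_def mat2_mult by (rule mat2_eqI) (simp_all add: s field_simps)
  have "(p * p + 16 * q * r) * (16 * q * r + s * s) - (q * h) * (64 * (r * h)) =
      (p * s - 16 * q * r)^2 + 16 * q * r * ((p + s)^2 - (2 * h)^2)"
    by (simp add: algebra_simps power2_eq_square)
  also have "\<dots> = 1" unfolding assms h by simp
  finally show ?thesis unfolding eq by (rule Gamma0_I) simp
qed

lemma det_involution_mat: "p * s - 16 * q * r = 1 \<Longrightarrow> det (involution_mat p q r s) = 1"
  by (drule arg_cong[of _ _ real_of_int]) (simp add: involution_mat_def det_mat2)

lemma i_powi_odd: "odd (a :: int) \<Longrightarrow> \<i> powi (2 * a) = - 1"
  by (auto elim!: oddE simp: power_int_add power_int_mult)

lemma scale8_involution_mat: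
  "scale8 ** involution_mat p q r s = gamma2_mat p (2 * q) (2 * r) s ** scale8"
  by (simp add: scale8_def involution_mat_def gamma2_mat_def mat2_mult mult.commute)

lemma involution_mat_odd:
  assumes "p * s - 16 * q * r = 1" "odd q" "odd r"
  shows "\<i> powi (p * (2 * q)) = - 1" "\<i> powi (- (2 * r * s)) = - 1"
proof -
  have "p * s = 2 * (8 * q * r) + 1" using assms(1) by simp
  hence "odd (p * s)" by (rule odd_from_double)
  hence "odd (p * q)" "odd (- (r * s))" using assms by simp_all
  from this[THEN i_powi_odd] show "\<i> powi (p * (2 * q)) = - 1" "\<i> powi (- (2 * r * s)) = - 1"
    by (simp_all add: mult_ac)
qed

lemma pullback_involution_mat:
  assumes "p * s - 16 * q * r = 1" "odd q" "odd r"
  shows "pullback (involution_mat p q r s) quot_U = - quot_U" "pullback (involution_mat p q r s) quot_V = - quot_V"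
  using pullback_quot_UV[OF _ scale8_involution_mat, of p q r s] det_involution_mat[OF assms(1)] assms(1)
    involution_mat_odd[OF assms]
  by (simp_all add: const_mero_uhp_uminus const_mero_uhp_1)

text \<open>\<open>theta_u\<close> at 8 z is constant on orbits and nowhere zero, yet the matrix
  changes its sign; hence no orbit in the upper half plane is fixed.\<close>

lemma involution_mat_moves_orbits:
  assumes w: "p * s - 16 * q * r = 1" "odd q" "odd r" and z: "z \<in> uhp"
  shows "Gamma0_orbit 64 (act (involution_mat p q r s) z) \<noteq> Gamma0_orbit 64 z"
proof
  let ?w = "involution_mat p q r s"
  assume eq: "Gamma0_orbit 64 (act ?w z) = Gamma0_orbit 64 z"
  have "mat 1 = mat2 (of_int 1) (of_int 0) (of_int 0) (of_int 1)" by (rule mat2_eqI) (simp_all add: mat_def)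
  also have "\<dots> \<in> Gamma0 64" by (rule Gamma0_I) simp_all
  finally have "act ?w z \<in> Gamma0_orbit 64 (act ?w z)"
    unfolding Gamma0_orbit_def by (rule image_eqI[rotated]) simp
  then obtain M where M: "M \<in> Gamma0 64" "act ?w z = act M z" unfolding eq by (auto simp: Gamma0_orbit_def)
  from Gamma0_E[OF M(1)] obtain a b k d where M': "M = mat2 (of_int a) (of_int b) (of_int (64 * k)) (of_int d)"
    and det: "a * d - 64 * b * k = 1" .
  have scaleM: "scale8 ** M = gamma2_mat a (4 * b) (4 * k) d ** scale8"
    by (simp add: scale8_def M' gamma2_mat_def mat2_mult mult.commute)
  have u: "theta_u (act scale8 (act N z)) = \<i> powi (a' * b') * theta_u (act scale8 z)"
    if "scale8 ** N = gamma2_mat a' b' c' d' ** scale8" "a' * d' - 4 * b' * c' = 1" "det N > 0" for N a' b' c' d'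
  proof -
    have "act scale8 (act N z) = act (gamma2_mat a' b' c' d') (act scale8 z)"
      using act_mult[OF that(3) z, of scale8] act_mult[of scale8 z "gamma2_mat a' b' c' d'"] z by (simp add: that(1))
    thus ?thesis using theta_uv_gamma2_mat[OF that(2), of "act scale8 z"] act_in_uhp[of scale8 z] z by simp
  qed
  have "theta_u (act scale8 (act ?w z)) = - theta_u (act scale8 z)"
    using u[OF scale8_involution_mat] det_involution_mat[OF w(1)] w(1) involution_mat_odd[OF w] by simp
  moreover have "theta_u (act scale8 (act M z)) = theta_u (act scale8 z)"
    using u[OF scaleM _ Gamma0_det_pos[OF M(1)]] det by (simp add: power_int_mult mult.left_commute[of a 4] mult.assoc)
  moreover have "theta_u (act scale8 z) \<noteq> 0" using theta_u_nonzero act_in_uhp[of scale8 z] z by simp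
  ultimately show False using M(2) by simp
qed

subsection \<open>The function field\<close>

definition gen_x :: mero_uhp where "gen_x = 2 * (1 + quot_V ^ 2) / quot_U ^ 2"
definition gen_y :: mero_uhp where "gen_y = 2 * gen_x * (quot_V / quot_U)"
definition gen_t :: mero_uhp where "gen_t = 2 * gen_y / quot_U"

lemma gen_equations:
  "gen_y ^ 2 = gen_x ^ 3 - 4 * gen_x" "gen_t ^ 2 = (-2 + gen_x) * (2 + gen_x) * (4 + gen_x ^ 2)"
proof -
  define a where "a = inverse quot_U"
  define b where "b = quot_V * a"
  have "a ^ 4 = (quot_U ^ 4 + quot_V ^ 4) * a ^ 4" using quot_UV_jacobi by simp
  also have "\<dots> = 1 + b ^ 4" using quot_UV_nonzero by (simp add: a_def b_def field_simps)
  finally have ab: "a ^ 4 - b ^ 4 = 1" by simp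
  have gens: "gen_x = 2 * (a^2 + b^2)" "gen_y = 2 * gen_x * b" "gen_t = 2 * gen_y * a"
    unfolding gen_x_def gen_y_def gen_t_def a_def b_def by (simp_all add: divide_inverse algebra_simps power_mult_distrib power_inverse)
  have "gen_x ^ 2 - 4 * (a ^ 4 - b ^ 4) = 4 * b ^ 2 * gen_x" "gen_x ^ 2 + 4 * (a ^ 4 - b ^ 4) = 4 * a ^ 2 * gen_x"
    unfolding gens(1) by (simp_all add: algebra_simps power2_eq_square power4_eq_xxxx)
  hence x: "gen_x ^ 2 - 4 = 4 * b ^ 2 * gen_x" "gen_x ^ 2 + 4 = 4 * a ^ 2 * gen_x" unfolding ab by simp_all
  have "gen_y ^ 2 = gen_x * (4 * b ^ 2 * gen_x)" unfolding gens(2) by (simp add: power2_eq_square)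
  thus "gen_y ^ 2 = gen_x ^ 3 - 4 * gen_x"
    unfolding x(1)[symmetric] by (simp add: algebra_simps power2_eq_square power3_eq_cube)
  have "gen_t ^ 2 = (4 * b ^ 2 * gen_x) * (4 * a ^ 2 * gen_x)"
    unfolding gens(2,3) by (simp add: power2_eq_square)
  thus "gen_t ^ 2 = (-2 + gen_x) * (2 + gen_x) * (4 + gen_x ^ 2)"
    unfolding x[symmetric] by (simp add: algebra_simps power2_eq_square)
qed

text \<open>x = 0 would give V^2 = -1, hence V^4 = 1 and U = 0 by Jacobi's identity.\<close>

lemma gen_nonzero: "gen_x \<noteq> 0" "gen_y \<noteq> 0" "gen_t \<noteq> 0"
proof -
  show "gen_x \<noteq> 0"
  proof
    assume "gen_x = 0"
    hence "2 * (1 + quot_V ^ 2) = 0" using quot_UV_nonzero by (simp only: gen_x_def) simp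
    hence "quot_V ^ 2 = - 1" by (simp only: mult_eq_0_iff) (simp add: eq_neg_iff_add_eq_0 add.commute)
    hence "(quot_V ^ 2) ^ 2 = 1" by simp
    hence "quot_V ^ 4 = 1" by (simp flip: power_mult)
    thus False using quot_UV_jacobi quot_UV_nonzero(1) by simp
  qed
  thus "gen_y \<noteq> 0" "gen_t \<noteq> 0" using quot_UV_nonzero by (simp_all add: gen_y_def gen_t_def)
qed

lemma Q_adjoin_gens: "Q_adjoin {gen_x, gen_y, gen_t} = Q_adjoin {quot_U, quot_V}"
proof
  have "quot_U \<in> Q_adjoin {quot_U, quot_V}" "quot_V \<in> Q_adjoin {quot_U, quot_V}" by (rule Q_adjoin_base; simp)+
  hence "gen_x \<in> Q_adjoin {quot_U, quot_V}" unfolding gen_x_def by (intro Q_adjoin_intros)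
  moreover from this have "gen_y \<in> Q_adjoin {quot_U, quot_V}"
    using \<open>quot_U \<in> _\<close> \<open>quot_V \<in> _\<close> unfolding gen_y_def by (intro Q_adjoin_intros)
  moreover from this have "gen_t \<in> Q_adjoin {quot_U, quot_V}"
    using \<open>quot_U \<in> _\<close> unfolding gen_t_def by (intro Q_adjoin_intros)
  ultimately show "Q_adjoin {gen_x, gen_y, gen_t} \<subseteq> Q_adjoin {quot_U, quot_V}"
    by (intro Q_adjoin_subset) auto
  let ?K = "Q_adjoin {gen_x, gen_y, gen_t}"
  have g: "gen_x \<in> ?K" "gen_y \<in> ?K" "gen_t \<in> ?K" by (rule Q_adjoin_base; simp)+
  have U: "quot_U = 2 * gen_y / gen_t" using gen_nonzero quot_UV_nonzero by (simp add: gen_t_def)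
  have "quot_U \<in> ?K" unfolding U by (intro Q_adjoin_intros g)
  moreover have "quot_V = gen_y * quot_U / (2 * gen_x)"
    using gen_nonzero quot_UV_nonzero by (simp add: gen_y_def)
  ultimately have "quot_V \<in> ?K" using g by (metis Q_adjoin_divide Q_adjoin_mult Q_adjoin_numeral(3))
  with \<open>quot_U \<in> ?K\<close> show "Q_adjoin {quot_U, quot_V} \<subseteq> ?K" by (intro Q_adjoin_subset) auto
qed

lemma pullback_gens:
  assumes "det w > 0" "pullback w quot_U = - quot_U" "pullback w quot_V = - quot_V"
  shows "pullback w gen_x = gen_x" "pullback w gen_y = gen_y" "pullback w gen_t = - gen_t"
proof -
  have num: "pullback w 2 = 2" using pullback_of_rat[OF assms(1), of 2] by simp
  note simps = pullback_divide[OF assms(1)] pullback_mult[OF assms(1)] pullback_add[OF assms(1)]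
    pullback_power[OF assms(1)] pullback_1[OF assms(1)] num assms(2,3)
  show x: "pullback w gen_x = gen_x" unfolding gen_x_def simps by simp
  show y: "pullback w gen_y = gen_y" unfolding gen_y_def simps x by simp
  show "pullback w gen_t = - gen_t" unfolding gen_t_def simps y by simp
qed

section \<open>Quadratic extensions with an involution\<close>

lemma pullback_Q_adjoin:
  assumes "det w > 0" "\<And>s. s \<in> S \<Longrightarrow> pullback w s \<in> Q_adjoin S" "f \<in> Q_adjoin S"
  shows "pullback w f \<in> Q_adjoin S"
proof -
  have "Q_adjoin S \<subseteq> {f. pullback w f \<in> Q_adjoin S}"
    by (rule Q_adjoin_minimal)
       (auto simp: assms(1,2) pullback_add pullback_mult pullback_inverse pullback_of_rat intro: Q_adjoin_intros)
  thus ?thesis using assms(3) by blast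
qed

lemma pullback_Q_adjoin_fixed:
  assumes "det w > 0" "\<And>s. s \<in> S \<Longrightarrow> pullback w s = s" "f \<in> Q_adjoin S"
  shows "pullback w f = f"
proof -
  have "Q_adjoin S \<subseteq> {f. pullback w f = f}"
    by (rule Q_adjoin_minimal)
       (auto simp: assms(1,2) pullback_add pullback_mult pullback_inverse pullback_of_rat)
  thus ?thesis using assms(3) by blast
qed

text \<open>The elements a + b t form a field: inverses come from multiplying by the conjugate a - b
  t, whose product with a + b t has no t.\<close>

lemma Q_adjoin_quadratic:
  assumes w: "det w > 0" "\<And>s. s \<in> S \<Longrightarrow> pullback w s = s" "pullback w t = - t" and t: "t ^ 2 \<in> Q_adjoin S"
    and f: "f \<in> Q_adjoin (insert t S)"
  obtains a b where "a \<in> Q_adjoin S" "b \<in> Q_adjoin S" "f = a + b * t"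
proof -
  let ?K = "Q_adjoin S"
  let ?L = "{a + b * t |a b. a \<in> ?K \<and> b \<in> ?K}"
  note 0 = Q_adjoin_numeral(1,2)[of S]
  have "Q_adjoin (insert t S) \<subseteq> ?L"
  proof (rule Q_adjoin_minimal)
    have "t = 0 + 1 * t" "s = s + 0 * t" for s by simp_all
    thus "insert t S \<subseteq> ?L" using 0 Q_adjoin_base[of _ S] by blast
    show "of_rat r \<in> ?L" for r
      using 0 Q_adjoin_of_rat[of r S] by (intro CollectI exI[of _ "of_rat r"] exI[of _ 0]) simp
    show "f + g \<in> ?L" if "f \<in> ?L" "g \<in> ?L" for f g
    proof -
      from that obtain a b c d where "a \<in> ?K" "b \<in> ?K" "c \<in> ?K" "d \<in> ?K" "f = a + b * t" "g = c + d * t" by blast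
      thus ?thesis
        by (intro CollectI exI[of _ "a + c"] exI[of _ "b + d"]) (auto intro: Q_adjoin_intros simp: algebra_simps)
    qed
    show "f * g \<in> ?L" if "f \<in> ?L" "g \<in> ?L" for f g
    proof -
      from that obtain a b c d where "a \<in> ?K" "b \<in> ?K" "c \<in> ?K" "d \<in> ?K" "f = a + b * t" "g = c + d * t" by blast
      thus ?thesis
        by (intro CollectI exI[of _ "a * c + b * d * t ^ 2"] exI[of _ "a * d + b * c"] conjI)
           (simp add: algebra_simps power2_eq_square, (intro Q_adjoin_intros t; assumption)+)
    qed
    show "inverse f \<in> ?L" if "f \<in> ?L" for f
    proof (cases "f = 0")
      case True
      thus ?thesis using that by simp
    next
      case False
      from that obtain a b where ab: "a \<in> ?K" "b \<in> ?K" "f = a + b * t" by blast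
      have "pullback w f = a - b * t"
        using ab pullback_Q_adjoin_fixed[OF w(1,2)] by (simp add: pullback_add pullback_mult w(1,3))
      \<comment> \<open>The conjugate is the image of a nonzero element under a homomorphism of
        fields, so the norm n does not vanish.\<close>
      moreover have "pullback w f \<noteq> 0"
        using False pullback_mult[OF w(1), of f "inverse f"] pullback_1[OF w(1)] by auto
      ultimately have nz: "a - b * t \<noteq> 0" by simp
      define n where "n = a ^ 2 - b ^ 2 * t ^ 2"
      have n: "n = f * (a - b * t)" by (simp add: n_def ab(3) algebra_simps power2_eq_square)
      have "n \<in> ?K" unfolding n_def by (intro Q_adjoin_intros ab t)
      moreover have "inverse f = a / n + (- b / n) * t"
      proof -
        have "inverse f = (a - b * t) / n" using False nz by (simp add: n field_simps)
        thus ?thesis by (simp add: diff_divide_distrib)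
      qed
      ultimately show ?thesis using ab by (intro CollectI exI[of _ "a / n"] exI[of _ "- b / n"]) (auto intro: Q_adjoin_intros)
    qed
  qed
  thus ?thesis using f that by blast
qed

lemma Q_adjoin_invariants:
  assumes w: "det w > 0" "\<And>s. s \<in> S \<Longrightarrow> pullback w s = s" "pullback w t = - t" and t: "t ^ 2 \<in> Q_adjoin S" "t \<noteq> 0"
  shows "{f \<in> Q_adjoin (insert t S). pullback w f = f} = Q_adjoin S"
proof safe
  fix f assume f: "f \<in> Q_adjoin (insert t S)" "pullback w f = f"
  from Q_adjoin_quadratic[OF w t(1) f(1)] obtain a b where ab: "a \<in> Q_adjoin S" "b \<in> Q_adjoin S" "f = a + b * t" .
  have "pullback w f = a - b * t"
    using ab pullback_Q_adjoin_fixed[OF w(1,2)] by (simp add: pullback_add pullback_mult w(1,3))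
  hence "b = 0" using f(2) ab(3) t(2) by (simp add: eq_neg_iff_add_eq_0 flip: mult_2)
  thus "f \<in> Q_adjoin S" using ab by simp
next
  fix f assume "f \<in> Q_adjoin S"
  thus "f \<in> Q_adjoin (insert t S)" using Q_adjoin_subset[of S "insert t S"] Q_adjoin_base[of _ "insert t S"] by blast
  show "pullback w f = f" by (rule pullback_Q_adjoin_fixed[OF w(1,2) \<open>f \<in> Q_adjoin S\<close>])
qed

lemma involution_mat_induces_involution:
  assumes w: "p * s - 16 * q * r = 1" "odd q" "odd r"
  shows "induces_involution_over_Q 64 (involution_mat p q r s)"
proof -
  let ?w = "involution_mat p q r s" and ?R = "rational_modular_functions 64"
  note det = det_involution_mat[OF w(1)]
  have pos: "det ?w > 0" using det by simp
  have sq: "?w ** ?w \<in> Gamma0 64" by (rule involution_mat_square[OF w(1)])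
  have "Gamma0_orbit 64 (act ?w (act ?w z)) = Gamma0_orbit 64 z" if "z \<in> uhp" for z
    unfolding act_mult[OF pos that, symmetric] by (rule Gamma0_orbit_act[OF sq that])
  moreover have "\<i> \<in> uhp" by (simp add: uhp_def)
  hence "\<exists>z\<in>uhp. Gamma0_orbit 64 (act ?w z) \<noteq> Gamma0_orbit 64 z"
    using involution_mat_moves_orbits[OF w] by blast
  moreover have "pullback ?w \<in> ring_iso (X0_function_field 64) (X0_function_field 64)"
  proof -
    have closed: "pullback ?w f \<in> ?R" if "f \<in> ?R" for f
      using that unfolding rational_modular_functions_64_UV
      by (rule pullback_Q_adjoin[OF pos, rotated])
         (simp_all only: insert_iff empty_iff, elim disjE, simp_all add: pullback_involution_mat[OF w] Q_adjoin_uminus Q_adjoin_base)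
    \<comment> \<open>The square of the matrix lies in \<open>Gamma0 64\<close>, so the pullback is
      its own inverse and bijectivity follows.\<close>
    have invol: "pullback ?w (pullback ?w f) = f" if "f \<in> ?R" for f
      unfolding pullback_pullback[OF pos pos]
      using that sq by (simp add: rational_modular_functions_altdef modular_functions_def)
    have "bij_betw (pullback ?w) ?R ?R"
      by (rule bij_betwI[where g = "pullback ?w"]) (use closed invol in auto)
    moreover have "pullback ?w \<in> ring_hom (X0_function_field 64) (X0_function_field 64)"
      by (rule ring_hom_memI)
         (auto simp: X0_function_field_def closed pullback_add pullback_mult pullback_1 pos)
    ultimately show ?thesis by (simp add: ring_iso_def X0_function_field_def)
  qed
  ultimately show ?thesis
    using det involution_mat_normalizes[OF w(1)] by (simp add: induces_involution_over_Q_def)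
qed

lemma rational_modular_functions_64: "rational_modular_functions 64 = Q_adjoin {gen_x, gen_y, gen_t}"
  unfolding rational_modular_functions_64_UV Q_adjoin_gens ..

subsection \<open>The coordinate ring\<close>

lemma field_Q_adjoin: "field (ring_of_type_algebra\<lparr>carrier := Q_adjoin S\<rparr>)"
proof -
  interpret field "ring_of_type_algebra :: 'a ring" by (rule field_from_type_algebra)
  show ?thesis unfolding Q_adjoin_def by (rule subfield_iff(2), rule generate_field_is_subfield) simp
qed

lemma inv_Q_adjoin:
  assumes "x \<in> Q_adjoin S" "x \<noteq> 0"
  shows "inv\<^bsub>ring_of_type_algebra\<lparr>carrier := Q_adjoin S\<rparr>\<^esub> x = inverse x"
proof -
  interpret field "ring_of_type_algebra\<lparr>carrier := Q_adjoin S\<rparr>" by (rule field_Q_adjoin)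
  have "inv\<^bsub>ring_of_type_algebra\<lparr>carrier := Q_adjoin S\<rparr>\<^esub> x * x = 1"
    using Units_l_inv[of x] assms by (simp add: field_Units)
  thus ?thesis using assms by (simp add: field_simps)
qed

definition eval1 :: "rat poly \<Rightarrow> mero_uhp" where "eval1 = eval_via of_rat gen_x"
definition eval2 :: "rat poly poly \<Rightarrow> mero_uhp" where "eval2 = eval_via eval1 gen_y"
definition eval3 :: "poly3 \<Rightarrow> mero_uhp" where "eval3 = eval_via eval2 gen_t"

lemma poly_hom_eval: "poly_hom eval1" "poly_hom eval2" "poly_hom eval3"
  unfolding eval1_def eval2_def eval3_def by (intro poly_hom_eval_via poly_hom_of_rat)+

lemma eval3_hom: "eval3 0 = 0" "eval3 1 = 1" "eval3 (p + q) = eval3 p + eval3 q" "eval3 (p * q) = eval3 p * eval3 q"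
  "eval3 (p - q) = eval3 p - eval3 q" "eval3 (p ^ n) = eval3 p ^ n" "eval3 (numeral k) = numeral k" "eval3 (- p) = - eval3 p"
  using poly_hom_eval(3) poly_hom_minus[OF poly_hom_eval(3)] poly_hom_power[OF poly_hom_eval(3)]
    poly_hom_numeral[OF poly_hom_eval(3)] by (auto simp: poly_hom_def)

lemma eval_pCons:
  "eval1 (pCons r a) = of_rat r + gen_x * eval1 a" "eval2 (pCons a b) = eval1 a + gen_y * eval2 b"
  "eval3 (pCons b c) = eval2 b + gen_t * eval3 c"
  unfolding eval3_def eval2_def eval1_def
  by (intro eval_via_pCons poly_hom_eval_via poly_hom_of_rat)+

lemma eval_0 [simp]: "eval1 0 = 0" "eval2 0 = 0" "eval3 0 = 0"
  by (simp_all add: eval1_def eval2_def eval3_def)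

lemma eval_vars: "eval3 polyX = gen_x" "eval3 polyY = gen_y" "eval3 polyT = gen_t"
  using poly_hom_eval by (simp_all add: polyX_def polyY_def polyT_def eval_pCons poly_hom_def)

lemma eval1_Q_adjoin: "eval1 a \<in> Q_adjoin {gen_x, gen_y}"
  unfolding eval1_def eval_via_sum[OF poly_hom_of_rat] by (intro Q_adjoin_intros Q_adjoin_base) simp

lemma eval2_Q_adjoin: "eval2 b \<in> Q_adjoin {gen_x, gen_y}"
  unfolding eval2_def eval_via_sum[OF poly_hom_eval(1)]
  by (intro Q_adjoin_intros Q_adjoin_base eval1_Q_adjoin) simp

lemma eval3_Q_adjoin: "eval3 c \<in> Q_adjoin {gen_x, gen_y, gen_t}"
proof -
  have "Q_adjoin {gen_x, gen_y} \<subseteq> Q_adjoin {gen_x, gen_y, gen_t}"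
    by (rule Q_adjoin_subset) (auto intro: Q_adjoin_base)
  thus ?thesis unfolding eval3_def eval_via_sum[OF poly_hom_eval(2)]
    using eval2_Q_adjoin by (intro Q_adjoin_sum Q_adjoin_mult Q_adjoin_power Q_adjoin_base[of gen_t]) auto
qed

text \<open>\<open>quarter_shift\<close> sends U^2 to -U^2 and fixes V, so x goes to -x and is not
  constant; algebraic elements over the rationals are constant.\<close>

lemma gen_x_transcendental: "a \<noteq> 0 \<Longrightarrow> eval1 a \<noteq> 0"
proof
  assume "a \<noteq> 0" "eval1 a = 0"
  then obtain c where c: "gen_x = const_mero_uhp c"
    using algebraic_over_rationals[of a gen_x] unfolding eval1_def by blast
  note d = det_quarter_shift
  have num: "pullback quarter_shift 2 = 2" using pullback_of_rat[OF d, of 2] by simp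
  have i: "const_mero_uhp \<i> ^ 2 = - 1"
    by (simp add: const_mero_uhp_power[symmetric] const_mero_uhp_uminus const_mero_uhp_1)
  have "pullback quarter_shift gen_x = const_mero_uhp (- 1) * gen_x"
    unfolding gen_x_def pullback_divide[OF d] pullback_mult[OF d] pullback_add[OF d] pullback_power[OF d]
      pullback_1[OF d] num quarter_shift_quot_UV power_mult_distrib i const_mero_uhp_uminus const_mero_uhp_1
    by (simp add: minus_divide_left)
  from const_mero_uhp_not_eigen[OF d this _ gen_nonzero(1)] c show False by simp
qed

definition cubic :: "rat poly" where "cubic = [:0, -4, 0, 1:]"
definition quartic :: "rat poly" where "quartic = [:-16, 0, 0, 0, 1:]"

lemma coordinate_relations:
  "polyX ^ 3 - 4 * polyX = [:[:cubic:]:]" "(-2 + polyX) * (2 + polyX) * (4 + polyX ^ 2) = [:[:quartic:]:]"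
  by (simp_all add: polyX_def cubic_def quartic_def numeral_poly power2_eq_square power3_eq_cube one_pCons)

lemma eval1_eq_0: "eval1 a = 0 \<Longrightarrow> a = 0"
  using gen_x_transcendental by blast

text \<open>Taking norms over the field generated by x gives a^2 = b^2 (X^3 - 4 X) in the polynomial
  ring, where the degrees have different parity unless both sides vanish.\<close>

lemma eval2_linear_eq_0:
  assumes "eval2 [:a, b:] = 0"
  shows "a = 0" "b = 0"
proof -
  have hom: "eval1 (p * q) = eval1 p * eval1 q" "eval1 (p - q) = eval1 p - eval1 q" for p q
    using poly_hom_eval(1) poly_hom_minus[OF poly_hom_eval(1)] by (auto simp: poly_hom_def)
  have "eval1 cubic = gen_y ^ 2"
    unfolding gen_equations cubic_def by (simp add: eval_pCons of_rat_minus power3_eq_cube algebra_simps)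
  moreover have "eval1 a = - (gen_y * eval1 b)"
    using assms by (simp add: eval_pCons eq_neg_iff_add_eq_0)
  ultimately have "eval1 (a * a - b * b * cubic) = 0" unfolding hom by (simp add: power2_eq_square mult_ac)
  hence eq: "a * a = b * b * cubic" using eval1_eq_0 by fastforce
  have c: "cubic \<noteq> 0" "Polynomial.degree cubic = 3" by (simp_all add: cubic_def)
  show "b = 0"
  proof (rule ccontr)
    assume b: "b \<noteq> 0"
    hence "a \<noteq> 0" using eq c by auto
    hence "2 * Polynomial.degree a = 2 * Polynomial.degree b + 3"
      using arg_cong[OF eq, of Polynomial.degree] b c by (simp add: degree_mult_eq)
    thus False by presburger
  qed
  thus "a = 0" using eq by simp
qed

text \<open>The involution fixes x and y and negates t, so the conjugate relation also holds; sum
  and difference separate the two parts.\<close>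

lemma eval3_linear_eq_0:
  assumes "eval3 [:b, c:] = 0"
  shows "eval2 b = 0" "eval2 c = 0"
proof -
  \<comment> \<open>A concrete admissible matrix: p = q = r = 1 forces s = 17.\<close>
  have w: "(1 :: int) * 17 - 16 * 1 * 1 = 1" "odd (1 :: int)" by simp_all
  let ?w = "involution_mat 1 1 1 17"
  have det: "det ?w > 0" using det_involution_mat[OF w(1)] by simp
  note gens = pullback_gens[OF det pullback_involution_mat[OF w(1,2,2)]]
  have inv: "pullback ?w (eval2 b) = eval2 b" for b
    by (rule pullback_Q_adjoin_fixed[OF det _ eval2_Q_adjoin]) (use gens in auto)
  have eq: "eval2 b + gen_t * eval2 c = 0" using assms by (simp add: eval_pCons)
  have "pullback ?w (eval2 b + gen_t * eval2 c) = 0" unfolding eq by (rule pullback_0[OF det])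
  hence diff: "eval2 b - gen_t * eval2 c = 0" by (simp add: pullback_add pullback_mult det inv gens)
  have "2 * eval2 b = (eval2 b + gen_t * eval2 c) + (eval2 b - gen_t * eval2 c)" by (simp only: mult_2) simp
  hence "2 * eval2 b = 0" unfolding eq diff by simp
  thus "eval2 b = 0" by (simp only: mult_eq_0_iff) simp
  thus "eval2 c = 0" using eq gen_nonzero by simp
qed

abbreviation curve_equations :: "poly3 set" where
  "curve_equations \<equiv> {polyY ^ 2 - (polyX ^ 3 - 4 * polyX),
     polyT ^ 2 - (-2 + polyX) * (2 + polyX) * (4 + polyX ^ 2)}"

text \<open>Division by two equations that are monic in Y and in T. The polynomials congruent to
  some (a + b Y) + (c + d Y) T, with coefficients in X alone, are closed under addition and under
  multiplication by Y and by T.\<close>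

lemma polynomial_reduction:
  fixes I :: "poly3 set"
  assumes I: "\<And>p q. p \<in> I \<Longrightarrow> q \<in> I \<Longrightarrow> p + q \<in> I" "\<And>p q. p \<in> I \<Longrightarrow> q * p \<in> I" and E: "curve_equations \<subseteq> I"
  shows "\<exists>a b c d. p - [:[:a, b:], [:c, d:]:] \<in> I"
proof -
  define red where "red = {p. \<exists>a b c d. p - [:[:a, b:], [:c, d:]:] \<in> I}"
  have red_cong: "q \<in> red" if "p \<in> red" "q - p \<in> I" for p q
  proof -
    from that(1) obtain a b c d where 1: "p - [:[:a, b:], [:c, d:]:] \<in> I" by (auto simp: red_def)
    have "(q - p) + (p - [:[:a, b:], [:c, d:]:]) \<in> I" by (rule I(1)[OF that(2) 1])
    thus ?thesis unfolding red_def by (simp only: diff_add_cancel add_diff_eq) blast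
  qed
  have I0: "0 \<in> I" using E I(2)[of _ 0] by auto
  have red_base: "[:[:a, b:], [:c, d:]:] \<in> red" for a b c d
    unfolding red_def using I0 by (intro CollectI exI[of _ a] exI[of _ b] exI[of _ c] exI[of _ d]) (simp only: diff_self)
  have add: "p + q \<in> red" if pq: "p \<in> red" "q \<in> red" for p q
  proof -
    from pq obtain a b c d a' b' c' d' where
      "p - [:[:a, b:], [:c, d:]:] \<in> I" "q - [:[:a', b':], [:c', d':]:] \<in> I" unfolding red_def by blast
    from I(1)[OF this] have "p + q - [:[:a + a', b + b':], [:c + c', d + d':]:] \<in> I"
      by (simp add: algebra_simps)
    thus ?thesis by (rule red_cong[OF red_base])
  qed
  have multY: "[:[:0, 1:]:] * p \<in> red" if p: "p \<in> red" for p
  proof -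
    from p obtain a b c d where "p - [:[:a, b:], [:c, d:]:] \<in> I" unfolding red_def by blast
    from I(2)[OF this, of "[:[:0, 1:]:]"]
    have 1: "[:[:0, 1:]:] * p - [:[:0, a, b:], [:0, c, d:]:] \<in> I" by (simp add: algebra_simps)
    have "polyY ^ 2 - (polyX ^ 3 - 4 * polyX) \<in> I" using E by simp
    from I(2)[OF this, of "[:[:b:], [:d:]:]"]
    have "[:[:0, a, b:], [:0, c, d:]:] - [:[:b * cubic, a:], [:d * cubic, c:]:] \<in> I"
      unfolding coordinate_relations by (simp add: polyY_def power2_eq_square algebra_simps)
    from I(1)[OF 1 this] have "[:[:0, 1:]:] * p - [:[:b * cubic, a:], [:d * cubic, c:]:] \<in> I"
      by (simp only: diff_add_cancel add_diff_eq)
    thus ?thesis by (rule red_cong[OF red_base])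
  qed
  have multT: "[:0, 1:] * p \<in> red" if p: "p \<in> red" for p
  proof -
    from p obtain a b c d where "p - [:[:a, b:], [:c, d:]:] \<in> I" unfolding red_def by blast
    from I(2)[OF this, of "[:0, 1:]"]
    have 1: "[:0, 1:] * p - [:0, [:a, b:], [:c, d:]:] \<in> I" by (simp add: algebra_simps)
    have "polyT ^ 2 - (-2 + polyX) * (2 + polyX) * (4 + polyX ^ 2) \<in> I" using E by simp
    from I(2)[OF this, of "[:[:c, d:]:]"]
    have "[:0, [:a, b:], [:c, d:]:] - [:[:c * quartic, d * quartic:], [:a, b:]:] \<in> I"
      unfolding coordinate_relations by (simp add: polyT_def power2_eq_square algebra_simps)
    from I(1)[OF 1 this] have "[:0, 1:] * p - [:[:c * quartic, d * quartic:], [:a, b:]:] \<in> I"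
      by (simp only: diff_add_cancel add_diff_eq)
    thus ?thesis by (rule red_cong[OF red_base])
  qed
  have "[:q:] \<in> red" for q
  proof (induction q)
    case 0
    show ?case using red_base[of 0 0 0 0] by simp
  next
    case (pCons a q)
    have "[:pCons a q:] = [:[:a, 0:], [:0, 0:]:] + [:[:0, 1:]:] * [:q:]" by simp
    thus ?case using add[OF red_base multY[OF pCons.IH]] by (simp only:)
  qed
  note const = this
  have "p \<in> red" for p
  proof (induction p)
    case 0
    show ?case using const[of 0] by simp
  next
    case (pCons q p)
    have "pCons q p = [:q:] + [:0, 1:] * p" by simp
    thus ?case using add[OF const multT[OF pCons.IH]] by (simp only:)
  qed
  thus ?thesis by (simp add: red_def)
qed

text \<open>The kernel of evaluation at x, y, t is exactly the ideal of the equations, since a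
  reduced polynomial evaluates to zero only if it is zero. The coordinate ring therefore embeds in
  the function field, which its image generates.\<close>

theorem affine_equations_X0_64: "affine_equations_over_Q curve_equations (X0_function_field 64)"
proof -
  let ?P = "ring_of_type_algebra :: poly3 ring"
  let ?K = "X0_function_field 64"
  have K: "?K = ring_of_type_algebra\<lparr>carrier := Q_adjoin {gen_x, gen_y, gen_t}\<rparr>"
    by (simp add: X0_function_field_def rational_modular_functions_64)
  have fieldK: "field ?K" unfolding K by (rule field_Q_adjoin)
  interpret P: cring ?P by (rule cring_from_type_algebra)
  interpret K: field ?K by (rule fieldK)
  have hom: "eval3 \<in> ring_hom ?P ?K"
    unfolding K by (rule ring_hom_memI) (simp_all add: eval3_Q_adjoin eval3_hom)
  interpret H: ring_hom_ring ?P ?K eval3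
    by (rule ring_hom_ringI2[OF P.ring_axioms K.ring_axioms hom])
  have ker: "a_kernel ?P ?K eval3 = {p. eval3 p = 0}"
    unfolding a_kernel_def' by (simp add: K)
  let ?I = "Idl\<^bsub>?P\<^esub> curve_equations"
  have ideal: "ideal ?I ?P" by (rule P.genideal_ideal) simp
  interpret I: ideal ?I ?P by (rule ideal)
  have Isub: "?I \<subseteq> a_kernel ?P ?K eval3"
    by (rule P.genideal_minimal[OF H.kernel_is_ideal])
       (auto simp: ker eval3_hom eval_vars gen_equations)
  have "a_kernel ?P ?K eval3 \<subseteq> ?I"
  proof
    fix p assume "p \<in> a_kernel ?P ?K eval3"
    hence p0: "eval3 p = 0" by (simp add: ker)
    have "\<exists>a b c d. p - [:[:a, b:], [:c, d:]:] \<in> ?I"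
    proof (rule polynomial_reduction)
      show "p + q \<in> ?I" if "p \<in> ?I" "q \<in> ?I" for p q using I.a_closed[OF that] by simp
      show "q * p \<in> ?I" if "p \<in> ?I" for p q using I.I_l_closed[OF that, of q] by simp
      show "curve_equations \<subseteq> ?I" by (rule P.genideal_self) simp
    qed
    then obtain a b c d where r: "p - [:[:a, b:], [:c, d:]:] \<in> ?I" by blast
    hence "eval3 (p - [:[:a, b:], [:c, d:]:]) = 0" using Isub unfolding ker by blast
    hence "eval3 [:[:a, b:], [:c, d:]:] = 0" unfolding eval3_hom(5) p0 by simp
    from eval3_linear_eq_0[OF this] have "a = 0" "b = 0" "c = 0" "d = 0"
      using eval2_linear_eq_0 by blast+
    thus "p \<in> ?I" using r by simp
  qed
  with Isub have ker_eq: "a_kernel ?P ?K eval3 = ?I" by blast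
  let ?R = "coordinate_ring curve_equations"
  have R: "?R = ?P Quot (a_kernel ?P ?K eval3)" unfolding coordinate_ring_def ker_eq ..
  define \<phi> where "\<phi> = (\<lambda>A. the_elem (eval3 ` A))"
  \<comment> \<open>The kernel of a homomorphism into a field is prime, so the coordinate ring is a
    domain.\<close>
  have "primeideal (a_kernel ?P ?K eval3) ?P"
  proof (rule primeidealI)
    show "carrier ?P \<noteq> a_kernel ?P ?K eval3"
    proof
      assume "carrier ?P = a_kernel ?P ?K eval3"
      hence "1 \<in> {p. eval3 p = 0}" unfolding ker by simp
      thus False by (simp add: eval3_hom)
    qed
  qed (use H.kernel_is_ideal P.cring_axioms in \<open>auto simp: ker eval3_hom\<close>)
  hence domR: "domain ?R" unfolding R by (rule primeideal.quotient_is_domain)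
  have \<phi>hom: "\<phi> \<in> ring_hom ?R ?K" unfolding R \<phi>_def by (rule H.the_elem_hom)
  have inj: "inj_on \<phi> (carrier ?R)"
    unfolding R \<phi>_def by (rule inj_onI) (rule H.the_elem_inj)
  have range: "\<phi> ` carrier ?R = range eval3" unfolding R \<phi>_def using H.the_elem_surj by simp
  interpret R: domain ?R by (rule domR)
  have "\<phi> \<zero>\<^bsub>?R\<^esub> = 0"
    using ring_hom_zero[OF \<phi>hom R.ring_axioms K.ring_axioms] by (simp add: K)
  hence nz: "b \<in> carrier ?R - {\<zero>\<^bsub>?R\<^esub>} \<longleftrightarrow> b \<in> carrier ?R \<and> \<phi> b \<noteq> 0" for b
    using inj_onD[OF inj, of b "\<zero>\<^bsub>?R\<^esub>"] R.zero_closed by auto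
  have \<phi>K: "\<phi> b \<in> Q_adjoin {gen_x, gen_y, gen_t}" if "b \<in> carrier ?R" for b
    using ring_hom_closed[OF \<phi>hom that] by (simp add: K)
  have "Q_adjoin {gen_x, gen_y, gen_t} = {\<phi> a * inverse (\<phi> b) |a b. a \<in> carrier ?R \<and> b \<in> carrier ?R \<and> \<phi> b \<noteq> 0}"
    (is "_ = ?F")
  proof
    show "?F \<subseteq> Q_adjoin {gen_x, gen_y, gen_t}" by (auto intro!: Q_adjoin_mult Q_adjoin_inverse \<phi>K)
    have F: "?F = {eval3 p * inverse (eval3 q) |p q. eval3 q \<noteq> 0}"
    proof -
      have "?F = {u * inverse v |u v. u \<in> \<phi> ` carrier ?R \<and> v \<in> \<phi> ` carrier ?R \<and> v \<noteq> 0}" by blast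
      thus ?thesis unfolding range by blast
    qed
    have FI: "f \<in> ?F" if "f = eval3 p / eval3 q" "eval3 q \<noteq> 0" for f p q
      using that unfolding F divide_inverse by blast
    \<comment> \<open>The fractions of values of polynomials are closed under the field operations
      and contain the generators; an inverse of 0 is 0 and is treated separately.\<close>
    show "Q_adjoin {gen_x, gen_y, gen_t} \<subseteq> ?F"
    proof (rule Q_adjoin_minimal)
      have "eval3 p \<in> ?F" for p using FI[of "eval3 p" p 1] by (simp add: eval3_hom)
      note 1 = this
      show "{gen_x, gen_y, gen_t} \<subseteq> ?F" using 1[of polyX] 1[of polyY] 1[of polyT] by (simp add: eval_vars)
      show "of_rat r \<in> ?F" for r using 1[of "[:[:[:r:]:]:]"] by (simp add: eval_pCons)
    next
      fix f g assume "f \<in> ?F" "g \<in> ?F"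
      then obtain p q p' q' where pq: "f = eval3 p / eval3 q" "g = eval3 p' / eval3 q'" "eval3 q \<noteq> 0" "eval3 q' \<noteq> 0"
        unfolding F divide_inverse by blast
      show "f + g \<in> ?F" by (rule FI[of _ "p * q' + p' * q" "q * q'"]) (use pq in \<open>simp_all add: eval3_hom field_simps\<close>)
      show "f * g \<in> ?F" by (rule FI[of _ "p * p'" "q * q'"]) (use pq in \<open>simp_all add: eval3_hom\<close>)
    next
      fix f assume "f \<in> ?F"
      then obtain p q where pq: "f = eval3 p / eval3 q" "eval3 q \<noteq> 0" unfolding F divide_inverse by blast
      show "inverse f \<in> ?F"
      proof (cases "eval3 p = 0")
        case True
        thus ?thesis using \<open>f \<in> ?F\<close> pq by simp
      next
        case False
        thus ?thesis by (intro FI[of _ q p]) (use pq in simp_all)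
      qed
    qed
  qed
  moreover have "inv\<^bsub>?K\<^esub> (\<phi> b) = inverse (\<phi> b)" if "b \<in> carrier ?R" "\<phi> b \<noteq> 0" for b
    unfolding K by (rule inv_Q_adjoin[OF \<phi>K[OF that(1)] that(2)])
  hence "{\<phi> a * inverse (\<phi> b) |a b. a \<in> carrier ?R \<and> b \<in> carrier ?R \<and> \<phi> b \<noteq> 0} =
      {\<phi> a \<otimes>\<^bsub>?K\<^esub> inv\<^bsub>?K\<^esub> \<phi> b |a b. a \<in> carrier ?R \<and> b \<in> carrier ?R - {\<zero>\<^bsub>?R\<^esub>}}"
    unfolding nz by (intro Collect_cong) (simp add: K, metis)
  ultimately have "carrier ?K = {\<phi> a \<otimes>\<^bsub>?K\<^esub> inv\<^bsub>?K\<^esub> \<phi> b |a b. a \<in> carrier ?R \<and> b \<in> carrier ?R - {\<zero>\<^bsub>?R\<^esub>}}"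
    by (simp add: K)
  thus ?thesis
    unfolding affine_equations_over_Q_def is_fraction_field_def using domR fieldK \<phi>hom inj by blast
qed

theorem mainTheorem11:
  fixes W w :: "real^2^2"
  assumes "W \<in> atkin_lehner_matrices 64 64"
    and "w = (S2 ** W) ** (S2 ** W)"
  shows "induces_involution_over_Q 64 w \<and>
    (\<exists>x\<in>rational_modular_functions 64. \<exists>y\<in>rational_modular_functions 64.
       \<exists>t\<in>rational_modular_functions 64.
       rational_modular_functions 64 = Q_adjoin {x, y, t} \<and>
       {f \<in> rational_modular_functions 64. pullback w f = f} = Q_adjoin {x, y} \<and>
       pullback w t = - t \<and>
       y ^ 2 = x ^ 3 - 4 * x \<and>
       t ^ 2 = (-2 + x) * (2 + x) * (4 + x ^ 2)) \<and>
    affine_equations_over_Q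
      {polyY ^ 2 - (polyX ^ 3 - 4 * polyX),
       polyT ^ 2 - (-2 + polyX) * (2 + polyX) * (4 + polyX ^ 2)}
      (X0_function_field 64)"
proof -
  from square_shift_atkin_lehner[OF assms] obtain p q r s where
    w: "w = involution_mat p q r s" and pqrs: "p * s - 16 * q * r = 1" "odd q" "odd r" .
  have det: "det w > 0" using det_involution_mat[OF pqrs(1)] by (simp add: w)
  note gens = pullback_gens[OF det pullback_involution_mat[OF pqrs, folded w]]
  have "gen_x \<in> Q_adjoin {gen_x, gen_y}" by (rule Q_adjoin_base) simp
  moreover have xy: "pullback w s = s" if "s \<in> {gen_x, gen_y}" for s using that gens by auto
  ultimately have t2: "gen_t ^ 2 \<in> Q_adjoin {gen_x, gen_y}"
    unfolding gen_equations by (intro Q_adjoin_intros)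
  have "{f \<in> rational_modular_functions 64. pullback w f = f} = Q_adjoin {gen_x, gen_y}"
    using Q_adjoin_invariants[OF det xy gens(3) t2 gen_nonzero(3)]
    unfolding rational_modular_functions_64 by (simp add: insert_commute)
  moreover have "gen_x \<in> rational_modular_functions 64" "gen_y \<in> rational_modular_functions 64"
    "gen_t \<in> rational_modular_functions 64"
    unfolding rational_modular_functions_64 by (rule Q_adjoin_base; simp)+
  ultimately show ?thesis
    using involution_mat_induces_involution[OF pqrs] affine_equations_X0_64 gens(3) gen_equations
      rational_modular_functions_64 unfolding w by blast
qed

end
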